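(* Let $(X_0,X_1)$ be a couple of analytically convex quasi-Banach lattices and $\Theta\in(0,1)$. If $$X_0^{1-\Theta}X_1^\Theta=\langle X_0,X_1,\Theta\rangle,$$ then $$[X_0,X_1]^i_\Theta=\langle X_0,X_1\rangle_\Theta.$$
   Context: Quasi-Banach lattice: given a $\sigma$-finite measure space $(\mathfrak{X},\mathcal{S},\mu)$ and the class $\mathfrak{M}$ of complex-valued $\mu$-measurable functions, a quasi-Banach space $X\subset\mathfrak{M}$ is a quasi-Banach lattice (of functions) if $f\in X$, $g\in\mathfrak{M}$, $|g|\le|f|$ $\mu$-a.e. imply $g\in X$ and $\|g\|_X\le\|f\|_X$. Couples consist of lattices on the same measure space. A quasi-Banach space is analytically convex if there is $C>0$ such that $\|P(0)\|_X\le C\max_{|z|=1}\|P(z)\|_X$ for every polynomial $P:\mathbb{C}\to X$ (quasi-norms are taken continuous). Calderón product: $X_0^{1-\Theta}X_1^\Theta$ is the set of all $f\in\mathfrak{M}$ for which $\inf\{\|f_0\|_{X_0}^{1-\Theta}\|f_1\|_{X_1}^\Theta:\ |f|\le|f_0|^{1-\Theta}|f_1|^\Theta\ \mu\text{-a.e.},\ f_j\in X_j,\ j\in\{0,1\}\}$ is finite; this infimum is its quasi-norm. Let $(X_0,X_1)$ be a couple of quasi-Banach spaces continuously embedded in a common Hausdorff topological vector space; $X_0+X_1$ carries the usual sum quasi-norm; $\Theta\in(0,1)$. $\langle X_0,X_1,\Theta\rangle$: all $a\in X_0+X_1$ for which there is $\{a_i\}_{i\in\mathbb{Z}}\subset X_0\cap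 X_1$ with $a=\sum_{i}a_i$ in $X_0+X_1$ and $\|\sum_{i\in F}\varepsilon_i2^{i(j-\Theta)}a_i\|_{X_j}\le C\sup_i|\varepsilon_i|$ for any finite $F\subset\mathbb{Z}$, any bounded $\{\varepsilon_i\}_{i\in\mathbb{Z}}\subset\mathbb{C}$, $j\in\{0,1\}$, with $C$ independent of $F,j$; the quasi-norm is the infimum of such $C$. $\langle X_0,X_1\rangle_\Theta$: all $a\in X_0+X_1$ for which there is $\{a_i\}_{i\in\mathbb{Z}}\subset X_0\cap X_1$ with $a=\sum_ia_i$ in $X_0+X_1$ such that, for any bounded $\{\varepsilon_i\}_{i\in\mathbb{Z}}\subset\mathbb{C}$ and $j\in\{0,1\}$, $\sum_{i\in\mathbb{Z}}\varepsilon_i2^{i(j-\Theta)}a_i$ converges in $X_j$ with $\|\sum_{i\in\mathbb{Z}}\varepsilon_i2^{i(j-\Theta)}a_i\|_{X_j}\le C\sup_i|\varepsilon_i|$, $C$ independent of $j$; the quasi-norm is the infimum of such $C$. Inner complex method (defined for $X_0+X_1$ analytically convex): let $S_0=\{z\in\mathbb{C}:0<\mathrm{Re}\,z<1\}$ and $S$ its closure. $\mathcal{A}=\mathcal{A}(X_0,X_1)$ is the set of all bounded analytic functions $f:S_0\to X_0+X_1$ (analytic = locally given by uniformly convergent power series) which extend continuously to $S$ such that the traces $t\mapsto f(j+it)$ are bounded continuous functions into $X_j$, $j\in\{0,1\}$, with quasi-norm $\|f\|_{\mathcal{A}}:=\max\{\sup_{t\in\mathbb{R}}\|f(it)\|_{X_0},\sup_{t\in\mathbb{R}}\|f(1+it)\|_{X_1}\}$.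 $\mathcal{A}_0$ is the closure in $\mathcal{A}$ of all $f\in\mathcal{A}$ with $f(z)\in X_0\cap X_1$ for all $z\in S_0$. $[X_0,X_1]^i_\Theta:=\{f(\Theta):f\in\mathcal{A}_0\}$ with $\|x\|:=\inf\{\|f\|_{\mathcal{A}}:f\in\mathcal{A}_0,\ f(\Theta)=x\}$. Equalities of quasi-Banach spaces are equalities of sets with equivalent quasi-norms. *)

theory Defs
  imports "HOL-Analysis.Analysis"
begin

text \<open>
  A space of measurable functions is given by representatives: a set of functions together with a
  quasi-norm on it. Functions that agree almost everywhere are identified throughout: the carriers
  below are closed under almost everywhere equality (among measurable functions), the quasi-norms
  do not see null sets, and equations between elements are stated almost everywhere.
\<close>

record 'a fspace =
  elems :: "('a \<Rightarrow> complex) set"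
  qnorm :: "('a \<Rightarrow> complex) \<Rightarrow> real"

definition converges_in ::
  "'a fspace \<Rightarrow> ('i \<Rightarrow> 'a \<Rightarrow> complex) \<Rightarrow> ('a \<Rightarrow> complex) \<Rightarrow> 'i filter \<Rightarrow> bool" where
  "converges_in X u l F \<longleftrightarrow> ((\<lambda>i. qnorm X (\<lambda>\<omega>. u i \<omega> - l \<omega>)) \<longlongrightarrow> 0) F"

locale quasi_banach_fspace =
  fixes M :: "'a measure" and X :: "'a fspace"
  assumes measurable: "elems X \<subseteq> borel_measurable M"
    and AE_closed: "\<lbrakk>f \<in> elems X; g \<in> borel_measurable M; AE \<omega> in M. g \<omega> = f \<omega>\<rbrakk>
      \<Longrightarrow> g \<in> elems X \<and> qnorm X g = qnorm X f"
    and zero_closed: "(\<lambda>_. 0) \<in> elems X"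
    and add_closed: "\<lbrakk>f \<in> elems X; g \<in> elems X\<rbrakk> \<Longrightarrow> (\<lambda>\<omega>. f \<omega> + g \<omega>) \<in> elems X"
    and scale_closed: "f \<in> elems X \<Longrightarrow> (\<lambda>\<omega>. c * f \<omega>) \<in> elems X"
    and qnorm_nonneg: "f \<in> elems X \<Longrightarrow> 0 \<le> qnorm X f"
    and qnorm_eq_0_iff: "f \<in> elems X \<Longrightarrow> qnorm X f = 0 \<longleftrightarrow> (AE \<omega> in M. f \<omega> = 0)"
    and qnorm_scale: "f \<in> elems X \<Longrightarrow> qnorm X (\<lambda>\<omega>. c * f \<omega>) = cmod c * qnorm X f"
    and qnorm_quasi_triangle: "\<exists>K. \<forall>f\<in>elems X. \<forall>g\<in>elems X.
      qnorm X (\<lambda>\<omega>. f \<omega> + g \<omega>) \<le> K * (qnorm X f + qnorm X g)"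
    and qnorm_continuous: "\<lbrakk>\<And>n. u n \<in> elems X; f \<in> elems X; converges_in X u f sequentially\<rbrakk>
      \<Longrightarrow> (\<lambda>n. qnorm X (u n)) \<longlonglongrightarrow> qnorm X f"
    and complete: "\<lbrakk>\<And>n. u n \<in> elems X;
        \<forall>e>0. \<exists>N. \<forall>m\<ge>N. \<forall>n\<ge>N. qnorm X (\<lambda>\<omega>. u m \<omega> - u n \<omega>) < e\<rbrakk>
      \<Longrightarrow> \<exists>f\<in>elems X. converges_in X u f sequentially"

locale quasi_banach_lattice = quasi_banach_fspace +
  assumes solid: "\<lbrakk>f \<in> elems X; g \<in> borel_measurable M; AE \<omega> in M. cmod (g \<omega>) \<le> cmod (f \<omega>)\<rbrakk>
      \<Longrightarrow> g \<in> elems X \<and> qnorm X g \<le> qnorm X f"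

definition vector_poly :: "nat \<Rightarrow> (nat \<Rightarrow> 'a \<Rightarrow> complex) \<Rightarrow> complex \<Rightarrow> 'a \<Rightarrow> complex" where
  "vector_poly n x z = (\<lambda>\<omega>. \<Sum>k\<le>n. z ^ k * x k \<omega>)"

text \<open>The supremum is attained, since the quasi-norm is continuous and the circle is compact.\<close>

definition analytically_convex :: "'a fspace \<Rightarrow> bool" where
  "analytically_convex X \<longleftrightarrow>
    (\<exists>C>0. \<forall>n x. (\<forall>k\<le>n. x k \<in> elems X) \<longrightarrow>
      qnorm X (vector_poly n x 0) \<le> C * (SUP z\<in>sphere 0 1. qnorm X (vector_poly n x z)))"

definition sum_space :: "'a measure \<Rightarrow> 'a fspace \<Rightarrow> 'a fspace \<Rightarrow> 'a fspace" where
  "sum_space M X0 X1 =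
    \<lparr>elems = {f \<in> borel_measurable M.
        \<exists>f0\<in>elems X0. \<exists>f1\<in>elems X1. AE \<omega> in M. f \<omega> = f0 \<omega> + f1 \<omega>},
     qnorm = (\<lambda>f. Inf {qnorm X0 f0 + qnorm X1 f1 |f0 f1.
        f0 \<in> elems X0 \<and> f1 \<in> elems X1 \<and> (AE \<omega> in M. f \<omega> = f0 \<omega> + f1 \<omega>)})\<rparr>"

definition equivalent_spaces :: "'a fspace \<Rightarrow> 'a fspace \<Rightarrow> bool" where
  "equivalent_spaces X Y \<longleftrightarrow> elems X = elems Y \<and>
    (\<exists>C>0. \<forall>f\<in>elems X. qnorm X f \<le> C * qnorm Y f \<and> qnorm Y f \<le> C * qnorm X f)"

definition calderon_bounds ::
  "'a measure \<Rightarrow> 'a fspace \<Rightarrow> 'a fspace \<Rightarrow> real \<Rightarrow> ('a \<Rightarrow> complex) \<Rightarrow> real set" where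
  "calderon_bounds M X0 X1 \<theta> f =
    {qnorm X0 f0 powr (1 - \<theta>) * qnorm X1 f1 powr \<theta> |f0 f1.
      f0 \<in> elems X0 \<and> f1 \<in> elems X1 \<and>
      (AE \<omega> in M. cmod (f \<omega>) \<le> cmod (f0 \<omega>) powr (1 - \<theta>) * cmod (f1 \<omega>) powr \<theta>)}"

text \<open>The infimum in the extended sense is finite exactly when the set of bounds is non-empty.\<close>

definition calderon_product ::
  "'a measure \<Rightarrow> 'a fspace \<Rightarrow> 'a fspace \<Rightarrow> real \<Rightarrow> 'a fspace" where
  "calderon_product M X0 X1 \<theta> =
    \<lparr>elems = {f \<in> borel_measurable M. calderon_bounds M X0 X1 \<theta> f \<noteq> {}},
     qnorm = (\<lambda>f. Inf (calderon_bounds M X0 X1 \<theta> f))\<rparr>"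

definition weighted_sum ::
  "real \<Rightarrow> real \<Rightarrow> (int \<Rightarrow> complex) \<Rightarrow> (int \<Rightarrow> 'a \<Rightarrow> complex) \<Rightarrow> int set \<Rightarrow> 'a \<Rightarrow> complex" where
  "weighted_sum \<theta> j \<epsilon> a F =
    (\<lambda>\<omega>. \<Sum>i\<in>F. \<epsilon> i * complex_of_real (2 powr (real_of_int i * (j - \<theta>))) * a i \<omega>)"

text \<open>
  Series indexed by the integers are understood as unconditional sums, that is, as limits along
  the finite subsets of the integers, as in \<^const>\<open>has_sum\<close>. In both methods below the estimates
  and the convergence required for all bounded \<open>\<epsilon>\<close> make the sums unconditional anyway.
\<close>

definition decomposes ::
  "'a measure \<Rightarrow> 'a fspace \<Rightarrow> 'a fspace \<Rightarrow> (int \<Rightarrow> 'a \<Rightarrow> complex) \<Rightarrow> ('a \<Rightarrow> complex) \<Rightarrow> bool" where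
  "decomposes M X0 X1 a f \<longleftrightarrow>
    (\<forall>i. a i \<in> elems X0 \<inter> elems X1) \<and>
    converges_in (sum_space M X0 X1) (\<lambda>F \<omega>. \<Sum>i\<in>F. a i \<omega>) f (finite_subsets_at_top UNIV)"

definition finite_sums_bounded ::
  "'a fspace \<Rightarrow> real \<Rightarrow> real \<Rightarrow> (int \<Rightarrow> 'a \<Rightarrow> complex) \<Rightarrow> real \<Rightarrow> bool" where
  "finite_sums_bounded X \<theta> j a C \<longleftrightarrow>
    (\<forall>F \<epsilon>. finite F \<longrightarrow> bounded (range \<epsilon>) \<longrightarrow>
      qnorm X (weighted_sum \<theta> j \<epsilon> a F) \<le> C * (SUP i. cmod (\<epsilon> i)))"

definition series_bounded ::
  "'a fspace \<Rightarrow> real \<Rightarrow> real \<Rightarrow> (int \<Rightarrow> 'a \<Rightarrow> complex) \<Rightarrow> real \<Rightarrow> bool" where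
  "series_bounded X \<theta> j a C \<longleftrightarrow>
    (\<forall>\<epsilon>. bounded (range \<epsilon>) \<longrightarrow>
      (\<exists>s\<in>elems X. converges_in X (weighted_sum \<theta> j \<epsilon> a) s (finite_subsets_at_top UNIV) \<and>
        qnorm X s \<le> C * (SUP i. cmod (\<epsilon> i))))"

definition bracket_bounds ::
  "'a measure \<Rightarrow> 'a fspace \<Rightarrow> 'a fspace \<Rightarrow> real \<Rightarrow> ('a \<Rightarrow> complex) \<Rightarrow> real set" where
  "bracket_bounds M X0 X1 \<theta> f =
    {C. \<exists>a. decomposes M X0 X1 a f \<and>
      finite_sums_bounded X0 \<theta> 0 a C \<and> finite_sums_bounded X1 \<theta> 1 a C}"

text \<open>The space $\langle X_0, X_1, \theta\rangle$.\<close>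

definition bracket_space ::
  "'a measure \<Rightarrow> 'a fspace \<Rightarrow> 'a fspace \<Rightarrow> real \<Rightarrow> 'a fspace" where
  "bracket_space M X0 X1 \<theta> =
    \<lparr>elems = {f \<in> elems (sum_space M X0 X1). bracket_bounds M X0 X1 \<theta> f \<noteq> {}},
     qnorm = (\<lambda>f. Inf (bracket_bounds M X0 X1 \<theta> f))\<rparr>"

definition conv_bracket_bounds ::
  "'a measure \<Rightarrow> 'a fspace \<Rightarrow> 'a fspace \<Rightarrow> real \<Rightarrow> ('a \<Rightarrow> complex) \<Rightarrow> real set" where
  "conv_bracket_bounds M X0 X1 \<theta> f =
    {C. \<exists>a. decomposes M X0 X1 a f \<and> series_bounded X0 \<theta> 0 a C \<and> series_bounded X1 \<theta> 1 a C}"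

text \<open>The space $\langle X_0, X_1\rangle_\theta$.\<close>

definition conv_bracket_space ::
  "'a measure \<Rightarrow> 'a fspace \<Rightarrow> 'a fspace \<Rightarrow> real \<Rightarrow> 'a fspace" where
  "conv_bracket_space M X0 X1 \<theta> =
    \<lparr>elems = {f \<in> elems (sum_space M X0 X1). conv_bracket_bounds M X0 X1 \<theta> f \<noteq> {}},
     qnorm = (\<lambda>f. Inf (conv_bracket_bounds M X0 X1 \<theta> f))\<rparr>"

definition open_strip :: "complex set" where
  "open_strip = {z. 0 < Re z \<and> Re z < 1}"

definition analytic_into ::
  "'a fspace \<Rightarrow> complex set \<Rightarrow> (complex \<Rightarrow> 'a \<Rightarrow> complex) \<Rightarrow> bool" where
  "analytic_into X D f \<longleftrightarrow> (\<forall>z\<in>D. f z \<in> elems X) \<and>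
    (\<forall>z0\<in>D. \<exists>r>0. \<exists>c. ball z0 r \<subseteq> D \<and> (\<forall>k. c k \<in> elems X) \<and>
      uniform_limit (ball z0 r)
        (\<lambda>n z. qnorm X (\<lambda>\<omega>. (\<Sum>k<n. (z - z0) ^ k * c k \<omega>) - f z \<omega>)) (\<lambda>_. 0) sequentially)"

definition continuous_into ::
  "'a fspace \<Rightarrow> 'b::topological_space set \<Rightarrow> ('b \<Rightarrow> 'a \<Rightarrow> complex) \<Rightarrow> bool" where
  "continuous_into X D f \<longleftrightarrow>
    (\<forall>z\<in>D. f z \<in> elems X) \<and> (\<forall>z\<in>D. converges_in X f (f z) (at z within D))"

definition bounded_into :: "'a fspace \<Rightarrow> 'b set \<Rightarrow> ('b \<Rightarrow> 'a \<Rightarrow> complex) \<Rightarrow> bool" where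
  "bounded_into X D f \<longleftrightarrow> (\<forall>z\<in>D. f z \<in> elems X) \<and> (\<exists>B. \<forall>z\<in>D. qnorm X (f z) \<le> B)"

text \<open>
  The elements of $\mathcal{A}(X_0, X_1)$ are represented by functions on the whole plane, of which
  only the values on the closed strip are relevant; there they are the continuous extension.
\<close>

definition calA ::
  "'a measure \<Rightarrow> 'a fspace \<Rightarrow> 'a fspace \<Rightarrow> (complex \<Rightarrow> 'a \<Rightarrow> complex) set" where
  "calA M X0 X1 = {f.
    bounded_into (sum_space M X0 X1) open_strip f \<and>
    analytic_into (sum_space M X0 X1) open_strip f \<and>
    continuous_into (sum_space M X0 X1) (closure open_strip) f \<and>
    bounded_into X0 UNIV (\<lambda>t. f (Complex 0 t)) \<and> continuous_into X0 UNIV (\<lambda>t. f (Complex 0 t)) \<and>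
    bounded_into X1 UNIV (\<lambda>t. f (Complex 1 t)) \<and> continuous_into X1 UNIV (\<lambda>t. f (Complex 1 t))}"

definition calA_norm :: "'a fspace \<Rightarrow> 'a fspace \<Rightarrow> (complex \<Rightarrow> 'a \<Rightarrow> complex) \<Rightarrow> real" where
  "calA_norm X0 X1 f =
    max (SUP t. qnorm X0 (f (Complex 0 t))) (SUP t. qnorm X1 (f (Complex 1 t)))"

definition calA0 ::
  "'a measure \<Rightarrow> 'a fspace \<Rightarrow> 'a fspace \<Rightarrow> (complex \<Rightarrow> 'a \<Rightarrow> complex) set" where
  "calA0 M X0 X1 = {f \<in> calA M X0 X1. \<forall>e>0. \<exists>g\<in>calA M X0 X1.
    (\<forall>z\<in>open_strip. g z \<in> elems X0 \<inter> elems X1) \<and> calA_norm X0 X1 (\<lambda>z \<omega>. f z \<omega> - g z \<omega>) < e}"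

text \<open>The inner complex interpolation space $[X_0, X_1]^i_\theta$.\<close>

definition inner_complex_space ::
  "'a measure \<Rightarrow> 'a fspace \<Rightarrow> 'a fspace \<Rightarrow> real \<Rightarrow> 'a fspace" where
  "inner_complex_space M X0 X1 \<theta> =
    \<lparr>elems = {x \<in> borel_measurable M.
        \<exists>f\<in>calA0 M X0 X1. AE \<omega> in M. f (complex_of_real \<theta>) \<omega> = x \<omega>},
     qnorm = (\<lambda>x. Inf {calA_norm X0 X1 f |f.
        f \<in> calA0 M X0 X1 \<and> (AE \<omega> in M. f (complex_of_real \<theta>) \<omega> = x \<omega>)})\<rparr>"

end

theory Submission
  imports Defs "HOL-Complex_Analysis.Complex_Analysis"
begin

text \<open>
  A series \<open>a\<close> that is admissible for $\langle X_0, X_1\rangle_\theta$ gives the function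
  $F(z) = \sum_i 2^{i(z - \theta)} a_i$ in $\mathcal{A}$ with $F(\theta) = \sum_i a_i$. Convergence for all
  bounded multipliers makes the tails uniformly small, so that finite sums, which take values in
  $X_0 \cap X_1$, approximate \<open>F\<close> in $\mathcal{A}$.

  For the converse inclusion, analytic convexity is first turned into a lattice convexity: some
  power mean of a bounded finite family in \<open>X\<close> is dominated by a bounded element (Kalton). Applied to samples
  of $h \in \mathcal{A}$ on the boundary, with Jensen's inequality discretised by Fejer kernels at roots of unity,
  this yields a three lines theorem for the Calderon product: $|h(\theta)| \le p_0^{1-\theta} p_1^\theta$ up to small errors,
  with $p_j$ controlled by the boundary values of \<open>h\<close>. If $f \in \mathcal{A}_0$ is the limit of
  $g_n \in \mathcal{A}$ with values in $X_0 \cap X_1$, converging geometrically, then the hypothesis gives a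
  decomposition of each $g_{n+1}(\theta) - g_n(\theta)$. Since these elements lie in $X_0 \cap X_1$, their
  decompositions can be cut down to finite ones, and the sum of finite decompositions with
  geometrically decreasing constants converges for every bounded multiplier.
\<close>

section \<open>Quasi-normed spaces of functions and their sums\<close>

text \<open>A quasi-Banach space need not be locally convex, so averages over the boundary cannot be
  taken as vector-valued integrals. All averages are finite ones, at roots of unity, and lattice
  convexity with some exponent p > 0 takes the place of local convexity. Sampling happens slightly
  inside the strip, where an analytic function is known to be close to its traces only in X0 + X1.
  The resulting errors are small but lie in the wrong space of the couple, and the majorants change
  with the size of the errors, so one cannot simply let the errors tend to 0. For a value in X0
  \<inter> X1 they can be absorbed; this is why the factorisation is applied to differences of the
  approximants and not to the limit. A second obstacle is that elements are classes modulo null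
  sets: the value at z is determined outside a null set that depends on z. Before scalar function
  theory applies, a version must be built that is holomorphic in z for almost every fixed point of
  the measure space.\<close>

text \<open>Unlike \<open>quasi_banach_fspace\<close>, this also covers the sum of a couple, whose quasi-norm need
  not be continuous.\<close>

locale quasi_normed_fspace =
  fixes M :: "'a measure" and X :: "'a fspace" and K :: real
  assumes K_ge_1: "1 \<le> K"
    and elems_measurable: "elems X \<subseteq> borel_measurable M"
    and AE_elem: "\<lbrakk>f \<in> elems X; g \<in> borel_measurable M; AE \<omega> in M. g \<omega> = f \<omega>\<rbrakk>
      \<Longrightarrow> g \<in> elems X \<and> qnorm X g = qnorm X f"
    and zero_elem: "(\<lambda>_. 0) \<in> elems X"
    and add_elem: "\<lbrakk>f \<in> elems X; g \<in> elems X\<rbrakk> \<Longrightarrow> (\<lambda>\<omega>. f \<omega> + g \<omega>) \<in> elems X"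
    and scale_elem: "f \<in> elems X \<Longrightarrow> (\<lambda>\<omega>. c * f \<omega>) \<in> elems X"
    and qnorm_ge_0: "f \<in> elems X \<Longrightarrow> 0 \<le> qnorm X f"
    and qnorm_zero_iff: "f \<in> elems X \<Longrightarrow> qnorm X f = 0 \<longleftrightarrow> (AE \<omega> in M. f \<omega> = 0)"
    and qnorm_mult: "f \<in> elems X \<Longrightarrow> qnorm X (\<lambda>\<omega>. c * f \<omega>) = cmod c * qnorm X f"
    and quasi_triangle: "\<lbrakk>f \<in> elems X; g \<in> elems X\<rbrakk> \<Longrightarrow>
      qnorm X (\<lambda>\<omega>. f \<omega> + g \<omega>) \<le> K * (qnorm X f + qnorm X g)"
begin

lemma K_pos: "0 < K" and K_nonneg: "0 \<le> K"
  using K_ge_1 by auto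

lemma meas: "f \<in> elems X \<Longrightarrow> f \<in> borel_measurable M"
  using elems_measurable by blast

lemma minus_closed: "f \<in> elems X \<Longrightarrow> (\<lambda>\<omega>. - f \<omega>) \<in> elems X"
  using scale_elem[of f "-1"] by simp

lemma diff_closed: "\<lbrakk>f \<in> elems X; g \<in> elems X\<rbrakk> \<Longrightarrow> (\<lambda>\<omega>. f \<omega> - g \<omega>) \<in> elems X"
  using add_elem[OF _ minus_closed, of f g] by simp

lemma sum_closed: "(\<And>i. i \<in> I \<Longrightarrow> f i \<in> elems X) \<Longrightarrow> (\<lambda>\<omega>. \<Sum>i\<in>I. f i \<omega>) \<in> elems X"
  by (induction I rule: infinite_finite_induct) (auto simp: zero_elem add_elem)

lemma qnorm_zero [simp]: "qnorm X (\<lambda>_. 0) = 0"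
  using qnorm_zero_iff[OF zero_elem] by simp

lemma qnorm_minus: "f \<in> elems X \<Longrightarrow> qnorm X (\<lambda>\<omega>. - f \<omega>) = qnorm X f"
  using qnorm_mult[of f "-1"] by simp

lemma qnorm_diff_commute:
  assumes "f \<in> elems X" "g \<in> elems X"
  shows "qnorm X (\<lambda>\<omega>. f \<omega> - g \<omega>) = qnorm X (\<lambda>\<omega>. g \<omega> - f \<omega>)"
  using qnorm_minus[OF diff_closed[OF assms]] by simp

lemma quasi_triangle_diff:
  assumes "f \<in> elems X" "g \<in> elems X"
  shows "qnorm X (\<lambda>\<omega>. f \<omega> - g \<omega>) \<le> K * (qnorm X f + qnorm X g)"
  using quasi_triangle[OF assms(1) minus_closed[OF assms(2)]] qnorm_minus[OF assms(2)] by simp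

lemma quasi_triangle3:
  assumes "f \<in> elems X" "g \<in> elems X" "h \<in> elems X"
  shows "qnorm X (\<lambda>\<omega>. f \<omega> - h \<omega>) \<le> K * (qnorm X (\<lambda>\<omega>. f \<omega> - g \<omega>) + qnorm X (\<lambda>\<omega>. g \<omega> - h \<omega>))"
  using quasi_triangle[OF diff_closed[OF assms(1,2)] diff_closed[OF assms(2,3)]] by simp

lemma AE_eq_closed:
  "\<lbrakk>f \<in> elems X; g \<in> borel_measurable M; AE \<omega> in M. g \<omega> = f \<omega>\<rbrakk> \<Longrightarrow> g \<in> elems X"
  "\<lbrakk>f \<in> elems X; g \<in> borel_measurable M; AE \<omega> in M. g \<omega> = f \<omega>\<rbrakk> \<Longrightarrow> qnorm X g = qnorm X f"
  using AE_elem by blast+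

lemma converges_in_unique:
  assumes "\<And>i. u i \<in> elems X" "f \<in> elems X" "g \<in> elems X" "F \<noteq> bot"
    "converges_in X u f F" "converges_in X u g F"
  shows "AE \<omega> in M. f \<omega> = g \<omega>"
proof -
  have "((\<lambda>i. K * (qnorm X (\<lambda>\<omega>. u i \<omega> - f \<omega>) + qnorm X (\<lambda>\<omega>. u i \<omega> - g \<omega>))) \<longlongrightarrow> K * (0 + 0)) F"
    using assms(5,6) unfolding converges_in_def by (intro tendsto_intros)
  moreover have "qnorm X (\<lambda>\<omega>. f \<omega> - g \<omega>) \<le> K * (qnorm X (\<lambda>\<omega>. u i \<omega> - f \<omega>) + qnorm X (\<lambda>\<omega>. u i \<omega> - g \<omega>))" for i
    using quasi_triangle3[OF assms(2) assms(1)[of i] assms(3)] qnorm_diff_commute[OF assms(1)[of i] assms(2)] by simp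
  ultimately have "qnorm X (\<lambda>\<omega>. f \<omega> - g \<omega>) \<le> 0"
    by (intro tendsto_lowerbound[of _ _ F]) (use assms(4) in auto)
  then have "qnorm X (\<lambda>\<omega>. f \<omega> - g \<omega>) = 0"
    using qnorm_ge_0[OF diff_closed[OF assms(2,3)]] by simp
  then show ?thesis
    using qnorm_zero_iff[OF diff_closed[OF assms(2,3)]] by simp
qed

lemma converges_in_add:
  assumes "\<And>i. u i \<in> elems X" "f \<in> elems X" "\<And>i. v i \<in> elems X" "g \<in> elems X"
    "converges_in X u f F" "converges_in X v g F"
  shows "converges_in X (\<lambda>i \<omega>. u i \<omega> + v i \<omega>) (\<lambda>\<omega>. f \<omega> + g \<omega>) F"
proof -
  have 1: "((\<lambda>i. K * (qnorm X (\<lambda>\<omega>. u i \<omega> - f \<omega>) + qnorm X (\<lambda>\<omega>. v i \<omega> - g \<omega>))) \<longlongrightarrow> K * (0 + 0)) F"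
    using assms(5,6) unfolding converges_in_def by (intro tendsto_intros)
  have 2: "qnorm X (\<lambda>\<omega>. u i \<omega> + v i \<omega> - (f \<omega> + g \<omega>)) \<le>
      K * (qnorm X (\<lambda>\<omega>. u i \<omega> - f \<omega>) + qnorm X (\<lambda>\<omega>. v i \<omega> - g \<omega>))" for i
    using quasi_triangle[OF diff_closed[OF assms(1,2)] diff_closed[OF assms(3,4)], of i i] 
    by (simp add: algebra_simps)
  show ?thesis
    unfolding converges_in_def
    by (rule tendsto_sandwich[OF _ _ tendsto_const[of 0] 1[simplified]])
       (use 2 qnorm_ge_0[OF diff_closed[OF add_elem[OF assms(1,3)] add_elem[OF assms(2,4)]]] in auto)
qed

lemma converges_in_scale:
  assumes "\<And>i. u i \<in> elems X" "f \<in> elems X" "converges_in X u f F"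
  shows "converges_in X (\<lambda>i \<omega>. c * u i \<omega>) (\<lambda>\<omega>. c * f \<omega>) F"
proof -
  have 1: "((\<lambda>i. cmod c * qnorm X (\<lambda>\<omega>. u i \<omega> - f \<omega>)) \<longlongrightarrow> cmod c * 0) F"
    using assms(3) unfolding converges_in_def by (intro tendsto_intros)
  have "qnorm X (\<lambda>\<omega>. c * u i \<omega> - c * f \<omega>) = cmod c * qnorm X (\<lambda>\<omega>. u i \<omega> - f \<omega>)" for i
    using qnorm_mult[OF diff_closed[OF assms(1,2)], of c i] by (simp add: algebra_simps)
  then show ?thesis
    using 1 by (simp add: converges_in_def)
qed

lemma converges_in_const: "f \<in> elems X \<Longrightarrow> converges_in X (\<lambda>_. f) f F"
  by (simp add: converges_in_def)

lemma converges_in_sum: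
  assumes "\<And>i k. k \<in> I \<Longrightarrow> u k i \<in> elems X" "\<And>k. k \<in> I \<Longrightarrow> f k \<in> elems X"
    "\<And>k. k \<in> I \<Longrightarrow> converges_in X (u k) (f k) F"
  shows "converges_in X (\<lambda>i \<omega>. \<Sum>k\<in>I. u k i \<omega>) (\<lambda>\<omega>. \<Sum>k\<in>I. f k \<omega>) F"
  using assms
proof (induction I rule: infinite_finite_induct)
  case (insert k I)
  then have "converges_in X (\<lambda>i \<omega>. u k i \<omega> + (\<Sum>k\<in>I. u k i \<omega>)) (\<lambda>\<omega>. f k \<omega> + (\<Sum>k\<in>I. f k \<omega>)) F"
    by (intro converges_in_add sum_closed) auto
  then show ?case using insert.hyps by simp
qed (auto intro: converges_in_const zero_elem)

end

locale normed_lattice = quasi_banach_lattice M X + quasi_normed_fspace M X K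
  for M :: "'a measure" and X :: "'a fspace" and K :: real

text \<open>Admissible constants of the quasi-triangle inequality form an upward closed set, so one
  common K >= 1 can serve both lattices of a couple.\<close>

lemma (in quasi_banach_lattice) normed_lattice_exists:
  "\<exists>K0. \<forall>K\<ge>K0. normed_lattice M X K"
proof -
  obtain K where K: "\<And>f g. f \<in> elems X \<Longrightarrow> g \<in> elems X \<Longrightarrow>
      qnorm X (\<lambda>\<omega>. f \<omega> + g \<omega>) \<le> K * (qnorm X f + qnorm X g)"
    using qnorm_quasi_triangle by blast
  show ?thesis
  proof (intro exI[of _ "max 1 K"] allI impI)
    fix L assume L: "max 1 K \<le> L"
    have tri: "qnorm X (\<lambda>\<omega>. f \<omega> + g \<omega>) \<le> L * (qnorm X f + qnorm X g)"
      if "f \<in> elems X" "g \<in> elems X" for f g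
      using K[OF that] mult_right_mono[of K L "qnorm X f + qnorm X g"] L
        qnorm_nonneg[OF that(1)] qnorm_nonneg[OF that(2)] by linarith
    have "quasi_normed_fspace M X L"
    proof
      show "1 \<le> L" using L by simp
    qed (rule measurable AE_closed zero_closed add_closed scale_closed qnorm_nonneg
        qnorm_eq_0_iff qnorm_scale tri; assumption)+
    then show "normed_lattice M X L"
      using quasi_banach_lattice_axioms by (simp add: normed_lattice_def)
  qed
qed

section \<open>Pointwise majorants with a norm bound\<close>

context normed_lattice
begin

text \<open>A pointwise bound together with the norm of an unnamed majorant. The function
  \<open>u\<close> may have either sign and need not be measurable, so lattice estimates compose
  without tracking representatives.\<close>

definition dominated :: "('a \<Rightarrow> real) \<Rightarrow> real \<Rightarrow> bool" where
  "dominated u c \<longleftrightarrow> (\<exists>f\<in>elems X. qnorm X f \<le> c \<and> (AE \<omega> in M. u \<omega> \<le> cmod (f \<omega>)))"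

lemma dominated_cmod: "f \<in> elems X \<Longrightarrow> qnorm X f \<le> c \<Longrightarrow> dominated (\<lambda>\<omega>. cmod (f \<omega>)) c"
  unfolding dominated_def by (intro bexI[of _ f]) auto

lemma dominated_mono:
  assumes "dominated v c" "AE \<omega> in M. u \<omega> \<le> v \<omega>" "c \<le> d"
  shows "dominated u d"
proof -
  obtain f where f: "f \<in> elems X" "qnorm X f \<le> c" "AE \<omega> in M. v \<omega> \<le> cmod (f \<omega>)"
    using assms(1) by (auto simp: dominated_def)
  have "AE \<omega> in M. u \<omega> \<le> cmod (f \<omega>)"
    using assms(2) f(3) by eventually_elim simp
  then show ?thesis
    unfolding dominated_def using f assms(3) by (intro bexI[of _ f]) auto
qed

lemma dominated_elem:
  assumes "dominated u c" "g \<in> borel_measurable M" "AE \<omega> in M. cmod (g \<omega>) \<le> u \<omega>"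
  shows "g \<in> elems X" "qnorm X g \<le> c"
proof -
  obtain f where f: "f \<in> elems X" "qnorm X f \<le> c" "AE \<omega> in M. u \<omega> \<le> cmod (f \<omega>)"
    using assms(1) by (auto simp: dominated_def)
  have "AE \<omega> in M. cmod (g \<omega>) \<le> cmod (f \<omega>)"
    using assms(3) f(3) by eventually_elim simp
  then show "g \<in> elems X" "qnorm X g \<le> c"
    using solid[OF f(1) assms(2)] f(2) by auto
qed

lemma dominated_nonneg: "dominated u c \<Longrightarrow> 0 \<le> c"
  unfolding dominated_def using qnorm_nonneg by force

lemma dominated_zero: "0 \<le> c \<Longrightarrow> dominated (\<lambda>_. 0) c"
  using dominated_cmod[OF zero_closed, of c] by simp

lemma dominated_majorant:
  assumes "dominated u c"
  obtains f where "(\<lambda>\<omega>. complex_of_real (f \<omega>)) \<in> elems X" "f \<in> borel_measurable M"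
    "\<And>\<omega>. 0 \<le> f \<omega>" "AE \<omega> in M. u \<omega> \<le> f \<omega>" "qnorm X (\<lambda>\<omega>. complex_of_real (f \<omega>)) \<le> c"
proof -
  obtain f where f: "f \<in> elems X" "qnorm X f \<le> c" "AE \<omega> in M. u \<omega> \<le> cmod (f \<omega>)"
    using assms(1) by (auto simp: dominated_def)
  have m: "f \<in> borel_measurable M" using meas f by auto
  have 1: "(\<lambda>\<omega>. complex_of_real (cmod (f \<omega>))) \<in> elems X"
    "qnorm X (\<lambda>\<omega>. complex_of_real (cmod (f \<omega>))) \<le> qnorm X f"
    using solid[OF f(1), of "\<lambda>\<omega>. complex_of_real (cmod (f \<omega>))"] m by auto
  show thesis
    by (rule that[of "\<lambda>\<omega>. cmod (f \<omega>)"]) (use 1 f m in auto)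
qed

lemma dominated_add:
  assumes "dominated u c" "dominated v d"
  shows "dominated (\<lambda>\<omega>. u \<omega> + v \<omega>) (K * (c + d))"
proof -
  obtain f where f: "(\<lambda>\<omega>. complex_of_real (f \<omega>)) \<in> elems X"
    "\<And>\<omega>. 0 \<le> f \<omega>" "AE \<omega> in M. u \<omega> \<le> f \<omega>" "qnorm X (\<lambda>\<omega>. complex_of_real (f \<omega>)) \<le> c"
    using dominated_majorant[OF assms(1)] by metis
  obtain g where g: "(\<lambda>\<omega>. complex_of_real (g \<omega>)) \<in> elems X"
    "\<And>\<omega>. 0 \<le> g \<omega>" "AE \<omega> in M. v \<omega> \<le> g \<omega>" "qnorm X (\<lambda>\<omega>. complex_of_real (g \<omega>)) \<le> d"
    using dominated_majorant[OF assms(2)] by metis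
  have "AE \<omega> in M. u \<omega> + v \<omega> \<le> cmod (complex_of_real (f \<omega>) + complex_of_real (g \<omega>))"
    using f(3) g(3)
  proof eventually_elim
    case (elim \<omega>)
    then show ?case using f(2)[of \<omega>] g(2)[of \<omega>] by (simp flip: of_real_add)
  qed
  moreover have "qnorm X (\<lambda>\<omega>. complex_of_real (f \<omega>) + complex_of_real (g \<omega>)) \<le> K * (c + d)"
    using quasi_triangle[OF f(1) g(1)] mult_left_mono[OF add_mono[OF f(4) g(4)] K_nonneg]
    by linarith
  ultimately show ?thesis
    unfolding dominated_def by (intro bexI[OF _ add_closed[OF f(1) g(1)]] conjI)
qed

lemma dominated_scale:
  assumes "dominated u c" "0 \<le> t"
  shows "dominated (\<lambda>\<omega>. t * u \<omega>) (t * c)"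
proof -
  obtain f where f: "f \<in> elems X" "qnorm X f \<le> c" "AE \<omega> in M. u \<omega> \<le> cmod (f \<omega>)"
    using assms(1) by (auto simp: dominated_def)
  have "AE \<omega> in M. t * u \<omega> \<le> cmod (of_real t * f \<omega>)"
    using f(3) by eventually_elim (use assms(2) in \<open>simp add: norm_mult mult_left_mono\<close>)
  moreover have "qnorm X (\<lambda>\<omega>. of_real t * f \<omega>) \<le> t * c"
    using f assms(2) by (simp add: qnorm_scale mult_left_mono)
  ultimately show ?thesis
    unfolding dominated_def by (intro bexI[OF _ scale_closed[OF f(1)]] conjI)
qed

text \<open>Summands are split off one at a time from the front, so the k-th passes through k + 1
  quasi-triangle inequalities. The weight \<open>K ^ Suc k\<close> is what the geometric rates have
  to beat.\<close>

lemma dominated_sum: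
  assumes "\<And>k. k < n \<Longrightarrow> dominated (u k) (c k)"
  shows "dominated (\<lambda>\<omega>. \<Sum>k<n. u k \<omega>) (\<Sum>k<n. K ^ Suc k * c k)"
  using assms
proof (induction n arbitrary: u c)
  case 0
  then show ?case using dominated_zero[of 0] by simp
next
  case (Suc n)
  have 1: "dominated (\<lambda>\<omega>. \<Sum>k<n. u (Suc k) \<omega>) (\<Sum>k<n. K ^ Suc k * c (Suc k))"
    by (rule Suc.IH) (use Suc.prems in auto)
  have "dominated (\<lambda>\<omega>. u 0 \<omega> + (\<Sum>k<n. u (Suc k) \<omega>)) (K * (c 0 + (\<Sum>k<n. K ^ Suc k * c (Suc k))))"
    by (rule dominated_add[OF _ 1]) (use Suc.prems in auto)
  then show ?case
    by (simp only: sum.lessThan_Suc_shift) (simp add: algebra_simps sum_distrib_left)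
qed

lemma geometric_sum_bound:
  fixes B :: real
  assumes "0 \<le> B"
  shows "(\<Sum>k<n. K ^ Suc k * (B / (2 * K) ^ k)) \<le> 2 * K * B"
proof -
  have "K ^ Suc k * (B / (2 * K) ^ k) = K * B * (1/2) ^ k" for k
    using K_pos by (simp add: field_simps power_mult_distrib)
  then have "(\<Sum>k<n. K ^ Suc k * (B / (2 * K) ^ k)) = K * B * (\<Sum>k<n. (1/2) ^ k)"
    by (simp only: sum_distrib_left)
  also have "\<dots> \<le> K * B * 2"
    by (rule mult_left_mono, subst geometric_sum) (use assms K_nonneg in auto)
  finally show ?thesis by (simp add: mult_ac)
qed

text \<open>Continuity of the quasi-norm carries a bound to the limit without an extra factor
  K.\<close>

lemma qnorm_limit_le:
  assumes "\<And>n. u n \<in> elems X" "f \<in> elems X" "converges_in X u f sequentially"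
    "\<And>n. n \<ge> n0 \<Longrightarrow> qnorm X (u n) \<le> c"
  shows "qnorm X f \<le> c"
  by (rule tendsto_upperbound[OF qnorm_continuous[OF assms(1,2,3)]])
     (use assms(4) in \<open>auto simp: eventually_sequentially\<close>)

text \<open>Absolute convergence: the factor \<open>(2 * K) ^ k\<close> beats the constants that the quasi-triangle
  inequality accumulates.\<close>

lemma geometric_series:
  assumes f: "\<And>k. f k \<in> elems X" "\<And>k. qnorm X (f k) \<le> B / (2 * K) ^ k"
  obtains s where "s \<in> elems X" "converges_in X (\<lambda>n \<omega>. \<Sum>k<n. f k \<omega>) s sequentially"
    "\<And>n. qnorm X (\<lambda>\<omega>. s \<omega> - (\<Sum>k<n. f k \<omega>)) \<le> 2 * K * B / (2 * K) ^ n"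
proof -
  have B: "0 \<le> B"
    using f(2)[of 0] qnorm_nonneg[OF f(1)[of 0]] by simp
  have cl: "(\<lambda>\<omega>. \<Sum>k<n. f k \<omega>) \<in> elems X" for n
    by (intro sum_closed f)
  \<comment> \<open>The lattice structure replaces a triangle inequality for many terms: the moduli
    are summed as majorants, and solidity returns to the block itself.\<close>
  have block: "qnorm X (\<lambda>\<omega>. (\<Sum>k<n + m. f k \<omega>) - (\<Sum>k<n. f k \<omega>)) \<le> 2 * K * B / (2 * K) ^ n" for m n
  proof -
    have "dominated (\<lambda>\<omega>. \<Sum>k<m. cmod (f (n + k) \<omega>)) (\<Sum>k<m. K ^ Suc k * (B / (2 * K) ^ n / (2 * K) ^ k))"
      by (intro dominated_sum dominated_cmod f order_trans[OF f(2)]) (simp add: power_add)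
    from dominated_mono[OF this _ geometric_sum_bound[of "B / (2 * K) ^ n"]]
    have d: "dominated (\<lambda>\<omega>. \<Sum>k<m. cmod (f (n + k) \<omega>)) (2 * K * B / (2 * K) ^ n)"
      using B K_pos by simp
    have eq: "(\<Sum>k<n + m. f k \<omega>) - (\<Sum>k<n. f k \<omega>) = (\<Sum>k<m. f (n + k) \<omega>)" for \<omega>
      by (induction m) auto
    show ?thesis
      unfolding eq
      by (rule dominated_elem(2)[OF d]) (auto intro!: norm_sum meas sum_closed f)
  qed
  have lim: "(\<lambda>n. 2 * K * B / (2 * K) ^ n) \<longlonglongrightarrow> 0"
  proof -
    have "(\<lambda>n. 2 * K * B * (1 / (2 * K)) ^ n) \<longlonglongrightarrow> 2 * K * B * 0"
      by (intro tendsto_intros LIMSEQ_realpow_zero) (use K_ge_1 in auto)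
    then show ?thesis by (simp add: power_one_over)
  qed
  have "\<forall>e>0. \<exists>N. \<forall>m\<ge>N. \<forall>n\<ge>N. qnorm X (\<lambda>\<omega>. (\<Sum>k<m. f k \<omega>) - (\<Sum>k<n. f k \<omega>)) < e"
  proof (intro allI impI)
    fix e :: real assume e: "e > 0"
    then obtain N where N: "\<And>n. n \<ge> N \<Longrightarrow> 2 * K * B / (2 * K) ^ n < e"
      using order_tendstoD(2)[OF lim e] by (auto simp: eventually_sequentially)
    have *: "qnorm X (\<lambda>\<omega>. (\<Sum>k<m. f k \<omega>) - (\<Sum>k<n. f k \<omega>)) < e" if "n \<ge> N" "m \<ge> n" for m n
      using block[of n "m - n"] N[OF that(1)] that(2) by simp
    have "qnorm X (\<lambda>\<omega>. (\<Sum>k<m. f k \<omega>) - (\<Sum>k<n. f k \<omega>)) < e" if "n \<ge> N" "m \<ge> N" for m n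
    proof (cases "m \<ge> n")
      case False
      then show ?thesis using *[of m n] that qnorm_diff_commute[OF cl[of m] cl[of n]] by simp
    qed (use * that in auto)
    then show "\<exists>N. \<forall>m\<ge>N. \<forall>n\<ge>N. qnorm X (\<lambda>\<omega>. (\<Sum>k<m. f k \<omega>) - (\<Sum>k<n. f k \<omega>)) < e" by blast
  qed
  from complete[OF cl this] obtain s where
    s: "s \<in> elems X" "converges_in X (\<lambda>n \<omega>. \<Sum>k<n. f k \<omega>) s sequentially" by blast
  have "qnorm X (\<lambda>\<omega>. s \<omega> - (\<Sum>k<n. f k \<omega>)) \<le> 2 * K * B / (2 * K) ^ n" for n
  proof (rule qnorm_limit_le[of "\<lambda>m \<omega>. (\<Sum>k<m. f k \<omega>) - (\<Sum>k<n. f k \<omega>)" _ n])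
    show "converges_in X (\<lambda>m \<omega>. (\<Sum>k<m. f k \<omega>) - (\<Sum>k<n. f k \<omega>)) (\<lambda>\<omega>. s \<omega> - (\<Sum>k<n. f k \<omega>)) sequentially"
      using s(2) by (simp only: converges_in_def add_diff_cancel_right' diff_diff_eq2 diff_add_cancel)
    show "qnorm X (\<lambda>\<omega>. (\<Sum>k<m. f k \<omega>) - (\<Sum>k<n. f k \<omega>)) \<le> 2 * K * B / (2 * K) ^ n" if "m \<ge> n" for m
      using block[of n "m - n"] that by simp
  qed (use cl s(1) diff_closed in auto)
  with s show thesis using that by blast
qed

text \<open>Convergence in norm has to yield a bound almost everywhere. With s the norm limit of the
  sums of moduli, the excess of a partial sum over |s| is dominated by the distance of every later
  partial sum to s. By solidity this excess has norm 0, hence vanishes almost everywhere.\<close>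

lemma geometric_majorant:
  assumes f: "\<And>k. f k \<in> elems X" "\<And>k. qnorm X (f k) \<le> B / (2 * K) ^ k"
  obtains V where "dominated V (2 * K * B)" "\<And>\<omega>. 0 \<le> V \<omega>" "V \<in> borel_measurable M"
    "(\<lambda>\<omega>. complex_of_real (V \<omega>)) \<in> elems X"
    "AE \<omega> in M. \<forall>n. (\<Sum>k<n. cmod (f k \<omega>)) \<le> V \<omega>"
proof -
  define g where "g k = (\<lambda>\<omega>. complex_of_real (cmod (f k \<omega>)))" for k
  have mf: "f k \<in> borel_measurable M" for k using meas f by auto
  have g: "g k \<in> elems X" "qnorm X (g k) \<le> B / (2 * K) ^ k" for k
    using solid[OF f(1)[of k], of "g k"] f(2)[of k] mf[of k] by (auto simp: g_def)
  obtain s where s: "s \<in> elems X" "converges_in X (\<lambda>n \<omega>. \<Sum>k<n. g k \<omega>) s sequentially"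
    "\<And>n. qnorm X (\<lambda>\<omega>. s \<omega> - (\<Sum>k<n. g k \<omega>)) \<le> 2 * K * B / (2 * K) ^ n"
    using geometric_series[OF g] by blast
  have ms: "s \<in> borel_measurable M" using meas s by auto
  have "AE \<omega> in M. (\<Sum>k<n. cmod (f k \<omega>)) \<le> cmod (s \<omega>)" for n
  proof -
    define d where "d \<omega> = complex_of_real (max 0 ((\<Sum>k<n. cmod (f k \<omega>)) - cmod (s \<omega>)))" for \<omega>
    have md: "d \<in> borel_measurable M"
      unfolding d_def using mf ms by measurable
    have dle: "cmod (d \<omega>) \<le> cmod ((\<Sum>k<m. g k \<omega>) - s \<omega>)" if "n \<le> m" for m \<omega>
    proof -
      have "(\<Sum>k<n. cmod (f k \<omega>)) \<le> (\<Sum>k<m. cmod (f k \<omega>))"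
        using that by (intro sum_mono2) auto
      also have "(\<Sum>k<m. cmod (f k \<omega>)) = cmod (\<Sum>k<m. g k \<omega>)"
        by (simp add: g_def sum_nonneg flip: of_real_sum)
      also have "\<dots> \<le> cmod ((\<Sum>k<m. g k \<omega>) - s \<omega>) + cmod (s \<omega>)"
        by (metis diff_add_cancel norm_triangle_ineq)
      finally show ?thesis by (simp add: d_def)
    qed
    have el: "(\<lambda>\<omega>. (\<Sum>k<m. g k \<omega>) - s \<omega>) \<in> elems X" for m
      by (intro diff_closed sum_closed g s)
    have d: "d \<in> elems X" 
      using solid[OF el[of n] md] dle[of n] by auto
    have "qnorm X d \<le> qnorm X (\<lambda>\<omega>. (\<Sum>k<m. g k \<omega>) - s \<omega>)" if "n \<le> m" for m
      using solid[OF el[of m] md] dle[OF that] by auto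
    then have "qnorm X d \<le> 0"
      by (intro tendsto_lowerbound[OF s(2)[unfolded converges_in_def]])
         (auto simp: eventually_sequentially)
    then have "AE \<omega> in M. d \<omega> = 0"
      using qnorm_nonneg[OF d] qnorm_eq_0_iff[OF d] by simp
    then show ?thesis
      by eventually_elim (auto simp: d_def max_def split: if_splits)
  qed
  then have "AE \<omega> in M. \<forall>n. (\<Sum>k<n. cmod (f k \<omega>)) \<le> cmod (s \<omega>)"
    by (simp add: AE_all_countable)
  moreover have "qnorm X s \<le> 2 * K * B"
    using s(3)[of 0] by simp
  moreover have "(\<lambda>\<omega>. complex_of_real (cmod (s \<omega>))) \<in> elems X"
    using solid[OF s(1), of "\<lambda>\<omega>. complex_of_real (cmod (s \<omega>))"] ms by simp
  ultimately show thesis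
    using that[of "\<lambda>\<omega>. cmod (s \<omega>)"] dominated_cmod[OF s(1)] ms by auto
qed

text \<open>The sums of moduli stay below a finite majorant almost everywhere, so the terms are
  summable there. This is the link between the quasi-norms and pointwise limits that makes the
  couple compatible.\<close>

lemma AE_tendsto_zero:
  assumes "\<And>k. f k \<in> elems X" "\<And>k. qnorm X (f k) \<le> B / (2 * K) ^ k"
  shows "AE \<omega> in M. (\<lambda>k. f k \<omega>) \<longlonglongrightarrow> 0"
proof -
  obtain V where "AE \<omega> in M. \<forall>n. (\<Sum>k<n. cmod (f k \<omega>)) \<le> V \<omega>"
    using geometric_majorant[OF assms] by blast
  then show ?thesis
  proof eventually_elim
    case (elim \<omega>)
    then have "summable (\<lambda>k. cmod (f k \<omega>))"
      using elim[rule_format, of "Suc _"]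
      by (intro bounded_imp_summable[of _ "V \<omega>"]) (simp_all only: lessThan_Suc_atMost norm_ge_zero)
    then show ?case
      by (intro tendsto_norm_zero_cancel[OF summable_LIMSEQ_zero])
  qed
qed

end

section \<open>The sum of a couple of lattices\<close>

locale lattice_couple = X0: normed_lattice M X0 K + X1: normed_lattice M X1 K
  for M :: "'a measure" and X0 X1 :: "'a fspace" and K :: real
begin

abbreviation Z :: "'a fspace" where "Z \<equiv> sum_space M X0 X1"

lemma K_ge_1: "1 \<le> K" and K_pos: "0 < K" and K_nonneg: "0 \<le> K"
  using X0.K_ge_1 by auto

lemma sum_set_bdd_below:
  "bdd_below {qnorm X0 f0 + qnorm X1 f1 |f0 f1.
    f0 \<in> elems X0 \<and> f1 \<in> elems X1 \<and> (AE \<omega> in M. f \<omega> = f0 \<omega> + f1 \<omega>)}"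
  by (rule bdd_belowI[of _ 0]) (auto intro!: add_nonneg_nonneg X0.qnorm_ge_0 X1.qnorm_ge_0)

lemma sum_elemI:
  assumes "f0 \<in> elems X0" "f1 \<in> elems X1" "f \<in> borel_measurable M" "AE \<omega> in M. f \<omega> = f0 \<omega> + f1 \<omega>"
  shows "f \<in> elems Z" "qnorm Z f \<le> qnorm X0 f0 + qnorm X1 f1"
proof -
  show "f \<in> elems Z" using assms by (auto simp: sum_space_def)
  have "qnorm X0 f0 + qnorm X1 f1 \<in> {qnorm X0 f0 + qnorm X1 f1 |f0 f1.
    f0 \<in> elems X0 \<and> f1 \<in> elems X1 \<and> (AE \<omega> in M. f \<omega> = f0 \<omega> + f1 \<omega>)}" using assms by blast
  then show "qnorm Z f \<le> qnorm X0 f0 + qnorm X1 f1"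
    unfolding sum_space_def fspace.simps by (rule cInf_lower) (rule sum_set_bdd_below)
qed

lemma sum_add_elem:
  assumes "f0 \<in> elems X0" "f1 \<in> elems X1"
  shows "(\<lambda>\<omega>. f0 \<omega> + f1 \<omega>) \<in> elems Z" "qnorm Z (\<lambda>\<omega>. f0 \<omega> + f1 \<omega>) \<le> qnorm X0 f0 + qnorm X1 f1"
  using X0.meas[OF assms(1)] X1.meas[OF assms(2)]
  by (intro sum_elemI(1)[OF assms] sum_elemI(2)[OF assms]; simp)+

lemma sum_elem_decomp:
  assumes "f \<in> elems Z" "qnorm Z f < e"
  obtains f0 f1 where "f0 \<in> elems X0" "f1 \<in> elems X1" "AE \<omega> in M. f \<omega> = f0 \<omega> + f1 \<omega>"
    "qnorm X0 f0 + qnorm X1 f1 < e"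
proof -
  let ?S = "{qnorm X0 f0 + qnorm X1 f1 |f0 f1.
    f0 \<in> elems X0 \<and> f1 \<in> elems X1 \<and> (AE \<omega> in M. f \<omega> = f0 \<omega> + f1 \<omega>)}"
  have "?S \<noteq> {}" using assms(1) by (auto simp: sum_space_def)
  moreover have "Inf ?S < e" using assms(2) by (simp add: sum_space_def)
  ultimately have "\<exists>x\<in>?S. x < e"
    using cInf_less_iff[OF _ sum_set_bdd_below] by blast
  then show thesis using that by blast
qed

lemma sum_elem_decomp_ex:
  assumes "f \<in> elems Z"
  shows "\<exists>f0\<in>elems X0. \<exists>f1\<in>elems X1. AE \<omega> in M. f \<omega> = f0 \<omega> + f1 \<omega>"
  using assms by (auto simp: sum_space_def)

lemma sum_qnorm_nonneg: assumes "f \<in> elems Z" shows "0 \<le> qnorm Z f"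
proof (rule ccontr)
  assume "\<not> 0 \<le> qnorm Z f"
  then have "qnorm Z f < 0" by simp
  from sum_elem_decomp[OF assms this] obtain f0 f1 where
    "f0 \<in> elems X0" "f1 \<in> elems X1" "qnorm X0 f0 + qnorm X1 f1 < 0" by blast
  then show False using X0.qnorm_ge_0[of f0] X1.qnorm_ge_0[of f1] by simp
qed

lemma sum_le_epsilonI:
  assumes "f \<in> elems Z" "\<And>f0 f1. f0 \<in> elems X0 \<Longrightarrow> f1 \<in> elems X1 \<Longrightarrow> AE \<omega> in M. f \<omega> = f0 \<omega> + f1 \<omega> \<Longrightarrow>
     c \<le> d * (qnorm X0 f0 + qnorm X1 f1)" "0 \<le> d"
  shows "c \<le> d * qnorm Z f"
proof -
  have "c \<le> d * (qnorm Z f + e)" if "e > 0" for e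
  proof -
    obtain f0 f1 where "f0 \<in> elems X0" "f1 \<in> elems X1" "AE \<omega> in M. f \<omega> = f0 \<omega> + f1 \<omega>"
      "qnorm X0 f0 + qnorm X1 f1 < qnorm Z f + e"
      using sum_elem_decomp[OF assms(1), of "qnorm Z f + e"] \<open>e > 0\<close> by auto
    then show ?thesis
      using assms(2)[of f0 f1] mult_left_mono[of "qnorm X0 f0 + qnorm X1 f1" "qnorm Z f + e" d] assms(3)
      by force
  qed
  then have "(\<lambda>e. d * (qnorm Z f + e)) \<midarrow>0\<rightarrow> d * (qnorm Z f + 0) \<Longrightarrow> c \<le> d * (qnorm Z f + 0)"
    by (intro tendsto_lowerbound[of "\<lambda>e. d * (qnorm Z f + e)" _ "at_right 0"])
       (auto intro: filterlim_mono at_le eventually_at_rightI[of 0 1])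
  moreover have "(\<lambda>e. d * (qnorm Z f + e)) \<midarrow>0\<rightarrow> d * (qnorm Z f + 0)"
    by (intro tendsto_intros)
  ultimately show ?thesis by simp
qed

lemma sum_scale:
  assumes "f \<in> elems Z"
  shows "(\<lambda>\<omega>. c * f \<omega>) \<in> elems Z" "qnorm Z (\<lambda>\<omega>. c * f \<omega>) \<le> cmod c * qnorm Z f"
proof -
  have m: "f \<in> borel_measurable M" using assms by (simp add: sum_space_def)
  have *: "(\<lambda>\<omega>. c * f \<omega>) \<in> elems Z \<and> qnorm Z (\<lambda>\<omega>. c * f \<omega>) \<le> cmod c * (qnorm X0 f0 + qnorm X1 f1)"
    if "f0 \<in> elems X0" "f1 \<in> elems X1" "AE \<omega> in M. f \<omega> = f0 \<omega> + f1 \<omega>" for f0 f1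
  proof -
    have "AE \<omega> in M. c * f \<omega> = c * f0 \<omega> + c * f1 \<omega>"
      using that(3) by eventually_elim (simp add: algebra_simps)
    from sum_elemI[OF X0.scale_elem[OF that(1)] X1.scale_elem[OF that(2)] _ this] show ?thesis
      using m by (auto simp: X0.qnorm_mult X1.qnorm_mult that algebra_simps)
  qed
  obtain f0 f1 where "f0 \<in> elems X0" "f1 \<in> elems X1" "AE \<omega> in M. f \<omega> = f0 \<omega> + f1 \<omega>"
    using sum_elem_decomp_ex[OF assms] by blast
  with * show "(\<lambda>\<omega>. c * f \<omega>) \<in> elems Z" by blast
  show "qnorm Z (\<lambda>\<omega>. c * f \<omega>) \<le> cmod c * qnorm Z f"
    by (rule sum_le_epsilonI[OF assms]) (use * in auto)
qed

text \<open>The axiom with content is definiteness. If the norm of f is 0, then f has decompositions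
  whose summands are geometrically small in X0 and X1; these tend to 0 almost everywhere, so f
  does.\<close>

sublocale Z: quasi_normed_fspace M Z K
proof
  show "1 \<le> K" by (rule K_ge_1)
  show "elems Z \<subseteq> borel_measurable M" by (auto simp: sum_space_def)
  show "(\<lambda>_. 0) \<in> elems Z"
    using sum_add_elem(1)[OF X0.zero_elem X1.zero_elem] by simp
  show "g \<in> elems Z \<and> qnorm Z g = qnorm Z f"
    if "f \<in> elems Z" "g \<in> borel_measurable M" "AE \<omega> in M. g \<omega> = f \<omega>" for f g
  proof -
    have iff: "(AE \<omega> in M. g \<omega> = f0 \<omega> + f1 \<omega>) \<longleftrightarrow> (AE \<omega> in M. f \<omega> = f0 \<omega> + f1 \<omega>)" for f0 f1
    proof
      assume "AE \<omega> in M. g \<omega> = f0 \<omega> + f1 \<omega>"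
      with that(3) show "AE \<omega> in M. f \<omega> = f0 \<omega> + f1 \<omega>" by eventually_elim simp
    next
      assume "AE \<omega> in M. f \<omega> = f0 \<omega> + f1 \<omega>"
      with that(3) show "AE \<omega> in M. g \<omega> = f0 \<omega> + f1 \<omega>" by eventually_elim simp
    qed
    show ?thesis using that(1,2) by (simp add: sum_space_def iff)
  qed
  show scale: "(\<lambda>\<omega>. c * f \<omega>) \<in> elems Z" if "f \<in> elems Z" for f c
    by (rule sum_scale[OF that])
  show "0 \<le> qnorm Z f" if "f \<in> elems Z" for f
    by (rule sum_qnorm_nonneg[OF that])
  have le: "(\<lambda>\<omega>. f \<omega> + g \<omega>) \<in> elems Z \<and> qnorm Z (\<lambda>\<omega>. f \<omega> + g \<omega>) \<le> K * (qnorm X0 f0 + qnorm X1 f1 + (qnorm X0 g0 + qnorm X1 g1))"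
    if "f \<in> elems Z" "g \<in> elems Z" "f0 \<in> elems X0" "f1 \<in> elems X1" "AE \<omega> in M. f \<omega> = f0 \<omega> + f1 \<omega>"
       "g0 \<in> elems X0" "g1 \<in> elems X1" "AE \<omega> in M. g \<omega> = g0 \<omega> + g1 \<omega>" for f g f0 f1 g0 g1
  proof -
    have "AE \<omega> in M. f \<omega> + g \<omega> = (f0 \<omega> + g0 \<omega>) + (f1 \<omega> + g1 \<omega>)"
      using that(5,8) by eventually_elim simp
    from sum_elemI[OF X0.add_elem[OF that(3,6)] X1.add_elem[OF that(4,7)] _ this]
    show ?thesis
      using X0.quasi_triangle[OF that(3,6)] X1.quasi_triangle[OF that(4,7)] that(1,2)
      by (auto simp: sum_space_def algebra_simps)
  qed
  show "(\<lambda>\<omega>. f \<omega> + g \<omega>) \<in> elems Z" if fg: "f \<in> elems Z" "g \<in> elems Z" for f g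
  proof -
    obtain f0 f1 where f: "f0 \<in> elems X0" "f1 \<in> elems X1" "AE \<omega> in M. f \<omega> = f0 \<omega> + f1 \<omega>"
      using sum_elem_decomp_ex[OF fg(1)] by blast
    obtain g0 g1 where g: "g0 \<in> elems X0" "g1 \<in> elems X1" "AE \<omega> in M. g \<omega> = g0 \<omega> + g1 \<omega>"
      using sum_elem_decomp_ex[OF fg(2)] by blast
    show ?thesis using le[OF fg f g] by (rule conjunct1)
  qed
  show "qnorm Z (\<lambda>\<omega>. f \<omega> + g \<omega>) \<le> K * (qnorm Z f + qnorm Z g)" if fg: "f \<in> elems Z" "g \<in> elems Z" for f g
  proof -
    have "qnorm Z (\<lambda>\<omega>. f \<omega> + g \<omega>) - K * (qnorm X0 f0 + qnorm X1 f1) \<le> K * qnorm Z g"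
      if f: "f0 \<in> elems X0" "f1 \<in> elems X1" "AE \<omega> in M. f \<omega> = f0 \<omega> + f1 \<omega>" for f0 f1
    proof (rule sum_le_epsilonI[OF fg(2) _ K_nonneg])
      fix g0 g1 assume "g0 \<in> elems X0" "g1 \<in> elems X1" "AE \<omega> in M. g \<omega> = g0 \<omega> + g1 \<omega>"
      from le[OF fg f this]
      show "qnorm Z (\<lambda>\<omega>. f \<omega> + g \<omega>) - K * (qnorm X0 f0 + qnorm X1 f1) \<le> K * (qnorm X0 g0 + qnorm X1 g1)"
        by (simp add: algebra_simps)
    qed
    then have "qnorm Z (\<lambda>\<omega>. f \<omega> + g \<omega>) - K * qnorm Z g \<le> K * qnorm Z f"
      by (intro sum_le_epsilonI[OF fg(1) _ K_nonneg]) (simp add: algebra_simps)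
    then show ?thesis by (simp add: algebra_simps)
  qed
  show "qnorm Z (\<lambda>\<omega>. c * f \<omega>) = cmod c * qnorm Z f" if "f \<in> elems Z" for f c
  proof (cases "c = 0")
    case True
    have "qnorm Z (\<lambda>\<omega>. 0) \<le> 0"
      using sum_add_elem(2)[OF X0.zero_elem X1.zero_elem] by simp
    then show ?thesis using True sum_qnorm_nonneg[OF scale[OF that, of 0]] by simp
  next
    case False
    have "qnorm Z (\<lambda>\<omega>. inverse c * (c * f \<omega>)) \<le> cmod (inverse c) * qnorm Z (\<lambda>\<omega>. c * f \<omega>)"
      by (rule sum_scale[OF scale[OF that]])
    moreover have "(\<lambda>\<omega>. inverse c * (c * f \<omega>)) = f" using False by (auto simp flip: mult.assoc)
    ultimately have "cmod c * qnorm Z f \<le> qnorm Z (\<lambda>\<omega>. c * f \<omega>)"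
      using False by (simp add: norm_divide norm_inverse field_simps)
    then show ?thesis using sum_scale(2)[OF that, of c] by simp
  qed
  show "qnorm Z f = 0 \<longleftrightarrow> (AE \<omega> in M. f \<omega> = 0)" if f: "f \<in> elems Z" for f
  proof
    assume "AE \<omega> in M. f \<omega> = 0"
    then have "qnorm Z f \<le> qnorm X0 (\<lambda>_. 0) + qnorm X1 (\<lambda>_. 0)"
      using f by (intro sum_elemI X0.zero_elem X1.zero_elem) (auto simp: sum_space_def)
    then show "qnorm Z f = 0" using sum_qnorm_nonneg[OF f] by simp
  next
    assume 0: "qnorm Z f = 0"
    have "\<exists>f0 f1. f0 \<in> elems X0 \<and> f1 \<in> elems X1 \<and> (AE \<omega> in M. f \<omega> = f0 \<omega> + f1 \<omega>) \<and>
      qnorm X0 f0 + qnorm X1 f1 < 1 / (2 * K) ^ n" for n :: nat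
    proof -
      have "qnorm Z f < 1 / (2 * K) ^ n" using 0 K_pos by simp
      show ?thesis by (rule sum_elem_decomp[OF f \<open>qnorm Z f < 1 / (2 * K) ^ n\<close>]) blast
    qed
    then obtain f0 f1 where d: "\<And>n. f0 n \<in> elems X0" "\<And>n. f1 n \<in> elems X1"
      "\<And>n. AE \<omega> in M. f \<omega> = f0 n \<omega> + f1 n \<omega>"
      "\<And>n. qnorm X0 (f0 n) + qnorm X1 (f1 n) < 1 / (2 * K) ^ n" by metis
    have "qnorm X0 (f0 n) \<le> 1 / (2 * K) ^ n" "qnorm X1 (f1 n) \<le> 1 / (2 * K) ^ n" for n
      using d(4)[of n] X0.qnorm_ge_0[OF d(1)[of n]] X1.qnorm_ge_0[OF d(2)[of n]] by linarith+
    from X0.AE_tendsto_zero[OF d(1) this(1)] X1.AE_tendsto_zero[OF d(2) this(2)]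
    have "AE \<omega> in M. (\<lambda>n. f0 n \<omega>) \<longlonglongrightarrow> 0" "AE \<omega> in M. (\<lambda>n. f1 n \<omega>) \<longlonglongrightarrow> 0" by blast+
    moreover have "AE \<omega> in M. \<forall>n. f \<omega> = f0 n \<omega> + f1 n \<omega>"
      using d(3) by (simp add: AE_all_countable)
    ultimately show "AE \<omega> in M. f \<omega> = 0"
    proof eventually_elim
      case (elim \<omega>)
      have "(\<lambda>n. f0 n \<omega> + f1 n \<omega>) \<longlonglongrightarrow> 0 + 0" by (intro tendsto_add elim)
      then have "(\<lambda>n::nat. f \<omega>) \<longlonglongrightarrow> 0" using elim(3) by simp
      then show ?case by (simp add: LIMSEQ_const_iff)
    qed
  qed
qed

lemma X0_sub: assumes "f \<in> elems X0" shows "f \<in> elems Z" "qnorm Z f \<le> qnorm X0 f"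
  using sum_add_elem[OF assms X1.zero_elem] by auto

lemma X1_sub: assumes "f \<in> elems X1" shows "f \<in> elems Z" "qnorm Z f \<le> qnorm X1 f"
  using sum_add_elem[OF X0.zero_elem assms] by auto

lemma converges_in_squeeze:
  assumes "((\<lambda>i. r i) \<longlongrightarrow> (0::real)) F" "eventually (\<lambda>i. (\<lambda>\<omega>. u i \<omega> - f \<omega>) \<in> elems Z) F"
    "eventually (\<lambda>i. qnorm Z (\<lambda>\<omega>. u i \<omega> - f \<omega>) \<le> r i) F"
  shows "converges_in Z u f F"
  unfolding converges_in_def
  by (rule tendsto_sandwich[OF _ assms(3) tendsto_const assms(1)])
     (use assms(2) in \<open>auto elim!: eventually_mono intro: Z.qnorm_ge_0\<close>)

lemma converges_in_X0_sum:
  assumes "\<And>i. u i \<in> elems X0" "f \<in> elems X0" "converges_in X0 u f F"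
  shows "converges_in Z u f F"
  by (rule converges_in_squeeze[OF assms(3)[unfolded converges_in_def]])
     (auto intro!: always_eventually X0_sub X0.diff_closed assms)

lemma converges_in_X1_sum:
  assumes "\<And>i. u i \<in> elems X1" "f \<in> elems X1" "converges_in X1 u f F"
  shows "converges_in Z u f F"
  by (rule converges_in_squeeze[OF assms(3)[unfolded converges_in_def]])
     (auto intro!: always_eventually X1_sub X1.diff_closed assms)

text \<open>Riesz decomposition: g is divided between the two spaces in proportion to the majorants
  p and q, so that |g| <= p + q gives summands bounded by p and by q.\<close>

lemma dominated_sum_elem:
  assumes "X0.dominated u c" "X1.dominated v d" "g \<in> borel_measurable M"
    "AE \<omega> in M. cmod (g \<omega>) \<le> u \<omega> + v \<omega>"
  shows "g \<in> elems Z" "qnorm Z g \<le> c + d"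
proof -
  obtain p where p: "p \<in> borel_measurable M" "\<And>\<omega>. 0 \<le> p \<omega>" "AE \<omega> in M. u \<omega> \<le> p \<omega>"
    "(\<lambda>\<omega>. complex_of_real (p \<omega>)) \<in> elems X0" "qnorm X0 (\<lambda>\<omega>. complex_of_real (p \<omega>)) \<le> c"
    using X0.dominated_majorant[OF assms(1)] by metis
  obtain q where q: "q \<in> borel_measurable M" "\<And>\<omega>. 0 \<le> q \<omega>" "AE \<omega> in M. v \<omega> \<le> q \<omega>"
    "(\<lambda>\<omega>. complex_of_real (q \<omega>)) \<in> elems X1" "qnorm X1 (\<lambda>\<omega>. complex_of_real (q \<omega>)) \<le> d"
    using X1.dominated_majorant[OF assms(2)] by metis
  \<comment> \<open>Where p + q = 0 the quotient is 0 by convention; there g vanishes as well, so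
    the two parts still add up to g.\<close>
  define g0 where "g0 \<omega> = g \<omega> * of_real (p \<omega> / (p \<omega> + q \<omega>))" for \<omega>
  define g1 where "g1 \<omega> = g \<omega> * of_real (q \<omega> / (p \<omega> + q \<omega>))" for \<omega>
  have m: "g0 \<in> borel_measurable M" "g1 \<in> borel_measurable M"
    unfolding g0_def g1_def using p(1) q(1) assms(3) by measurable
  have bound: "AE \<omega> in M. cmod (g \<omega>) \<le> p \<omega> + q \<omega>"
    using assms(4) p(3) q(3) by eventually_elim simp
  have 0: "AE \<omega> in M. cmod (g0 \<omega>) \<le> cmod (complex_of_real (p \<omega>))"
    using bound
  proof eventually_elim
    case (elim \<omega>)
    have "cmod (g \<omega>) * p \<omega> \<le> (p \<omega> + q \<omega>) * p \<omega>" using elim p(2) by (intro mult_right_mono) auto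
    then show ?case using p(2)[of \<omega>] q(2)[of \<omega>]
      by (cases "p \<omega> + q \<omega> = 0") (auto simp: g0_def norm_mult norm_divide field_simps simp flip: of_real_add)
  qed
  have 1: "AE \<omega> in M. cmod (g1 \<omega>) \<le> cmod (complex_of_real (q \<omega>))"
    using bound
  proof eventually_elim
    case (elim \<omega>)
    have "cmod (g \<omega>) * q \<omega> \<le> (p \<omega> + q \<omega>) * q \<omega>" using elim q(2) by (intro mult_right_mono) auto
    then show ?case using p(2)[of \<omega>] q(2)[of \<omega>]
      by (cases "p \<omega> + q \<omega> = 0") (auto simp: g1_def norm_mult norm_divide field_simps simp flip: of_real_add)
  qed
  have eq: "AE \<omega> in M. g \<omega> = g0 \<omega> + g1 \<omega>"
    using bound
  proof eventually_elim
    case (elim \<omega>)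
    show ?case
    proof (cases "p \<omega> + q \<omega> = 0")
      case True
      then show ?thesis using elim by (simp add: g0_def g1_def)
    next
      case False
      then have "p \<omega> / (p \<omega> + q \<omega>) + q \<omega> / (p \<omega> + q \<omega>) = 1" by (simp flip: add_divide_distrib)
      then show ?thesis unfolding g0_def g1_def by (metis mult.right_neutral of_real_1 of_real_add ring_class.ring_distribs(1))
    qed
  qed
  note s0 = X0.solid[OF p(4) m(1) 0] and s1 = X1.solid[OF q(4) m(2) 1]
  show "g \<in> elems Z" "qnorm Z g \<le> c + d"
    using sum_elemI[OF conjunct1[OF s0] conjunct1[OF s1] assms(3) eq] s0 s1 p(5) q(5) by auto
qed

end

section \<open>A discrete Jensen inequality\<close>

definition unit_root :: "nat \<Rightarrow> nat \<Rightarrow> complex" where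
  "unit_root N k = cis (2 * pi * (real k / real N))"

text \<open>On the unit circle the real part is the Fejer kernel divided by N, that is |1 + z + ...
  + z^(N-1)|^2 / N^2. The polynomial is its holomorphic completion, so combinations of translates
  can be exponentiated to holomorphic functions of prescribed modulus.\<close>

definition fejer :: "nat \<Rightarrow> complex \<Rightarrow> complex" where
  "fejer N z = (of_nat N + 2 * (\<Sum>j=1..<N. of_nat (N - j) * z ^ j)) / of_nat N ^ 2"

lemma norm_unit_root [simp]: "cmod (unit_root N k) = 1"
  by (simp add: unit_root_def)

lemma fejer_zero: "0 < N \<Longrightarrow> fejer N 0 = 1 / of_nat N"
  by (simp add: fejer_def power2_eq_square power_0_left)

lemma holomorphic_fejer [holomorphic_intros]:
  "f holomorphic_on A \<Longrightarrow> (\<lambda>z. fejer N (f z)) holomorphic_on A"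
  unfolding fejer_def by (cases "N = 0") (auto intro!: holomorphic_intros)

lemma cmod_add_power2: "(cmod (a + b))\<^sup>2 = (cmod a)\<^sup>2 + 2 * Re (a * cnj b) + (cmod b)\<^sup>2"
  unfolding cmod_power2 by (simp add: power2_eq_square algebra_simps)

text \<open>Passing from N to N + 1 adds z^N to the geometric sum. The cross term contributes twice
  the real parts of z, ..., z^N, which raises each coefficient N - j by one.\<close>

lemma Re_fejer_aux:
  assumes "cmod z = 1"
  shows "real N + 2 * Re (\<Sum>j=1..<N. of_nat (N - j) * z ^ j) = (cmod (\<Sum>j<N. z ^ j))\<^sup>2"
proof (induction N)
  case (Suc N)
  have zz: "z * cnj z = 1" using assms by (simp add: complex_norm_square[symmetric])
  have "(\<Sum>j<N. z ^ j) * cnj (z ^ N) = (\<Sum>j<N. cnj (z ^ (N - j)))"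
    unfolding sum_distrib_right
  proof (intro sum.cong refl)
    fix j assume "j \<in> {..<N}"
    then have "z ^ j * cnj (z ^ N) = z ^ j * (cnj z ^ j * cnj z ^ (N - j))"
      by (simp flip: power_add)
    also have "\<dots> = (z * cnj z) ^ j * cnj z ^ (N - j)" by (simp add: power_mult_distrib)
    finally show "z ^ j * cnj (z ^ N) = cnj (z ^ (N - j))" using zz by simp
  qed
  then have "Re ((\<Sum>j<N. z ^ j) * cnj (z ^ N)) = (\<Sum>j<N. Re (z ^ (N - j)))"
    by (simp only: Re_sum cnj.sel(1))
  also have "\<dots> = (\<Sum>j=1..N. Re (z ^ j))"
    by (rule sum.reindex_bij_witness[of _ "\<lambda>j. N - j" "\<lambda>j. N - j"]) auto
  finally have cross: "Re ((\<Sum>j<N. z ^ j) * cnj (z ^ N)) = (\<Sum>j=1..N. Re (z ^ j))" .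
  have "(cmod (\<Sum>j<Suc N. z ^ j))\<^sup>2 = (cmod (\<Sum>j<N. z ^ j))\<^sup>2 + 2 * Re ((\<Sum>j<N. z ^ j) * cnj (z ^ N)) + (cmod (z ^ N))\<^sup>2"
    by (simp only: sum.lessThan_Suc cmod_add_power2)
  also have "\<dots> = real N + 2 * Re (\<Sum>j=1..<N. of_nat (N - j) * z ^ j) + 2 * (\<Sum>j=1..N. Re (z ^ j)) + 1"
    using Suc.IH cross assms by (simp add: norm_power)
  finally have main: "(cmod (\<Sum>j<Suc N. z ^ j))\<^sup>2 =
    real N + 2 * Re (\<Sum>j=1..<N. of_nat (N - j) * z ^ j) + 2 * (\<Sum>j=1..N. Re (z ^ j)) + 1" .
  have shift: "(\<Sum>j=1..N. Re (z ^ j)) + Re (\<Sum>j=1..<N. of_nat (N - j) * z ^ j) = Re (\<Sum>j=1..N. of_nat (Suc N - j) * z ^ j)"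
  proof -
    have "(\<Sum>j=1..<N. of_nat (N - j) * z ^ j) = (\<Sum>j=1..N. of_nat (N - j) * z ^ j)"
      by (intro sum.mono_neutral_left) auto
    moreover have "(\<Sum>j=1..N. of_nat (Suc N - j) * z ^ j) = (\<Sum>j=1..N. z ^ j) + (\<Sum>j=1..N. of_nat (N - j) * z ^ j)"
      unfolding sum.distrib[symmetric]
      by (intro sum.cong) (auto simp: Suc_diff_le algebra_simps)
    ultimately show ?thesis by simp
  qed
  show ?case
    unfolding main atLeastLessThanSuc_atLeastAtMost shift[symmetric] by simp
qed simp

lemma Re_fejer:
  assumes "cmod z = 1"
  shows "Re (fejer N z) = (cmod (\<Sum>j<N. z ^ j))\<^sup>2 / real N ^ 2"
proof -
  have "fejer N z = (of_nat N + 2 * (\<Sum>j=1..<N. of_nat (N - j) * z ^ j)) / of_real (real N ^ 2)"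
    by (simp add: fejer_def)
  then have "Re (fejer N z) = (real N + 2 * Re (\<Sum>j=1..<N. of_nat (N - j) * z ^ j)) / real N ^ 2"
    by (simp only: Re_divide_of_real) simp
  then show ?thesis by (simp only: Re_fejer_aux[OF assms])
qed

lemma Re_fejer_nonneg: "cmod z = 1 \<Longrightarrow> 0 \<le> Re (fejer N z)"
  by (simp add: Re_fejer)

text \<open>The geometric sum times z - 1 is z^N - 1, of modulus at most 2. This quadratic decay
  away from 1 is the only concentration property of the kernel that enters.\<close>

lemma Re_fejer_decay:
  assumes "cmod z = 1"
  shows "Re (fejer N z) * (cmod (z - 1))\<^sup>2 \<le> 4 / real N ^ 2"
proof -
  have "(z - 1) * (\<Sum>j<N. z ^ j) = z ^ N - 1"
    by (simp add: power_diff_1_eq)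
  then have "cmod (z - 1) * cmod (\<Sum>j<N. z ^ j) \<le> 2"
    by (metis (no_types) assms norm_mult norm_one norm_power norm_triangle_ineq4 one_add_one power_one)
  then have "(cmod (z - 1) * cmod (\<Sum>j<N. z ^ j))\<^sup>2 \<le> 2\<^sup>2"
    by (intro power_mono) auto
  then show ?thesis
    by (simp add: Re_fejer[OF assms] power_mult_distrib divide_right_mono mult.commute)
qed

lemma cmod_times_cnj_minus_1:
  assumes "cmod w = 1"
  shows "cmod (z * cnj w - 1) = cmod (z - w)"
proof -
  have "(z * cnj w - 1) * w = z - w"
    using assms by (simp add: algebra_simps complex_norm_square[symmetric])
  then show ?thesis using assms by (metis mult.right_neutral norm_mult)
qed

lemma sum_unit_root_power:
  assumes "0 < j" "j < N"
  shows "(\<Sum>k<N. cnj (unit_root N k) ^ j) = 0"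
proof -
  define x where "x = cis (- (2 * pi * (real j / real N)))"
  have p: "cnj (unit_root N k) ^ j = x ^ k" for k
    by (simp add: unit_root_def x_def Complex.DeMoivre cis_cnj mult_ac)
  have "x ^ N = cis (- (2 * pi * real j))"
    using assms by (simp add: x_def Complex.DeMoivre)
  also have "\<dots> = 1" using cis_multiple_2pi[of "- real j"] by simp
  finally have "x ^ N = 1" .
  moreover have "x \<noteq> 1"
  proof
    assume "x = 1"
    then have "cos (2 * pi * (real j / real N)) = 1" by (simp add: x_def cis.ctr complex_eq_iff)
    then obtain i :: int where "2 * pi * (real j / real N) = of_int i * 2 * pi"
      by (auto simp: cos_one_2pi_int)
    then have "2 * pi * (real j / real N) = 2 * pi * of_int i" by (simp only: mult_ac)
    then have "real j / real N = of_int i" by (simp only: mult_cancel_left) simp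
    moreover have "0 < real j / real N" "real j / real N < 1" using assms by auto
    ultimately show False by auto
  qed
  ultimately show ?thesis
    unfolding p by (simp add: geometric_sum)
qed

text \<open>Summation over the roots of unity kills every power except the constant term. The
  weights therefore add up to exactly 1, and no normalisation error occurs in the
  discretisation.\<close>

lemma sum_Re_fejer:
  assumes "0 < N"
  shows "(\<Sum>k<N. Re (fejer N (z * cnj (unit_root N k)))) = 1"
proof -
  have "(\<Sum>k<N. fejer N (z * cnj (unit_root N k))) =
      (of_nat N * of_nat N + 2 * (\<Sum>j=1..<N. of_nat (N - j) * z ^ j * (\<Sum>k<N. cnj (unit_root N k) ^ j))) / of_nat N ^ 2"
    unfolding fejer_def sum_divide_distrib[symmetric] sum.distrib sum_distrib_left[symmetric]
    by (subst sum.swap) (simp add: power_mult_distrib sum_distrib_left mult_ac)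
  also have "\<dots> = 1"
    using assms by (simp add: sum_unit_root_power power2_eq_square)
  finally show ?thesis by (metis Re_sum one_complex.sel(1))
qed

text \<open>With b = |\<phi>| + c, the polynomial W interpolates ln b by Fejer weights, and Re W + E
  majorises ln b on the circle because ln b has Lipschitz constant at most L / c there. The maximum
  principle for \<open>\<phi> z * exp (- W z)\<close> gives the claim, since Re W(0) is the plain
  mean. The floor c keeps the logarithm finite at zeros of \<phi>.\<close>

lemma discrete_jensen:
  fixes \<phi> :: "complex \<Rightarrow> complex"
  assumes cont: "continuous_on (cball 0 1) \<phi>" and hol: "\<phi> holomorphic_on ball 0 1"
    and c: "0 < c" and N: "0 < N"
    and lip: "\<And>z w. cmod z = 1 \<Longrightarrow> cmod w = 1 \<Longrightarrow> cmod (\<phi> z - \<phi> w) \<le> L * cmod (z - w)"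
  shows "cmod (\<phi> 0) \<le> exp (2 * L / (c * sqrt N) + (\<Sum>k<N. ln (cmod (\<phi> (unit_root N k)) + c)) / N)"
proof -
  define \<zeta> where "\<zeta> = unit_root N"
  define b where "b z = cmod (\<phi> z) + c" for z
  define W where "W z = (\<Sum>k<N. fejer N (z * cnj (\<zeta> k)) * of_real (ln (b (\<zeta> k))))" for z
  define E where "E = 2 * L / (c * sqrt N)"
  have L: "0 \<le> L" using lip[of 1 "-1"] norm_ge_zero[of "\<phi> 1 - \<phi> (-1)"] by (simp add: order_trans[OF norm_ge_zero] del: norm_ge_zero; linarith)
  have b: "0 < b z" "c \<le> b z" for z using c by (auto simp: b_def add_nonneg_pos)
  have holW: "W holomorphic_on A" for A
    unfolding W_def by (intro holomorphic_intros)
  have key: "ln (b z) \<le> Re (W z) + E" if z: "cmod z = 1" for z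
  proof -
    define w where "w k = Re (fejer N (z * cnj (\<zeta> k)))" for k
    define d where "d k = cmod (z - \<zeta> k)" for k
    have nz: "cmod (z * cnj (\<zeta> k)) = 1" for k using z by (simp add: norm_mult \<zeta>_def)
    have w0: "0 \<le> w k" for k unfolding w_def by (rule Re_fejer_nonneg[OF nz])
    have wd: "w k * (d k)\<^sup>2 \<le> 4 / real N ^ 2" for k
      using Re_fejer_decay[OF nz, of N k] cmod_times_cnj_minus_1[of "\<zeta> k" z] by (simp add: w_def d_def \<zeta>_def)
    have w1: "(\<Sum>k<N. w k) = 1" unfolding w_def \<zeta>_def by (rule sum_Re_fejer[OF N])
    \<comment> \<open>The mean distance to the nodes is estimated from the mean square distance, at
      most 4 / N, by d <= (t + d^2 / t) / 2. This t balances the two terms.\<close>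
    define t where "t = 2 / sqrt N"
    have t: "t > 0" using N by (simp add: t_def)
    have "(\<Sum>k<N. w k * d k) \<le> (\<Sum>k<N. (t * w k + w k * (d k)\<^sup>2 / t) / 2)"
    proof (rule sum_mono)
      fix k
      have "0 \<le> (t - d k)\<^sup>2" by simp
      then have "2 * t * d k \<le> t\<^sup>2 + (d k)\<^sup>2" by (simp add: power2_diff)
      then have "d k \<le> (t + (d k)\<^sup>2 / t) / 2" using t by (simp add: field_simps power2_eq_square)
      from mult_left_mono[OF this w0[of k]] show "w k * d k \<le> (t * w k + w k * (d k)\<^sup>2 / t) / 2"
        by (simp add: algebra_simps)
    qed
    also have "\<dots> = (t * (\<Sum>k<N. w k) + (\<Sum>k<N. w k * (d k)\<^sup>2) / t) / 2"
      by (simp add: sum.distrib sum_distrib_left sum_divide_distrib add_divide_distrib)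
    also have "(\<Sum>k<N. w k * (d k)\<^sup>2) \<le> (\<Sum>k<N. 4 / real N ^ 2)"
      by (intro sum_mono wd)
    also have "(\<Sum>k<N. 4 / real N ^ 2) = 4 / N" using N by (simp add: power2_eq_square)
    also have "(t * (\<Sum>k<N. w k) + 4 / N / t) / 2 = t"
    proof -
      have "t * t = 4 / N" by (simp add: t_def)
      then have "4 / N / t = t" using t by (metis nonzero_mult_div_cancel_right less_irrefl)
      then show ?thesis using w1 by simp
    qed
    finally have sumd: "(\<Sum>k<N. w k * d k) \<le> t" using t by (simp add: divide_right_mono)
    have "ln (b z) - Re (W z) = (\<Sum>k<N. w k * ln (b z)) - (\<Sum>k<N. w k * ln (b (\<zeta> k)))"
      using w1 by (simp add: W_def w_def flip: sum_distrib_right)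
    also have "\<dots> = (\<Sum>k<N. w k * (ln (b z) - ln (b (\<zeta> k))))"
      by (simp add: algebra_simps sum_subtractf)
    also have "\<dots> \<le> (\<Sum>k<N. w k * (L / c * d k))"
    proof (intro sum_mono mult_left_mono w0)
      fix k
      have "ln (b z) - ln (b (\<zeta> k)) = ln (b z / b (\<zeta> k))"
        using b(1)[of z] b(1)[of "\<zeta> k"] by (simp add: ln_div)
      also have "\<dots> \<le> b z / b (\<zeta> k) - 1" using b by (intro ln_le_minus_one) auto
      also have "\<dots> = (b z - b (\<zeta> k)) / b (\<zeta> k)" using b(1)[of "\<zeta> k"] by (simp add: field_simps)
      also have "\<dots> \<le> cmod (\<phi> z - \<phi> (\<zeta> k)) / b (\<zeta> k)"
        using b(1)[of "\<zeta> k"] norm_triangle_ineq2[of "\<phi> z" "\<phi> (\<zeta> k)"] by (intro divide_right_mono) (auto simp: b_def)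
      also have "\<dots> \<le> cmod (\<phi> z - \<phi> (\<zeta> k)) / c"
        using b(2)[of "\<zeta> k"] c by (intro divide_left_mono) auto
      also have "\<dots> \<le> L * d k / c" 
        using lip[OF z, of "\<zeta> k"] c by (intro divide_right_mono) (auto simp: d_def \<zeta>_def)
      finally show "ln (b z) - ln (b (\<zeta> k)) \<le> L / c * d k" by simp
    qed
    also have "\<dots> = L / c * (\<Sum>k<N. w k * d k)" by (simp add: sum_distrib_left mult_ac)
    also have "\<dots> \<le> L / c * t" using sumd L c by (intro mult_left_mono) auto
    also have "\<dots> = E" by (simp add: E_def t_def)
    finally show ?thesis by simp
  qed
  have "cmod (\<phi> 0 * exp (- W 0)) \<le> exp E"
  proof (rule maximum_modulus_frontier[of "\<lambda>z. \<phi> z * exp (- W z)" "ball 0 1"])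
    show "(\<lambda>z. \<phi> z * exp (- W z)) holomorphic_on interior (ball 0 1)"
      using hol by (auto intro!: holomorphic_intros holW)
    show "continuous_on (closure (ball 0 1)) (\<lambda>z. \<phi> z * exp (- W z))"
      using cont by (auto intro!: continuous_intros holomorphic_on_imp_continuous_on[OF holW])
    fix z :: complex assume "z \<in> frontier (ball 0 1)"
    then have z: "cmod z = 1" by simp
    have "cmod (\<phi> z * exp (- W z)) = cmod (\<phi> z) * exp (- Re (W z))" by (simp add: norm_mult)
    also have "\<dots> \<le> b z * exp (- Re (W z))" using c by (intro mult_right_mono) (auto simp: b_def)
    also have "\<dots> = exp (ln (b z) - Re (W z))" using b by (simp add: exp_diff exp_minus field_simps)
    also have "\<dots> \<le> exp E" using key[OF z] by simp
    finally show "cmod (\<phi> z * exp (- W z)) \<le> exp E" .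
  qed auto
  moreover have "Re (W 0) = (\<Sum>k<N. ln (b (\<zeta> k))) / N"
    using N by (simp add: W_def fejer_zero sum_divide_distrib)
  ultimately have "cmod (\<phi> 0) * exp (- ((\<Sum>k<N. ln (b (\<zeta> k))) / N)) \<le> exp E"
    by (simp add: norm_mult)
  then have "cmod (\<phi> 0) \<le> exp E * exp ((\<Sum>k<N. ln (b (\<zeta> k))) / N)"
    by (simp add: exp_minus field_simps)
  then show ?thesis by (simp add: E_def b_def \<zeta>_def exp_add)
qed

section \<open>Polynomials localized on arcs\<close>

text \<open>The circle is cut into n half-open arcs k / n <= x < (k + 1) / n, numbered cyclically.
  Writing the predecessor as \<open>(k + n - 1) mod n\<close> avoids truncated subtraction at k =
  0.\<close>

definition adjacent_arcs :: "nat \<Rightarrow> nat \<Rightarrow> nat set" where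
  "adjacent_arcs n k = {k, (k + 1) mod n, (k + n - 1) mod n}"

lemma sin_pi_lower:
  assumes "0 < a" "a \<le> t" "t \<le> 1 - a"
  shows "sin (pi * a) \<le> sin (pi * t)"
proof (cases "t \<le> 1 / 2")
  case True
  have "0 \<le> pi * a" using assms by simp
  moreover have "pi * t \<le> pi * (1 / 2)" using True by (intro mult_left_mono) auto
  moreover have "pi * a \<le> pi * t" using assms by (intro mult_left_mono) auto
  ultimately show ?thesis by (intro sin_monotone_2pi_le) (use pi_gt_zero in linarith)+
next
  case False
  have "sin (pi * a) \<le> sin (pi * (1 - t))"
  proof (rule sin_monotone_2pi_le)
    have "0 \<le> pi * a" using assms by simp
    then show "- (pi / 2) \<le> pi * a" using pi_gt_zero by linarith
    show "pi * a \<le> pi * (1 - t)" using assms by (intro mult_left_mono) auto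
    have "pi * (1 - t) \<le> pi * (1 / 2)" using False by (intro mult_left_mono) auto
    then show "pi * (1 - t) \<le> pi / 2" by simp
  qed
  also have "\<dots> = sin (pi * t)" by (simp add: algebra_simps)
  finally show ?thesis .
qed

lemma cmod_cis_diff: "cmod (cis a - cis b) = 2 * \<bar>sin ((a - b) / 2)\<bar>"
proof -
  have "cis a - cis b = cis ((a + b) / 2) * (2 * \<i> * of_real (sin ((a - b) / 2)))"
  proof -
    have "cis a = cis ((a + b) / 2) * cis ((a - b) / 2)" "cis b = cis ((a + b) / 2) * cis (- ((a - b) / 2))"
      by (simp_all add: cis_mult field_simps)
    then have "cis a - cis b = cis ((a + b) / 2) * (cis ((a - b) / 2) - cis (- ((a - b) / 2)))"
      by (simp add: algebra_simps)
    also have "cis ((a - b) / 2) - cis (- ((a - b) / 2)) = 2 * \<i> * of_real (sin ((a - b) / 2))"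
      by (simp add: complex_eq_iff)
    finally show ?thesis .
  qed
  then show ?thesis by (simp add: norm_mult)
qed

text \<open>For non-adjacent arcs a whole arc lies between them in both directions around the
  circle, so |x - y| lies between 1 / n and 1 - 1 / n. The chord has length 2 |sin (pi (x -
  y))|.\<close>

lemma distance_between_arcs:
  assumes x: "0 \<le> x" "real k \<le> n * x" "n * x < real k + 1"
    and y: "real m \<le> n * y" "n * y < real m + 1"
    and km: "k < n" "m < n" "m \<notin> adjacent_arcs n k"
  shows "n \<ge> 2" "2 * sin (pi / n) \<le> cmod (cis (2 * pi * x) - cis (2 * pi * y))"
proof -
  have ne: "m \<noteq> k" "m \<noteq> (k + 1) mod n" "m \<noteq> (k + n - 1) mod n"
    using km(3) by (auto simp: adjacent_arcs_def)
  show n2: "n \<ge> 2" using km ne(1) by linarith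
  have "1 / n \<le> \<bar>x - y\<bar> \<and> \<bar>x - y\<bar> \<le> 1 - 1 / n"
  proof (cases "m > k")
    case True
    then have "m \<noteq> k + 1" using ne(2) km by auto
    moreover have "m \<noteq> n - 1 \<or> k \<noteq> 0"
      using ne(3) km by (cases "k = 0") auto
    ultimately have "k + 2 \<le> m" "m + 2 \<le> n + k" using True km by linarith+
    then have "real k + 2 \<le> real m" "real m + 2 \<le> real n + real k" by linarith+
    then have "1 \<le> n * y - n * x" "n * y - n * x \<le> n - 1" using x y by linarith+
    then have "1 \<le> n * (y - x)" "n * (y - x) \<le> n - 1" by (auto simp: algebra_simps)
    then have "1 / n \<le> y - x" "y - x \<le> 1 - 1 / n" using n2 by (auto simp: field_simps)
    moreover have "y - x > 0" using calculation n2 by (smt (verit) divide_pos_pos of_nat_0_less_iff pos2 order_less_le_trans)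
    ultimately show ?thesis by (simp add: abs_if)
  next
    case False
    then have mk: "m < k" using ne by simp
    have "(k + n - 1) mod n = k - 1" using mk km 
      by (metis (no_types, lifting) Nat.add_diff_assoc2 One_nat_def Suc_leI less_imp_diff_less mod_add_self2 mod_less not_less_zero zero_less_iff_neq_zero)
    then have "m \<noteq> k - 1" using ne(3) by simp
    moreover have "m \<noteq> 0 \<or> k \<noteq> n - 1"
      using ne(2) km by (auto)
    ultimately have "m + 2 \<le> k" "k + 2 \<le> n + m" using mk km by linarith+
    then have "real m + 2 \<le> real k" "real k + 2 \<le> real n + real m" by linarith+
    then have "1 \<le> n * x - n * y" "n * x - n * y \<le> n - 1" using x y by linarith+
    then have "1 \<le> n * (x - y)" "n * (x - y) \<le> n - 1" by (auto simp: algebra_simps)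
    then have "1 / n \<le> x - y" "x - y \<le> 1 - 1 / n" using n2 by (auto simp: field_simps)
    moreover have "x - y > 0" using calculation n2 by (smt (verit) divide_pos_pos of_nat_0_less_iff pos2 order_less_le_trans)
    ultimately show ?thesis by (simp add: abs_if)
  qed
  then have "sin (pi * (1 / n)) \<le> sin (pi * \<bar>x - y\<bar>)"
    using n2 by (intro sin_pi_lower) auto
  also have "\<dots> \<le> \<bar>sin (pi * (x - y))\<bar>"
  proof (cases "x \<ge> y")
    case False
    then have "pi * \<bar>x - y\<bar> = - (pi * (x - y))" by (simp add: algebra_simps)
    then show ?thesis by simp
  qed simp
  also have "pi * (x - y) = (2 * pi * x - 2 * pi * y) / 2" by (simp add: algebra_simps)
  finally show "2 * sin (pi / n) \<le> cmod (cis (2 * pi * x) - cis (2 * pi * y))"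
    unfolding cmod_cis_diff by simp
qed

text \<open>E is a smoothed outer function whose modulus should be 1 on the arcs in S and \<epsilon>
  elsewhere. Its logarithm is ln \<epsilon> times a sum of Fejer kernels over the nodes outside S.
  Since the kernels are equally weighted at 0, the value there is governed by the proportion of arcs
  in S alone.\<close>

lemma localized_entire_function:
  assumes S: "S \<subseteq> {..<n}" and n: "0 < n" and \<epsilon>: "0 < \<epsilon>" "\<epsilon> < 1"
  obtains E where "E holomorphic_on UNIV" "cmod (E 0) = \<epsilon> powr (1 - card S / n)"
    "\<And>z. cmod z = 1 \<Longrightarrow> cmod (E z) \<le> 1"
    "\<And>(x::real) k. 0 \<le> x \<Longrightarrow> k < n \<Longrightarrow> real k \<le> n * x \<Longrightarrow> n * x < real k + 1 \<Longrightarrow>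
       S \<inter> adjacent_arcs n k = {} \<Longrightarrow> cmod (E (cis (2 * pi * x))) \<le> 2 * \<epsilon>"
proof -
  \<comment> \<open>Half the least chord between non-adjacent arcs. For n = 1 there are no such arcs
    and 1 is a dummy value.\<close>
  define s where "s = (if n \<ge> 2 then sin (pi / n) else 1)"
  have s: "0 < s"
  proof (cases "n \<ge> 2")
    case True
    then have "pi / n < pi / 1" by (intro divide_strict_left_mono) auto
    then show ?thesis using True n by (auto simp: s_def intro!: sin_gt_zero)
  qed (simp add: s_def)
  \<comment> \<open>Each arc carries L nodes. L is so large that the kernels of S have total weight
    at most ln 2 / (- ln \<epsilon>) on arcs not adjacent to S; this costs a factor 2 in the modulus
    of E.\<close>
  obtain L :: nat where L: "- ln \<epsilon> / (n * s\<^sup>2 * ln 2) < L"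
    using reals_Archimedean2 by blast
  have lneg: "ln \<epsilon> < 0" using \<epsilon> by simp
  have L0: "0 < L" 
  proof (rule ccontr)
    assume "\<not> 0 < L"
    then have "- ln \<epsilon> / (n * s\<^sup>2 * ln 2) < 0" using L by simp
    moreover have "- ln \<epsilon> / (n * s\<^sup>2 * ln 2) > 0" using lneg n s by (intro divide_pos_pos) auto
    ultimately show False by simp
  qed
  define N where "N = n * L"
  have N: "0 < N" using n L0 by (simp add: N_def)
  define I where "I = {m. m < N \<and> m div L \<notin> S}"
  define I' where "I' = {m. m < N \<and> m div L \<in> S}"
  have fin: "finite I" "finite I'" by (auto simp: I_def I'_def)
  have split: "{..<N} = I \<union> I'" "I \<inter> I' = {}" by (auto simp: I_def I'_def)
  define G where "G z = (\<Sum>m\<in>I. fejer N (z * cnj (unit_root N m)))" for z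
  define E where "E z = exp (of_real (ln \<epsilon>) * G z)" for z
  have fS: "finite S" using S finite_subset by blast
  have cardI: "card I = (n - card S) * L"
  proof -
    have "I = (\<Union>k\<in>{..<n} - S. {k * L..<k * L + L})"
    proof (intro equalityI subsetI)
      fix m assume m: "m \<in> I"
      then have "m div L < n" using L0 by (simp add: I_def N_def less_mult_imp_div_less)
      moreover have "m \<in> {m div L * L..<m div L * L + L}"
        using L0 dividend_less_div_times[of L m] div_times_less_eq_dividend[of m L] by simp
      ultimately show "m \<in> (\<Union>k\<in>{..<n} - S. {k * L..<k * L + L})"
        using m by (intro UN_I[of "m div L"]) (auto simp: I_def)
    next
      fix m assume "m \<in> (\<Union>k\<in>{..<n} - S. {k * L..<k * L + L})"
      then obtain k where k: "k < n" "k \<notin> S" "k * L \<le> m" "m < k * L + L" by auto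
      then have "m div L = k" by (intro div_nat_eqI) (auto simp: mult.commute)
      moreover have "k * L + L \<le> n * L" using k(1) by (metis Suc_leI add.commute mult_Suc mult_le_mono1)
      ultimately show "m \<in> I" using k by (simp add: I_def N_def)
    qed
    moreover have "card (\<Union>k\<in>{..<n} - S. {k * L..<k * L + L}) = (\<Sum>k\<in>{..<n} - S. card {k * L..<k * L + L})"
    proof (intro card_UN_disjoint ballI impI)
      fix i j assume "i \<in> {..<n} - S" "j \<in> {..<n} - S" "i \<noteq> j"
      show "{i * L..<i * L + L} \<inter> {j * L..<j * L + L} = {}"
      proof (rule ccontr)
        assume "{i * L..<i * L + L} \<inter> {j * L..<j * L + L} \<noteq> {}"
        then obtain m where "m \<in> {i * L..<i * L + L}" "m \<in> {j * L..<j * L + L}" by blast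
        then have "m div L = i" "m div L = j" by (auto intro!: div_nat_eqI simp: mult.commute)
        then show False using \<open>i \<noteq> j\<close> by simp
      qed
    qed auto
    moreover have "card ({..<n} - S) = n - card S" using S fS by (simp add: card_Diff_subset)
    ultimately show ?thesis by simp
  qed
  have cS: "card S \<le> n" using S card_mono[of "{..<n}" S] by simp
  have G0: "G 0 = of_real (1 - card S / n)"
  proof -
    have "G 0 = of_real (real (card I) / real N)"
      using N by (simp add: G_def fejer_zero)
    also have "real (card I) / real N = 1 - card S / n"
      using n L0 cS by (simp add: cardI N_def field_simps of_nat_diff)
    finally show ?thesis .
  qed
  have nz: "cmod (z * cnj (unit_root N m)) = 1" if "cmod z = 1" for z m
    using that by (simp add: norm_mult)
  have ReG: "Re (G z) = 1 - (\<Sum>m\<in>I'. Re (fejer N (z * cnj (unit_root N m))))" for z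
  proof -
    have "(\<Sum>m\<in>I \<union> I'. Re (fejer N (z * cnj (unit_root N m)))) = 1"
      using sum_Re_fejer[OF N, of z] split(1) by simp
    then show ?thesis
      using sum.union_disjoint[OF fin split(2), of "\<lambda>m. Re (fejer N (z * cnj (unit_root N m)))"] by (simp add: G_def)
  qed
  have cE: "cmod (E z) = exp (ln \<epsilon> * Re (G z))" for z
    by (simp add: E_def)
  show thesis
  proof (rule that[of E])
    show "E holomorphic_on UNIV"
      unfolding E_def G_def by (intro holomorphic_intros)
    show "cmod (E 0) = \<epsilon> powr (1 - card S / n)"
      using \<epsilon> by (simp add: cE G0 powr_def mult.commute)
    show "cmod (E z) \<le> 1" if z: "cmod z = 1" for z
    proof -
      have "0 \<le> Re (G z)" unfolding G_def Re_sum by (intro sum_nonneg Re_fejer_nonneg nz z)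
      then show ?thesis using lneg by (simp add: cE mult_nonpos_nonneg)
    qed
    fix x :: real and k assume x: "0 \<le> x" "k < n" "real k \<le> n * x" "n * x < real k + 1" and disj: "S \<inter> adjacent_arcs n k = {}"
    let ?z = "cis (2 * pi * x)"
    have "Re (fejer N (?z * cnj (unit_root N m))) \<le> 1 / (real N ^ 2 * s\<^sup>2)" if m: "m \<in> I'" for m
    proof -
      have mS: "m div L \<in> S" "m < N" using m by (auto simp: I'_def)
      have y: "real (m div L) \<le> n * (m / N)" "n * (m / N) < real (m div L) + 1"
      proof -
        have e: "n * (m / N) = m / L" using n L0 by (simp add: N_def)
        show "real (m div L) \<le> n * (m / N)" unfolding e by (rule of_nat_div_le_of_nat)
        have "m < m div L * L + L" using L0 dividend_less_div_times[of L m] by simp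
        then have "real m < real (m div L * L + L)" by (simp only: of_nat_less_iff)
        then show "n * (m / N) < real (m div L) + 1" unfolding e using L0 by (simp add: field_simps)
      qed
      note far = distance_between_arcs[OF x(1) x(3) x(4) y x(2)]
      have "m div L < n" "m div L \<notin> adjacent_arcs n k" using mS S disj by auto
      from far[OF this] have "2 * s \<le> cmod (?z - unit_root N m)"
        by (simp add: s_def unit_root_def)
      then have "(2 * s)\<^sup>2 \<le> (cmod (?z * cnj (unit_root N m) - 1))\<^sup>2"
        using s by (intro power_mono) (auto simp: cmod_times_cnj_minus_1)
      then have "Re (fejer N (?z * cnj (unit_root N m))) * (2 * s)\<^sup>2 \<le> 4 / real N ^ 2"
        using Re_fejer_decay[OF nz[of ?z m], of N] Re_fejer_nonneg[OF nz[of ?z m], of N]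
          mult_left_mono[of "(2 * s)\<^sup>2" "(cmod (?z * cnj (unit_root N m) - 1))\<^sup>2"] by force
      then show ?thesis using s N by (simp add: field_simps power2_eq_square)
    qed
    then have "(\<Sum>m\<in>I'. Re (fejer N (?z * cnj (unit_root N m)))) \<le> card I' * (1 / (real N ^ 2 * s\<^sup>2))"
      by (intro sum_bounded_above)
    also have "\<dots> \<le> N * (1 / (real N ^ 2 * s\<^sup>2))"
    proof (rule mult_right_mono)
      have "card I' \<le> card {..<N}" by (rule card_mono) (auto simp: I'_def)
      then show "real (card I') \<le> N" by simp
    qed (use s in auto)
    also have "\<dots> = 1 / (n * L * s\<^sup>2)" using N by (simp add: N_def power2_eq_square)
    also have "\<dots> \<le> ln 2 / (- ln \<epsilon>)"
    proof -
      have "- ln \<epsilon> \<le> ln 2 * (n * L * s\<^sup>2)"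
        using L n s by (simp add: field_simps)
      then show ?thesis using n L0 s lneg by (simp add: field_simps)
    qed
    finally have "1 - ln 2 / (- ln \<epsilon>) \<le> Re (G ?z)" unfolding ReG by simp
    then have "ln \<epsilon> * Re (G ?z) \<le> ln \<epsilon> * (1 - ln 2 / (- ln \<epsilon>))"
      using lneg by (intro mult_left_mono_neg) auto
    also have "\<dots> = ln \<epsilon> + ln 2" using lneg by (simp add: field_simps)
    finally have "cmod (E ?z) \<le> exp (ln \<epsilon> + ln 2)" by (simp add: cE)
    then show "cmod (E ?z) \<le> 2 * \<epsilon>" using \<epsilon> by (simp add: exp_add)
  qed
qed

text \<open>Taylor polynomials at 0 are used because they keep the value at 0 exactly, while the
  approximation is uniform on the closed disc.\<close>

lemma entire_polynomial_approximation:
  assumes "E holomorphic_on UNIV" "0 < \<delta>"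
  obtains n c where "c 0 = E 0" "\<And>z. cmod z \<le> 1 \<Longrightarrow> cmod ((\<Sum>k\<le>n. c k * z ^ k) - E z) < \<delta>"
proof -
  define c where "c k = (deriv ^^ k) E 0 / fact k" for k
  have s: "(\<lambda>k. c k * z ^ k) sums E z" if "z \<in> ball 0 3" for z
    using holomorphic_power_series[of E 0 3 z] assms(1) that holomorphic_on_subset
    by (auto simp: c_def)
  have "ereal (norm (2::complex)) \<le> conv_radius c"
    by (intro conv_radius_geI sums_summable[OF s]) simp
  then have "ereal 1 < conv_radius c" by (rule order_less_le_trans[rotated]) simp
  from powser_uniform_limit[OF this, of 0]
  have "\<forall>\<^sub>F n in sequentially. \<forall>z\<in>cball 0 1. dist (\<Sum>k<n. c k * (z - 0) ^ k) (\<Sum>k. c k * (z - 0) ^ k) < \<delta>"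
    using assms(2) by (auto dest: uniform_limitD)
  then have "\<forall>\<^sub>F n in sequentially. \<forall>z\<in>cball 0 1. dist (\<Sum>k<Suc n. c k * (z - 0) ^ k) (\<Sum>k. c k * (z - 0) ^ k) < \<delta>"
    by (simp only: eventually_sequentially_Suc[of "\<lambda>n. \<forall>z\<in>cball 0 1. dist (\<Sum>k<n. c k * (z - 0) ^ k) (\<Sum>k. c k * (z - 0) ^ k) < \<delta>"])
  then obtain n where n: "\<And>z. z \<in> cball 0 1 \<Longrightarrow> dist (\<Sum>k<Suc n. c k * (z - 0) ^ k) (\<Sum>k. c k * (z - 0) ^ k) < \<delta>"
    using eventually_happens'[OF sequentially_bot] by blast
  show thesis
  proof (rule that[of c n])
    show "c 0 = E 0" by (simp add: c_def)
    fix z :: complex assume z: "cmod z \<le> 1"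
    have "(\<Sum>k. c k * z ^ k) = E z" using s[of z] z by (simp add: sums_iff)
    then show "cmod ((\<Sum>k\<le>n. c k * z ^ k) - E z) < \<delta>"
      using n[of z] z by (simp add: dist_norm lessThan_Suc_atMost)
  qed
qed

text \<open>An approximation error \<epsilon> turns the bounds 1 and 2 \<epsilon> into 2 and 3
  \<epsilon>. The claim is a single existential formula so that a polynomial can be chosen for every
  S at once.\<close>

lemma localized_polynomials:
  assumes S: "S \<subseteq> {..<n}" and n: "0 < n" and \<epsilon>: "0 < \<epsilon>" "\<epsilon> < 1"
  shows "\<exists>m c. cmod (c 0) = \<epsilon> powr (1 - card S / n) \<and> (\<forall>z k. cmod z = 1 \<longrightarrow> cmod (\<Sum>k\<le>m. c k * z ^ k) \<le> 2) \<and>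
     (\<forall>(x::real) k. 0 \<le> x \<longrightarrow> k < n \<longrightarrow> real k \<le> n * x \<longrightarrow> n * x < real k + 1 \<longrightarrow>
       S \<inter> adjacent_arcs n k = {} \<longrightarrow> cmod (\<Sum>k\<le>m. c k * cis (2 * pi * x) ^ k) \<le> 3 * \<epsilon>)"
proof -
  obtain E where E: "E holomorphic_on UNIV" "cmod (E 0) = \<epsilon> powr (1 - card S / n)"
    "\<And>z. cmod z = 1 \<Longrightarrow> cmod (E z) \<le> 1"
    "\<And>(x::real) k. 0 \<le> x \<Longrightarrow> k < n \<Longrightarrow> real k \<le> n * x \<Longrightarrow> n * x < real k + 1 \<Longrightarrow>
       S \<inter> adjacent_arcs n k = {} \<Longrightarrow> cmod (E (cis (2 * pi * x))) \<le> 2 * \<epsilon>"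
    using localized_entire_function[OF S n \<epsilon>] by blast
  obtain m c where c: "c 0 = E 0" "\<And>z. cmod z \<le> 1 \<Longrightarrow> cmod ((\<Sum>k\<le>m. c k * z ^ k) - E z) < \<epsilon>"
    using entire_polynomial_approximation[OF E(1) \<epsilon>(1)] by blast
  have le: "cmod (\<Sum>k\<le>m. c k * z ^ k) \<le> cmod (E z) + \<epsilon>" if "cmod z \<le> 1" for z
    using c(2)[OF that] norm_triangle_ineq2[of "\<Sum>k\<le>m. c k * z ^ k" "E z"] by linarith
  have "cmod (\<Sum>k\<le>m. c k * z ^ k) \<le> 2" if "cmod z = 1" for z
    using le[of z] E(3)[OF that] that \<epsilon> by linarith
  moreover have "cmod (\<Sum>k\<le>m. c k * cis (2 * pi * x) ^ k) \<le> 3 * \<epsilon>"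
    if "0 \<le> x" "k < n" "real k \<le> n * x" "n * x < real k + 1" "S \<inter> adjacent_arcs n k = {}" for x :: real and k
    using le[of "cis (2 * pi * x)"] E(4)[OF that] by simp
  ultimately show ?thesis using c(1) E(2) by (intro exI[of _ m] exI[of _ c]) auto
qed

section \<open>Lattice convexity from analytic convexity\<close>

context normed_lattice
begin

text \<open>For fixed \<open>\<omega>\<close> let \<open>S\<close> be the set of arcs \<open>k\<close> with \<open>q \<omega> \<le> u k \<omega>\<close>. Multiplying \<open>q\<close> by a polynomial localized on
  the arcs in \<open>S\<close> leaves at least \<open>s * q\<close> at \<open>0\<close>, because \<open>S\<close> contains half of the arcs, while on each
  arc the product is bounded by \<open>3 * s\<^sup>2 * q\<close> plus multiples of the few neighbouring \<open>u k\<close>.\<close>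

lemma half_cover:
  assumes ac: "analytically_convex X"
  obtains C where "0 \<le> C" "\<And>n u q a. \<lbrakk>0 < n; (\<lambda>\<omega>. complex_of_real (q \<omega>)) \<in> elems X; q \<in> borel_measurable M;
      \<And>\<omega>. 0 \<le> q \<omega>; \<And>k. k < n \<Longrightarrow> u k \<in> borel_measurable M; \<And>k \<omega>. k < n \<Longrightarrow> 0 \<le> u k \<omega>;
      \<And>k. k < n \<Longrightarrow> dominated (u k) a; \<And>\<omega>. n \<le> 2 * card {k. k < n \<and> q \<omega> \<le> u k \<omega>}\<rbrakk>
      \<Longrightarrow> qnorm X (\<lambda>\<omega>. complex_of_real (q \<omega>)) \<le> C * a"
proof -
  obtain Ca where Ca: "Ca > 0" "\<And>n x. (\<And>k. k \<le> n \<Longrightarrow> x k \<in> elems X) \<Longrightarrow>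
      qnorm X (vector_poly n x 0) \<le> Ca * (SUP z\<in>sphere 0 1. qnorm X (vector_poly n x z))"
    using ac unfolding analytically_convex_def by blast
  \<comment> \<open>The second bound gives 3 Ca K s <= 1/2, which allows the term with the norm of q
    to be absorbed at the end.\<close>
  define s where "s = min (1/2) (1 / (6 * Ca * K))"
  have s: "0 < s" "s < 1" "3 * Ca * K * s \<le> 1/2"
    using Ca(1) K_pos by (auto simp: s_def min_def field_simps)
  define C where "C = 12 * Ca * K ^ 3 / s"
  have C: "0 \<le> C" using s Ca K_pos by (simp add: C_def)
  show thesis
  proof (rule that[OF C])
    fix n u q a
    assume n: "0 < n" and qX: "(\<lambda>\<omega>. complex_of_real (q \<omega>)) \<in> elems X" and mq: "q \<in> borel_measurable M"
      and q0: "\<And>\<omega>. 0 \<le> q \<omega>" and mu: "\<And>k. k < n \<Longrightarrow> u k \<in> borel_measurable M"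
      and u0: "\<And>k \<omega>. k < n \<Longrightarrow> 0 \<le> u k \<omega>"
      and dom: "\<And>k. k < n \<Longrightarrow> dominated (u k) a" and half: "\<And>\<omega>. n \<le> 2 * card {k. k < n \<and> q \<omega> \<le> u k \<omega>}"
    let ?Q = "qnorm X (\<lambda>\<omega>. complex_of_real (q \<omega>))"
    \<comment> \<open>The square is the point: at 0 the polynomial has modulus at least
      \<epsilon>^(1/2) = s, as S contains half of the arcs, whereas away from S it is at most 3
      \<epsilon> = 3 s^2, smaller by a factor of order s.\<close>
    define \<epsilon> where "\<epsilon> = s\<^sup>2"
    have \<epsilon>: "0 < \<epsilon>" "\<epsilon> < 1" using s by (auto simp: \<epsilon>_def abs_square_less_1)
    define good where "good S p \<longleftrightarrow> cmod (snd p 0) = \<epsilon> powr (1 - card S / n) \<and>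
       (\<forall>z. cmod z = 1 \<longrightarrow> cmod (\<Sum>k\<le>fst p. snd p k * z ^ k) \<le> 2) \<and>
       (\<forall>(x::real) k. 0 \<le> x \<longrightarrow> k < n \<longrightarrow> real k \<le> n * x \<longrightarrow> n * x < real k + 1 \<longrightarrow>
       S \<inter> adjacent_arcs n k = {} \<longrightarrow> cmod (\<Sum>k\<le>fst p. snd p k * cis (2 * pi * x) ^ k) \<le> 3 * \<epsilon>)"
      for S :: "nat set" and p :: "nat \<times> (nat \<Rightarrow> complex)"
    have "\<forall>S\<in>Pow {..<n}. \<exists>p. good S p"
      using localized_polynomials[OF _ n \<epsilon>] by (simp add: good_def)
    from bchoice[OF this] obtain P where P: "\<And>S. S \<subseteq> {..<n} \<Longrightarrow> good S (P S)" by blast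
    note P = P[unfolded good_def, THEN conjunct1] P[unfolded good_def, THEN conjunct2, THEN conjunct1, rule_format]
      P[unfolded good_def, THEN conjunct2, THEN conjunct2, rule_format]
    \<comment> \<open>There are finitely many sets S, so one degree serves all of them and the
      pointwise choice of polynomials becomes one vector polynomial.\<close>
    define N where "N = Max ((\<lambda>S. fst (P S)) ` Pow {..<n})"
    have N: "fst (P S) \<le> N" if "S \<subseteq> {..<n}" for S
      unfolding N_def using that by (intro Max_ge) auto
    define c where "c S k = (if k \<le> fst (P S) then snd (P S) k else 0)" for S k
    have csum: "(\<Sum>k\<le>N. c S k * z ^ k) = (\<Sum>k\<le>fst (P S). snd (P S) k * z ^ k)" if "S \<subseteq> {..<n}" for S z
      using N[OF that] by (intro sum.mono_neutral_cong_right) (auto simp: c_def)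
    define S where "S \<omega> = {k. k < n \<and> q \<omega> \<le> u k \<omega>}" for \<omega>
    have Ssub: "S \<omega> \<subseteq> {..<n}" for \<omega> by (auto simp: S_def)
    \<comment> \<open>Measurability of the coefficients: they depend on \<omega> through S \<omega>,
      which takes finitely many values.\<close>
    have mS: "S \<in> measurable M (count_space (Pow {..<n}))"
    proof (subst measurable_count_space_eq2)
      have "S -` {A} \<inter> space M \<in> sets M" if "A \<subseteq> {..<n}" for A
      proof -
        have "S -` {A} \<inter> space M = {\<omega>\<in>space M. \<forall>k\<in>{..<n}. (q \<omega> \<le> u k \<omega>) = (k \<in> A)}"
        proof -
          have "S \<omega> = A \<longleftrightarrow> (\<forall>k\<in>{..<n}. (q \<omega> \<le> u k \<omega>) = (k \<in> A))" for \<omega>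
            unfolding S_def using that by blast
          then show ?thesis by blast
        qed
        also have "\<dots> \<in> sets M"
        proof (rule sets.sets_Collect_finite_All)
          fix k assume "k \<in> {..<n}"
          then have "{\<omega>\<in>space M. q \<omega> \<le> u k \<omega>} \<in> sets M" "{\<omega>\<in>space M. u k \<omega> < q \<omega>} \<in> sets M"
            using mq mu by (auto intro: borel_measurable_le borel_measurable_less)
          then show "{\<omega>\<in>space M. (q \<omega> \<le> u k \<omega>) = (k \<in> A)} \<in> sets M"
            by (cases "k \<in> A") (auto simp: not_le)
        qed simp
        finally show ?thesis .
      qed
      then show "S \<in> space M \<rightarrow> Pow {..<n} \<and> (\<forall>a\<in>Pow {..<n}. S -` {a} \<inter> space M \<in> sets M)"
        using Ssub by auto
    qed simp
    define x where "x k = (\<lambda>\<omega>. complex_of_real (q \<omega>) * c (S \<omega>) k)" for k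
    have xX: "x k \<in> elems X" for k
    proof -
      have m: "(\<lambda>\<omega>. c (S \<omega>) k) \<in> borel_measurable M"
        by (rule measurable_compose[OF mS, of "\<lambda>S. c S k"]) simp
      define B where "B = Max ((\<lambda>S. cmod (c S k)) ` Pow {..<n})"
      have B: "cmod (c (S \<omega>) k) \<le> B" for \<omega>
        unfolding B_def using Ssub by (intro Max_ge) auto
      have "cmod (x k \<omega>) \<le> cmod (complex_of_real B * complex_of_real (q \<omega>))" for \<omega>
        using mult_left_mono[OF B q0, of \<omega> \<omega>] q0[of \<omega>] order_trans[OF norm_ge_zero B]
        by (simp add: x_def norm_mult mult.commute)
      then show ?thesis
        using solid[OF scale_closed[OF qX, of "complex_of_real B"], of "x k"] m mq
        by (auto simp: x_def)
    qed
    have vp: "vector_poly N x z \<omega> = complex_of_real (q \<omega>) * (\<Sum>k\<le>fst (P (S \<omega>)). snd (P (S \<omega>)) k * z ^ k)" for z \<omega>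
      by (simp only: csum[OF Ssub, symmetric] vector_poly_def x_def sum_distrib_left) (simp add: mult_ac)
    have vpX: "vector_poly N x z \<in> elems X" for z
      unfolding vector_poly_def by (intro sum_closed scale_closed xX)
    have circle: "qnorm X (vector_poly N x z) \<le> K * (6 * K\<^sup>2 * a + 3 * \<epsilon> * ?Q)" if z: "z \<in> sphere 0 1" for z
    proof -
      define t where "t = Arg2pi z / (2 * pi)"
      have t: "0 \<le> t" "t < 1" and zt: "z = cis (2 * pi * t)"
        using Arg2pi[of z] z by (auto simp: t_def is_Arg_def cis_conv_exp)
      define k where "k = nat \<lfloor>n * t\<rfloor>"
      have "real k = of_int \<lfloor>n * t\<rfloor>" using t by (simp add: k_def)
      then have k: "real k \<le> n * t" "n * t < real k + 1" by linarith+
      have "n * t < real n * 1" using t n by (intro mult_strict_left_mono) auto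
      then have kn: "k < n" using k by simp
      \<comment> \<open>Only three of the functions \<open>u\<close> are added here, so the norm
        bound does not grow with n.\<close>
      define w where "w \<omega> = u k \<omega> + (u ((k + 1) mod n) \<omega> + u ((k + n - 1) mod n) \<omega>)" for \<omega>
      have w: "dominated w (K * (a + K * (a + a)))"
        unfolding w_def using n kn by (intro dominated_add dom) auto
      have a0: "0 \<le> a" using dominated_nonneg[OF dom[OF kn]] .
      have "K * (a + K * (a + a)) \<le> 3 * K\<^sup>2 * a"
      proof -
        have "a + K * (a + a) \<le> K * a + K * (a + a)" using K_ge_1 a0 mult_right_mono[of 1 K a] by simp
        from mult_left_mono[OF this K_nonneg] show ?thesis by (simp add: power2_eq_square algebra_simps)
      qed
      then have w: "dominated w (3 * K\<^sup>2 * a)" by (rule dominated_mono[OF w, rotated]) simp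
      have "dominated (\<lambda>\<omega>. 2 * w \<omega> + 3 * \<epsilon> * cmod (complex_of_real (q \<omega>))) (K * (2 * (3 * K\<^sup>2 * a) + 3 * \<epsilon> * ?Q))"
        by (intro dominated_add dominated_scale w dominated_cmod qX order_refl) (use \<epsilon> in auto)
      moreover have "cmod (vector_poly N x z \<omega>) \<le> 2 * w \<omega> + 3 * \<epsilon> * cmod (complex_of_real (q \<omega>))" for \<omega>
      proof (cases "S \<omega> \<inter> adjacent_arcs n k = {}")
        case True
        have "cmod (\<Sum>k\<le>fst (P (S \<omega>)). snd (P (S \<omega>)) k * z ^ k) \<le> 3 * \<epsilon>"
          using P(3)[OF Ssub t(1) kn k True] by (simp add: zt)
        then have "cmod (vector_poly N x z \<omega>) \<le> q \<omega> * (3 * \<epsilon>)"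
          using q0[of \<omega>] by (simp add: vp norm_mult mult_left_mono)
        moreover have "0 \<le> w \<omega>" using u0 n kn by (simp add: w_def)
        ultimately show ?thesis using q0[of \<omega>] by (simp add: mult_ac)
      next
        case False
        then obtain j where j: "j \<in> S \<omega>" "j \<in> adjacent_arcs n k" by auto
        have "q \<omega> \<le> u j \<omega>" using j(1) by (simp add: S_def)
        also have "\<dots> \<le> w \<omega>" using j(2) u0[of k \<omega>] u0[of "(k+1) mod n" \<omega>] u0[of "(k + n - 1) mod n" \<omega>] n kn
          by (auto simp: w_def adjacent_arcs_def)
        finally have qw: "q \<omega> \<le> w \<omega>" .
        have "cmod (\<Sum>k\<le>fst (P (S \<omega>)). snd (P (S \<omega>)) k * z ^ k) \<le> 2"
          using P(2)[OF Ssub] z by simp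
        then have "cmod (vector_poly N x z \<omega>) \<le> q \<omega> * 2"
          using q0[of \<omega>] by (simp add: vp norm_mult mult_left_mono)
        also have "\<dots> \<le> 2 * w \<omega> + 3 * \<epsilon> * cmod (complex_of_real (q \<omega>))"
          using qw q0[of \<omega>] \<epsilon> by (simp add: add_increasing2)
        finally show ?thesis .
      qed
      ultimately show ?thesis
        by (intro dominated_elem(2)[of _ _ "vector_poly N x z"]) (auto intro: meas vpX simp: mult_ac)
    qed
    have "(SUP z\<in>sphere 0 1. qnorm X (vector_poly N x z)) \<le> K * (6 * K\<^sup>2 * a + 3 * \<epsilon> * ?Q)"
      by (rule cSUP_least) (use circle in auto)
    with Ca(2)[of N x] xX Ca(1) have up: "qnorm X (vector_poly N x 0) \<le> Ca * (K * (6 * K\<^sup>2 * a + 3 * \<epsilon> * ?Q))"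
      by (meson less_imp_le mult_left_mono order_trans)
    have "qnorm X (\<lambda>\<omega>. complex_of_real s * complex_of_real (q \<omega>)) \<le> qnorm X (vector_poly N x 0)"
    proof -
      have "cmod (complex_of_real s * complex_of_real (q \<omega>)) \<le> cmod (vector_poly N x 0 \<omega>)" for \<omega>
      proof -
        have "(\<Sum>k\<le>fst (P (S \<omega>)). snd (P (S \<omega>)) k * 0 ^ k) = snd (P (S \<omega>)) 0"
          by (simp add: power_0_left if_distrib cong: if_cong)
        then have e: "cmod (vector_poly N x 0 \<omega>) = q \<omega> * \<epsilon> powr (1 - card (S \<omega>) / n)"
          using P(1)[OF Ssub] q0[of \<omega>] by (simp add: vp norm_mult)
        have "real n \<le> 2 * real (card (S \<omega>))" using half[of \<omega>] unfolding S_def by linarith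
        then have "1 - card (S \<omega>) / n \<le> 1 / 2" using n by (simp add: field_simps)
        then have "\<epsilon> powr (1/2) \<le> \<epsilon> powr (1 - card (S \<omega>) / n)" using \<epsilon> by (intro powr_mono') auto
        moreover have "\<epsilon> powr (1/2) = s" using s \<epsilon> by (simp add: powr_half_sqrt \<epsilon>_def)
        ultimately have "s \<le> \<epsilon> powr (1 - card (S \<omega>) / n)" by simp
        from mult_left_mono[OF this q0[of \<omega>]] show ?thesis
          unfolding e using q0[of \<omega>] s by (simp add: norm_mult mult.commute)
      qed
      then show ?thesis using solid[OF vpX[of 0], of "\<lambda>\<omega>. complex_of_real s * complex_of_real (q \<omega>)"] mq by auto
    qed
    then have "s * ?Q \<le> Ca * (K * (6 * K\<^sup>2 * a + 3 * \<epsilon> * ?Q))"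
      using up qnorm_scale[OF qX, of "complex_of_real s"] s by simp
    also have "\<dots> = 6 * Ca * K ^ 3 * a + (3 * Ca * K * s) * (s * ?Q)"
      by (simp add: \<epsilon>_def power2_eq_square power3_eq_cube algebra_simps)
    also have "\<dots> \<le> 6 * Ca * K ^ 3 * a + 1/2 * (s * ?Q)"
      using s qnorm_nonneg[OF qX] by (intro add_left_mono mult_right_mono) auto
    \<comment> \<open>By the choice of s half of the left-hand side is absorbed.\<close>
    finally have "s * ?Q \<le> 12 * Ca * K ^ 3 * a" by simp
    then show "?Q \<le> C * a" using s by (simp add: C_def field_simps)
  qed
qed

definition family_bounded :: "nat set \<Rightarrow> (nat \<Rightarrow> 'a \<Rightarrow> real) \<Rightarrow> real \<Rightarrow> bool" where
  "family_bounded I u a \<longleftrightarrow> finite I \<and> I \<noteq> {} \<and>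
    (\<forall>k\<in>I. u k \<in> borel_measurable M \<and> (\<forall>\<omega>. 0 \<le> u k \<omega>) \<and> dominated (u k) a)"

text \<open>\<open>q\<close> is a quantile of order \<open>1 - s\<close> of the family \<open>u\<close>, with respect to normalised counting measure.\<close>

definition quantile_bound :: "real \<Rightarrow> real \<Rightarrow> bool" where
  "quantile_bound s C \<longleftrightarrow> (\<forall>I u a. family_bounded I u a \<longrightarrow>
    (\<exists>q. q \<in> borel_measurable M \<and> (\<forall>\<omega>. 0 \<le> q \<omega>) \<and> dominated q (C * a) \<and>
      (\<forall>\<omega>. real (card {k\<in>I. q \<omega> < u k \<omega>}) \<le> s * card I)))"

text \<open>The maximum of minima over m-element subsets is the m-th largest value. At least m
  members reach it and fewer than m exceed it, so \<open>half_cover\<close> applies on one side and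
  the quantile property holds on the other. Written this way the function is visibly
  measurable.\<close>

lemma median_bound:
  assumes ac: "analytically_convex X"
  obtains C where "0 \<le> C" "quantile_bound (1/2) C"
proof -
  obtain C where C: "0 \<le> C" "\<And>n u q a. \<lbrakk>0 < n; (\<lambda>\<omega>. complex_of_real (q \<omega>)) \<in> elems X; q \<in> borel_measurable M;
      \<And>\<omega>. 0 \<le> q \<omega>; \<And>k. k < n \<Longrightarrow> u k \<in> borel_measurable M; \<And>k \<omega>. k < n \<Longrightarrow> 0 \<le> u k \<omega>;
      \<And>k. k < n \<Longrightarrow> dominated (u k) a; \<And>\<omega>. n \<le> 2 * card {k. k < n \<and> q \<omega> \<le> u k \<omega>}\<rbrakk>
      \<Longrightarrow> qnorm X (\<lambda>\<omega>. complex_of_real (q \<omega>)) \<le> C * a"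
    using half_cover[OF ac] by blast
  have "\<exists>q. q \<in> borel_measurable M \<and> (\<forall>\<omega>. 0 \<le> q \<omega>) \<and> dominated q (C * a) \<and>
      (\<forall>\<omega>. real (card {k\<in>I. q \<omega> < u k \<omega>}) \<le> 1/2 * card I)" if fb: "family_bounded I u a" for I u a
  proof -
    have fin: "finite I" and ne: "I \<noteq> {}" and mu: "\<And>k. k \<in> I \<Longrightarrow> u k \<in> borel_measurable M"
      and u0: "\<And>k \<omega>. k \<in> I \<Longrightarrow> 0 \<le> u k \<omega>" and dom: "\<And>k. k \<in> I \<Longrightarrow> dominated (u k) a"
      using fb by (auto simp: family_bounded_def)
    define n where "n = card I"
    have n: "0 < n" using fin ne by (simp add: n_def card_gt_0_iff)
    \<comment> \<open>Rounding up makes both n <= 2 m and 2 (m - 1) <= n true.\<close>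
    define m where "m = (n + 1) div 2"
    have m: "1 \<le> m" "m \<le> n" "n \<le> 2 * m" "2 * (m - 1) \<le> n" using n by (auto simp: m_def)
    define \<S> where "\<S> = {S. S \<subseteq> I \<and> card S = m}"
    have fS: "finite \<S>" using fin by (simp add: \<S>_def)
    have neS: "\<S> \<noteq> {}" using obtain_subset_with_card_n[of m I] m(2) by (auto simp: \<S>_def n_def)
    have SS: "finite S" "S \<noteq> {}" "S \<subseteq> I" "card S = m" if "S \<in> \<S>" for S
      using that m fin finite_subset by (auto simp: \<S>_def)
    define q where "q \<omega> = Max ((\<lambda>S. Min ((\<lambda>k. u k \<omega>) ` S)) ` \<S>)" for \<omega>
    have mq: "q \<in> borel_measurable M"
      unfolding q_def using fS SS mu by (intro borel_measurable_Max borel_measurable_Min) blast+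
    have large: "m \<le> card {k\<in>I. q \<omega> \<le> u k \<omega>}" for \<omega>
    proof -
      have "q \<omega> \<in> (\<lambda>S. Min ((\<lambda>k. u k \<omega>) ` S)) ` \<S>"
        unfolding q_def using fS neS by (intro Max_in) auto
      then obtain S where S: "S \<in> \<S>" "q \<omega> = Min ((\<lambda>k. u k \<omega>) ` S)" by auto
      have "S \<subseteq> {k\<in>I. q \<omega> \<le> u k \<omega>}" using SS[OF S(1)] S(2) by auto
      from card_mono[OF _ this] show ?thesis using SS[OF S(1)] fin by simp
    qed
    have small: "card {k\<in>I. q \<omega> < u k \<omega>} < m" for \<omega>
    proof (rule ccontr)
      assume "\<not> card {k\<in>I. q \<omega> < u k \<omega>} < m"
      then obtain S where S: "S \<subseteq> {k\<in>I. q \<omega> < u k \<omega>}" "card S = m"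
        using obtain_subset_with_card_n[of m "{k\<in>I. q \<omega> < u k \<omega>}"] by (metis not_less)
      then have SS': "S \<in> \<S>" by (auto simp: \<S>_def)
      have "q \<omega> < Min ((\<lambda>k. u k \<omega>) ` S)" using S SS[OF SS'] by (subst Min_gr_iff) auto
      also have "\<dots> \<le> q \<omega>" unfolding q_def using fS SS' by (intro Max_ge) auto
      finally show False by simp
    qed
    have ex: "\<exists>k\<in>I. q \<omega> \<le> u k \<omega>" for \<omega>
    proof -
      have "{k\<in>I. q \<omega> \<le> u k \<omega>} \<noteq> {}" using large[of \<omega>] m(1) by (metis card.empty not_one_le_zero order_trans)
      then show ?thesis by auto
    qed
    have q0: "0 \<le> q \<omega>" for \<omega>
    proof -
      obtain S where S: "S \<in> \<S>" using neS by auto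
      have "0 \<le> Min ((\<lambda>k. u k \<omega>) ` S)" using SS[OF S] u0 by (subst Min_ge_iff) auto
      also have "\<dots> \<le> q \<omega>" unfolding q_def using fS S by (intro Max_ge) auto
      finally show ?thesis .
    qed
    obtain h where h: "bij_betw h {..<n} I"
      using ex_bij_betw_nat_finite[OF fin] by (auto simp: n_def atLeast0LessThan)
    have hI: "h k \<in> I" if "k < n" for k using h that by (auto simp: bij_betw_def)
    \<comment> \<open>This crude bound depends on n and serves only to place q in X. The uniform
      norm bound then comes from \<open>half_cover\<close>.\<close>
    have "dominated (\<lambda>\<omega>. \<Sum>k<n. u (h k) \<omega>) (\<Sum>k<n. K ^ Suc k * a)"
      by (intro dominated_sum dom hI)
    moreover have "q \<omega> \<le> (\<Sum>k<n. u (h k) \<omega>)" for \<omega>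
    proof -
      obtain k where k: "k \<in> I" "q \<omega> \<le> u k \<omega>" using ex by blast
      then obtain j where "j < n" "k = h j" using h by (auto simp: bij_betw_def)
      then have "q \<omega> \<le> u (h j) \<omega>" using k by simp
      also have "\<dots> \<le> (\<Sum>k<n. u (h k) \<omega>)" using \<open>j < n\<close> by (intro member_le_sum) (auto intro: u0 hI)
      finally show ?thesis .
    qed
    ultimately have qX: "(\<lambda>\<omega>. complex_of_real (q \<omega>)) \<in> elems X"
      using mq q0 by (intro dominated_elem(1)) auto
    have "qnorm X (\<lambda>\<omega>. complex_of_real (q \<omega>)) \<le> C * a"
    proof (rule C(2)[OF n qX mq q0, of "\<lambda>k. u (h k)"])
      fix \<omega>
      have "card {k. k < n \<and> q \<omega> \<le> u (h k) \<omega>} = card {k\<in>I. q \<omega> \<le> u k \<omega>}"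
        by (rule bij_betw_same_card[of h], rule bij_betw_subset[OF h])
           (use h in \<open>auto simp: bij_betw_def\<close>)
      then show "n \<le> 2 * card {k. k < n \<and> q \<omega> \<le> u (h k) \<omega>}" using large[of \<omega>] m(3) by linarith
    qed (use mu u0 dom hI in auto)
    then have "dominated q (C * a)"
      using dominated_cmod[OF qX] q0 by (simp add: abs_of_nonneg)
    moreover have "real (card {k\<in>I. q \<omega> < u k \<omega>}) \<le> 1/2 * card I" for \<omega>
      using small[of \<omega>] m(4) unfolding n_def by linarith
    ultimately show ?thesis using mq q0 by blast
  qed
  then show thesis using that[of C] C(1) by (auto simp: quantile_bound_def)
qed

text \<open>The quantile of the family of pairwise maxima is used for the original family. If a
  proportion x of the members exceeds a level, then 1 - (1 - x)^2 of the pairs does. For s <= 1/2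
  the bound s on the latter forces x <= 2 s / 3. Pairs are encoded as naturals because families are
  indexed by naturals, and a maximum of two costs the factor 2 K.\<close>

lemma quantile_bound_step:
  assumes q: "quantile_bound s C" and s: "0 < s" "s \<le> 1/2"
  shows "quantile_bound (2/3 * s) (C * (2 * K))"
  unfolding quantile_bound_def
proof (intro allI impI)
  fix I u a assume fb: "family_bounded I u a"
  have fin: "finite I" and ne: "I \<noteq> {}" and mu: "\<And>k. k \<in> I \<Longrightarrow> u k \<in> borel_measurable M"
    and u0: "\<And>k \<omega>. k \<in> I \<Longrightarrow> 0 \<le> u k \<omega>" and dom: "\<And>k. k \<in> I \<Longrightarrow> dominated (u k) a"
    using fb by (auto simp: family_bounded_def)
  define v where "v k \<omega> = max (u (fst (prod_decode k)) \<omega>) (u (snd (prod_decode k)) \<omega>)" for k \<omega>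
  define J where "J = prod_encode ` (I \<times> I)"
  have "dominated (v k) (2 * K * a)" if k: "k \<in> J" for k
  proof -
    obtain i j where ij: "i \<in> I" "j \<in> I" "k = prod_encode (i, j)" using k unfolding J_def by blast
    have "dominated (\<lambda>\<omega>. u i \<omega> + u j \<omega>) (K * (a + a))" using dom ij by (intro dominated_add)
    then show ?thesis
      by (rule dominated_mono[OF _ AE_I2]) (use ij u0 in \<open>auto simp: v_def max_def\<close>)
  qed
  moreover have "v k \<in> borel_measurable M" "0 \<le> v k \<omega>" if k: "k \<in> J" for k \<omega>
  proof -
    obtain i j where ij: "i \<in> I" "j \<in> I" "k = prod_encode (i, j)" using k unfolding J_def by blast
    have "v k = (\<lambda>\<omega>. max (u i \<omega>) (u j \<omega>))" using ij by (simp add: v_def fun_eq_iff)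
    then show "v k \<in> borel_measurable M" "0 \<le> v k \<omega>"
      using ij mu u0 by (auto intro: borel_measurable_max max.coboundedI1)
  qed
  ultimately have "family_bounded J v (2 * K * a)"
    using fin ne by (auto simp: family_bounded_def J_def)
  then obtain p where p: "p \<in> borel_measurable M" "\<And>\<omega>. 0 \<le> p \<omega>" "dominated p (C * (2 * K * a))"
      "\<And>\<omega>. real (card {k\<in>J. p \<omega> < v k \<omega>}) \<le> s * card J"
    using q unfolding quantile_bound_def by blast
  have "real (card {k\<in>I. p \<omega> < u k \<omega>}) \<le> 2/3 * s * card I" for \<omega>
  proof -
    define A where "A = {k\<in>I. p \<omega> < u k \<omega>}"
    have A: "A \<subseteq> I" "finite A" using fin by (auto simp: A_def)
    have inj: "inj_on prod_encode Z" for Z using inj_prod_encode inj_on_subset by blast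
    have "{k\<in>J. p \<omega> < v k \<omega>} = prod_encode ` (I \<times> I - (I - A) \<times> (I - A))"
      by (auto simp: J_def v_def A_def less_max_iff_disj)
    then have "card {k\<in>J. p \<omega> < v k \<omega>} = card (I \<times> I - (I - A) \<times> (I - A))"
      using card_image[OF inj] by simp
    also have "\<dots> = card I * card I - (card I - card A) * (card I - card A)"
      using A fin by (subst card_Diff_subset) (auto simp: card_cartesian_product card_Diff_subset)
    finally have c: "card {k\<in>J. p \<omega> < v k \<omega>} = card I * card I - (card I - card A) * (card I - card A)" .
    have cJ: "card J = card I * card I"
      using card_image[OF inj] by (simp add: J_def card_cartesian_product)
    have le: "card A \<le> card I" using A fin card_mono by blast
    define x where "x = real (card A)"
    define n where "n = real (card I)"
    have n: "0 < n" using fin ne by (simp add: n_def card_gt_0_iff)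
    have xn: "0 \<le> x" "x \<le> n" using le by (auto simp: x_def n_def)
    have "(card I - card A) * (card I - card A) \<le> card I * card I" by (intro mult_le_mono) auto
    then have "real (card {k\<in>J. p \<omega> < v k \<omega>}) = n * n - (n - x) * (n - x)"
      unfolding c using le by (simp add: x_def n_def of_nat_diff)
    then have ineq: "n * n - (n - x) * (n - x) \<le> s * (n * n)"
      using p(4)[of \<omega>] by (simp add: cJ n_def)
    have "x \<le> 2/3 * s * n"
    proof (rule ccontr)
      assume "\<not> x \<le> 2/3 * s * n"
      then have *: "2/3 * s * n < x" by simp
      have y: "0 < 2/3 * s * n" using s n by simp
      have "2/3 * s * n * (2 * n - 2/3 * s * n) \<le> x * (2 * n - x)"
      proof -
        have "x * (2 * n - x) - 2/3 * s * n * (2 * n - 2/3 * s * n) = (x - 2/3 * s * n) * (2 * n - x - 2/3 * s * n)"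
          by (simp add: algebra_simps)
        moreover have "2/3 * s * n \<le> n" using s n by simp
        ultimately show ?thesis using * xn by (smt (verit) mult_nonneg_nonneg)
      qed
      moreover have "s * n * n < 2/3 * s * n * (2 * n - 2/3 * s * n)"
      proof -
        have "3/2 * n < 2 * n - 2/3 * s * n" using s n mult_right_mono[of s "1/2" n] by simp
        then have "2/3 * s * n * (3/2 * n) < 2/3 * s * n * (2 * n - 2/3 * s * n)"
          using y by (intro mult_strict_left_mono) auto
        then show ?thesis by (simp add: mult_ac)
      qed
      ultimately show False using ineq by (simp add: algebra_simps)
    qed
    then show ?thesis by (simp add: A_def x_def n_def)
  qed
  then show "\<exists>q. q \<in> borel_measurable M \<and> (\<forall>\<omega>. 0 \<le> q \<omega>) \<and> dominated q (C * (2 * K) * a) \<and>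
      (\<forall>\<omega>. real (card {k\<in>I. q \<omega> < u k \<omega>}) \<le> 2/3 * s * card I)"
    using p by (intro exI[of _ p]) (simp add: mult_ac)
qed

lemma quantile_bound_iterate:
  assumes "quantile_bound (1/2) C"
  shows "quantile_bound ((2/3) ^ j / 2) (C * (2 * K) ^ j)"
proof (induction j)
  case (Suc j)
  have "(2/3) ^ j / 2 \<le> (1/2 :: real)" by (simp add: power_le_one)
  from quantile_bound_step[OF Suc.IH _ this] show ?case by (simp add: mult_ac)
qed (use assms in simp)

text \<open>The counting argument sums the quantiles of order \<open>1 - (2/3) ^ j / 2\<close>: their norms grow
  like \<open>(2 * K) ^ j\<close>, which a small exponent \<open>p\<close> compensates. This is the lattice convexity
  that Kalton derives from analytic convexity.\<close>

lemma power_mean_bound: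
  assumes ac: "analytically_convex X"
  obtains p0 where "0 < p0" "\<And>p. 0 < p \<Longrightarrow> p \<le> p0 \<Longrightarrow> \<exists>C\<ge>0. \<forall>I u a. family_bounded I u a \<longrightarrow>
    (\<exists>g. g \<in> borel_measurable M \<and> (\<forall>\<omega>. 0 \<le> g \<omega>) \<and> dominated g (C * a) \<and>
      (\<forall>\<omega>. (\<Sum>k\<in>I. u k \<omega> powr p) \<le> card I * g \<omega> powr p))"
proof -
  obtain C0 where C0: "0 \<le> C0" "quantile_bound (1/2) C0" using median_bound[OF ac] by blast
  \<comment> \<open>For p <= p0 the number \<beta> below is at most 1 / (4 K^2), so the j-th
    quantile, of norm of order (2 K)^j, weighted by \<beta>^j and charged \<open>K ^ Suc j\<close>,
    leaves a geometric series of ratio at most 1/2.\<close>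
  define p0 where "p0 = ln (3/2) / (2 * ln (4 * K\<^sup>2))"
  have K2: "1 < 4 * K\<^sup>2" using one_le_power[OF K_ge_1, of 2] by linarith
  have p0: "0 < p0" unfolding p0_def using K2 by (intro divide_pos_pos mult_pos_pos ln_gt_zero) auto
  show thesis
  proof (rule that[OF p0])
    fix p :: real assume p: "0 < p" "p \<le> p0"
    \<comment> \<open>The decay (2/3)^j of the proportions is shared equally: one factor (2/3)^(j/2)
      equals \<beta>^(j p) and pays for the norms, the other makes the sum over j converge.\<close>
    define \<beta> where "\<beta> = (2/3) powr (1 / (2 * p))"
    have \<beta>: "0 < \<beta>" "2 * K\<^sup>2 * \<beta> \<le> 1/2"
    proof -
      show "0 < \<beta>" by (simp add: \<beta>_def)
      have "ln \<beta> = 1 / (2 * p) * ln (2/3)" by (simp add: \<beta>_def ln_powr)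
      also have "ln (2/3 :: real) = - ln (3/2)" by (simp add: ln_div)
      also have "1 / (2 * p) * - ln (3/2) \<le> - ln (4 * K\<^sup>2)"
      proof -
        have "0 < 2 * ln (4 * K\<^sup>2)" using K2 by (intro mult_pos_pos ln_gt_zero) auto
        then have "p * (2 * ln (4 * K\<^sup>2)) \<le> ln (3/2)"
          using p(2) by (simp only: p0_def pos_le_divide_eq)
        then show ?thesis using p(1) by (simp add: field_simps)
      qed
      finally have "exp (ln \<beta>) \<le> exp (- ln (4 * K\<^sup>2))" by simp
      moreover have "0 < 4 * K\<^sup>2" using K2 by linarith
      ultimately have "\<beta> \<le> inverse (4 * K\<^sup>2)"
        using \<open>0 < \<beta>\<close> by (simp only: exp_minus exp_ln)
      then have "2 * K\<^sup>2 * \<beta> \<le> 2 * K\<^sup>2 * inverse (4 * K\<^sup>2)" by (rule mult_left_mono) simp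
      also have "2 * K\<^sup>2 * inverse (4 * K\<^sup>2) = 1/2 * (K\<^sup>2 * inverse (K\<^sup>2))"
        by (simp only: inverse_mult_distrib) simp
      also have "K\<^sup>2 * inverse (K\<^sup>2) = 1" using K_pos by (intro right_inverse) simp
      finally show "2 * K\<^sup>2 * \<beta> \<le> 1/2" by simp
    qed
    define \<sigma> where "\<sigma> = sqrt (2/3 :: real)"
    have \<sigma>: "0 < \<sigma>" "\<sigma> < 1" by (auto simp: \<sigma>_def)
    have \<beta>p: "\<beta> powr p = \<sigma>" using p by (simp add: \<beta>_def powr_powr \<sigma>_def powr_half_sqrt)
    define \<Lambda> where "\<Lambda> = 1 / (1 - \<sigma>)"
    have \<Lambda>: "0 < \<Lambda>" using \<sigma> by (simp add: \<Lambda>_def)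
    define C where "C = \<Lambda> powr (1/p) * (2 * K * C0)"
    have C: "0 \<le> C" using C0 K_pos by (simp add: C_def)
    have "\<exists>g. g \<in> borel_measurable M \<and> (\<forall>\<omega>. 0 \<le> g \<omega>) \<and> dominated g (C * a) \<and>
      (\<forall>\<omega>. (\<Sum>k\<in>I. u k \<omega> powr p) \<le> card I * g \<omega> powr p)" if fb: "family_bounded I u a" for I u a
    proof -
      have fin: "finite I" and ne: "I \<noteq> {}" and mu: "\<And>k. k \<in> I \<Longrightarrow> u k \<in> borel_measurable M"
        and u0: "\<And>k \<omega>. k \<in> I \<Longrightarrow> 0 \<le> u k \<omega>" and dom: "\<And>k. k \<in> I \<Longrightarrow> dominated (u k) a"
        using fb by (auto simp: family_bounded_def)
      have a0: "0 \<le> a" using ne dom dominated_nonneg by blast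
      define n where "n = card I"
      have n: "0 < n" using fin ne by (simp add: n_def card_gt_0_iff)
      have "\<exists>q. q \<in> borel_measurable M \<and> (\<forall>\<omega>. 0 \<le> q \<omega>) \<and> dominated q (C0 * (2 * K) ^ j * a) \<and>
        (\<forall>\<omega>. real (card {k\<in>I. q \<omega> < u k \<omega>}) \<le> (2/3) ^ j / 2 * card I)" for j :: nat
        using quantile_bound_iterate[OF C0(2), of j] fb unfolding quantile_bound_def by blast
      then have "\<forall>j. \<exists>q. q \<in> borel_measurable M \<and> (\<forall>\<omega>. 0 \<le> q \<omega>) \<and> dominated q (C0 * (2 * K) ^ j * a) \<and>
        (\<forall>\<omega>. real (card {k\<in>I. q \<omega> < u k \<omega>}) \<le> (2/3) ^ j / 2 * card I)" by (rule allI)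
      from choice[OF this] obtain q where q: "\<And>j. q j \<in> borel_measurable M" "\<And>j \<omega>. 0 \<le> q j \<omega>"
        "\<And>j. dominated (q j) (C0 * (2 * K) ^ j * a)"
        "\<And>j \<omega>. real (card {k\<in>I. q j \<omega> < u k \<omega>}) \<le> (2/3) ^ j / 2 * card I"
        by blast
      have "(\<lambda>j. (2/3::real) ^ j / 2 * card I) \<longlonglongrightarrow> 0 / 2 * card I"
        by (intro tendsto_intros LIMSEQ_realpow_zero) auto
      then have "eventually (\<lambda>j. (2/3::real) ^ j / 2 * card I < 1) sequentially"
        by (rule order_tendstoD) simp
      \<comment> \<open>At this level fewer than one index may exceed the quantile, hence none does,
        and finitely many levels suffice.\<close>
      then obtain J where J: "(2/3::real) ^ J / 2 * card I < 1" by (auto simp: eventually_sequentially)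
      have top: "u k \<omega> \<le> q J \<omega>" if "k \<in> I" for k \<omega>
      proof (rule ccontr)
        assume "\<not> u k \<omega> \<le> q J \<omega>"
        then have "k \<in> {k\<in>I. q J \<omega> < u k \<omega>}" using that by auto
        then have "0 < card {k\<in>I. q J \<omega> < u k \<omega>}" using fin by (auto simp: card_gt_0_iff)
        then show False using q(4)[of J \<omega>] J by linarith
      qed
      \<comment> \<open>A single function that dominates every quantile up to the factor
        \<beta>^(-j).\<close>
      define G where "G \<omega> = (\<Sum>j<Suc J. \<beta> ^ j * q j \<omega>)" for \<omega>
      have G0: "0 \<le> G \<omega>" for \<omega> unfolding G_def using \<beta> q(2) by (intro sum_nonneg) auto
      have dG: "dominated G (\<Sum>j<Suc J. K ^ Suc j * (\<beta> ^ j * (C0 * (2 * K) ^ j * a)))"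
        unfolding G_def using \<beta> by (intro dominated_sum dominated_scale q) auto
      have leG: "(\<Sum>j<Suc J. K ^ Suc j * (\<beta> ^ j * (C0 * (2 * K) ^ j * a))) \<le> 2 * K * C0 * a"
      proof -
        have "(\<Sum>j<Suc J. K ^ Suc j * (\<beta> ^ j * (C0 * (2 * K) ^ j * a))) = (\<Sum>j<Suc J. K * C0 * a * (2 * K\<^sup>2 * \<beta>) ^ j)"
          by (intro sum.cong refl) (simp add: power_mult_distrib power2_eq_square mult_ac)
        also have "\<dots> = K * C0 * a * (\<Sum>j<Suc J. (2 * K\<^sup>2 * \<beta>) ^ j)" by (simp only: sum_distrib_left)
        also have "\<dots> \<le> K * C0 * a * (\<Sum>j<Suc J. (1/2) ^ j)"
          using K_pos C0 a0 \<beta> by (intro mult_left_mono sum_mono power_mono) auto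
        also have "\<dots> \<le> K * C0 * a * 2"
          by (rule mult_left_mono, subst geometric_sum) (use K_pos C0 a0 in auto)
        finally show ?thesis by (simp add: mult_ac)
      qed
      have domG: "dominated G (2 * K * C0 * a)" by (rule dominated_mono[OF dG _ leG]) simp
      define g where "g \<omega> = \<Lambda> powr (1/p) * G \<omega>" for \<omega>
      have "dominated g (C * a)"
        using dominated_scale[OF domG, of "\<Lambda> powr (1/p)"] by (simp add: g_def[abs_def] C_def mult_ac)
      moreover have "g \<in> borel_measurable M" unfolding g_def G_def using q(1) by measurable
      moreover have "0 \<le> g \<omega>" for \<omega> using G0 by (simp add: g_def)
      moreover have "(\<Sum>k\<in>I. u k \<omega> powr p) \<le> card I * g \<omega> powr p" for \<omega>
      proof -
        \<comment> \<open>Layer decomposition: if j + 1 is the first level whose quantile reaches u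
          k, then u k exceeds level j and is at most level j + 1.\<close>
        have 1: "u k \<omega> powr p \<le> q 0 \<omega> powr p + (\<Sum>j<J. of_bool (q j \<omega> < u k \<omega>) * q (Suc j) \<omega> powr p)" if k: "k \<in> I" for k
        proof (cases "u k \<omega> \<le> q 0 \<omega>")
          case True
          then have "u k \<omega> powr p \<le> q 0 \<omega> powr p" using p u0[OF k] by (intro powr_mono2) auto
          moreover have "0 \<le> (\<Sum>j<J. of_bool (q j \<omega> < u k \<omega>) * q (Suc j) \<omega> powr p)" by (intro sum_nonneg) auto
          ultimately show ?thesis by linarith
        next
          case False
          define i where "i = (LEAST j. u k \<omega> \<le> q j \<omega>)"
          have i: "u k \<omega> \<le> q i \<omega>" "i \<le> J" unfolding i_def
            using LeastI[of "\<lambda>j. u k \<omega> \<le> q j \<omega>", OF top[OF k]] Least_le[of "\<lambda>j. u k \<omega> \<le> q j \<omega>", OF top[OF k]] by auto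
          have "i \<noteq> 0" using False i by (metis)
          then obtain j where j: "i = Suc j" by (cases i) auto
          have "q j \<omega> < u k \<omega>" using not_less_Least[of j "\<lambda>j. u k \<omega> \<le> q j \<omega>"] j by (auto simp: i_def[symmetric])
          then have "u k \<omega> powr p \<le> of_bool (q j \<omega> < u k \<omega>) * q (Suc j) \<omega> powr p"
            using p i j u0[OF k] by (auto intro: powr_mono2)
          also have "\<dots> \<le> (\<Sum>j<J. of_bool (q j \<omega> < u k \<omega>) * q (Suc j) \<omega> powr p)"
            using i j by (intro member_le_sum) auto
          finally show ?thesis by (simp add: add_increasing)
        qed
        have "(\<Sum>k\<in>I. u k \<omega> powr p) \<le> (\<Sum>k\<in>I. q 0 \<omega> powr p + (\<Sum>j<J. of_bool (q j \<omega> < u k \<omega>) * q (Suc j) \<omega> powr p))"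
          by (intro sum_mono 1)
        also have "\<dots> = n * q 0 \<omega> powr p + (\<Sum>j<J. (\<Sum>k\<in>I. of_bool (q j \<omega> < u k \<omega>)) * q (Suc j) \<omega> powr p)"
          by (simp add: sum.distrib n_def sum.swap[of _ I] sum_distrib_right)
        also have "\<dots> = n * q 0 \<omega> powr p + (\<Sum>j<J. card {k\<in>I. q j \<omega> < u k \<omega>} * q (Suc j) \<omega> powr p)"
          using fin by (simp add: sum.If_cases of_bool_def Int_def)
        \<comment> \<open>The proportion for level j meets the quantile of level j + 1. The shift of
          index is free because (2/3)^j / 2 <= (2/3)^(j + 1).\<close>
        also have "\<dots> \<le> n * q 0 \<omega> powr p + (\<Sum>j<J. (n * (2/3) ^ Suc j) * q (Suc j) \<omega> powr p)"
        proof (intro add_left_mono sum_mono mult_right_mono)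
          fix j
          have "(2/3) ^ j / 2 * real (card I) \<le> n * (2/3) ^ Suc j" by (simp add: n_def)
          with q(4)[of j \<omega>] show "real (card {k\<in>I. q j \<omega> < u k \<omega>}) \<le> n * (2/3) ^ Suc j" by linarith
        qed auto
        also have "\<dots> = n * (\<Sum>j<Suc J. (2/3) ^ j * q j \<omega> powr p)"
          by (subst sum.lessThan_Suc_shift) (simp add: sum_distrib_left algebra_simps)
        also have "\<dots> \<le> n * (\<Sum>j<Suc J. \<sigma> ^ j * G \<omega> powr p)"
        proof (intro mult_left_mono sum_mono)
          fix j assume j: "j \<in> {..<Suc J}"
          have "\<beta> ^ j * q j \<omega> \<le> G \<omega>" unfolding G_def using j \<beta> q(2) by (intro member_le_sum) auto
          then have "(\<beta> ^ j * q j \<omega>) powr p \<le> G \<omega> powr p" using \<beta> q(2)[of j \<omega>] p by (intro powr_mono2) auto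
          moreover have "(\<beta> ^ j * q j \<omega>) powr p = \<sigma> ^ j * q j \<omega> powr p"
          proof -
            have "(\<beta> ^ j) powr p = (\<beta> powr p) ^ j" using \<beta> by (simp add: powr_powr mult.commute flip: powr_realpow)
            then show ?thesis using \<beta> q(2)[of j \<omega>] by (simp add: powr_mult \<beta>p)
          qed
          moreover have "(2/3 :: real) ^ j = \<sigma> ^ j * \<sigma> ^ j" by (simp add: \<sigma>_def flip: power_mult_distrib)
          ultimately show "(2/3) ^ j * q j \<omega> powr p \<le> \<sigma> ^ j * G \<omega> powr p"
            using \<sigma> by (simp add: mult.assoc mult_left_mono)
        qed auto
        also have "\<dots> = n * ((\<Sum>j<Suc J. \<sigma> ^ j) * G \<omega> powr p)" by (simp only: sum_distrib_right)
        also have "\<dots> \<le> n * (\<Lambda> * G \<omega> powr p)"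
        proof (intro mult_left_mono mult_right_mono)
          have "(\<Sum>j<Suc J. \<sigma> ^ j) = (1 - \<sigma> ^ Suc J) / (1 - \<sigma>)"
            using \<sigma> by (subst geometric_sum) (auto simp: field_simps)
          also have "\<dots> \<le> \<Lambda>" unfolding \<Lambda>_def using \<sigma> by (intro divide_right_mono) auto
          finally show "(\<Sum>j<Suc J. \<sigma> ^ j) \<le> \<Lambda>" .
        qed auto
        also have "\<Lambda> * G \<omega> powr p = g \<omega> powr p"
          using p \<Lambda> G0 by (simp add: g_def powr_mult powr_powr)
        finally show ?thesis by (simp add: n_def)
      qed
      ultimately show ?thesis by blast
    qed
    with C show "\<exists>C\<ge>0. \<forall>I u a. family_bounded I u a \<longrightarrow>
    (\<exists>g. g \<in> borel_measurable M \<and> (\<forall>\<omega>. 0 \<le> g \<omega>) \<and> dominated g (C * a) \<and>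
      (\<forall>\<omega>. (\<Sum>k\<in>I. u k \<omega> powr p) \<le> card I * g \<omega> powr p))" by blast
  qed
qed

lemma dominated_finite_sum:
  assumes "finite T" "\<And>i. i \<in> T \<Longrightarrow> \<exists>c. dominated (V i) c"
  shows "\<exists>c. dominated (\<lambda>\<omega>. \<Sum>i\<in>T. V i \<omega>) c"
  using assms
proof (induction T)
  case empty
  then show ?case using dominated_zero[of 0] by auto
next
  case (insert i T)
  then obtain c d where "dominated (V i) c" "dominated (\<lambda>\<omega>. \<Sum>i\<in>T. V i \<omega>) d" by blast
  from dominated_add[OF this] show ?case using insert.hyps by auto
qed

end

section \<open>Pointwise holomorphic versions of analytic functions\<close>

context lattice_couple
begin

lemma dominated_couple_elem:
  assumes "X0.dominated u c" "X1.dominated v d" "g \<in> borel_measurable M"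
    "AE \<omega> in M. cmod (g \<omega>) \<le> t * (u \<omega> + v \<omega>)" "0 \<le> t"
  shows "g \<in> elems Z" "qnorm Z g \<le> t * (c + d)"
proof -
  have *: "AE \<omega> in M. cmod (g \<omega>) \<le> t * u \<omega> + t * v \<omega>"
    using assms(4) by (simp add: distrib_left)
  show "g \<in> elems Z" "qnorm Z g \<le> t * (c + d)"
    using dominated_sum_elem[OF X0.dominated_scale[OF assms(1,5)] X1.dominated_scale[OF assms(2,5)] assms(3) *]
    by (simp_all add: distrib_left)
qed

text \<open>On a smaller disc the scaled coefficients decay like (2 K)^(-k) in X0 + X1. They can be
  split into parts with geometrically small norms in X0 and X1, which gives majorants valid almost
  everywhere, independently of z. The pointwise sum is then the limit in X0 + X1 as well, so it
  equals h z almost everywhere.\<close>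

lemma analytic_pointwise_series:
  assumes h: "analytic_into Z D h" and z0: "z0 \<in> D"
  shows "\<exists>\<rho> c V0 V1 B. 0 < \<rho> \<and> ball z0 \<rho> \<subseteq> D \<and> X0.dominated V0 B \<and> X1.dominated V1 B \<and>
    (AE \<omega> in M. \<forall>n. (\<Sum>k<n. cmod (c k \<omega>) * \<rho> ^ k) \<le> V0 \<omega> + V1 \<omega>) \<and>
    (\<forall>z\<in>ball z0 \<rho>. AE \<omega> in M. (\<lambda>k. c k \<omega> * (z - z0) ^ k) sums h z \<omega>)"
proof -
  obtain r c where r: "r > 0" "ball z0 r \<subseteq> D" and c: "\<And>k. c k \<in> elems Z"
    and unif: "uniform_limit (ball z0 r)
        (\<lambda>n z. qnorm Z (\<lambda>\<omega>. (\<Sum>k<n. (z - z0) ^ k * c k \<omega>) - h z \<omega>)) (\<lambda>_. 0) sequentially"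
    using h z0 unfolding analytic_into_def by blast
  have hZ: "h z \<in> elems Z" if "z \<in> D" for z using h that by (simp add: analytic_into_def)
  have SZ: "(\<lambda>\<omega>. \<Sum>k<n. (z - z0) ^ k * c k \<omega>) \<in> elems Z" for n z
    by (intro Z.sum_closed Z.scale_elem c)
  \<comment> \<open>The coefficients are bounded at radius r / 2; dividing this radius by 2 K
    supplies the decay that the majorants require.\<close>
  define \<rho> where "\<rho> = r / (4 * K)"
  have \<rho>: "0 < \<rho>" "\<rho> < r" "\<rho> / (r / 2) = 1 / (2 * K)"
    using r K_pos K_ge_1 by (auto simp: \<rho>_def field_simps)
  obtain n0 where "\<forall>n\<ge>n0. \<forall>z\<in>ball z0 r. dist (qnorm Z (\<lambda>\<omega>. (\<Sum>k<n. (z - z0) ^ k * c k \<omega>) - h z \<omega>)) 0 < 1"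
    using uniform_limitD[OF unif, of 1] unfolding eventually_sequentially by auto
  then have n0: "qnorm Z (\<lambda>\<omega>. (\<Sum>k<n. (z - z0) ^ k * c k \<omega>) - h z \<omega>) < 1"
    if "n \<ge> n0" "z \<in> ball z0 r" for n z
    using that by (force simp: dist_real_def)
  \<comment> \<open>No Cauchy estimate is at hand in a quasi-normed space. The terms are bounded as
    differences of consecutive partial sums, both of which are close to h z.\<close>
  have big: "qnorm Z (c k) * (r / 2) ^ k \<le> 2 * K" if k: "k \<ge> n0" for k
  proof -
    define z where "z = z0 + of_real (r / 2)"
    have z: "z \<in> ball z0 r" using r by (simp add: z_def dist_norm)
    let ?S = "\<lambda>n \<omega>. \<Sum>k<n. (z - z0) ^ k * c k \<omega>"
    have hz: "h z \<in> elems Z" using hZ z r(2) by auto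
    have "qnorm Z (\<lambda>\<omega>. ?S (Suc k) \<omega> - ?S k \<omega>) \<le>
        K * (qnorm Z (\<lambda>\<omega>. ?S (Suc k) \<omega> - h z \<omega>) + qnorm Z (\<lambda>\<omega>. h z \<omega> - ?S k \<omega>))"
      by (rule Z.quasi_triangle3[OF SZ hz SZ])
    also have "\<dots> \<le> K * (1 + 1)"
      using n0[of "Suc k" z] n0[of k z] k z K_pos Z.qnorm_diff_commute[OF SZ hz, of z k]
      by (intro mult_left_mono add_mono) (auto intro: less_imp_le)
    also have "(\<lambda>\<omega>. ?S (Suc k) \<omega> - ?S k \<omega>) = (\<lambda>\<omega>. (z - z0) ^ k * c k \<omega>)" by auto
    also have "qnorm Z (\<lambda>\<omega>. (z - z0) ^ k * c k \<omega>) = (r / 2) ^ k * qnorm Z (c k)"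
      using r by (simp add: Z.qnorm_mult[OF c] z_def norm_power norm_divide)
    finally show ?thesis by (simp add: mult_ac)
  qed
  define B where "B = 2 * K + 1 + (\<Sum>k<n0. qnorm Z (c k) * (r / 2) ^ k)"
  have cB: "qnorm Z (c k) * (r / 2) ^ k < B" for k
  proof (cases "k < n0")
    case True
    have "qnorm Z (c k) * (r / 2) ^ k \<le> (\<Sum>k<n0. qnorm Z (c k) * (r / 2) ^ k)"
      using True r by (intro member_le_sum) (auto intro!: mult_nonneg_nonneg Z.qnorm_ge_0 c)
    then show ?thesis using K_pos by (simp add: B_def)
  next
    case False
    moreover have "0 \<le> (\<Sum>k<n0. qnorm Z (c k) * (r / 2) ^ k)"
      using r by (intro sum_nonneg mult_nonneg_nonneg Z.qnorm_ge_0 c) auto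
    ultimately show ?thesis using big[of k] by (simp add: B_def)
  qed
  have "\<exists>p q. p \<in> elems X0 \<and> q \<in> elems X1 \<and> (AE \<omega> in M. of_real (\<rho> ^ k) * c k \<omega> = p \<omega> + q \<omega>) \<and>
      qnorm X0 p + qnorm X1 q < B / (2 * K) ^ k" for k
  proof -
    have "qnorm Z (\<lambda>\<omega>. of_real (\<rho> ^ k) * c k \<omega>) = \<rho> ^ k * qnorm Z (c k)"
      using \<rho> by (simp add: Z.qnorm_mult[OF c] norm_power)
    also have "\<rho> ^ k * qnorm Z (c k) = qnorm Z (c k) * (r / 2) ^ k / (2 * K) ^ k"
    proof -
      have "\<rho> ^ k = (r / 2 * (\<rho> / (r / 2))) ^ k" using r by simp
      then show ?thesis unfolding \<rho>(3) power_mult_distrib[of "r / 2"] by (simp add: power_one_over)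
    qed
    also have "\<dots> < B / (2 * K) ^ k"
      using cB[of k] K_pos by (intro divide_strict_right_mono) auto
    finally have lt: "qnorm Z (\<lambda>\<omega>. of_real (\<rho> ^ k) * c k \<omega>) < B / (2 * K) ^ k" .
    show ?thesis by (rule sum_elem_decomp[OF Z.scale_elem[OF c] lt]) blast
  qed
  then have "\<forall>k. \<exists>pq. fst pq \<in> elems X0 \<and> snd pq \<in> elems X1 \<and> (AE \<omega> in M. of_real (\<rho> ^ k) * c k \<omega> = fst pq \<omega> + snd pq \<omega>) \<and>
      qnorm X0 (fst pq) + qnorm X1 (snd pq) < B / (2 * K) ^ k" by simp
  from choice[OF this] obtain pq where pq: "\<And>k. fst (pq k) \<in> elems X0" "\<And>k. snd (pq k) \<in> elems X1"
    "\<And>k. AE \<omega> in M. of_real (\<rho> ^ k) * c k \<omega> = fst (pq k) \<omega> + snd (pq k) \<omega>"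
    "\<And>k. qnorm X0 (fst (pq k)) + qnorm X1 (snd (pq k)) < B / (2 * K) ^ k" by blast
  have le: "qnorm X0 (fst (pq k)) \<le> B / (2 * K) ^ k" "qnorm X1 (snd (pq k)) \<le> B / (2 * K) ^ k" for k
    using pq(4)[of k] X0.qnorm_ge_0[OF pq(1)[of k]] X1.qnorm_ge_0[OF pq(2)[of k]] by linarith+
  obtain V0 where V0: "X0.dominated V0 (2 * K * B)" "AE \<omega> in M. \<forall>n. (\<Sum>k<n. cmod (fst (pq k) \<omega>)) \<le> V0 \<omega>"
    using X0.geometric_majorant[OF pq(1) le(1)] by blast
  obtain V1 where V1: "X1.dominated V1 (2 * K * B)" "AE \<omega> in M. \<forall>n. (\<Sum>k<n. cmod (snd (pq k) \<omega>)) \<le> V1 \<omega>"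
    using X1.geometric_majorant[OF pq(2) le(2)] by blast
  have "AE \<omega> in M. \<forall>k. of_real (\<rho> ^ k) * c k \<omega> = fst (pq k) \<omega> + snd (pq k) \<omega>"
    using pq(3) by (simp add: AE_all_countable)
  then have bound: "AE \<omega> in M. \<forall>n. (\<Sum>k<n. cmod (c k \<omega>) * \<rho> ^ k) \<le> V0 \<omega> + V1 \<omega>"
    using V0(2) V1(2)
  proof eventually_elim
    case (elim \<omega>)
    have "(\<Sum>k<n. cmod (c k \<omega>) * \<rho> ^ k) \<le> V0 \<omega> + V1 \<omega>" for n
    proof -
      have "cmod (c k \<omega>) * \<rho> ^ k \<le> cmod (fst (pq k) \<omega>) + cmod (snd (pq k) \<omega>)" for k
      proof -
        have "cmod (c k \<omega>) * \<rho> ^ k = cmod (of_real (\<rho> ^ k) * c k \<omega>)"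
          using \<rho> by (simp add: norm_mult norm_power)
        then show ?thesis using elim(1) by (metis norm_triangle_ineq)
      qed
      then have "(\<Sum>k<n. cmod (c k \<omega>) * \<rho> ^ k) \<le> (\<Sum>k<n. cmod (fst (pq k) \<omega>)) + (\<Sum>k<n. cmod (snd (pq k) \<omega>))"
        unfolding sum.distrib[symmetric] by (intro sum_mono)
      then show ?thesis using elim(2,3) by (meson add_mono order_trans)
    qed
    then show ?case by blast
  qed
  have sums: "AE \<omega> in M. (\<lambda>k. c k \<omega> * (z - z0) ^ k) sums h z \<omega>" if z: "z \<in> ball z0 \<rho>" for z
  proof -
    define t where "t = cmod (z - z0) / \<rho>"
    have t: "0 \<le> t" "t < 1" using z \<rho> by (auto simp: t_def dist_norm norm_minus_commute)
    have zt: "cmod (z - z0) = t * \<rho>" using \<rho> by (simp add: t_def)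
    have zr: "z \<in> ball z0 r" using z \<rho> by auto
    define G where "G \<omega> = (\<Sum>k. c k \<omega> * (z - z0) ^ k)" for \<omega>
    have mc: "c k \<in> borel_measurable M" for k using Z.meas[OF c] .
    have mG: "G \<in> borel_measurable M" unfolding G_def using mc by measurable
    have pt: "AE \<omega> in M. (\<lambda>k. c k \<omega> * (z - z0) ^ k) sums G \<omega> \<and>
        (\<forall>n. cmod (G \<omega> - (\<Sum>k<n. (z - z0) ^ k * c k \<omega>)) \<le> t ^ n * (V0 \<omega> + V1 \<omega>))"
      using bound
    proof eventually_elim
      case (elim \<omega>)
      have nb: "cmod (c k \<omega> * (z - z0) ^ k) = cmod (c k \<omega>) * \<rho> ^ k * t ^ k" for k
        by (simp add: norm_mult norm_power zt power_mult_distrib)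
      have tk: "t ^ k \<le> 1" for k using t by (simp add: power_le_one)
      have abs: "(\<Sum>k<n. cmod (c k \<omega> * (z - z0) ^ k)) \<le> V0 \<omega> + V1 \<omega>" for n
      proof -
        have "(\<Sum>k<n. cmod (c k \<omega> * (z - z0) ^ k)) \<le> (\<Sum>k<n. cmod (c k \<omega>) * \<rho> ^ k)"
          unfolding nb using tk \<rho> by (intro sum_mono) (auto intro!: mult_left_le)
        then show ?thesis using elim order_trans by blast
      qed
      have sm: "summable (\<lambda>k. cmod (c k \<omega> * (z - z0) ^ k))"
      proof (rule bounded_imp_summable)
        fix n show "(\<Sum>k\<le>n. cmod (c k \<omega> * (z - z0) ^ k)) \<le> V0 \<omega> + V1 \<omega>"
          using abs[of "Suc n"] by (simp only: lessThan_Suc_atMost)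
      qed simp
      have sG: "(\<lambda>k. c k \<omega> * (z - z0) ^ k) sums G \<omega>"
        unfolding G_def by (rule summable_sums[OF summable_norm_cancel[OF sm]])
      \<comment> \<open>The tail is bounded by t^n times fixed majorants in X0 and X1, so pointwise
        convergence is upgraded to convergence in the quasi-norm of the sum.\<close>
      have "cmod (G \<omega> - (\<Sum>k<n. (z - z0) ^ k * c k \<omega>)) \<le> t ^ n * (V0 \<omega> + V1 \<omega>)" for n
      proof -
        have lim: "(\<lambda>m. cmod ((\<Sum>k<m + n. c k \<omega> * (z - z0) ^ k) - (\<Sum>k<n. c k \<omega> * (z - z0) ^ k)))
            \<longlonglongrightarrow> cmod (G \<omega> - (\<Sum>k<n. c k \<omega> * (z - z0) ^ k))"
          using LIMSEQ_ignore_initial_segment[OF sG[unfolded sums_def], of n] by (intro tendsto_intros)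
        have "cmod ((\<Sum>k<m + n. c k \<omega> * (z - z0) ^ k) - (\<Sum>k<n. c k \<omega> * (z - z0) ^ k)) \<le> t ^ n * (V0 \<omega> + V1 \<omega>)" for m
        proof -
          have "(\<Sum>k<m + n. c k \<omega> * (z - z0) ^ k) - (\<Sum>k<n. c k \<omega> * (z - z0) ^ k) = (\<Sum>k=n..<m+n. c k \<omega> * (z - z0) ^ k)"
            by (subst sum_diff_nat_ivl[of 0 n "m+n", symmetric]) (auto simp: lessThan_atLeast0)
          also have "cmod \<dots> \<le> (\<Sum>k=n..<m+n. cmod (c k \<omega> * (z - z0) ^ k))" by (rule norm_sum)
          also have "\<dots> \<le> (\<Sum>k=n..<m+n. t ^ n * (cmod (c k \<omega>) * \<rho> ^ k))"
          proof (rule sum_mono)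
            fix k assume "k \<in> {n..<m+n}"
            then have "t ^ k \<le> t ^ n" using t by (intro power_decreasing) auto
            then show "cmod (c k \<omega> * (z - z0) ^ k) \<le> t ^ n * (cmod (c k \<omega>) * \<rho> ^ k)"
              unfolding nb using \<rho> by (subst mult.commute, intro mult_right_mono) auto
          qed
          also have "\<dots> = t ^ n * (\<Sum>k=n..<m+n. cmod (c k \<omega>) * \<rho> ^ k)" by (simp add: sum_distrib_left)
          also have "\<dots> \<le> t ^ n * (\<Sum>k<m+n. cmod (c k \<omega>) * \<rho> ^ k)"
            using t \<rho> by (intro mult_left_mono sum_mono2) auto
          also have "\<dots> \<le> t ^ n * (V0 \<omega> + V1 \<omega>)" using t elim by (intro mult_left_mono) auto
          finally show ?thesis .
        qed
        then have "cmod (G \<omega> - (\<Sum>k<n. c k \<omega> * (z - z0) ^ k)) \<le> t ^ n * (V0 \<omega> + V1 \<omega>)"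
          by (intro tendsto_upperbound[OF lim]) auto
        then show ?thesis by (simp add: mult.commute)
      qed
      then show ?case using sG by blast
    qed
    have mS: "(\<lambda>\<omega>. \<Sum>k<n. (z - z0) ^ k * c k \<omega>) \<in> borel_measurable M" for n
      using Z.meas[OF SZ] .
    have GS: "(\<lambda>\<omega>. G \<omega> - (\<Sum>k<n. (z - z0) ^ k * c k \<omega>)) \<in> elems Z"
        "qnorm Z (\<lambda>\<omega>. G \<omega> - (\<Sum>k<n. (z - z0) ^ k * c k \<omega>)) \<le> t ^ n * (2 * K * B + 2 * K * B)" for n
    proof -
      have *: "AE \<omega> in M. cmod (G \<omega> - (\<Sum>k<n. (z - z0) ^ k * c k \<omega>)) \<le> t ^ n * (V0 \<omega> + V1 \<omega>)"
        using pt by eventually_elim blast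
      show "(\<lambda>\<omega>. G \<omega> - (\<Sum>k<n. (z - z0) ^ k * c k \<omega>)) \<in> elems Z"
        "qnorm Z (\<lambda>\<omega>. G \<omega> - (\<Sum>k<n. (z - z0) ^ k * c k \<omega>)) \<le> t ^ n * (2 * K * B + 2 * K * B)"
        using dominated_couple_elem[OF V0(1) V1(1) borel_measurable_diff[OF mG mS] *] t by auto
    qed
    have GZ: "G \<in> elems Z" using GS(1)[of 0] by simp
    have "converges_in Z (\<lambda>n \<omega>. \<Sum>k<n. (z - z0) ^ k * c k \<omega>) G sequentially"
    proof (rule converges_in_squeeze)
      have "(\<lambda>n. t ^ n * (2 * K * B + 2 * K * B)) \<longlonglongrightarrow> 0 * (2 * K * B + 2 * K * B)"
        using t by (intro tendsto_intros LIMSEQ_realpow_zero) auto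
      then show "(\<lambda>n. t ^ n * (2 * K * B + 2 * K * B)) \<longlonglongrightarrow> 0" by simp
      show "\<forall>\<^sub>F n in sequentially. (\<lambda>\<omega>. (\<Sum>k<n. (z - z0) ^ k * c k \<omega>) - G \<omega>) \<in> elems Z"
        by (intro always_eventually allI Z.diff_closed SZ GZ)
      show "\<forall>\<^sub>F n in sequentially. qnorm Z (\<lambda>\<omega>. (\<Sum>k<n. (z - z0) ^ k * c k \<omega>) - G \<omega>) \<le> t ^ n * (2 * K * B + 2 * K * B)"
        using GS(2) Z.qnorm_diff_commute[OF SZ GZ] by (intro always_eventually allI) simp
    qed
    from Z.converges_in_unique[OF SZ[where z = z] GZ _ sequentially_bot this, of "h z"]
    have "AE \<omega> in M. G \<omega> = h z \<omega>"
      using tendsto_uniform_limitI[OF unif zr] hZ zr r(2) by (auto simp: converges_in_def)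
    with pt show ?thesis by eventually_elim simp
  qed
  have "ball z0 \<rho> \<subseteq> D" using r \<rho> by auto
  then show ?thesis
    by (intro exI[of _ \<rho>] exI[of _ c] exI[of _ V0] exI[of _ V1] exI[of _ "2 * K * B"] conjI ballI
        \<rho>(1) V0(1) V1(1) bound sums)
qed

end

text \<open>Equalities almost everywhere can be collected only for countably many z. With a
  countable dense set of points, continuity extends them to all z outside one null set.\<close>

lemma open_eq_from_dense:
  fixes f g :: "complex \<Rightarrow> complex"
  assumes "open S" "continuous_on S f" "continuous_on S g"
    "\<And>X. open X \<Longrightarrow> X \<noteq> {} \<Longrightarrow> \<exists>d\<in>Q. d \<in> X" "\<And>q. q \<in> Q \<inter> S \<Longrightarrow> f q = g q" "z \<in> S"
  shows "f z = g z"
proof (rule ccontr)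
  assume ne: "f z \<noteq> g z"
  have "continuous_on S (\<lambda>z. f z - g z)" using assms by (intro continuous_intros)
  then have "open (S \<inter> (\<lambda>z. f z - g z) -` (- {0}))"
    using assms(1) continuous_open_preimage[of S _ "- {0}"] by auto
  moreover have "z \<in> S \<inter> (\<lambda>z. f z - g z) -` (- {0})" using ne assms(6) by simp
  ultimately obtain q where "q \<in> Q" "q \<in> S \<inter> (\<lambda>z. f z - g z) -` (- {0})" using assms(4) by blast
  then show False using assms(5)[of q] by auto
qed

context lattice_couple
begin

text \<open>Finitely many discs cover C. Outside one null set the local power series agree with h on
  a countable dense set, hence with each other on overlaps, and glue to a function holomorphic in z.
  By contrast the null set of \<open>H z \<omega> = h z \<omega>\<close> still depends on z, so
  later only finitely many values of h are inserted.\<close>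

lemma analytic_pointwise_holomorphic:
  assumes h: "analytic_into Z D h" and C: "compact C" "C \<subseteq> D"
  obtains H U V0 V1 B0 B1 where "open U" "C \<subseteq> U" "X0.dominated V0 B0" "X1.dominated V1 B1"
    "AE \<omega> in M. (\<lambda>z. H z \<omega>) holomorphic_on U \<and> (\<forall>z\<in>U. cmod (H z \<omega>) \<le> V0 \<omega> + V1 \<omega>)"
    "\<And>z. z \<in> U \<Longrightarrow> AE \<omega> in M. H z \<omega> = h z \<omega>" "\<And>\<omega>. 0 \<le> V0 \<omega>" "\<And>\<omega>. 0 \<le> V1 \<omega>"
proof -
  have "\<forall>z0\<in>C. \<exists>\<rho> c V0 V1 B. 0 < \<rho> \<and> ball z0 \<rho> \<subseteq> D \<and> X0.dominated V0 B \<and> X1.dominated V1 B \<and>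
    (AE \<omega> in M. \<forall>n. (\<Sum>k<n. cmod (c k \<omega>) * \<rho> ^ k) \<le> V0 \<omega> + V1 \<omega>) \<and>
    (\<forall>z\<in>ball z0 \<rho>. AE \<omega> in M. (\<lambda>k. c k \<omega> * (z - z0) ^ k) sums h z \<omega>)"
    using analytic_pointwise_series[OF h] C by blast
  from bchoice[OF this] obtain \<rho> where "\<forall>z0\<in>C. \<exists>c V0 V1 B. 0 < \<rho> z0 \<and> ball z0 (\<rho> z0) \<subseteq> D \<and> X0.dominated V0 B \<and> X1.dominated V1 B \<and>
    (AE \<omega> in M. \<forall>n. (\<Sum>k<n. cmod (c k \<omega>) * \<rho> z0 ^ k) \<le> V0 \<omega> + V1 \<omega>) \<and>
    (\<forall>z\<in>ball z0 (\<rho> z0). AE \<omega> in M. (\<lambda>k. c k \<omega> * (z - z0) ^ k) sums h z \<omega>)" by blast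
  from bchoice[OF this] obtain c where "\<forall>z0\<in>C. \<exists>V0 V1 B. 0 < \<rho> z0 \<and> ball z0 (\<rho> z0) \<subseteq> D \<and> X0.dominated V0 B \<and> X1.dominated V1 B \<and>
    (AE \<omega> in M. \<forall>n. (\<Sum>k<n. cmod (c z0 k \<omega>) * \<rho> z0 ^ k) \<le> V0 \<omega> + V1 \<omega>) \<and>
    (\<forall>z\<in>ball z0 (\<rho> z0). AE \<omega> in M. (\<lambda>k. c z0 k \<omega> * (z - z0) ^ k) sums h z \<omega>)" by blast
  from bchoice[OF this] obtain V0 where "\<forall>z0\<in>C. \<exists>V1 B. 0 < \<rho> z0 \<and> ball z0 (\<rho> z0) \<subseteq> D \<and> X0.dominated (V0 z0) B \<and> X1.dominated V1 B \<and>
    (AE \<omega> in M. \<forall>n. (\<Sum>k<n. cmod (c z0 k \<omega>) * \<rho> z0 ^ k) \<le> V0 z0 \<omega> + V1 \<omega>) \<and>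
    (\<forall>z\<in>ball z0 (\<rho> z0). AE \<omega> in M. (\<lambda>k. c z0 k \<omega> * (z - z0) ^ k) sums h z \<omega>)" by blast
  from bchoice[OF this] obtain V1 where V: "\<forall>z0\<in>C. \<exists>B. 0 < \<rho> z0 \<and> ball z0 (\<rho> z0) \<subseteq> D \<and> X0.dominated (V0 z0) B \<and> X1.dominated (V1 z0) B \<and>
    (AE \<omega> in M. \<forall>n. (\<Sum>k<n. cmod (c z0 k \<omega>) * \<rho> z0 ^ k) \<le> V0 z0 \<omega> + V1 z0 \<omega>) \<and>
    (\<forall>z\<in>ball z0 (\<rho> z0). AE \<omega> in M. (\<lambda>k. c z0 k \<omega> * (z - z0) ^ k) sums h z \<omega>)" by blast
  have \<rho>: "0 < \<rho> z0" and d0: "\<exists>B. X0.dominated (V0 z0) B" and d1: "\<exists>B. X1.dominated (V1 z0) B"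
    and bd: "AE \<omega> in M. \<forall>n. (\<Sum>k<n. cmod (c z0 k \<omega>) * \<rho> z0 ^ k) \<le> V0 z0 \<omega> + V1 z0 \<omega>"
    and sm: "\<And>z. z\<in>ball z0 (\<rho> z0) \<Longrightarrow> AE \<omega> in M. (\<lambda>k. c z0 k \<omega> * (z - z0) ^ k) sums h z \<omega>"
    if "z0 \<in> C" for z0
    using V[rule_format, OF that] by blast+
  have "C \<subseteq> (\<Union>z\<in>C. ball z (\<rho> z))" using \<rho> by auto
  from compactE_image[OF C(1) open_ball this] obtain T where T: "T \<subseteq> C" "finite T" "C \<subseteq> (\<Union>z\<in>T. ball z (\<rho> z))"
    by blast
  define U where "U = (\<Union>z\<in>T. ball z (\<rho> z))"
  define G where "G i z \<omega> = (\<Sum>k. c i k \<omega> * (z - i) ^ k)" for i z \<omega>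
  \<comment> \<open>An arbitrary choice of disc, made before \<omega> is fixed; for almost every
    \<omega> the result does not depend on it.\<close>
  define ix where "ix z = (SOME i. i \<in> T \<and> z \<in> ball i (\<rho> i))" for z
  define H where "H z = G (ix z) z" for z
  have ix: "ix z \<in> T" "z \<in> ball (ix z) (\<rho> (ix z))" if "z \<in> U" for z
  proof -
    have "\<exists>i. i \<in> T \<and> z \<in> ball i (\<rho> i)" using that by (auto simp: U_def)
    from someI_ex[OF this] show "ix z \<in> T" "z \<in> ball (ix z) (\<rho> (ix z))" by (auto simp: ix_def)
  qed
  obtain Q :: "complex set" where Q: "countable Q" "\<And>X. open X \<Longrightarrow> X \<noteq> {} \<Longrightarrow> \<exists>d\<in>Q. d \<in> X"
    using countable_dense_setE by blast
  have bdT: "AE \<omega> in M. \<forall>i\<in>T. \<forall>n. (\<Sum>k<n. cmod (c i k \<omega>) * \<rho> i ^ k) \<le> V0 i \<omega> + V1 i \<omega>"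
    using bd T by (subst AE_finite_all) auto
  have Gh: "AE \<omega> in M. G i z \<omega> = h z \<omega>" if "i \<in> T" "z \<in> ball i (\<rho> i)" for i z
    using sm[of i z] that T by (auto simp: G_def sums_iff elim!: eventually_mono)
  have eqQ: "AE \<omega> in M. \<forall>q\<in>Q. \<forall>i\<in>T. q \<in> ball i (\<rho> i) \<longrightarrow> G i q \<omega> = h q \<omega>"
  proof (subst AE_ball_countable[OF Q(1)], intro ballI)
    fix q
    show "AE \<omega> in M. \<forall>i\<in>T. q \<in> ball i (\<rho> i) \<longrightarrow> G i q \<omega> = h q \<omega>"
    proof (subst AE_finite_all[OF T(2)], intro ballI)
      fix i assume "i \<in> T"
      then show "AE \<omega> in M. q \<in> ball i (\<rho> i) \<longrightarrow> G i q \<omega> = h q \<omega>"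
        using Gh[of i q] by (cases "q \<in> ball i (\<rho> i)") auto
    qed
  qed
  define W0 where "W0 \<omega> = (\<Sum>i\<in>T. max 0 (V0 i \<omega>))" for \<omega>
  define W1 where "W1 \<omega> = (\<Sum>i\<in>T. max 0 (V1 i \<omega>))" for \<omega>
  have pos0: "\<exists>c. X0.dominated (\<lambda>\<omega>. max 0 (V \<omega>)) c" if "\<exists>c. X0.dominated V c" for V
    using that by (auto simp: X0.dominated_def)
  have pos1: "\<exists>c. X1.dominated (\<lambda>\<omega>. max 0 (V \<omega>)) c" if "\<exists>c. X1.dominated V c" for V
    using that by (auto simp: X1.dominated_def)
  have "\<exists>c. X0.dominated W0 c"
    unfolding W0_def by (rule X0.dominated_finite_sum[OF T(2)]) (rule pos0, rule d0, use T(1) in auto)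
  then obtain B0 where B0: "X0.dominated W0 B0" ..
  have "\<exists>c. X1.dominated W1 c"
    unfolding W1_def by (rule X1.dominated_finite_sum[OF T(2)]) (rule pos1, rule d1, use T(1) in auto)
  then obtain B1 where B1: "X1.dominated W1 B1" ..
  have main: "AE \<omega> in M. (\<lambda>z. H z \<omega>) holomorphic_on U \<and> (\<forall>z\<in>U. cmod (H z \<omega>) \<le> W0 \<omega> + W1 \<omega>)"
    using bdT eqQ
  proof eventually_elim
    case (elim \<omega>)
    have sc: "summable (\<lambda>k. cmod (c i k \<omega> * (z - i) ^ k)) \<and> (\<Sum>k. cmod (c i k \<omega> * (z - i) ^ k)) \<le> W0 \<omega> + W1 \<omega>"
      if i: "i \<in> T" and z: "z \<in> ball i (\<rho> i)" for i z
    proof -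
      have "V0 i \<omega> \<le> W0 \<omega>" "V1 i \<omega> \<le> W1 \<omega>"
        unfolding W0_def W1_def using member_le_sum[OF i, of "\<lambda>i. max 0 (V0 i \<omega>)"]
          member_le_sum[OF i, of "\<lambda>i. max 0 (V1 i \<omega>)"] T(2) by auto
      moreover have "(\<Sum>k<n. cmod (c i k \<omega> * (z - i) ^ k)) \<le> (\<Sum>k<n. cmod (c i k \<omega>) * \<rho> i ^ k)" for n
        using z by (intro sum_mono) (auto simp: norm_mult norm_power dist_norm norm_minus_commute intro!: mult_left_mono power_mono)
      ultimately have le: "(\<Sum>k<n. cmod (c i k \<omega> * (z - i) ^ k)) \<le> W0 \<omega> + W1 \<omega>" for n
        using elim(1) i by (meson add_mono order_trans)
      have s: "summable (\<lambda>k. cmod (c i k \<omega> * (z - i) ^ k))"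
      proof (rule bounded_imp_summable)
        fix n show "(\<Sum>k\<le>n. cmod (c i k \<omega> * (z - i) ^ k)) \<le> W0 \<omega> + W1 \<omega>"
          using le[of "Suc n"] by (simp only: lessThan_Suc_atMost)
      qed simp
      then show ?thesis using suminf_le_const[OF s le] by blast
    qed
    have holG: "(\<lambda>z. G i z \<omega>) holomorphic_on ball i (\<rho> i)" if i: "i \<in> T" for i
    proof (rule power_series_holomorphic)
      fix w assume "w \<in> ball i (\<rho> i)"
      then show "(\<lambda>n. c i n \<omega> * (w - i) ^ n) sums G i w \<omega>"
        unfolding G_def by (intro summable_sums summable_norm_cancel[OF conjunct1[OF sc[OF i]]])
    qed
    have GG: "G i z \<omega> = G j z \<omega>" if "i \<in> T" "j \<in> T" "z \<in> ball i (\<rho> i)" "z \<in> ball j (\<rho> j)" for i j z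
    proof (rule open_eq_from_dense[of "ball i (\<rho> i) \<inter> ball j (\<rho> j)" "\<lambda>z. G i z \<omega>" "\<lambda>z. G j z \<omega>" Q])
      show "continuous_on (ball i (\<rho> i) \<inter> ball j (\<rho> j)) (\<lambda>z. G i z \<omega>)"
        "continuous_on (ball i (\<rho> i) \<inter> ball j (\<rho> j)) (\<lambda>z. G j z \<omega>)"
        by (rule continuous_on_subset[OF holomorphic_on_imp_continuous_on[OF holG[OF that(1)]] inf_le1],
            rule continuous_on_subset[OF holomorphic_on_imp_continuous_on[OF holG[OF that(2)]] inf_le2])
    qed (use elim(2) that Q(2) in auto)
    have HG: "H z \<omega> = G i z \<omega>" if "i \<in> T" "z \<in> ball i (\<rho> i)" for i z
    proof -
      have "z \<in> U" using that by (auto simp: U_def)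
      from GG[OF ix(1)[OF this] that(1) ix(2)[OF this] that(2)] show ?thesis by (simp add: H_def)
    qed
    have "(\<lambda>z. H z \<omega>) holomorphic_on U"
      unfolding U_def
    proof (intro holomorphic_on_UN_open)
      fix i assume "i \<in> T"
      then show "(\<lambda>z. H z \<omega>) holomorphic_on ball i (\<rho> i)"
        using holG holomorphic_cong[OF refl, of "ball i (\<rho> i)" "\<lambda>z. H z \<omega>" "\<lambda>z. G i z \<omega>"] HG by blast
    qed simp
    moreover have "cmod (H z \<omega>) \<le> W0 \<omega> + W1 \<omega>" if "z \<in> U" for z
      using sc[OF ix[OF that]] summable_norm[of "\<lambda>k. c (ix z) k \<omega> * (z - ix z) ^ k"]
      unfolding H_def G_def by linarith
    ultimately show ?case by blast
  qed
  show thesis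
  proof (rule that[OF _ _ B0 B1 main])
    show "open U" by (auto simp: U_def)
    show "C \<subseteq> U" using T by (simp add: U_def)
    show "AE \<omega> in M. H z \<omega> = h z \<omega>" if "z \<in> U" for z
      using Gh[OF ix[OF that]] by (simp add: H_def)
    show "0 \<le> W0 \<omega>" "0 \<le> W1 \<omega>" for \<omega> by (auto simp: W0_def W1_def intro!: sum_nonneg)
  qed
qed

end

text \<open>Cauchy's estimate on discs of radius (R - 1) / 2 about points of the closed unit disc.
  The Lipschitz constant is proportional to the bound V, which later lets V cancel.\<close>

lemma lipschitz_from_bound:
  fixes f :: "complex \<Rightarrow> complex"
  assumes hol: "f holomorphic_on ball 0 R" and R: "1 < R" and bd: "\<And>z. z \<in> ball 0 R \<Longrightarrow> cmod (f z) \<le> V"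
    and z: "cmod z \<le> 1" and w: "cmod w \<le> 1"
  shows "cmod (f z - f w) \<le> 2 * V / (R - 1) * cmod (z - w)"
proof (rule field_differentiable_bound[of "cball 0 1" f "deriv f"])
  fix x :: complex assume x: "x \<in> cball 0 1"
  have xR: "x \<in> ball 0 R" using x R by simp
  show "(f has_field_derivative deriv f x) (at x within cball 0 1)"
    using holomorphic_derivI[OF hol open_ball xR] .
  define \<rho> where "\<rho> = (R - 1) / 2"
  have \<rho>: "0 < \<rho>" using R by (simp add: \<rho>_def)
  have sub: "cball x \<rho> \<subseteq> ball 0 R"
  proof
    fix y assume "y \<in> cball x \<rho>"
    then have "cmod (y - x) \<le> \<rho>" by (simp add: dist_norm norm_minus_commute)
    then have "cmod y \<le> 1 + \<rho>" using x norm_triangle_ineq[of x "y - x"] by simp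
    also have "\<dots> < R" using R by (simp add: \<rho>_def field_simps)
    finally show "y \<in> ball 0 R" by simp
  qed
  have "cmod ((deriv ^^ 1) f x) \<le> fact 1 * V / \<rho> ^ 1"
  proof (rule Cauchy_inequality[OF _ _ \<rho>])
    show "f holomorphic_on ball x \<rho>" using hol sub ball_subset_cball by (meson holomorphic_on_subset order_trans)
    show "continuous_on (cball x \<rho>) f" using hol sub by (meson holomorphic_on_imp_continuous_on continuous_on_subset)
    fix y assume "cmod (x - y) = \<rho>"
    then show "cmod (f y) \<le> V" using sub by (intro bd) (auto simp: dist_norm subset_iff)
  qed
  then show "cmod (deriv f x) \<le> 2 * V / (R - 1)" by (simp add: \<rho>_def mult.commute)
qed (use z w in auto)

lemma card_rational_points:
  fixes a b :: real
  assumes "0 < N" "a \<le> b"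
  shows "card {k::nat. k < N \<and> a \<le> k / N \<and> k / N \<le> b} \<le> N * (b - a) + 1"
proof (cases "{k::nat. k < N \<and> a \<le> k / N \<and> k / N \<le> b} = {}")
  case False
  define S where "S = {k::nat. k < N \<and> a \<le> k / N \<and> k / N \<le> b}"
  have fin: "finite S" by (simp add: S_def)
  define m where "m = Min S"
  define n where "n = Max S"
  have m: "m \<in> S" "n \<in> S" using fin False by (auto simp: m_def n_def S_def[symmetric])
  have "S \<subseteq> {m..n}" using fin by (auto simp: m_def n_def)
  then have "card S \<le> card {m..n}" by (intro card_mono) auto
  then have "real (card S) \<le> real (Suc n - m)" by simp
  moreover have "m \<le> n" using m fin by (simp add: n_def)
  ultimately have "real (card S) \<le> real n - real m + 1" by (simp add: of_nat_diff)
  moreover have "real n \<le> N * b" "N * a \<le> real m" using m assms by (auto simp: S_def field_simps)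
  ultimately show ?thesis by (simp add: S_def algebra_simps)
qed (use assms in \<open>simp del: Collect_empty_eq\<close>)

section \<open>The conformal map onto the strip\<close>

text \<open>The conformal map of the disc onto the strip with \<open>0 \<mapsto> \<theta>\<close>: the Moebius map onto the right
  half plane followed by a logarithm. The arc \<open>\<theta> < x < 1\<close> of the circle \<open>cis (2 * pi * x)\<close>
  goes to the line \<open>Re z = 0\<close>.\<close>

definition half_plane_map :: "real \<Rightarrow> complex \<Rightarrow> complex" where
  "half_plane_map \<theta> \<zeta> = - \<i> * (cis (pi * \<theta>) - cis (- (pi * \<theta>)) * \<zeta>) / (1 - \<zeta>)"

definition strip_map :: "real \<Rightarrow> complex \<Rightarrow> complex" where
  "strip_map \<theta> \<zeta> = 1 / 2 - \<i> / of_real pi * Ln (half_plane_map \<theta> \<zeta>)"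

text \<open>Up to the factor sin (pi \<theta>) this is the Poisson kernel with pole 1. Its sign
  shows that the disc goes to the right half plane and the circle to the imaginary axis.\<close>

lemma Re_half_plane_map:
  assumes "\<zeta> \<noteq> 1"
  shows "Re (half_plane_map \<theta> \<zeta>) = sin (pi * \<theta>) * (1 - (cmod \<zeta>)\<^sup>2) / (cmod (1 - \<zeta>))\<^sup>2"
proof -
  have "half_plane_map \<theta> \<zeta> = (- \<i> * (cis (pi * \<theta>) - cis (- (pi * \<theta>)) * \<zeta>) * cnj (1 - \<zeta>)) / of_real ((cmod (1 - \<zeta>))\<^sup>2)"
    unfolding half_plane_map_def complex_norm_square using assms
    by (simp add: divide_simps)
  then have "Re (half_plane_map \<theta> \<zeta>) = Re (- \<i> * (cis (pi * \<theta>) - cis (- (pi * \<theta>)) * \<zeta>) * cnj (1 - \<zeta>)) / (cmod (1 - \<zeta>))\<^sup>2"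
    by (simp only: Re_divide_of_real)
  also have "Re (- \<i> * (cis (pi * \<theta>) - cis (- (pi * \<theta>)) * \<zeta>) * cnj (1 - \<zeta>)) = sin (pi * \<theta>) * (1 - (cmod \<zeta>)\<^sup>2)"
    unfolding cmod_power2 by (simp add: power2_eq_square algebra_simps)
  finally show ?thesis .
qed

lemma half_plane_map_nonzero:
  assumes "\<zeta> \<noteq> 1" "\<zeta> \<noteq> cis (2 * pi * \<theta>)"
  shows "half_plane_map \<theta> \<zeta> \<noteq> 0"
proof
  assume "half_plane_map \<theta> \<zeta> = 0"
  then have "cis (pi * \<theta>) = cis (- (pi * \<theta>)) * \<zeta>" using assms(1) by (simp add: half_plane_map_def)
  then have "cis (pi * \<theta>) * cis (pi * \<theta>) = (cis (pi * \<theta>) * cis (- (pi * \<theta>))) * \<zeta>" by (simp add: mult.assoc)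
  then have "cis (2 * pi * \<theta>) = \<zeta>" by (simp add: cis_mult mult_ac)
  then show False using assms by simp
qed

text \<open>The branch cut of \<open>Ln\<close> is avoided up to the boundary: the real part is
  non-negative, so only the value 0 is critical, and it is taken at cis (2 pi \<theta>)
  alone.\<close>

lemma half_plane_map_slit:
  assumes \<theta>: "0 < \<theta>" "\<theta> < 1" and "cmod \<zeta> \<le> 1" "\<zeta> \<noteq> 1" "\<zeta> \<noteq> cis (2 * pi * \<theta>)"
  shows "half_plane_map \<theta> \<zeta> \<notin> \<real>\<^sub>\<le>\<^sub>0"
proof
  assume *: "half_plane_map \<theta> \<zeta> \<in> \<real>\<^sub>\<le>\<^sub>0"
  have "0 < sin (pi * \<theta>)" using \<theta> by (intro sin_gt_zero) (auto simp: mult_less_cancel_left1)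
  moreover have "(cmod \<zeta>)\<^sup>2 \<le> 1" using assms(3) by (simp add: power_le_one)
  ultimately have "0 \<le> Re (half_plane_map \<theta> \<zeta>)"
    unfolding Re_half_plane_map[OF assms(4)] by simp
  with * have "half_plane_map \<theta> \<zeta> = 0" by (auto simp: complex_nonpos_Reals_iff complex_eq_iff)
  with half_plane_map_nonzero[OF assms(4,5)] show False by simp
qed

lemma strip_map_ball:
  assumes \<theta>: "0 < \<theta>" "\<theta> < 1" and "cmod \<zeta> < 1"
  shows "strip_map \<theta> \<zeta> \<in> open_strip"
proof -
  have ne: "\<zeta> \<noteq> 1" "\<zeta> \<noteq> cis (2 * pi * \<theta>)" using assms(3) by auto
  have "0 < sin (pi * \<theta>)" using \<theta> by (intro sin_gt_zero) (auto simp: mult_less_cancel_left1)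
  moreover have "(cmod \<zeta>)\<^sup>2 < 1" using assms(3) by (simp add: abs_square_less_1)
  ultimately have "0 < Re (half_plane_map \<theta> \<zeta>)"
    unfolding Re_half_plane_map[OF ne(1)] using ne by (intro divide_pos_pos mult_pos_pos) auto
  then have "\<bar>Im (Ln (half_plane_map \<theta> \<zeta>))\<bar> < pi / 2"
    using Re_Ln_pos_lt[OF half_plane_map_nonzero[OF ne]] by simp
  then have "- (1/2) < Im (Ln (half_plane_map \<theta> \<zeta>)) / pi" "Im (Ln (half_plane_map \<theta> \<zeta>)) / pi < 1/2"
    by (auto simp: field_simps abs_less_iff)
  moreover have "Re (strip_map \<theta> \<zeta>) = 1/2 + Im (Ln (half_plane_map \<theta> \<zeta>)) / pi"
    by (simp add: strip_map_def)
  ultimately have "0 < Re (strip_map \<theta> \<zeta>)" "Re (strip_map \<theta> \<zeta>) < 1" by linarith+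
  then show ?thesis by (simp add: open_strip_def)
qed

lemma holomorphic_strip_map:
  assumes \<theta>: "0 < \<theta>" "\<theta> < 1"
  shows "strip_map \<theta> holomorphic_on ball 0 1"
proof -
  have "half_plane_map \<theta> holomorphic_on ball 0 1"
    unfolding half_plane_map_def by (intro holomorphic_intros) auto
  moreover have "half_plane_map \<theta> \<zeta> \<notin> \<real>\<^sub>\<le>\<^sub>0" if "\<zeta> \<in> ball 0 1" for \<zeta>
    using that by (intro half_plane_map_slit \<theta>) auto
  ultimately show ?thesis unfolding strip_map_def by (intro holomorphic_intros) auto
qed

lemma continuous_strip_map:
  assumes \<theta>: "0 < \<theta>" "\<theta> < 1"
  shows "continuous_on (cball 0 1 - {1, cis (2 * pi * \<theta>)}) (strip_map \<theta>)"
proof -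
  have "continuous_on (cball 0 1 - {1, cis (2 * pi * \<theta>)}) (half_plane_map \<theta>)"
    unfolding half_plane_map_def by (intro continuous_intros) auto
  moreover have "half_plane_map \<theta> \<zeta> \<notin> \<real>\<^sub>\<le>\<^sub>0" if "\<zeta> \<in> cball 0 1 - {1, cis (2 * pi * \<theta>)}" for \<zeta>
    using that by (intro half_plane_map_slit \<theta>) auto
  ultimately show ?thesis unfolding strip_map_def by (intro continuous_intros) auto
qed

lemma strip_map_zero:
  assumes \<theta>: "0 < \<theta>" "\<theta> < 1"
  shows "strip_map \<theta> 0 = of_real \<theta>"
proof -
  have "half_plane_map \<theta> 0 = cis (pi * \<theta> - pi / 2)"
    by (simp add: half_plane_map_def cis_mult[symmetric] diff_conv_add_uminus del: add_uminus_conv_diff)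
  also have "\<dots> = exp (\<i> * of_real (pi * \<theta> - pi / 2))" by (simp add: cis_conv_exp)
  finally have "Ln (half_plane_map \<theta> 0) = \<i> * of_real (pi * \<theta> - pi / 2)"
  proof -
    assume e: "half_plane_map \<theta> 0 = exp (\<i> * of_real (pi * \<theta> - pi / 2))"
    have "0 < pi * \<theta>" "pi * \<theta> < pi" using \<theta> by auto
    then have "- pi < pi * \<theta> - pi / 2" "pi * \<theta> - pi / 2 \<le> pi" using pi_gt_zero by linarith+
    then show ?thesis unfolding e by (intro Ln_exp) auto
  qed
  then show ?thesis by (simp add: strip_map_def complex_eq_iff field_simps)
qed

text \<open>Half-angle form, from cis a - cis (-a) = 2 i sin a. The sign of sin (pi (x - \<theta>))
  selects the half of the imaginary axis, hence the imaginary part of the logarithm and the boundary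
  line of the strip.\<close>

lemma half_plane_map_circle:
  assumes "0 < x" "x < 1"
  shows "half_plane_map \<theta> (cis (2 * pi * x)) = - \<i> * of_real (sin (pi * (x - \<theta>)) / sin (pi * x))"
proof -
  have s: "0 < sin (pi * x)" using assms by (intro sin_gt_zero) (auto simp: mult_less_cancel_left1)
  have dc: "cis a - cis (- a) = 2 * \<i> * of_real (sin a)" for a by (simp add: complex_eq_iff)
  have 1: "cis (pi * \<theta>) - cis (- (pi * \<theta>)) * cis (2 * pi * x) = cis (pi * x) * (2 * \<i> * of_real (sin (pi * \<theta> - pi * x)))"
    unfolding dc[symmetric] by (simp add: cis_mult algebra_simps)
  have 2: "1 - cis (2 * pi * x) = cis (pi * x) * (- (2 * \<i> * of_real (sin (pi * x))))"
    unfolding dc[symmetric] by (simp add: cis_mult algebra_simps)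
  have "sin (pi * \<theta> - pi * x) = - sin (pi * (x - \<theta>))"
    using sin_minus[of "pi * (x - \<theta>)"] by (simp add: algebra_simps)
  then have "half_plane_map \<theta> (cis (2 * pi * x)) =
      - \<i> * (cis (pi * x) * (2 * \<i> * of_real (- sin (pi * (x - \<theta>)))) / (cis (pi * x) * (- (2 * \<i> * of_real (sin (pi * x))))))"
    unfolding half_plane_map_def 1 2 by simp
  also have "cis (pi * x) * (2 * \<i> * of_real (- sin (pi * (x - \<theta>)))) / (cis (pi * x) * (- (2 * \<i> * of_real (sin (pi * x))))) =
      of_real (sin (pi * (x - \<theta>)) / sin (pi * x))"
    using s by (simp add: field_simps)
  finally show ?thesis .
qed

lemma strip_map_left_arc:
  assumes \<theta>: "0 < \<theta>" "\<theta> < x" "x < 1"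
  shows "\<exists>t. strip_map \<theta> (cis (2 * pi * x)) = Complex 0 t"
proof -
  have "0 < sin (pi * x)" using assms by (intro sin_gt_zero) (auto simp: mult_less_cancel_left1)
  moreover have "0 < sin (pi * (x - \<theta>))" using assms by (intro sin_gt_zero) (auto simp: mult_less_cancel_left1)
  ultimately have r: "0 < sin (pi * (x - \<theta>)) / sin (pi * x)" by simp
  define r where "r = sin (pi * (x - \<theta>)) / sin (pi * x)"
  have "Ln (- \<i> * of_real r) = of_real (ln r) + Ln (- \<i>)"
    using r[folded r_def] Ln_times_of_real[of r "- \<i>"] by (simp add: mult.commute Ln_of_real)
  also have "Ln (- \<i>) = - \<i> * of_real pi / 2" by simp
  finally have L: "Ln (- \<i> * of_real r) = of_real (ln r) + - \<i> * of_real pi / 2" .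
  have "half_plane_map \<theta> (cis (2 * pi * x)) = - \<i> * of_real r"
    using half_plane_map_circle[of x \<theta>] assms by (simp add: r_def)
  then have "strip_map \<theta> (cis (2 * pi * x)) = Complex 0 (- ln r / pi)"
    unfolding strip_map_def by (simp only: L) (simp add: complex_eq_iff)
  then show ?thesis by blast
qed

lemma strip_map_right_arc:
  assumes \<theta>: "\<theta> < 1" "0 < x" "x < \<theta>"
  shows "\<exists>t. strip_map \<theta> (cis (2 * pi * x)) = Complex 1 t"
proof -
  have "0 < sin (pi * x)" using assms by (intro sin_gt_zero) (auto simp: mult_less_cancel_left1)
  moreover have "0 < sin (pi * (\<theta> - x))" using assms by (intro sin_gt_zero) (auto simp: mult_less_cancel_left1)
  moreover have "sin (pi * (x - \<theta>)) = - sin (pi * (\<theta> - x))"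
    using sin_minus[of "pi * (x - \<theta>)"] by (simp add: algebra_simps)
  ultimately have r: "0 < - (sin (pi * (x - \<theta>)) / sin (pi * x))" by simp
  define r where "r = - (sin (pi * (x - \<theta>)) / sin (pi * x))"
  have "Ln (\<i> * of_real r) = of_real (ln r) + Ln \<i>"
    using r[folded r_def] Ln_times_of_real[of r "\<i>"] by (simp add: mult.commute Ln_of_real)
  also have "Ln \<i> = \<i> * of_real pi / 2" by simp
  finally have L: "Ln (\<i> * of_real r) = of_real (ln r) + \<i> * of_real pi / 2" .
  have "half_plane_map \<theta> (cis (2 * pi * x)) = \<i> * of_real r"
    using half_plane_map_circle[of x \<theta>] assms by (simp add: r_def)
  then have "strip_map \<theta> (cis (2 * pi * x)) = Complex 1 (- ln r / pi)"
    unfolding strip_map_def by (simp only: L) (simp add: complex_eq_iff)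
  then show ?thesis by blast
qed

lemma closure_open_strip: "closure open_strip = {z. 0 \<le> Re z \<and> Re z \<le> 1}"
proof -
  have o: "open_strip = {z. 0 < Re z} \<inter> {z. Re z < 1}" by (auto simp: open_strip_def)
  have cv: "convex open_strip" unfolding o by (intro convex_Int convex_halfspace_Re_gt convex_halfspace_Re_lt)
  show ?thesis
  proof (intro equalityI)
    have "closed {z. 0 \<le> Re z \<and> Re z \<le> 1}"
      by (intro closed_Collect_conj closed_Collect_le continuous_intros)
    then show "closure open_strip \<subseteq> {z. 0 \<le> Re z \<and> Re z \<le> 1}"
      by (intro closure_minimal) (auto simp: open_strip_def)
    show "{z. 0 \<le> Re z \<and> Re z \<le> 1} \<subseteq> closure open_strip"
    proof
      fix z :: complex assume z: "z \<in> {z. 0 \<le> Re z \<and> Re z \<le> 1}"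
      define u where "u n = z + of_real (1 / (real n + 2)) * (1/2 - z)" for n :: nat
      have "u n \<in> open_strip" for n
      proof -
        define t where "t = 1 / (real n + 2)"
        have t: "0 < t" "t < 1" by (auto simp: t_def)
        have "Re (u n) = (1 - t) * Re z + t * (1/2)" unfolding u_def t_def[symmetric] by (simp add: algebra_simps)
        moreover have "0 \<le> (1 - t) * Re z" using t z by auto
        moreover have "(1 - t) * Re z + t * (1/2) \<le> (1 - t) * 1 + t * (1/2)"
          using t z by (intro add_right_mono mult_left_mono) auto
        moreover have "(1 - t) * 1 + t * (1/2) = 1 - t / 2" by simp
        ultimately have "0 < Re (u n)" "Re (u n) < 1" using t by linarith+
        then show ?thesis unfolding open_strip_def by simp
      qed
      moreover have "u \<longlonglongrightarrow> z + of_real 0 * (1/2 - z)"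
        unfolding u_def by (intro tendsto_intros) real_asymp
      ultimately show "z \<in> closure open_strip"
        unfolding closure_sequential by (intro exI[of _ u]) simp
    qed
  qed
qed

section \<open>Uniform approach to the boundary\<close>

context lattice_couple
begin

text \<open>Lebesgue number argument with one quasi-triangle inequality through the centre of a
  ball, hence the tolerance e / (2 K). Only the first point has to lie in C; the second will be a
  point inside the strip.\<close>

lemma continuous_into_uniform:
  assumes h: "continuous_into Z S h" and C: "compact C" "C \<subseteq> S" and e: "0 < e"
  obtains d where "0 < d" "\<And>z z'. z \<in> C \<Longrightarrow> z' \<in> S \<Longrightarrow> dist z z' < d \<Longrightarrow>
    qnorm Z (\<lambda>\<omega>. h z' \<omega> - h z \<omega>) < e"
proof -
  have hZ: "h z \<in> elems Z" if "z \<in> S" for z using h that by (simp add: continuous_into_def)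
  define e' where "e' = e / (2 * K)"
  have e': "0 < e'" using e K_pos by (simp add: e'_def)
  have "\<exists>d>0. \<forall>z'\<in>S. dist z' z < d \<longrightarrow> qnorm Z (\<lambda>\<omega>. h z' \<omega> - h z \<omega>) < e'" if z: "z \<in> S" for z
  proof -
    have "((\<lambda>z'. qnorm Z (\<lambda>\<omega>. h z' \<omega> - h z \<omega>)) \<longlongrightarrow> 0) (at z within S)"
      using h z by (simp add: continuous_into_def converges_in_def)
    from order_tendstoD(2)[OF this e'] obtain d where d: "d > 0"
      "\<And>z'. z' \<in> S \<Longrightarrow> z' \<noteq> z \<Longrightarrow> dist z' z < d \<Longrightarrow> qnorm Z (\<lambda>\<omega>. h z' \<omega> - h z \<omega>) < e'"
      by (auto simp: eventually_at)
    have "qnorm Z (\<lambda>\<omega>. h z' \<omega> - h z \<omega>) < e'" if "z' \<in> S" "dist z' z < d" for z'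
      using d(2)[of z'] that e' by (cases "z' = z") auto
    then show ?thesis using d(1) by blast
  qed
  then have "\<forall>z\<in>S. \<exists>d>0. \<forall>z'\<in>S. dist z' z < d \<longrightarrow> qnorm Z (\<lambda>\<omega>. h z' \<omega> - h z \<omega>) < e'" by blast
  from bchoice[OF this] obtain d where d: "\<And>z. z \<in> S \<Longrightarrow> 0 < d z"
    "\<And>z z'. z \<in> S \<Longrightarrow> z' \<in> S \<Longrightarrow> dist z' z < d z \<Longrightarrow> qnorm Z (\<lambda>\<omega>. h z' \<omega> - h z \<omega>) < e'" by blast
  have "C \<subseteq> \<Union> ((\<lambda>z. ball z (d z)) ` S)" using C d(1) by force
  from Heine_Borel_lemma[OF C(1) this] obtain r where r: "r > 0"
    "\<And>x. x \<in> C \<Longrightarrow> \<exists>B\<in>(\<lambda>z. ball z (d z)) ` S. ball x r \<subseteq> B" by (metis (no_types, lifting) imageE open_ball)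
  show thesis
  proof (rule that[OF r(1)])
    fix z z' assume z: "z \<in> C" "z' \<in> S" "dist z z' < r"
    obtain y where y: "y \<in> S" "ball z r \<subseteq> ball y (d y)" using r(2)[OF z(1)] by blast
    have "z \<in> ball z r" "z' \<in> ball z r" using z(3) r(1) by auto
    then have "z \<in> ball y (d y)" "z' \<in> ball y (d y)" using y(2) by blast+
    then have "qnorm Z (\<lambda>\<omega>. h z \<omega> - h y \<omega>) < e'" "qnorm Z (\<lambda>\<omega>. h z' \<omega> - h y \<omega>) < e'"
      using d(2)[OF y(1), of z] d(2)[OF y(1), of z'] z C by (auto simp: dist_commute)
    moreover have "qnorm Z (\<lambda>\<omega>. h z' \<omega> - h z \<omega>) \<le> K * (qnorm Z (\<lambda>\<omega>. h z' \<omega> - h y \<omega>) + qnorm Z (\<lambda>\<omega>. h y \<omega> - h z \<omega>))"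
      using z C y by (intro Z.quasi_triangle3 hZ) auto
    moreover have "qnorm Z (\<lambda>\<omega>. h y \<omega> - h z \<omega>) = qnorm Z (\<lambda>\<omega>. h z \<omega> - h y \<omega>)"
      using z C y by (intro Z.qnorm_diff_commute hZ) auto
    ultimately have "qnorm Z (\<lambda>\<omega>. h z' \<omega> - h z \<omega>) < K * (e' + e')"
      using K_pos by (smt (verit) mult_strict_left_mono)
    then show "qnorm Z (\<lambda>\<omega>. h z' \<omega> - h z \<omega>) < e" using K_pos by (simp add: e'_def)
  qed
qed

text \<open>One radius serves all points of a compact part of the circle that avoids the two
  preimages of infinity. The number of sample points is fixed only after the radius, so the radius
  must not depend on the individual samples.\<close>

lemma radial_limit_uniform:
  assumes \<theta>: "0 < \<theta>" "\<theta> < 1" and h: "continuous_into Z (closure open_strip) h"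
    and C: "compact C" "C \<subseteq> sphere 0 1 - {1, cis (2 * pi * \<theta>)}" and e: "0 < e"
  obtains r where "0 < r" "r < 1" "\<And>\<zeta>. \<zeta> \<in> C \<Longrightarrow>
    qnorm Z (\<lambda>\<omega>. h (strip_map \<theta> (of_real r * \<zeta>)) \<omega> - h (strip_map \<theta> \<zeta>) \<omega>) < e"
proof -
  let ?E = "cball 0 1 - {1, cis (2 * pi * \<theta>)}"
  have cont: "continuous_on ?E (strip_map \<theta>)" by (rule continuous_strip_map[OF \<theta>])
  have CE: "C \<subseteq> ?E" using C(2) by auto
  have inball: "strip_map \<theta> \<zeta> \<in> open_strip" if "cmod \<zeta> < 1" for \<zeta> using strip_map_ball[OF \<theta> that] .
  have mapcl: "strip_map \<theta> \<zeta> \<in> closure open_strip" if \<zeta>: "\<zeta> \<in> C" for \<zeta>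
  proof -
    define u where "u n = of_real (1 - 1 / (real n + 2)) * \<zeta>" for n :: nat
    have c1: "cmod \<zeta> = 1" using \<zeta> C(2) by auto
    have un: "cmod (u n) < 1" for n using c1 by (simp add: u_def norm_mult del: of_real_diff of_real_divide)
    have "u \<longlonglongrightarrow> of_real 1 * \<zeta>" unfolding u_def by (intro tendsto_intros) real_asymp
    then have "u \<longlonglongrightarrow> \<zeta>" by simp
    moreover have "u n \<in> ?E" for n using un[of n] by auto
    ultimately have "(\<lambda>n. strip_map \<theta> (u n)) \<longlonglongrightarrow> strip_map \<theta> \<zeta>"
      by (intro continuous_on_tendsto_compose[OF cont] always_eventually allI) (use CE \<zeta> in auto)
    moreover have "strip_map \<theta> (u n) \<in> open_strip" for n by (rule inball[OF un])
    ultimately show ?thesis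
      unfolding closure_sequential by (intro exI[of _ "\<lambda>n. strip_map \<theta> (u n)"]) simp
  qed
  have comp: "compact (strip_map \<theta> ` C)"
    using compact_continuous_image[OF continuous_on_subset[OF cont CE] C(1)] .
  have subC: "strip_map \<theta> ` C \<subseteq> closure open_strip" using mapcl by auto
  obtain d where d: "0 < d" "\<And>z z'. z \<in> strip_map \<theta> ` C \<Longrightarrow> z' \<in> closure open_strip \<Longrightarrow> dist z z' < d \<Longrightarrow>
      qnorm Z (\<lambda>\<omega>. h z' \<omega> - h z \<omega>) < e"
    using continuous_into_uniform[OF h comp subC e] by blast
  \<comment> \<open>The union of the radial segments ending in C; it is compact, so
    \<open>strip_map\<close> is uniformly continuous on it.\<close>
  define P where "P = (\<lambda>(s, \<zeta>). complex_of_real s * \<zeta>) ` ({1/2..1} \<times> C)"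
  have cP: "compact P"
    unfolding P_def using C(1)
    by (intro compact_continuous_image compact_Times) (auto simp: case_prod_unfold intro!: continuous_intros)
  have PE: "P \<subseteq> ?E"
  proof
    fix x assume "x \<in> P"
    then obtain s \<zeta> where s: "x = of_real s * \<zeta>" "1/2 \<le> s" "s \<le> 1" "\<zeta> \<in> C" by (auto simp: P_def)
    have n: "cmod x = s" using s C(2) by (auto simp: norm_mult)
    show "x \<in> ?E"
    proof (cases "s = 1")
      case True then show ?thesis using s CE by auto
    next
      case False then show ?thesis using s n by auto
    qed
  qed
  have "uniformly_continuous_on P (strip_map \<theta>)"
    using compact_uniformly_continuous[OF continuous_on_subset[OF cont PE] cP] .
  then obtain \<rho> where \<rho>: "\<rho> > 0" "\<And>x y. x \<in> P \<Longrightarrow> y \<in> P \<Longrightarrow> dist y x < \<rho> \<Longrightarrow> dist (strip_map \<theta> y) (strip_map \<theta> x) < d"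
    using d(1) unfolding uniformly_continuous_on_def by metis
  define r where "r = max (1/2) (1 - \<rho> / 2)"
  have r: "1/2 \<le> r" "r < 1" "1 - r < \<rho>" using \<rho> by (auto simp: r_def)
  show thesis
  proof (rule that)
    show "0 < r" "r < 1" using r by auto
    fix \<zeta> assume \<zeta>: "\<zeta> \<in> C"
    have c1: "cmod \<zeta> = 1" using \<zeta> C(2) by auto
    have P: "of_real r * \<zeta> \<in> P" using r \<zeta> by (auto simp: P_def intro!: image_eqI[of _ _ "(r, \<zeta>)"])
    have P': "\<zeta> \<in> P" using r \<zeta> by (auto simp: P_def intro!: image_eqI[of _ _ "(1, \<zeta>)"])
    have "dist (of_real r * \<zeta>) \<zeta> = cmod (of_real (r - 1) * \<zeta>)" by (simp add: dist_norm algebra_simps)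
    also have "\<dots> = 1 - r" using c1 r by (simp add: norm_mult del: of_real_diff)
    finally have "dist (strip_map \<theta> (of_real r * \<zeta>)) (strip_map \<theta> \<zeta>) < d"
      using \<rho>(2)[OF P' P] r by simp
    moreover have "strip_map \<theta> (of_real r * \<zeta>) \<in> closure open_strip"
      using r c1 closure_subset inball[of "of_real r * \<zeta>"] by (auto simp: norm_mult)
    ultimately show "qnorm Z (\<lambda>\<omega>. h (strip_map \<theta> (of_real r * \<zeta>)) \<omega> - h (strip_map \<theta> \<zeta>) \<omega>) < e"
      using \<zeta> by (intro d(2)) (auto simp: dist_commute)
  qed
qed

end

section \<open>A three lines estimate\<close>

text \<open>Concavity of the logarithm as ln a <= a - 1, applied to the p-th power of (x + y + v) /
  G. The constant is the one for which the averaged remainder is at most 0: one factor 3 bounds a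
  sum of three terms by their maximum, and 3^(1/p) comes from adding three p-th powers. The term v
  keeps all logarithms finite.\<close>

lemma log_sum_le_power_mean:
  fixes x y :: "nat \<Rightarrow> real"
  assumes fin: "finite I" and p: "0 < p" and v: "0 < v"
    and x: "\<And>k. k \<in> I \<Longrightarrow> 0 \<le> x k" "(\<Sum>k\<in>I. x k powr p) \<le> card I * g0 powr p"
    and y: "\<And>k. k \<in> I \<Longrightarrow> 0 \<le> y k" "(\<Sum>k\<in>I. y k powr p) \<le> card I * g1 powr p"
    and g: "0 \<le> g0" "0 \<le> g1"
  shows "(\<Sum>k\<in>I. ln (x k + y k + v)) \<le> card I * ln (3 * 3 powr (1 / p) * (g0 + g1 + v))"
proof -
  define G where "G = 3 * 3 powr (1 / p) * (g0 + g1 + v)"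
  have G: "0 < G" using g v by (simp add: G_def)
  have Gp: "G powr p = 3 powr p * 3 * (g0 + g1 + v) powr p"
    using p g v by (simp add: G_def powr_mult powr_powr)
  have term_le: "ln (x k + y k + v) \<le> (1 / p) * ((3 powr p * (x k powr p + y k powr p + v powr p)) / G powr p - 1) + ln G"
    if k: "k \<in> I" for k
  proof -
    define u where "u = x k + y k + v"
    have u: "0 < u" using x(1)[OF k] y(1)[OF k] v by (simp add: u_def)
    have "u powr p \<le> (3 * max (x k) (max (y k) v)) powr p"
      using x(1)[OF k] y(1)[OF k] v p by (intro powr_mono2) (auto simp: u_def)
    also have "\<dots> = 3 powr p * (max (x k) (max (y k) v)) powr p"
      using v by (simp add: powr_mult)
    also have "(max (x k) (max (y k) v)) powr p \<le> x k powr p + y k powr p + v powr p"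
      by (auto simp: max_def)
    finally have up: "u powr p \<le> 3 powr p * (x k powr p + y k powr p + v powr p)" by simp
    have "p * (ln u - ln G) = ln (u powr p / G powr p)"
      using u G by (simp add: ln_div ln_powr algebra_simps)
    also have "\<dots> \<le> u powr p / G powr p - 1"
      using u G by (intro ln_le_minus_one) auto
    also have "\<dots> \<le> (3 powr p * (x k powr p + y k powr p + v powr p)) / G powr p - 1"
      using up by (intro diff_right_mono divide_right_mono) auto
    finally have "ln u - ln G \<le> (1 / p) * ((3 powr p * (x k powr p + y k powr p + v powr p)) / G powr p - 1)"
      using p by (simp add: field_simps)
    then show ?thesis by (simp add: u_def)
  qed
  have "(\<Sum>k\<in>I. x k powr p + y k powr p + v powr p) \<le> card I * (g0 powr p + g1 powr p + v powr p)"
    using x(2) y(2) by (simp add: sum.distrib algebra_simps)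
  also have "\<dots> \<le> card I * (3 * (g0 + g1 + v) powr p)"
  proof (rule mult_left_mono)
    have "g0 powr p \<le> (g0 + g1 + v) powr p" "g1 powr p \<le> (g0 + g1 + v) powr p" "v powr p \<le> (g0 + g1 + v) powr p"
      using g v p by (auto intro!: powr_mono2)
    then show "g0 powr p + g1 powr p + v powr p \<le> 3 * (g0 + g1 + v) powr p" by linarith
  qed simp
  finally have S: "(\<Sum>k\<in>I. x k powr p + y k powr p + v powr p) \<le> card I * (3 * (g0 + g1 + v) powr p)" .
  have "(\<Sum>k\<in>I. ln (x k + y k + v)) \<le>
      (\<Sum>k\<in>I. (1 / p) * ((3 powr p * (x k powr p + y k powr p + v powr p)) / G powr p - 1) + ln G)"
    by (intro sum_mono term_le)
  also have "\<dots> = (1 / p) * (3 powr p * (\<Sum>k\<in>I. x k powr p + y k powr p + v powr p) / G powr p - card I) + card I * ln G"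
    by (simp add: sum.distrib sum_subtractf flip: sum_distrib_left sum_divide_distrib)
  also have "\<dots> \<le> (1 / p) * (3 powr p * (card I * (3 * (g0 + g1 + v) powr p)) / G powr p - card I) + card I * ln G"
    using p S by (intro add_right_mono mult_left_mono diff_right_mono divide_right_mono) auto
  also have "3 powr p * (card I * (3 * (g0 + g1 + v) powr p)) / G powr p = card I"
  proof -
    have e: "3 powr p * (card I * (3 * (g0 + g1 + v) powr p)) = card I * G powr p" by (simp add: Gp)
    show ?thesis unfolding e using G by simp
  qed
  finally show ?thesis by (simp add: G_def)
qed

text \<open>Writing ln Gb = ln (\<delta> Gb) - ln \<delta>, the rest group fills the gaps (1 -
  \<theta>) N - n0 and \<theta> N - n1 with the value ln (\<delta> Gb), harmless inside the other
  two logarithms. The surplus - ln \<delta> is multiplied by the small size of the group and costs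
  at most ln 2.\<close>

lemma combine_log_means:
  fixes G0 G1 Gb :: real
  assumes N: "0 < N" "N = n0 + n1 + nb" and G: "0 < G0" "0 < G1" "0 < Gb" and \<delta>: "0 < \<delta>" "\<delta> < 1"
    and n: "n0 \<le> (1 - \<theta>) * N" "n1 \<le> \<theta> * N" "nb * (- ln \<delta>) \<le> N * ln 2"
    and nn: "0 \<le> n0" "0 \<le> n1" "0 \<le> nb"
  shows "(n0 * ln G0 + n1 * ln G1 + nb * ln Gb) / N \<le> ln 2 + (1 - \<theta>) * ln (G0 + \<delta> * Gb) + \<theta> * ln (G1 + \<delta> * Gb)"
proof -
  define l0 where "l0 = ln (G0 + \<delta> * Gb)"
  define l1 where "l1 = ln (G1 + \<delta> * Gb)"
  define lb where "lb = ln (\<delta> * Gb)"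
  have dG: "0 < \<delta> * Gb" using \<delta> G by simp
  have l: "ln G0 \<le> l0" "ln G1 \<le> l1" "lb \<le> l0" "lb \<le> l1"
    using G dG by (auto simp: l0_def l1_def lb_def add_pos_pos)
  have lnb: "ln Gb = lb - ln \<delta>" using G \<delta> by (simp add: lb_def ln_mult)
  have "n0 * ln G0 + n1 * ln G1 + nb * ln Gb = n0 * ln G0 + n1 * ln G1 + ((1 - \<theta>) * N - n0) * lb + (\<theta> * N - n1) * lb + nb * (- ln \<delta>)"
    unfolding lnb using N(2) by (simp add: algebra_simps)
  also have "\<dots> \<le> n0 * l0 + n1 * l1 + ((1 - \<theta>) * N - n0) * l0 + (\<theta> * N - n1) * l1 + N * ln 2"
    using nn l n by (intro add_mono mult_left_mono) auto
  also have "\<dots> = N * (ln 2 + (1 - \<theta>) * l0 + \<theta> * l1)" by (simp add: algebra_simps)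
  finally show ?thesis using N(1) by (simp add: field_simps l0_def l1_def)
qed

context normed_lattice
begin

definition power_mean_constant :: "real \<Rightarrow> real \<Rightarrow> bool" where
  "power_mean_constant p C \<longleftrightarrow> 0 \<le> C \<and> (\<forall>I u a. family_bounded I u a \<longrightarrow>
    (\<exists>g. g \<in> borel_measurable M \<and> (\<forall>\<omega>. 0 \<le> g \<omega>) \<and> dominated g (C * a) \<and>
      (\<forall>\<omega>. (\<Sum>k\<in>I. u k \<omega> powr p) \<le> card I * g \<omega> powr p)))"

lemma power_mean_elems:
  fixes I :: "nat set"
  assumes "power_mean_constant p C" "finite I" "0 \<le> a"
    "\<And>k. k \<in> I \<Longrightarrow> f k \<in> elems X" "\<And>k. k \<in> I \<Longrightarrow> qnorm X (f k) \<le> a"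
  obtains g where "\<And>\<omega>. 0 \<le> g \<omega>" "dominated g (C * a)"
      "\<And>\<omega>. (\<Sum>k\<in>I. cmod (f k \<omega>) powr p) \<le> card I * g \<omega> powr p"
proof (cases "I = {}")
  case True
  have "0 \<le> C * a" using assms by (simp add: power_mean_constant_def)
  then show ?thesis using True dominated_zero by (intro that[of "\<lambda>_. 0"]) auto
next
  case False
  have "family_bounded I (\<lambda>k \<omega>. cmod (f k \<omega>)) a"
    using False assms(2,4,5) meas by (auto simp: family_bounded_def intro!: dominated_cmod)
  with assms(1)[unfolded power_mean_constant_def] have "\<exists>g. g \<in> borel_measurable M \<and> (\<forall>\<omega>. 0 \<le> g \<omega>) \<and>
      dominated g (C * a) \<and> (\<forall>\<omega>. (\<Sum>k\<in>I. cmod (f k \<omega>) powr p) \<le> card I * g \<omega> powr p)" by simp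
  then obtain g where "g \<in> borel_measurable M \<and> (\<forall>\<omega>. 0 \<le> g \<omega>) \<and>
      dominated g (C * a) \<and> (\<forall>\<omega>. (\<Sum>k\<in>I. cmod (f k \<omega>) powr p) \<le> card I * g \<omega> powr p)" ..
  then show ?thesis by (intro that[of g]) auto
qed

end

section \<open>Samples on a circle inside the disc\<close>

context lattice_couple
begin

lemma group_log_mean:
  fixes I :: "nat set"
  assumes C: "X0.power_mean_constant p C0" "X1.power_mean_constant p C1" and p: "0 < p"
    and fin: "finite I" and ab: "0 \<le> a" "0 \<le> b"
    and x: "\<And>k. k \<in> I \<Longrightarrow> x k \<in> elems X0" "\<And>k. k \<in> I \<Longrightarrow> qnorm X0 (x k) \<le> a"
    and y: "\<And>k. k \<in> I \<Longrightarrow> y k \<in> elems X1" "\<And>k. k \<in> I \<Longrightarrow> qnorm X1 (y k) \<le> b"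
  obtains g0 g1 where "X0.dominated g0 (C0 * a)" "X1.dominated g1 (C1 * b)"
    "\<And>\<omega>. 0 \<le> g0 \<omega>" "\<And>\<omega>. 0 \<le> g1 \<omega>"
    "\<And>\<omega> v. 0 < v \<Longrightarrow> (\<Sum>k\<in>I. ln (cmod (x k \<omega>) + cmod (y k \<omega>) + v)) \<le>
        card I * ln (3 * 3 powr (1 / p) * (g0 \<omega> + g1 \<omega> + v))"
proof (rule X0.power_mean_elems[OF C(1) fin ab(1) x], assumption, assumption)
  fix g0 assume g0: "\<And>\<omega>. 0 \<le> g0 \<omega>" "X0.dominated g0 (C0 * a)"
      "\<And>\<omega>. (\<Sum>k\<in>I. cmod (x k \<omega>) powr p) \<le> card I * g0 \<omega> powr p"
  show thesis
  proof (rule X1.power_mean_elems[OF C(2) fin ab(2) y], assumption, assumption)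
    fix g1 assume g1: "\<And>\<omega>. 0 \<le> g1 \<omega>" "X1.dominated g1 (C1 * b)"
      "\<And>\<omega>. (\<Sum>k\<in>I. cmod (y k \<omega>) powr p) \<le> card I * g1 \<omega> powr p"
    show thesis
      by (rule that[OF g0(2) g1(2) g0(1) g1(1)], rule log_sum_le_power_mean[OF fin p])
         (use g0 g1 in auto)
  qed
qed

text \<open>Samples have parts in both spaces under one logarithm, so one exponent must serve both
  lattices. The minimum works because every smaller exponent is admissible.\<close>

lemma power_mean_constants:
  assumes "analytically_convex X0" "analytically_convex X1"
  obtains p C0 C1 where "0 < p" "X0.power_mean_constant p C0" "X1.power_mean_constant p C1"
proof -
  obtain p0 where p0: "0 < p0" "\<And>p. 0 < p \<Longrightarrow> p \<le> p0 \<Longrightarrow> \<exists>C\<ge>0. \<forall>I u a. X0.family_bounded I u a \<longrightarrow>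
    (\<exists>g. g \<in> borel_measurable M \<and> (\<forall>\<omega>. 0 \<le> g \<omega>) \<and> X0.dominated g (C * a) \<and>
      (\<forall>\<omega>. (\<Sum>k\<in>I. u k \<omega> powr p) \<le> card I * g \<omega> powr p))"
    using X0.power_mean_bound[OF assms(1)] by blast
  obtain p1 where p1: "0 < p1" "\<And>p. 0 < p \<Longrightarrow> p \<le> p1 \<Longrightarrow> \<exists>C\<ge>0. \<forall>I u a. X1.family_bounded I u a \<longrightarrow>
    (\<exists>g. g \<in> borel_measurable M \<and> (\<forall>\<omega>. 0 \<le> g \<omega>) \<and> X1.dominated g (C * a) \<and>
      (\<forall>\<omega>. (\<Sum>k\<in>I. u k \<omega> powr p) \<le> card I * g \<omega> powr p))"
    using X1.power_mean_bound[OF assms(2)] by blast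
  have p: "0 < min p0 p1" using p0 p1 by simp
  obtain C0 where "X0.power_mean_constant (min p0 p1) C0"
    using p0(2)[OF p] unfolding X0.power_mean_constant_def by auto
  moreover obtain C1 where "X1.power_mean_constant (min p0 p1) C1"
    using p1(2)[OF p] unfolding X1.power_mean_constant_def by auto
  ultimately show thesis using that p by blast
qed

text \<open>The error g - f is split in X0 + X1; its X0 part is joined to f, and its X1 part remains
  as a small term in the wrong space. These terms are the source of the remainders in the three
  lines estimate.\<close>

lemma decompose_near_X0:
  assumes f: "f \<in> elems X0" "qnorm X0 f \<le> a" and g: "g \<in> elems Z" "qnorm Z (\<lambda>\<omega>. g \<omega> - f \<omega>) < e"
  obtains x y where "x \<in> elems X0" "y \<in> elems X1" "qnorm X0 x \<le> K * (a + e)" "qnorm X1 y \<le> e"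
    "AE \<omega> in M. g \<omega> = x \<omega> + y \<omega>"
proof -
  have gf: "(\<lambda>\<omega>. g \<omega> - f \<omega>) \<in> elems Z" using g(1) X0_sub(1)[OF f(1)] by (rule Z.diff_closed)
  show ?thesis
  proof (rule sum_elem_decomp[OF gf g(2)])
    fix u v assume uv: "u \<in> elems X0" "v \<in> elems X1" "AE \<omega> in M. g \<omega> - f \<omega> = u \<omega> + v \<omega>" "qnorm X0 u + qnorm X1 v < e"
    have le: "qnorm X0 u \<le> e" "qnorm X1 v \<le> e"
      using uv(4) X0.qnorm_ge_0[OF uv(1)] X1.qnorm_ge_0[OF uv(2)] by linarith+
    have "qnorm X0 (\<lambda>\<omega>. f \<omega> + u \<omega>) \<le> K * (a + e)"
      using X0.quasi_triangle[OF f(1) uv(1)] mult_left_mono[OF add_mono[OF f(2) le(1)] K_nonneg] by linarith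
    moreover have "AE \<omega> in M. g \<omega> = (f \<omega> + u \<omega>) + v \<omega>"
      using uv(3) by eventually_elim (simp add: algebra_simps)
    ultimately show ?thesis by (intro that[OF X0.add_elem[OF f(1) uv(1)] uv(2) _ le(2)])
  qed
qed

lemma decompose_near_X1:
  assumes f: "f \<in> elems X1" "qnorm X1 f \<le> a" and g: "g \<in> elems Z" "qnorm Z (\<lambda>\<omega>. g \<omega> - f \<omega>) < e"
  obtains x y where "x \<in> elems X0" "y \<in> elems X1" "qnorm X0 x \<le> e" "qnorm X1 y \<le> K * (a + e)"
    "AE \<omega> in M. g \<omega> = x \<omega> + y \<omega>"
proof -
  have gf: "(\<lambda>\<omega>. g \<omega> - f \<omega>) \<in> elems Z" using g(1) X1_sub(1)[OF f(1)] by (rule Z.diff_closed)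
  show ?thesis
  proof (rule sum_elem_decomp[OF gf g(2)])
    fix u v assume uv: "u \<in> elems X0" "v \<in> elems X1" "AE \<omega> in M. g \<omega> - f \<omega> = u \<omega> + v \<omega>" "qnorm X0 u + qnorm X1 v < e"
    have le: "qnorm X0 u \<le> e" "qnorm X1 v \<le> e"
      using uv(4) X0.qnorm_ge_0[OF uv(1)] X1.qnorm_ge_0[OF uv(2)] by linarith+
    have "qnorm X1 (\<lambda>\<omega>. f \<omega> + v \<omega>) \<le> K * (a + e)"
      using X1.quasi_triangle[OF f(1) uv(2)] mult_left_mono[OF add_mono[OF f(2) le(2)] K_nonneg] by linarith
    moreover have "AE \<omega> in M. g \<omega> = u \<omega> + (f \<omega> + v \<omega>)"
      using uv(3) by eventually_elim (simp add: algebra_simps)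
    ultimately show ?thesis by (intro that[OF uv(1) X1.add_elem[OF f(1) uv(2)] le(1)])
  qed
qed

text \<open>The points \<open>k / N\<close> of the circle split into those on the arc of \<open>Re z = 0\<close>, those on the arc of
  \<open>Re z = 1\<close>, and a small rest near the two end points, where only the boundedness of \<open>h\<close> is known.\<close>

definition sample_split where
  "sample_split \<theta> \<tau> A e B x g p \<longleftrightarrow> fst p \<in> elems X0 \<and> snd p \<in> elems X1 \<and>
    (AE \<omega> in M. g \<omega> = fst p \<omega> + snd p \<omega>) \<and>
    (\<theta> + \<tau> \<le> x \<and> x \<le> 1 - \<tau> \<longrightarrow> qnorm X0 (fst p) \<le> K * (A + e) \<and> qnorm X1 (snd p) \<le> e) \<and>
    (\<tau> \<le> x \<and> x \<le> \<theta> - \<tau> \<longrightarrow> qnorm X0 (fst p) \<le> e \<and> qnorm X1 (snd p) \<le> K * (A + e)) \<and>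
    (\<not> (\<theta> + \<tau> \<le> x \<and> x \<le> 1 - \<tau>) \<longrightarrow> \<not> (\<tau> \<le> x \<and> x \<le> \<theta> - \<tau>) \<longrightarrow>
       qnorm X0 (fst p) \<le> B \<and> qnorm X1 (snd p) \<le> B)"
  for \<theta> \<tau> A e B x :: real and g :: "'a \<Rightarrow> complex" and p :: "('a \<Rightarrow> complex) \<times> ('a \<Rightarrow> complex)"

text \<open>On the arcs trimmed by \<tau> the samples are within e of a boundary trace, so one
  summand is controlled by A and the other by e. Near the two end points only the crude bound B in
  the sum space is available. The radius r is independent of N.\<close>

lemma sample_decomposition:
  assumes \<theta>: "0 < \<theta>" "\<theta> < 1" and h: "h \<in> calA M X0 X1" and A: "0 < A"
    and b0: "\<And>t. qnorm X0 (h (Complex 0 t)) \<le> A" and b1: "\<And>t. qnorm X1 (h (Complex 1 t)) \<le> A"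
    and \<tau>: "0 < \<tau>" and e: "0 < e" and B: "\<And>z. z \<in> open_strip \<Longrightarrow> qnorm Z (h z) < B"
  obtains r where "0 < r" "r < 1"
    "\<And>N. \<exists>p. \<forall>k. sample_split \<theta> \<tau> A e B (k / N) (h (strip_map \<theta> (of_real r * unit_root N k))) (p k)"
proof -
  have hc: "continuous_into Z (closure open_strip) h" using h by (simp add: calA_def)
  have hb: "h (Complex 0 t) \<in> elems X0" "h (Complex 1 t) \<in> elems X1" for t
    using h by (auto simp: calA_def bounded_into_def)
  have hZ: "h z \<in> elems Z" if "z \<in> closure open_strip" for z using hc that by (simp add: continuous_into_def)
  define J where "J = {\<theta> + \<tau>..1 - \<tau>} \<union> {\<tau>..\<theta> - \<tau>}"
  define C where "C = (\<lambda>x. cis (2 * pi * x)) ` J"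
  have "compact J" by (simp add: J_def compact_Un)
  then have cC: "compact C" unfolding C_def by (intro compact_continuous_image continuous_intros) auto
  have J: "0 < x" "x < 1" "x \<noteq> \<theta>" if "x \<in> J" for x using that \<tau> \<theta> by (auto simp: J_def)
  have cis_inj: "cis (2 * pi * x) \<noteq> cis (2 * pi * y)" if "0 < x" "x < 1" "0 \<le> y" "y < 1" "x \<noteq> y" for x y
  proof
    assume "cis (2 * pi * x) = cis (2 * pi * y)"
    then have "\<bar>sin ((2 * pi * x - 2 * pi * y) / 2)\<bar> = 0" using cmod_cis_diff[of "2 * pi * x" "2 * pi * y"] by simp
    moreover have "2 * pi * x - 2 * pi * y = 2 * (pi * (x - y))" by (simp add: algebra_simps)
    ultimately have "sin (pi * (x - y)) = 0" by simp
    then obtain i :: int where i: "pi * (x - y) = of_int i * pi" by (auto simp: sin_zero_iff_int2)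
    then have "x - y = of_int i" by simp
    moreover have "-1 < x - y" "x - y < 1" using that by auto
    ultimately have "i = 0" by linarith
    with \<open>x - y = of_int i\<close> that show False by simp
  qed
  have subC: "C \<subseteq> sphere 0 1 - {1, cis (2 * pi * \<theta>)}"
  proof -
    have "cis (2 * pi * x) \<noteq> 1" "cis (2 * pi * x) \<noteq> cis (2 * pi * \<theta>)" if "x \<in> J" for x
      using cis_inj[of x 0] cis_inj[of x \<theta>] J[OF that] \<theta> by auto
    then show ?thesis by (auto simp: C_def)
  qed
  obtain r where r: "0 < r" "r < 1" "\<And>\<zeta>. \<zeta> \<in> C \<Longrightarrow>
    qnorm Z (\<lambda>\<omega>. h (strip_map \<theta> (of_real r * \<zeta>)) \<omega> - h (strip_map \<theta> \<zeta>) \<omega>) < e"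
    using radial_limit_uniform[OF \<theta> hc cC subC e] by blast
  have inner: "strip_map \<theta> (of_real r * unit_root N k) \<in> open_strip" for N k
    using r by (intro strip_map_ball \<theta>) (simp add: norm_mult)
  have innerZ: "h (strip_map \<theta> (of_real r * unit_root N k)) \<in> elems Z" for N k
    using hZ inner closure_subset by blast
  have ex: "\<exists>p. sample_split \<theta> \<tau> A e B (k / N) (h (strip_map \<theta> (of_real r * unit_root N k))) p" for N k :: nat
  proof -
    let ?z = "strip_map \<theta> (of_real r * unit_root N k)"
    define x where "x = real k / real N"
    have ur: "unit_root N k = cis (2 * pi * x)" by (simp add: unit_root_def x_def)
    consider (left) "\<theta> + \<tau> \<le> x" "x \<le> 1 - \<tau>" | (right) "\<tau> \<le> x" "x \<le> \<theta> - \<tau>"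
      | (rest) "\<not> (\<theta> + \<tau> \<le> x \<and> x \<le> 1 - \<tau>)" "\<not> (\<tau> \<le> x \<and> x \<le> \<theta> - \<tau>)" by blast
    then show ?thesis
    proof cases
      case left
      then obtain t where t: "strip_map \<theta> (unit_root N k) = Complex 0 t"
        using strip_map_left_arc[of \<theta> x] \<theta> \<tau> unfolding ur by auto
      have "unit_root N k \<in> C" using left by (auto simp: C_def J_def ur)
      from r(3)[OF this] have near: "qnorm Z (\<lambda>\<omega>. h ?z \<omega> - h (Complex 0 t) \<omega>) < e" by (simp add: t)
      obtain u v where
        uv: "u \<in> elems X0" "v \<in> elems X1" "qnorm X0 u \<le> K * (A + e)" "qnorm X1 v \<le> e" "AE \<omega> in M. h ?z \<omega> = u \<omega> + v \<omega>"
        by (rule decompose_near_X0[OF hb(1) b0 innerZ near])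
      have "\<not> (\<tau> \<le> x \<and> x \<le> \<theta> - \<tau>)" using left \<tau> by auto
      then show ?thesis
        using uv left unfolding x_def[symmetric] sample_split_def by (intro exI[of _ "(u, v)"]) auto
    next
      case right
      then obtain t where t: "strip_map \<theta> (unit_root N k) = Complex 1 t"
        using strip_map_right_arc[of \<theta> x] \<theta> \<tau> unfolding ur by auto
      have "unit_root N k \<in> C" using right by (auto simp: C_def J_def ur)
      from r(3)[OF this] have near: "qnorm Z (\<lambda>\<omega>. h ?z \<omega> - h (Complex 1 t) \<omega>) < e" by (simp add: t)
      obtain u v where
        uv: "u \<in> elems X0" "v \<in> elems X1" "qnorm X0 u \<le> e" "qnorm X1 v \<le> K * (A + e)" "AE \<omega> in M. h ?z \<omega> = u \<omega> + v \<omega>"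
        by (rule decompose_near_X1[OF hb(2) b1 innerZ near])
      have "\<not> (\<theta> + \<tau> \<le> x \<and> x \<le> 1 - \<tau>)" using right \<tau> by auto
      then show ?thesis
        using uv right unfolding x_def[symmetric] sample_split_def by (intro exI[of _ "(u, v)"]) auto
    next
      case rest
      show ?thesis
      proof (rule sum_elem_decomp[OF innerZ B[OF inner]])
        fix u v assume uv: "u \<in> elems X0" "v \<in> elems X1" "AE \<omega> in M. h ?z \<omega> = u \<omega> + v \<omega>" "qnorm X0 u + qnorm X1 v < B"
        have "qnorm X0 u \<le> B" "qnorm X1 v \<le> B"
          using uv(4) X0.qnorm_ge_0[OF uv(1)] X1.qnorm_ge_0[OF uv(2)] by linarith+
        then show ?thesis
          using uv rest unfolding x_def[symmetric] sample_split_def by (intro exI[of _ "(u, v)"]) auto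
      qed
    qed
  qed
  show thesis
  proof (rule that[OF r(1,2)])
    fix N :: nat
    show "\<exists>p. \<forall>k. sample_split \<theta> \<tau> A e B (k / N) (h (strip_map \<theta> (of_real r * unit_root N k))) (p k)"
      by (rule choice[OF allI[OF ex]])
  qed
qed

text \<open>For almost every \<omega> the discrete Jensen inequality is applied to the pulled back
  holomorphic version of h. Both the Lipschitz constant and the floor are proportional to V = V0 +
  V1 at \<omega>, so V cancels and the error \<Lambda> / (\<epsilon> sqrt N) is uniform in \<omega>.
  Where V vanishes, so does h.\<close>

lemma jensen_on_compact:
  assumes \<theta>: "0 < \<theta>" "\<theta> < 1" and h: "analytic_into Z open_strip h" and r: "0 < r" "r < 1"
  obtains V0 V1 B0 B1 \<Lambda> where "X0.dominated V0 B0" "X1.dominated V1 B1" "0 \<le> \<Lambda>"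
    "\<And>\<omega>. 0 \<le> V0 \<omega>" "\<And>\<omega>. 0 \<le> V1 \<omega>"
    "\<And>N \<epsilon>. 0 < N \<Longrightarrow> 0 < \<epsilon> \<Longrightarrow> AE \<omega> in M. (V0 \<omega> + V1 \<omega> = 0 \<longrightarrow> h (of_real \<theta>) \<omega> = 0) \<and>
      (0 < V0 \<omega> + V1 \<omega> \<longrightarrow> cmod (h (of_real \<theta>) \<omega>) \<le> exp (\<Lambda> / (\<epsilon> * sqrt N) +
        (\<Sum>k<N. ln (cmod (h (strip_map \<theta> (of_real r * unit_root N k)) \<omega>) + \<epsilon> * (V0 \<omega> + V1 \<omega>))) / N))"
proof -
  \<comment> \<open>A radius between r and 1 leaves room for Cauchy's estimate around the sampling
    circle.\<close>
  define r' where "r' = (1 + r) / 2"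
  have r': "r < r'" "r' < 1" using r by (auto simp: r'_def)
  define C where "C = strip_map \<theta> ` cball 0 r'"
  have sub: "cball 0 r' \<subseteq> ball (0::complex) 1" using r' by auto
  have cC: "compact C"
    unfolding C_def using continuous_on_subset[OF holomorphic_on_imp_continuous_on[OF holomorphic_strip_map[OF \<theta>]] sub]
    by (intro compact_continuous_image) auto
  have sC: "C \<subseteq> open_strip" using strip_map_ball[OF \<theta>] r' by (auto simp: C_def)
  obtain H U V0 V1 B0 B1 where U: "open U" "C \<subseteq> U" and V: "X0.dominated V0 B0" "X1.dominated V1 B1"
    and H: "AE \<omega> in M. (\<lambda>z. H z \<omega>) holomorphic_on U \<and> (\<forall>z\<in>U. cmod (H z \<omega>) \<le> V0 \<omega> + V1 \<omega>)"
    and Hh: "\<And>z. z \<in> U \<Longrightarrow> AE \<omega> in M. H z \<omega> = h z \<omega>" and Vn: "\<And>\<omega>. 0 \<le> V0 \<omega>" "\<And>\<omega>. 0 \<le> V1 \<omega>"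
    by (rule analytic_pointwise_holomorphic[OF h cC sC], rule that) blast+
  define R where "R = r' / r"
  have R: "1 < R" using r r' by (simp add: R_def)
  define \<Lambda> where "\<Lambda> = 4 / (R - 1)"
  have inC: "strip_map \<theta> (of_real r * \<zeta>) \<in> C" if "\<zeta> \<in> ball 0 R" for \<zeta>
  proof -
    have "cmod \<zeta> < r' / r" using that by (simp add: R_def)
    then have "r * cmod \<zeta> < r'" using r by (simp add: field_simps)
    then show ?thesis using r by (auto simp: C_def norm_mult)
  qed
  show thesis
  proof (rule that[OF V _ Vn])
    show "0 \<le> \<Lambda>" using R by (simp add: \<Lambda>_def)
    fix N :: nat and \<epsilon> :: real
    assume N: "0 < N" and \<epsilon>: "0 < \<epsilon>"
    have "AE \<omega> in M. \<forall>k\<in>{..<N}. H (strip_map \<theta> (of_real r * unit_root N k)) \<omega> = h (strip_map \<theta> (of_real r * unit_root N k)) \<omega>"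
    proof (subst AE_finite_all, simp, intro ballI)
      fix k
      show "AE \<omega> in M. H (strip_map \<theta> (of_real r * unit_root N k)) \<omega> = h (strip_map \<theta> (of_real r * unit_root N k)) \<omega>"
        using U inC[of "unit_root N k"] R by (intro Hh) auto
    qed
    moreover have "AE \<omega> in M. H (of_real \<theta>) \<omega> = h (of_real \<theta>) \<omega>"
      using U inC[of 0] R by (intro Hh) (auto simp: strip_map_zero[OF \<theta>])
    ultimately show "AE \<omega> in M. (V0 \<omega> + V1 \<omega> = 0 \<longrightarrow> h (of_real \<theta>) \<omega> = 0) \<and>
      (0 < V0 \<omega> + V1 \<omega> \<longrightarrow> cmod (h (of_real \<theta>) \<omega>) \<le> exp (\<Lambda> / (\<epsilon> * sqrt N) +
        (\<Sum>k<N. ln (cmod (h (strip_map \<theta> (of_real r * unit_root N k)) \<omega>) + \<epsilon> * (V0 \<omega> + V1 \<omega>))) / N))"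
      using H
    proof eventually_elim
      case (elim \<omega>)
      define V where "V = V0 \<omega> + V1 \<omega>"
      define \<phi> where "\<phi> \<zeta> = H (strip_map \<theta> (of_real r * \<zeta>)) \<omega>" for \<zeta>
      have bd: "cmod (\<phi> \<zeta>) \<le> V" if "\<zeta> \<in> ball 0 R" for \<zeta>
        using inC[OF that] U elim(3) by (auto simp: \<phi>_def V_def)
      have "(\<lambda>\<zeta>. strip_map \<theta> (of_real r * \<zeta>)) holomorphic_on ball 0 R"
      proof -
        have "(\<lambda>\<zeta>. of_real r * \<zeta>) ` ball 0 R \<subseteq> ball (0::complex) 1"
        proof (clarsimp simp: norm_mult)
          fix \<zeta> :: complex assume "cmod \<zeta> < R"
          then have "r * cmod \<zeta> < r'" using r by (simp add: R_def field_simps)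
          then show "\<bar>r\<bar> * cmod \<zeta> < 1" using r r' by simp
        qed
        then show ?thesis
          using holomorphic_on_compose_gen[of "\<lambda>\<zeta>. of_real r * \<zeta>" "ball 0 R" "strip_map \<theta>" "ball 0 1"]
            holomorphic_strip_map[OF \<theta>] by (auto simp: o_def intro: holomorphic_intros)
      qed
      moreover have "(\<lambda>\<zeta>. strip_map \<theta> (of_real r * \<zeta>)) ` ball 0 R \<subseteq> U" using inC U by blast
      ultimately have hol: "\<phi> holomorphic_on ball 0 R"
        using holomorphic_on_compose_gen[of "\<lambda>\<zeta>. strip_map \<theta> (of_real r * \<zeta>)" "ball 0 R" "\<lambda>z. H z \<omega>" U]
          elim(3) by (simp add: o_def \<phi>_def[abs_def])
      have sub1: "cball 0 1 \<subseteq> ball (0::complex) R" "ball 0 1 \<subseteq> ball (0::complex) R" using R by auto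
      have \<phi>0: "\<phi> 0 = h (of_real \<theta>) \<omega>" using elim(2) by (simp add: \<phi>_def strip_map_zero[OF \<theta>])
      show ?case
      proof (intro conjI impI)
        assume "V0 \<omega> + V1 \<omega> = 0"
        then show "h (of_real \<theta>) \<omega> = 0" using bd[of 0] R by (simp add: V_def \<phi>0[symmetric])
      next
        assume "0 < V0 \<omega> + V1 \<omega>"
        then have V: "0 < V" by (simp add: V_def)
        have "cmod (\<phi> 0) \<le> exp (2 * (2 * V / (R - 1)) / ((\<epsilon> * V) * sqrt N) + (\<Sum>k<N. ln (cmod (\<phi> (unit_root N k)) + \<epsilon> * V)) / N)"
        proof (rule discrete_jensen)
          show "continuous_on (cball 0 1) \<phi>"
            by (rule continuous_on_subset[OF holomorphic_on_imp_continuous_on[OF hol] sub1(1)])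
          show "\<phi> holomorphic_on ball 0 1" by (rule holomorphic_on_subset[OF hol sub1(2)])
          show "0 < \<epsilon> * V" using \<epsilon> V by simp
          show "cmod (\<phi> z - \<phi> w) \<le> 2 * V / (R - 1) * cmod (z - w)" if "cmod z = 1" "cmod w = 1" for z w
            using that by (intro lipschitz_from_bound[OF hol R bd]) auto
        qed (rule N)
        also have "2 * (2 * V / (R - 1)) / ((\<epsilon> * V) * sqrt N) = \<Lambda> / (\<epsilon> * sqrt N)"
          using V by (simp add: \<Lambda>_def)
        also have "(\<Sum>k<N. ln (cmod (\<phi> (unit_root N k)) + \<epsilon> * V)) =
            (\<Sum>k<N. ln (cmod (h (strip_map \<theta> (of_real r * unit_root N k)) \<omega>) + \<epsilon> * V))"
          using elim(1) by (intro sum.cong) (auto simp: \<phi>_def)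
        finally show "cmod (h (of_real \<theta>) \<omega>) \<le> exp (\<Lambda> / (\<epsilon> * sqrt N) +
          (\<Sum>k<N. ln (cmod (h (strip_map \<theta> (of_real r * unit_root N k)) \<omega>) + \<epsilon> * (V0 \<omega> + V1 \<omega>))) / N)"
          by (simp add: \<phi>0 V_def)
      qed
    qed
  qed
qed

end

text \<open>An interval of length l contains at most N l + 1 points k / N. Each arc is shortened by
  2 \<tau>, and 1 <= 2 \<tau> N pays for the additional point, so the arcs carry at most their exact
  share. The three remaining intervals have total length 4 \<tau>.\<close>

lemma card_outside_arcs:
  fixes \<theta> \<tau> :: real
  assumes \<theta>: "0 < \<theta>" "\<theta> < 1" and \<tau>: "0 < \<tau>" and N: "0 < N" "1 \<le> 2 * \<tau> * N"
  defines "I0 \<equiv> {k::nat. k < N \<and> \<theta> + \<tau> \<le> k / N \<and> k / N \<le> 1 - \<tau>}"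
    and "I1 \<equiv> {k::nat. k < N \<and> \<tau> \<le> k / N \<and> k / N \<le> \<theta> - \<tau>}"
  shows "card I0 \<le> (1 - \<theta>) * N" "card I1 \<le> \<theta> * N" "card ({..<N} - (I0 \<union> I1)) \<le> 4 * \<tau> * N + 3"
proof -
  show "card I0 \<le> (1 - \<theta>) * N"
  proof (cases "\<theta> + \<tau> \<le> 1 - \<tau>")
    case True
    then have "card I0 \<le> N * (1 - \<tau> - (\<theta> + \<tau>)) + 1"
      unfolding I0_def by (intro card_rational_points N)
    then show ?thesis using N by (simp add: algebra_simps)
  next
    case False
    then have "I0 = {}" by (auto simp: I0_def)
    then show ?thesis using \<theta> by simp
  qed
  show "card I1 \<le> \<theta> * N"
  proof (cases "\<tau> \<le> \<theta> - \<tau>")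
    case True
    then have "card I1 \<le> N * (\<theta> - \<tau> - \<tau>) + 1"
      unfolding I1_def by (intro card_rational_points N)
    then show ?thesis using N by (simp add: algebra_simps)
  next
    case False
    then have "I1 = {}" by (auto simp: I1_def)
    then show ?thesis using \<theta> by simp
  qed
  define J where "J a b = {k::nat. k < N \<and> a \<le> k / N \<and> k / N \<le> b}" for a b :: real
  have J: "card (J a b) \<le> N * (b - a) + 1" if "a \<le> b" for a b :: real
    unfolding J_def using N that by (intro card_rational_points) auto
  have "k \<in> J 0 \<tau> \<union> (J (\<theta> - \<tau>) (\<theta> + \<tau>) \<union> J (1 - \<tau>) 1)" if "k < N" "k \<notin> I0" "k \<notin> I1" for k
  proof -
    have "0 \<le> real k / N" "real k / N \<le> 1" using that N by auto
    then show ?thesis using that by (auto simp: J_def I0_def I1_def)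
  qed
  then have "{..<N} - (I0 \<union> I1) \<subseteq> J 0 \<tau> \<union> (J (\<theta> - \<tau>) (\<theta> + \<tau>) \<union> J (1 - \<tau>) 1)" by auto
  then have "card ({..<N} - (I0 \<union> I1)) \<le> card (J 0 \<tau> \<union> (J (\<theta> - \<tau>) (\<theta> + \<tau>) \<union> J (1 - \<tau>) 1))"
    by (intro card_mono) (auto simp: J_def)
  also have "\<dots> \<le> card (J 0 \<tau>) + (card (J (\<theta> - \<tau>) (\<theta> + \<tau>)) + card (J (1 - \<tau>) 1))"
    by (intro order_trans[OF card_Un_le] add_left_mono card_Un_le)
  finally have "real (card ({..<N} - (I0 \<union> I1))) \<le> card (J 0 \<tau>) + (card (J (\<theta> - \<tau>) (\<theta> + \<tau>)) + card (J (1 - \<tau>) 1))"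
    by linarith
  also have "\<dots> \<le> (N * (\<tau> - 0) + 1) + ((N * (\<theta> + \<tau> - (\<theta> - \<tau>)) + 1) + (N * (1 - (1 - \<tau>)) + 1))"
    using \<tau> J[of 0 \<tau>] J[of "\<theta> - \<tau>" "\<theta> + \<tau>"] J[of "1 - \<tau>" 1] by linarith
  also have "\<dots> = 4 * \<tau> * N + 3" by (simp add: algebra_simps)
  finally show "card ({..<N} - (I0 \<union> I1)) \<le> 4 * \<tau> * N + 3" .
qed

context lattice_couple
begin

text \<open>P0 and P1 are the principal parts, bounded in terms of the boundary values. R1 and R0
  come from parts of samples lying in the other space and are as small as desired, but P0 and P1 may
  change with \<eta>. The proof fixes the tolerances before the radius r, the majorants V0, V1 after
  r, and \<epsilon> and N last, since each depends on what precedes it.\<close>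

lemma three_lines_estimate:
  assumes ac: "analytically_convex X0" "analytically_convex X1" and \<theta>: "0 < \<theta>" "\<theta> < 1"
  obtains C where "0 < C" "\<And>h A \<eta>. \<lbrakk>h \<in> calA M X0 X1; 0 < A; \<And>t. qnorm X0 (h (Complex 0 t)) \<le> A;
      \<And>t. qnorm X1 (h (Complex 1 t)) \<le> A; 0 < \<eta>\<rbrakk> \<Longrightarrow>
    \<exists>P0 P1 R0 R1. X0.dominated P0 (C * A) \<and> X1.dominated P1 (C * A) \<and> X0.dominated R0 \<eta> \<and> X1.dominated R1 \<eta> \<and>
      (\<forall>\<omega>. 0 \<le> P0 \<omega> \<and> 0 \<le> P1 \<omega> \<and> 0 \<le> R0 \<omega> \<and> 0 \<le> R1 \<omega>) \<and>
      (AE \<omega> in M. cmod (h (of_real \<theta>) \<omega>) \<le> (P0 \<omega> + R1 \<omega>) powr (1 - \<theta>) * (P1 \<omega> + R0 \<omega>) powr \<theta>)"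
proof -
  obtain p C0 C1 where p: "0 < p" and C01: "X0.power_mean_constant p C0" "X1.power_mean_constant p C1"
    using power_mean_constants[OF ac] by blast
  have Cn: "0 \<le> C0" "0 \<le> C1" using C01 by (auto simp: X0.power_mean_constant_def X1.power_mean_constant_def)
  define D where "D = C0 + C1 + 1"
  have D: "1 \<le> D" "C0 \<le> D" "C1 \<le> D" using Cn by (auto simp: D_def)
  define c where "c = 3 * 3 powr (1 / p)"
  have c: "0 < c" by (simp add: c_def)
  define C where "C = 16 * c * K\<^sup>2 * D"
  have C: "0 < C" using c D K_pos by (simp add: C_def)
  show thesis
  proof (rule that[OF C])
    fix h and A \<eta> :: real
    assume h: "h \<in> calA M X0 X1" and A: "0 < A" and b0: "\<And>t. qnorm X0 (h (Complex 0 t)) \<le> A"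
      and b1: "\<And>t. qnorm X1 (h (Complex 1 t)) \<le> A" and \<eta>: "0 < \<eta>"
    have an: "analytic_into Z open_strip h" using h by (simp add: calA_def)
    obtain B' where B': "\<And>z. z \<in> open_strip \<Longrightarrow> qnorm Z (h z) \<le> B'"
      using h by (auto simp: calA_def bounded_into_def)
    define B where "B = max B' 0 + 1"
    have B: "0 < B" "\<And>z. z \<in> open_strip \<Longrightarrow> qnorm Z (h z) < B"
    proof -
      show "0 < B" by (simp add: B_def)
      show "qnorm Z (h z) < B" if "z \<in> open_strip" for z
        using B'[OF that] max.cobounded1[of B' 0] unfolding B_def by linarith
    qed
    \<comment> \<open>The common bound for all error terms. The factor 12 c K^2 is the cost of
      adding three of them, with the constant 4 c in front; \<kappa> <= A lets them also be hidden
      in the principal parts.\<close>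
    define \<kappa> where "\<kappa> = min A (\<eta> / (12 * c * K\<^sup>2))"
    have \<kappa>: "0 < \<kappa>" "\<kappa> \<le> A" "12 * c * K\<^sup>2 * \<kappa> \<le> \<eta>"
      using A \<eta> c K_pos by (auto simp: \<kappa>_def min_def field_simps)
    define e where "e = min A (\<kappa> / D)"
    have e: "0 < e" "e \<le> A" "D * e \<le> \<kappa>" using A \<kappa> D by (auto simp: e_def min_def field_simps)
    \<comment> \<open>Makes \<delta> times the crude bound of the bad samples negligible; the price
      is the number of bad samples allowed by \<open>\<beta>\<close>.\<close>
    define \<delta> where "\<delta> = min (1/2) (\<kappa> / (D * B))"
    have \<delta>: "0 < \<delta>" "\<delta> < 1" "\<delta> * (D * B) \<le> \<kappa>" using \<kappa> D B by (auto simp: \<delta>_def min_def field_simps)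
    have ln\<delta>: "ln \<delta> < 0" using \<delta> by simp
    \<comment> \<open>The proportion of bad samples for which the surplus - ln \<delta> contributes
      at most ln 2 to the mean.\<close>
    define \<beta> where "\<beta> = ln 2 / (- ln \<delta>)"
    have \<beta>: "0 < \<beta>" unfolding \<beta>_def using ln\<delta> by (intro divide_pos_pos) auto
    \<comment> \<open>There are at most 4 \<tau> N + 3 = \<beta> N / 2 + 3 bad samples, and this is
      at most \<beta> N as soon as \<beta> N >= 6.\<close>
    define \<tau> where "\<tau> = \<beta> / 8"
    have \<tau>: "0 < \<tau>" using \<beta> by (simp add: \<tau>_def)
    obtain r where r: "0 < r" "r < 1"
      and split: "\<And>N. \<exists>p. \<forall>k. sample_split \<theta> \<tau> A e B (k / N) (h (strip_map \<theta> (of_real r * unit_root N k))) (p k)"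
      by (rule sample_decomposition[OF \<theta> h A b0 b1 \<tau> e(1) B(2)], assumption, rule that) blast+
    obtain V0 V1 B0 B1 \<Lambda> where V: "X0.dominated V0 B0" "X1.dominated V1 B1" and \<Lambda>: "0 \<le> \<Lambda>"
      and Vn: "\<And>\<omega>. 0 \<le> V0 \<omega>" "\<And>\<omega>. 0 \<le> V1 \<omega>"
      and jen: "\<And>N \<epsilon>. 0 < N \<Longrightarrow> 0 < \<epsilon> \<Longrightarrow> AE \<omega> in M. (V0 \<omega> + V1 \<omega> = 0 \<longrightarrow> h (of_real \<theta>) \<omega> = 0) \<and>
      (0 < V0 \<omega> + V1 \<omega> \<longrightarrow> cmod (h (of_real \<theta>) \<omega>) \<le> exp (\<Lambda> / (\<epsilon> * sqrt N) +
        (\<Sum>k<N. ln (cmod (h (strip_map \<theta> (of_real r * unit_root N k)) \<omega>) + \<epsilon> * (V0 \<omega> + V1 \<omega>))) / N))"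
      by (rule jensen_on_compact[OF \<theta> an r], rule that) blast+
    have Bn: "0 \<le> B0" "0 \<le> B1" using X0.dominated_nonneg[OF V(1)] X1.dominated_nonneg[OF V(2)] by auto
    \<comment> \<open>The floor \<epsilon> (V0 + V1) must itself be a small error in both spaces, so
      \<epsilon> is chosen after the norms of V0 and V1 are known.\<close>
    define \<epsilon> where "\<epsilon> = \<kappa> / (2 * (B0 + B1 + 1))"
    have \<epsilon>: "0 < \<epsilon>" using \<kappa> Bn by (simp add: \<epsilon>_def)
    have \<epsilon>B: "2 * \<epsilon> * B0 \<le> \<kappa>" "2 * \<epsilon> * B1 \<le> \<kappa>"
    proof -
      have "2 * (\<kappa> / (2 * W)) * W = \<kappa>" if "0 < W" for W using that by simp
      from this[of "B0 + B1 + 1"] have "2 * \<epsilon> * (B0 + B1 + 1) = \<kappa>" using Bn by (simp only: \<epsilon>_def)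
      moreover have "2 * \<epsilon> * B0 \<le> 2 * \<epsilon> * (B0 + B1 + 1)" "2 * \<epsilon> * B1 \<le> 2 * \<epsilon> * (B0 + B1 + 1)"
        using \<epsilon> Bn by (intro mult_left_mono; simp)+
      ultimately show "2 * \<epsilon> * B0 \<le> \<kappa>" "2 * \<epsilon> * B1 \<le> \<kappa>" by linarith+
    qed
    \<comment> \<open>The conditions provide, in order: N > 0, at most the exact share of points on
      each arc, few bad points, and a Jensen error of at most ln 2.\<close>
    obtain N :: nat where N: "max 1 (max (1 / (2 * \<tau>)) (max (6 / \<beta>) ((\<Lambda> / (\<epsilon> * ln 2))\<^sup>2))) < N"
      using reals_Archimedean2 by blast
    have N0: "0 < N" using N by (metis max_less_iff_conj of_nat_0_less_iff zero_less_one order_less_trans)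
    have N1: "1 \<le> 2 * \<tau> * N" using N \<tau> by (simp add: field_simps)
    have N2: "6 \<le> \<beta> * N" using N \<beta> by (simp add: field_simps)
    have N3: "\<Lambda> / (\<epsilon> * sqrt N) \<le> ln 2"
    proof -
      have "(\<Lambda> / (\<epsilon> * ln 2))\<^sup>2 \<le> N" using N by simp
      then have "\<Lambda> / (\<epsilon> * ln 2) \<le> sqrt N" by (rule real_le_rsqrt)
      then show ?thesis using \<epsilon> N0 by (simp add: field_simps)
    qed
    define I0 where "I0 = {k::nat. k < N \<and> \<theta> + \<tau> \<le> k / N \<and> k / N \<le> 1 - \<tau>}"
    define I1 where "I1 = {k::nat. k < N \<and> \<tau> \<le> k / N \<and> k / N \<le> \<theta> - \<tau>}"
    define Ib where "Ib = {..<N} - (I0 \<union> I1)"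
    note cards = card_outside_arcs[OF \<theta> \<tau> N0 N1, folded I0_def I1_def, folded Ib_def]
    have fin: "finite I0" "finite I1" "finite Ib" by (auto simp: I0_def I1_def Ib_def)
    have disj: "I0 \<inter> I1 = {}" using \<tau> by (auto simp: I0_def I1_def)
    have un: "{..<N} = (I0 \<union> I1) \<union> Ib" "(I0 \<union> I1) \<inter> Ib = {}" by (auto simp: I0_def I1_def Ib_def)
    have cardN: "real N = card I0 + card I1 + card Ib"
    proof -
      have "N = card ({..<N})" by simp
      also have "\<dots> = card I0 + card I1 + card Ib"
        unfolding un(1) using card_Un_disjoint[OF _ fin(3) un(2)] card_Un_disjoint[OF fin(1,2) disj] fin by simp
      finally show ?thesis by linarith
    qed
    have nb: "card Ib * (- ln \<delta>) \<le> N * ln 2"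
    proof -
      have "card Ib \<le> 4 * \<tau> * N + 3" by (rule cards(3))
      also have "\<dots> \<le> \<beta> * N" using N2 by (simp add: \<tau>_def)
      finally have "card Ib * (- ln \<delta>) \<le> \<beta> * N * (- ln \<delta>)" using ln\<delta> by (intro mult_right_mono) auto
      also have "\<dots> = N * ln 2" using ln\<delta> by (simp add: \<beta>_def)
      finally show ?thesis .
    qed
    from split[of N] obtain q where q: "\<And>k. sample_split \<theta> \<tau> A e B (k / N) (h (strip_map \<theta> (of_real r * unit_root N k))) (q k)"
      by blast
    note qs = q[unfolded sample_split_def]
    have qe: "fst (q k) \<in> elems X0" "snd (q k) \<in> elems X1" for k using qs[of k] by blast+
    have qAE: "AE \<omega> in M. h (strip_map \<theta> (of_real r * unit_root N k)) \<omega> = fst (q k) \<omega> + snd (q k) \<omega>" for k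
      using qs[of k] by blast
    have q0: "qnorm X0 (fst (q k)) \<le> K * (A + e)" "qnorm X1 (snd (q k)) \<le> e" if "k \<in> I0" for k
      using qs[of k] that by (auto simp: I0_def)
    have q1: "qnorm X0 (fst (q k)) \<le> e" "qnorm X1 (snd (q k)) \<le> K * (A + e)" if "k \<in> I1" for k
      using qs[of k] that by (auto simp: I1_def)
    have qb: "qnorm X0 (fst (q k)) \<le> B" "qnorm X1 (snd (q k)) \<le> B" if "k \<in> Ib" for k
      using qs[of k] that by (auto simp: Ib_def I0_def I1_def)
    have KA: "0 \<le> K * (A + e)" using K_pos A e by simp
    obtain g00 g01 where g0: "X0.dominated g00 (C0 * (K * (A + e)))" "X1.dominated g01 (C1 * e)"
        "\<And>\<omega>. 0 \<le> g00 \<omega>" "\<And>\<omega>. 0 \<le> g01 \<omega>"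
        "\<And>\<omega> v. 0 < v \<Longrightarrow> (\<Sum>k\<in>I0. ln (cmod (fst (q k) \<omega>) + cmod (snd (q k) \<omega>) + v)) \<le>
        card I0 * ln (3 * 3 powr (1 / p) * (g00 \<omega> + g01 \<omega> + v))"
      by (rule group_log_mean[where x = "\<lambda>k. fst (q k)" and y = "\<lambda>k. snd (q k)",
            OF C01 p fin(1) KA less_imp_le[OF e(1)] qe(1) q0(1) qe(2) q0(2)], assumption, assumption, rule that) blast+
    obtain g10 g11 where g1: "X0.dominated g10 (C0 * e)" "X1.dominated g11 (C1 * (K * (A + e)))"
        "\<And>\<omega>. 0 \<le> g10 \<omega>" "\<And>\<omega>. 0 \<le> g11 \<omega>"
        "\<And>\<omega> v. 0 < v \<Longrightarrow> (\<Sum>k\<in>I1. ln (cmod (fst (q k) \<omega>) + cmod (snd (q k) \<omega>) + v)) \<le>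
        card I1 * ln (3 * 3 powr (1 / p) * (g10 \<omega> + g11 \<omega> + v))"
      by (rule group_log_mean[where x = "\<lambda>k. fst (q k)" and y = "\<lambda>k. snd (q k)",
            OF C01 p fin(2) less_imp_le[OF e(1)] KA qe(1) q1(1) qe(2) q1(2)], assumption, assumption, rule that) blast+
    obtain gb0 gb1 where gb: "X0.dominated gb0 (C0 * B)" "X1.dominated gb1 (C1 * B)"
        "\<And>\<omega>. 0 \<le> gb0 \<omega>" "\<And>\<omega>. 0 \<le> gb1 \<omega>"
        "\<And>\<omega> v. 0 < v \<Longrightarrow> (\<Sum>k\<in>Ib. ln (cmod (fst (q k) \<omega>) + cmod (snd (q k) \<omega>) + v)) \<le>
        card Ib * ln (3 * 3 powr (1 / p) * (gb0 \<omega> + gb1 \<omega> + v))"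
      by (rule group_log_mean[where x = "\<lambda>k. fst (q k)" and y = "\<lambda>k. snd (q k)",
            OF C01 p fin(3) less_imp_le[OF B(1)] less_imp_le[OF B(1)] qe(1) qb(1) qe(2) qb(2)], assumption, assumption, rule that) blast+
    \<comment> \<open>The factor 4 collects the two losses of ln 2, from Jensen's inequality and
      from the bad samples. The floor appears twice, as v + \<delta> v <= 2 v. Every term is sorted
      by the space in which it is controlled, not by the arc it came from.\<close>
    define P0 where "P0 \<omega> = 4 * c * (g00 \<omega> + (\<delta> * gb0 \<omega> + 2 * \<epsilon> * V0 \<omega>))" for \<omega>
    define R1 where "R1 \<omega> = 4 * c * (g01 \<omega> + (\<delta> * gb1 \<omega> + 2 * \<epsilon> * V1 \<omega>))" for \<omega>
    define P1 where "P1 \<omega> = 4 * c * (g11 \<omega> + (\<delta> * gb1 \<omega> + 2 * \<epsilon> * V1 \<omega>))" for \<omega>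
    define R0 where "R0 \<omega> = 4 * c * (g10 \<omega> + (\<delta> * gb0 \<omega> + 2 * \<epsilon> * V0 \<omega>))" for \<omega>
    have nn: "0 \<le> P0 \<omega> \<and> 0 \<le> P1 \<omega> \<and> 0 \<le> R0 \<omega> \<and> 0 \<le> R1 \<omega>" for \<omega>
      using c \<delta> \<epsilon> g0(3,4) g1(3,4) gb(3,4) Vn
      by (auto simp: P0_def P1_def R0_def R1_def intro!: mult_nonneg_nonneg add_nonneg_nonneg)
    have small: "\<delta> * (C0 * B) \<le> \<kappa>" "\<delta> * (C1 * B) \<le> \<kappa>" "C0 * e \<le> \<kappa>" "C1 * e \<le> \<kappa>"
    proof -
      have "\<delta> * (C0 * B) \<le> \<delta> * (D * B)" "\<delta> * (C1 * B) \<le> \<delta> * (D * B)"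
        using \<delta> D B by (auto intro!: mult_left_mono mult_right_mono)
      with \<delta>(3) show "\<delta> * (C0 * B) \<le> \<kappa>" "\<delta> * (C1 * B) \<le> \<kappa>" by linarith+
      have "C0 * e \<le> D * e" "C1 * e \<le> D * e" using e D by (auto intro!: mult_right_mono)
      with e(3) show "C0 * e \<le> \<kappa>" "C1 * e \<le> \<kappa>" by linarith+
    qed
    have remainder: "4 * c * (K * (s + K * (x + y))) \<le> \<eta>" if "s \<le> \<kappa>" "x \<le> \<kappa>" "y \<le> \<kappa>" for s x y
    proof -
      have "K * (s + K * (x + y)) \<le> K * (K * \<kappa> + K * (\<kappa> + \<kappa>))"
      proof (intro mult_left_mono add_mono K_nonneg)
        show "s \<le> K * \<kappa>" using that(1) mult_right_mono[OF K_ge_1, of \<kappa>] \<kappa> by linarith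
      qed (use that in auto)
      then have "4 * c * (K * (s + K * (x + y))) \<le> 4 * c * (K * (K * \<kappa> + K * (\<kappa> + \<kappa>)))"
        by (rule mult_left_mono) (use c in simp)
      also have "\<dots> = 12 * c * K\<^sup>2 * \<kappa>" by (simp add: power2_eq_square algebra_simps)
      finally show ?thesis using \<kappa>(3) by linarith
    qed
    have principal: "4 * c * (K * (Cj * (K * (A + e)) + K * (x + y))) \<le> C * A" if "0 \<le> Cj" "Cj \<le> D" "x \<le> \<kappa>" "y \<le> \<kappa>" for Cj x y
    proof -
      have a1: "Cj * (K * (A + e)) \<le> D * (K * (A + A))"
        using that e A K_pos D by (intro mult_mono) auto
      have a2: "K * (x + y) \<le> K * (D * (A + A))"
      proof (intro mult_left_mono K_nonneg)
        have "x + y \<le> 1 * (A + A)" using add_mono[OF that(3,4)] add_mono[OF \<kappa>(2,2)] by simp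
        also have "\<dots> \<le> D * (A + A)" using D A by (intro mult_right_mono) auto
        finally show "x + y \<le> D * (A + A)" .
      qed
      have "4 * c * (K * (Cj * (K * (A + e)) + K * (x + y))) \<le> 4 * c * (K * (D * (K * (A + A)) + K * (D * (A + A))))"
        by (rule mult_left_mono[OF mult_left_mono[OF add_mono[OF a1 a2] K_nonneg]]) (use c in simp)
      also have "\<dots> = C * A" by (simp add: C_def power2_eq_square algebra_simps)
      finally show ?thesis .
    qed
    have c4: "0 \<le> 4 * c" using c by simp
    have \<epsilon>2: "0 \<le> 2 * \<epsilon>" using \<epsilon> by simp
    have X0t: "X0.dominated (\<lambda>\<omega>. \<delta> * gb0 \<omega> + 2 * \<epsilon> * V0 \<omega>) (K * (\<delta> * (C0 * B) + 2 * \<epsilon> * B0))"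
      using \<delta> \<epsilon>2 by (intro X0.dominated_add X0.dominated_scale gb V) auto
    have X1t: "X1.dominated (\<lambda>\<omega>. \<delta> * gb1 \<omega> + 2 * \<epsilon> * V1 \<omega>) (K * (\<delta> * (C1 * B) + 2 * \<epsilon> * B1))"
      using \<delta> \<epsilon>2 by (intro X1.dominated_add X1.dominated_scale gb V) auto
    have "X0.dominated P0 (C * A)"
      by (rule X0.dominated_mono[OF X0.dominated_scale[OF X0.dominated_add[OF g0(1) X0t] c4]])
         (use principal[OF Cn(1) D(2) small(1) \<epsilon>B(1)] in \<open>auto simp: P0_def\<close>)
    moreover have "X1.dominated P1 (C * A)"
      by (rule X1.dominated_mono[OF X1.dominated_scale[OF X1.dominated_add[OF g1(2) X1t] c4]])
         (use principal[OF Cn(2) D(3) small(2) \<epsilon>B(2)] in \<open>auto simp: P1_def\<close>)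
    moreover have "X0.dominated R0 \<eta>"
      by (rule X0.dominated_mono[OF X0.dominated_scale[OF X0.dominated_add[OF g1(1) X0t] c4]])
         (use remainder[OF small(3) small(1) \<epsilon>B(1)] in \<open>auto simp: R0_def\<close>)
    moreover have "X1.dominated R1 \<eta>"
      by (rule X1.dominated_mono[OF X1.dominated_scale[OF X1.dominated_add[OF g0(2) X1t] c4]])
         (use remainder[OF small(4) small(2) \<epsilon>B(2)] in \<open>auto simp: R1_def\<close>)
    moreover have "AE \<omega> in M. cmod (h (of_real \<theta>) \<omega>) \<le> (P0 \<omega> + R1 \<omega>) powr (1 - \<theta>) * (P1 \<omega> + R0 \<omega>) powr \<theta>"
    proof -
      have "AE \<omega> in M. \<forall>k\<in>{..<N}. h (strip_map \<theta> (of_real r * unit_root N k)) \<omega> = fst (q k) \<omega> + snd (q k) \<omega>"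
        by (subst AE_finite_all) (use qAE in auto)
      with jen[OF N0 \<epsilon>] show ?thesis
      proof eventually_elim
        case (elim \<omega>)
        show ?case
        proof (cases "V0 \<omega> + V1 \<omega> = 0")
          case True
          then show ?thesis using elim(1) by simp
        next
          case False
          \<comment> \<open>The same floor enters all three groups, since the Jensen inequality
            supplies it once for all samples.\<close>
          define v where "v = \<epsilon> * (V0 \<omega> + V1 \<omega>)"
          have Vpos: "0 < V0 \<omega> + V1 \<omega>" using False Vn[of \<omega>] by linarith
          have v: "0 < v" using \<epsilon> Vpos by (simp add: v_def)
          define G0 where "G0 = c * (g00 \<omega> + g01 \<omega> + v)"
          define G1 where "G1 = c * (g10 \<omega> + g11 \<omega> + v)"
          define Gb where "Gb = c * (gb0 \<omega> + gb1 \<omega> + v)"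
          have G: "0 < G0" "0 < G1" "0 < Gb"
            using c v g0(3,4)[of \<omega>] g1(3,4)[of \<omega>] gb(3,4)[of \<omega>]
            by (auto simp: G0_def G1_def Gb_def intro!: mult_pos_pos add_nonneg_pos add_nonneg_nonneg)
          let ?S = "\<lambda>k. ln (cmod (fst (q k) \<omega>) + cmod (snd (q k) \<omega>) + v)"
          have "(\<Sum>k<N. ln (cmod (h (strip_map \<theta> (of_real r * unit_root N k)) \<omega>) + v)) \<le> (\<Sum>k<N. ?S k)"
          proof (rule sum_mono)
            fix k assume "k \<in> {..<N}"
            then have "cmod (h (strip_map \<theta> (of_real r * unit_root N k)) \<omega>) \<le> cmod (fst (q k) \<omega>) + cmod (snd (q k) \<omega>)"
              using elim(2) norm_triangle_ineq by metis
            then show "ln (cmod (h (strip_map \<theta> (of_real r * unit_root N k)) \<omega>) + v) \<le> ?S k"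
              using v by (subst ln_le_cancel_iff) (auto intro: add_nonneg_pos)
          qed
          also have "\<dots> = (\<Sum>k\<in>I0. ?S k) + (\<Sum>k\<in>I1. ?S k) + (\<Sum>k\<in>Ib. ?S k)"
            unfolding un(1) using sum.union_disjoint[OF _ fin(3) un(2), of ?S] sum.union_disjoint[OF fin(1,2) disj, of ?S] fin by simp
          also have "\<dots> \<le> card I0 * ln G0 + card I1 * ln G1 + card Ib * ln Gb"
            unfolding G0_def G1_def Gb_def c_def
            by (intro add_mono g0(5)[OF v] g1(5)[OF v] gb(5)[OF v])
          finally have "(\<Sum>k<N. ln (cmod (h (strip_map \<theta> (of_real r * unit_root N k)) \<omega>) + v)) / N \<le>
              (card I0 * ln G0 + card I1 * ln G1 + card Ib * ln Gb) / N" by (intro divide_right_mono) auto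
          also have "\<dots> \<le> ln 2 + (1 - \<theta>) * ln (G0 + \<delta> * Gb) + \<theta> * ln (G1 + \<delta> * Gb)"
            by (rule combine_log_means[OF _ cardN[unfolded of_nat_add] G \<delta>(1,2) cards(1,2) nb]) (use N0 in auto)
          finally have main: "(\<Sum>k<N. ln (cmod (h (strip_map \<theta> (of_real r * unit_root N k)) \<omega>) + v)) / N \<le>
              ln 2 + (1 - \<theta>) * ln (G0 + \<delta> * Gb) + \<theta> * ln (G1 + \<delta> * Gb)" .
          have dG: "0 < G0 + \<delta> * Gb" "0 < G1 + \<delta> * Gb" using G \<delta> by (auto intro!: add_pos_pos)
          have "cmod (h (of_real \<theta>) \<omega>) \<le> exp (\<Lambda> / (\<epsilon> * sqrt N) +
              (\<Sum>k<N. ln (cmod (h (strip_map \<theta> (of_real r * unit_root N k)) \<omega>) + v)) / N)"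
            using elim(1) Vpos by (simp add: v_def)
          also have "\<dots> \<le> exp (ln 2 + (ln 2 + (1 - \<theta>) * ln (G0 + \<delta> * Gb) + \<theta> * ln (G1 + \<delta> * Gb)))"
            using main N3 by simp
          also have "ln 2 + (ln 2 + (1 - \<theta>) * ln (G0 + \<delta> * Gb) + \<theta> * ln (G1 + \<delta> * Gb)) =
              (1 - \<theta>) * ln (4 * (G0 + \<delta> * Gb)) + \<theta> * ln (4 * (G1 + \<delta> * Gb))"
          proof -
            have "ln (4::real) = 2 * ln 2" using ln_realpow[of 2 2] by simp
            then have "ln (4 * x) = 2 * ln 2 + ln x" if "0 < x" for x :: real using that by (simp add: ln_mult)
            then show ?thesis using dG by (simp only:) (simp add: algebra_simps)
          qed
          also have "exp \<dots> = (4 * (G0 + \<delta> * Gb)) powr (1 - \<theta>) * (4 * (G1 + \<delta> * Gb)) powr \<theta>"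
            using dG by (simp add: exp_add powr_def)
          also have "\<dots> \<le> (P0 \<omega> + R1 \<omega>) powr (1 - \<theta>) * (P1 \<omega> + R0 \<omega>) powr \<theta>"
          proof (intro mult_mono powr_mono2)
            have "\<delta> * v \<le> v" using \<delta> v by (simp add: mult_left_le_one_le)
            then have vv: "v + \<delta> * v \<le> 2 * v" by simp
            have "G0 + \<delta> * Gb = c * (g00 \<omega> + g01 \<omega> + (\<delta> * gb0 \<omega> + \<delta> * gb1 \<omega>) + (v + \<delta> * v))"
              by (simp add: G0_def Gb_def algebra_simps)
            also have "\<dots> \<le> c * (g00 \<omega> + g01 \<omega> + (\<delta> * gb0 \<omega> + \<delta> * gb1 \<omega>) + 2 * v)"
              using c vv by (intro mult_left_mono) auto
            finally show "4 * (G0 + \<delta> * Gb) \<le> P0 \<omega> + R1 \<omega>" by (simp add: P0_def R1_def v_def algebra_simps)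
            have "G1 + \<delta> * Gb = c * (g10 \<omega> + g11 \<omega> + (\<delta> * gb0 \<omega> + \<delta> * gb1 \<omega>) + (v + \<delta> * v))"
              by (simp add: G1_def Gb_def algebra_simps)
            also have "\<dots> \<le> c * (g10 \<omega> + g11 \<omega> + (\<delta> * gb0 \<omega> + \<delta> * gb1 \<omega>) + 2 * v)"
              using c vv by (intro mult_left_mono) auto
            finally show "4 * (G1 + \<delta> * Gb) \<le> P1 \<omega> + R0 \<omega>" by (simp add: P1_def R0_def v_def algebra_simps)
          qed (use dG \<theta> in auto)
          finally show ?thesis .
        qed
      qed
    qed
    ultimately show "\<exists>P0 P1 R0 R1. X0.dominated P0 (C * A) \<and> X1.dominated P1 (C * A) \<and> X0.dominated R0 \<eta> \<and> X1.dominated R1 \<eta> \<and>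
      (\<forall>\<omega>. 0 \<le> P0 \<omega> \<and> 0 \<le> P1 \<omega> \<and> 0 \<le> R0 \<omega> \<and> 0 \<le> R1 \<omega>) \<and>
      (AE \<omega> in M. cmod (h (of_real \<theta>) \<omega>) \<le> (P0 \<omega> + R1 \<omega>) powr (1 - \<theta>) * (P1 \<omega> + R0 \<omega>) powr \<theta>)"
      using nn by (intro exI[of _ P0] exI[of _ P1] exI[of _ R0] exI[of _ R1]) simp
  qed
qed

end

section \<open>Unconditional multiplier series\<close>

lemma eventually_finite_subsets_UNIV:
  "eventually P (finite_subsets_at_top UNIV) \<longleftrightarrow> (\<exists>F0. finite F0 \<and> (\<forall>F. finite F \<and> F0 \<subseteq> F \<longrightarrow> P F))"
  by (simp add: eventually_finite_subsets_at_top)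

text \<open>The weights 2^(i (j - \<theta>)) are already contained in \<open>b\<close>, so both end
  point spaces are instances. The assumption describes a bounded map from bounded sequences to
  X.\<close>

locale multiplier_series = normed_lattice M X K
  for M :: "'a measure" and X :: "'a fspace" and K :: real +
  fixes b :: "int \<Rightarrow> 'a \<Rightarrow> complex" and C :: real
  assumes b_elem: "b i \<in> elems X"
    and bounded_multiplier: "bounded (range \<epsilon>) \<Longrightarrow>
      \<exists>s\<in>elems X. converges_in X (\<lambda>F \<omega>. \<Sum>i\<in>F. \<epsilon> i * b i \<omega>) s (finite_subsets_at_top UNIV) \<and>
        qnorm X s \<le> C * (SUP i. cmod (\<epsilon> i))"
begin

text \<open>The sum is determined only up to null sets; a representative is selected, and linearity
  can therefore be stated only almost everywhere.\<close>

definition T :: "(int \<Rightarrow> complex) \<Rightarrow> 'a \<Rightarrow> complex" where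
  "T \<epsilon> = (SOME s. s \<in> elems X \<and> converges_in X (\<lambda>F \<omega>. \<Sum>i\<in>F. \<epsilon> i * b i \<omega>) s (finite_subsets_at_top UNIV) \<and>
        qnorm X s \<le> C * (SUP i. cmod (\<epsilon> i)))"

lemma T_spec:
  assumes "bounded (range \<epsilon>)"
  shows T_elem: "T \<epsilon> \<in> elems X"
    and T_converges: "converges_in X (\<lambda>F \<omega>. \<Sum>i\<in>F. \<epsilon> i * b i \<omega>) (T \<epsilon>) (finite_subsets_at_top UNIV)"
    and T_le_SUP: "qnorm X (T \<epsilon>) \<le> C * (SUP i. cmod (\<epsilon> i))"
proof -
  have "\<exists>s. s \<in> elems X \<and> converges_in X (\<lambda>F \<omega>. \<Sum>i\<in>F. \<epsilon> i * b i \<omega>) s (finite_subsets_at_top UNIV) \<and>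
        qnorm X s \<le> C * (SUP i. cmod (\<epsilon> i))"
    using bounded_multiplier[OF assms] unfolding Bex_def .
  note * = someI_ex[OF this, folded T_def]
  show "T \<epsilon> \<in> elems X" by (rule conjunct1[OF *])
  show "converges_in X (\<lambda>F \<omega>. \<Sum>i\<in>F. \<epsilon> i * b i \<omega>) (T \<epsilon>) (finite_subsets_at_top UNIV)"
    by (rule conjunct1[OF conjunct2[OF *]])
  show "qnorm X (T \<epsilon>) \<le> C * (SUP i. cmod (\<epsilon> i))" by (rule conjunct2[OF conjunct2[OF *]])
qed

lemma bounded_rangeI: "(\<And>i. cmod (\<epsilon> i) \<le> B) \<Longrightarrow> bounded (range \<epsilon>)" for \<epsilon> :: "int \<Rightarrow> complex"
  by (auto simp: bounded_iff)

lemma C_nonneg: "0 \<le> C"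
proof -
  have "bounded (range (\<lambda>_::int. 1::complex))" by (rule bounded_rangeI[of _ 1]) simp
  from T_elem[OF this] T_le_SUP[OF this] show ?thesis using qnorm_ge_0 by force
qed

lemma T_le:
  assumes "\<And>i. cmod (\<epsilon> i) \<le> B"
  shows "qnorm X (T \<epsilon>) \<le> C * B"
proof -
  have "(SUP i. cmod (\<epsilon> i)) \<le> B" by (rule cSUP_least) (use assms in auto)
  then show ?thesis
    using T_le_SUP[OF bounded_rangeI[OF assms]] mult_left_mono[OF _ C_nonneg] by (meson order_trans)
qed

lemma partial_elem: "(\<lambda>\<omega>. \<Sum>i\<in>F. \<epsilon> i * b i \<omega>) \<in> elems X"
  by (intro sum_closed scale_elem b_elem)

lemma T_unique:
  assumes "bounded (range \<epsilon>)" "s \<in> elems X"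
    "converges_in X (\<lambda>F \<omega>. \<Sum>i\<in>F. \<epsilon> i * b i \<omega>) s (finite_subsets_at_top UNIV)"
  shows "AE \<omega> in M. T \<epsilon> \<omega> = s \<omega>"
  by (rule converges_in_unique[OF partial_elem T_elem[OF assms(1)] assms(2) _ T_converges[OF assms(1)] assms(3)]) simp

lemma T_add_scale:
  assumes "bounded (range \<epsilon>)" "bounded (range \<delta>)"
  shows "AE \<omega> in M. T (\<lambda>i. \<epsilon> i + c * \<delta> i) \<omega> = T \<epsilon> \<omega> + c * T \<delta> \<omega>"
proof (rule T_unique)
  obtain B1 where B1: "\<And>i. cmod (\<epsilon> i) \<le> B1" using assms(1) by (auto simp: bounded_iff)
  obtain B2 where B2: "\<And>i. cmod (\<delta> i) \<le> B2" using assms(2) by (auto simp: bounded_iff)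
  have "cmod (\<epsilon> i + c * \<delta> i) \<le> B1 + cmod c * B2" for i
    using norm_triangle_ineq[of "\<epsilon> i" "c * \<delta> i"] B1[of i] mult_left_mono[OF B2[of i], of "cmod c"]
    by (simp add: norm_mult)
  then show "bounded (range (\<lambda>i. \<epsilon> i + c * \<delta> i))" by (rule bounded_rangeI)
  show "(\<lambda>\<omega>. T \<epsilon> \<omega> + c * T \<delta> \<omega>) \<in> elems X"
    using assms by (intro add_elem scale_elem T_elem)
  have "converges_in X (\<lambda>F \<omega>. (\<Sum>i\<in>F. \<epsilon> i * b i \<omega>) + c * (\<Sum>i\<in>F. \<delta> i * b i \<omega>)) (\<lambda>\<omega>. T \<epsilon> \<omega> + c * T \<delta> \<omega>) (finite_subsets_at_top UNIV)"
    using assms by (intro converges_in_add converges_in_scale scale_elem partial_elem T_elem T_converges)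
  moreover have "(\<Sum>i\<in>F. \<epsilon> i * b i \<omega>) + c * (\<Sum>i\<in>F. \<delta> i * b i \<omega>) = (\<Sum>i\<in>F. (\<epsilon> i + c * \<delta> i) * b i \<omega>)" for F \<omega>
    by (simp add: sum_distrib_left sum.distrib algebra_simps)
  ultimately show "converges_in X (\<lambda>F \<omega>. \<Sum>i\<in>F. (\<epsilon> i + c * \<delta> i) * b i \<omega>) (\<lambda>\<omega>. T \<epsilon> \<omega> + c * T \<delta> \<omega>) (finite_subsets_at_top UNIV)"
    by simp
qed

lemma T_diff:
  assumes "bounded (range \<epsilon>)" "bounded (range \<delta>)"
  shows "AE \<omega> in M. T (\<lambda>i. \<epsilon> i - \<delta> i) \<omega> = T \<epsilon> \<omega> - T \<delta> \<omega>"
  using T_add_scale[OF assms, of "-1"] by simp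

lemma T_diff_norm:
  assumes "bounded (range \<epsilon>)" "bounded (range \<delta>)" "\<And>i. cmod (\<epsilon> i - \<delta> i) \<le> B"
  shows "qnorm X (\<lambda>\<omega>. T \<epsilon> \<omega> - T \<delta> \<omega>) \<le> C * B"
proof -
  have bd: "bounded (range (\<lambda>i. \<epsilon> i - \<delta> i))" by (rule bounded_rangeI[OF assms(3)])
  have "qnorm X (T (\<lambda>i. \<epsilon> i - \<delta> i)) = qnorm X (\<lambda>\<omega>. T \<epsilon> \<omega> - T \<delta> \<omega>)"
    by (rule AE_eq_closed(2)[OF diff_closed[OF T_elem[OF assms(1)] T_elem[OF assms(2)]] meas[OF T_elem[OF bd]]
        T_diff[OF assms(1,2)]])
  then show ?thesis using T_le[of "\<lambda>i. \<epsilon> i - \<delta> i" B] assms(3) by simp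
qed

lemma T_finite:
  assumes "finite F0" "\<And>i. i \<notin> F0 \<Longrightarrow> \<epsilon> i = 0"
  shows "AE \<omega> in M. T \<epsilon> \<omega> = (\<Sum>i\<in>F0. \<epsilon> i * b i \<omega>)"
proof (rule T_unique)
  have "range \<epsilon> \<subseteq> insert 0 (\<epsilon> ` F0)" using assms(2) by auto
  then show "bounded (range \<epsilon>)" using assms(1) by (meson finite_imageI finite_insert finite_imp_bounded bounded_subset)
  show "(\<lambda>\<omega>. \<Sum>i\<in>F0. \<epsilon> i * b i \<omega>) \<in> elems X" by (rule partial_elem)
  have "eventually (\<lambda>F. qnorm X (\<lambda>\<omega>. (\<Sum>i\<in>F. \<epsilon> i * b i \<omega>) - (\<Sum>i\<in>F0. \<epsilon> i * b i \<omega>)) = 0) (finite_subsets_at_top UNIV)"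
    unfolding eventually_finite_subsets_UNIV
  proof (intro exI[of _ F0] conjI allI impI assms(1))
    fix F assume F: "finite F \<and> F0 \<subseteq> F"
    have "(\<Sum>i\<in>F0. \<epsilon> i * b i \<omega>) = (\<Sum>i\<in>F. \<epsilon> i * b i \<omega>)" for \<omega>
      using F assms(2) by (intro sum.mono_neutral_left) auto
    then show "qnorm X (\<lambda>\<omega>. (\<Sum>i\<in>F. \<epsilon> i * b i \<omega>) - (\<Sum>i\<in>F0. \<epsilon> i * b i \<omega>)) = 0" by simp
  qed
  then show "converges_in X (\<lambda>F \<omega>. \<Sum>i\<in>F. \<epsilon> i * b i \<omega>) (\<lambda>\<omega>. \<Sum>i\<in>F0. \<epsilon> i * b i \<omega>) (finite_subsets_at_top UNIV)"
    unfolding converges_in_def by (rule tendsto_eventually)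
qed

text \<open>A gliding hump: disjoint blocks with large sums would combine into one bounded multiplier
  whose series diverges.\<close>

lemma uniform_tail:
  assumes e: "0 < e"
  obtains F0 where "finite F0" "\<And>\<epsilon>. (\<And>i. cmod (\<epsilon> i) \<le> 1) \<Longrightarrow> (\<And>i. i \<in> F0 \<Longrightarrow> \<epsilon> i = 0) \<Longrightarrow> qnorm X (T \<epsilon>) \<le> e"
proof (rule ccontr)
  assume neg: "\<not> thesis"
  note tail = that
  \<comment> \<open>Truncating a multiplier to a finite block costs one quasi-triangle inequality:
    from e / K > e' + ... with e / K = 2 e' a block sum larger than e' remains.\<close>
  define e' where "e' = e / (2 * K)"
  have e': "0 < e'" using e K_pos by (simp add: e'_def)
  have step: "\<exists>p. (\<forall>i. cmod (fst p i) \<le> 1) \<and> finite (snd p) \<and> snd p \<inter> F0 = {} \<and>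
      e' < qnorm X (\<lambda>\<omega>. \<Sum>i\<in>snd p. fst p i * b i \<omega>)" if F0: "finite F0" for F0
  proof -
    have "\<exists>\<epsilon>. (\<forall>i. cmod (\<epsilon> i) \<le> 1) \<and> (\<forall>i\<in>F0. \<epsilon> i = 0) \<and> e < qnorm X (T \<epsilon>)"
    proof (rule ccontr)
      assume n: "\<nexists>\<epsilon>. (\<forall>i. cmod (\<epsilon> i) \<le> 1) \<and> (\<forall>i\<in>F0. \<epsilon> i = 0) \<and> e < qnorm X (T \<epsilon>)"
      have thesis
      proof (rule tail[OF F0])
        fix \<epsilon> :: "int \<Rightarrow> complex"
        assume "\<And>i. cmod (\<epsilon> i) \<le> 1" "\<And>i. i \<in> F0 \<Longrightarrow> \<epsilon> i = 0"
        then have "\<not> e < qnorm X (T \<epsilon>)" using n by blast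
        then show "qnorm X (T \<epsilon>) \<le> e" by simp
      qed
      with neg show False ..
    qed
    then obtain \<epsilon> where \<epsilon>: "\<And>i. cmod (\<epsilon> i) \<le> 1" "\<And>i. i \<in> F0 \<Longrightarrow> \<epsilon> i = 0" "e < qnorm X (T \<epsilon>)"
      by blast
    have bd: "bounded (range \<epsilon>)" using \<epsilon>(1) by (rule bounded_rangeI)
    from T_converges[OF bd, unfolded converges_in_def]
    have "eventually (\<lambda>F. qnorm X (\<lambda>\<omega>. (\<Sum>i\<in>F. \<epsilon> i * b i \<omega>) - T \<epsilon> \<omega>) < e') (finite_subsets_at_top UNIV)"
      using e' by (intro order_tendstoD)
    then obtain F where F: "finite F" "qnorm X (\<lambda>\<omega>. (\<Sum>i\<in>F. \<epsilon> i * b i \<omega>) - T \<epsilon> \<omega>) < e'"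
      unfolding eventually_finite_subsets_UNIV by blast
    have eq: "(\<Sum>i\<in>F - F0. \<epsilon> i * b i \<omega>) = (\<Sum>i\<in>F. \<epsilon> i * b i \<omega>)" for \<omega>
      using F(1) \<epsilon>(2) by (intro sum.mono_neutral_left) auto
    have "qnorm X (T \<epsilon>) \<le> K * (qnorm X (\<lambda>\<omega>. T \<epsilon> \<omega> - (\<Sum>i\<in>F. \<epsilon> i * b i \<omega>)) + qnorm X (\<lambda>\<omega>. \<Sum>i\<in>F. \<epsilon> i * b i \<omega>))"
      using quasi_triangle[OF diff_closed[OF T_elem[OF bd] partial_elem[of \<epsilon> F]] partial_elem[of \<epsilon> F]] by simp
    then have "e / K < e' + qnorm X (\<lambda>\<omega>. \<Sum>i\<in>F. \<epsilon> i * b i \<omega>)"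
      using \<epsilon>(3) F(2) qnorm_diff_commute[OF T_elem[OF bd] partial_elem, of \<epsilon> F] K_pos
      by (smt (verit) mult.commute mult_less_cancel_right_pos nonzero_eq_divide_eq mult_strict_left_mono)
    moreover have "e / K = 2 * e'" by (simp add: e'_def)
    ultimately have "e' < qnorm X (\<lambda>\<omega>. \<Sum>i\<in>F. \<epsilon> i * b i \<omega>)" by linarith
    then show ?thesis
      using \<epsilon>(1) F(1) by (intro exI[of _ "(\<epsilon>, F - F0)"]) (auto simp: eq)
  qed
  then have "\<forall>F0\<in>Collect finite. \<exists>p. (\<forall>i. cmod (fst p i) \<le> 1) \<and> finite (snd p) \<and> snd p \<inter> F0 = {} \<and>
      e' < qnorm X (\<lambda>\<omega>. \<Sum>i\<in>snd p. fst p i * b i \<omega>)" by simp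
  from bchoice[OF this] obtain p where p: "\<forall>F0\<in>Collect finite. (\<forall>i. cmod (fst (p F0) i) \<le> 1) \<and> finite (snd (p F0)) \<and> snd (p F0) \<inter> F0 = {} \<and>
      e' < qnorm X (\<lambda>\<omega>. \<Sum>i\<in>snd (p F0). fst (p F0) i * b i \<omega>)" ..
  \<comment> \<open>S n collects the first n blocks; each new block is taken disjoint from
    it.\<close>
  define S where "S = rec_nat {} (\<lambda>_ F. F \<union> snd (p F))"
  have S: "S 0 = {}" "S (Suc n) = S n \<union> snd (p (S n))" for n by (simp_all add: S_def)
  have finS: "finite (S n)" for n by (induction n) (use S p in auto)
  define G where "G n = snd (p (S n))" for n
  define \<epsilon>n where "\<epsilon>n n = fst (p (S n))" for n
  have pn: "cmod (\<epsilon>n n i) \<le> 1" "finite (G n)" "G n \<inter> S n = {}"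
      "e' < qnorm X (\<lambda>\<omega>. \<Sum>i\<in>G n. \<epsilon>n n i * b i \<omega>)" for n i
    using p finS[of n] by (auto simp: G_def \<epsilon>n_def)
  have Smono: "S m \<subseteq> S n" if "m \<le> n" for m n
    using that by (induction rule: dec_induct) (auto simp: S)
  have GS: "G m \<subseteq> S n" if "m < n" for m n
  proof -
    have "G m \<subseteq> S (Suc m)" by (auto simp: S G_def)
    then show ?thesis using Smono[of "Suc m" n] that by auto
  qed
  have disj: "m = n" if "i \<in> G m" "i \<in> G n" for i m n
    using GS[of m n] GS[of n m] pn(3)[of m] pn(3)[of n] that by (cases m n rule: linorder_cases) blast+
  define \<epsilon> where "\<epsilon> i = (if \<exists>n. i \<in> G n then \<epsilon>n (THE n. i \<in> G n) i else 0)" for i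
  have \<epsilon>G: "\<epsilon> i = \<epsilon>n n i" if "i \<in> G n" for i n
  proof -
    have "(THE n. i \<in> G n) = n" using that disj by (intro the_equality) auto
    then show ?thesis using that by (auto simp: \<epsilon>_def)
  qed
  have "cmod (\<epsilon> i) \<le> 1" for i by (simp add: \<epsilon>_def pn)
  then have bd: "bounded (range \<epsilon>)" by (rule bounded_rangeI)
  define e'' where "e'' = e' / (2 * K)"
  have e'': "0 < e''" using e' K_pos by (simp add: e''_def)
  from T_converges[OF bd, unfolded converges_in_def]
  have "eventually (\<lambda>F. qnorm X (\<lambda>\<omega>. (\<Sum>i\<in>F. \<epsilon> i * b i \<omega>) - T \<epsilon> \<omega>) < e'') (finite_subsets_at_top UNIV)"
    using e'' by (intro order_tendstoD)
  then obtain F1 where F1: "finite F1" "\<And>F. finite F \<Longrightarrow> F1 \<subseteq> F \<Longrightarrow> qnorm X (\<lambda>\<omega>. (\<Sum>i\<in>F. \<epsilon> i * b i \<omega>) - T \<epsilon> \<omega>) < e''"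
    unfolding eventually_finite_subsets_UNIV by blast
  have "\<exists>n. G n \<inter> F1 = {}"
  proof (rule ccontr)
    assume "\<nexists>n. G n \<inter> F1 = {}"
    then have "\<forall>n. \<exists>i. i \<in> G n \<inter> F1" by blast
    from choice[OF this] obtain g where g: "\<And>n. g n \<in> G n \<inter> F1" by blast
    have "inj g" using g disj by (intro injI) (metis IntD1)
    moreover have "range g \<subseteq> F1" using g by blast
    ultimately show False using F1(1) finite_imageD[of g UNIV] finite_subset infinite_UNIV_nat by blast
  qed
  then obtain n where n: "G n \<inter> F1 = {}" ..
  have eq: "(\<Sum>i\<in>F1 \<union> G n. \<epsilon> i * b i \<omega>) - (\<Sum>i\<in>F1. \<epsilon> i * b i \<omega>) = (\<Sum>i\<in>G n. \<epsilon>n n i * b i \<omega>)" for \<omega>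
    using sum.union_disjoint[OF F1(1) pn(2)[of n], of "\<lambda>i. \<epsilon> i * b i \<omega>"] n \<epsilon>G by (simp add: Int_commute)
  \<comment> \<open>Among infinitely many disjoint blocks one misses F1. Its sum is a difference of
    two partial sums beyond F1, both within e'' of the limit, so it is at most e'.\<close>
  have "qnorm X (\<lambda>\<omega>. (\<Sum>i\<in>F1 \<union> G n. \<epsilon> i * b i \<omega>) - (\<Sum>i\<in>F1. \<epsilon> i * b i \<omega>)) \<le>
      K * (qnorm X (\<lambda>\<omega>. (\<Sum>i\<in>F1 \<union> G n. \<epsilon> i * b i \<omega>) - T \<epsilon> \<omega>) + qnorm X (\<lambda>\<omega>. T \<epsilon> \<omega> - (\<Sum>i\<in>F1. \<epsilon> i * b i \<omega>)))"
    by (rule quasi_triangle3[OF partial_elem T_elem[OF bd] partial_elem])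
  also have "\<dots> \<le> K * (e'' + e'')"
    using F1(2)[of "F1 \<union> G n"] F1(2)[of F1] F1(1) pn(2)[of n] qnorm_diff_commute[OF T_elem[OF bd] partial_elem, of \<epsilon> F1]
    by (intro mult_left_mono add_mono K_nonneg) (auto intro: less_imp_le)
  also have "\<dots> = e'" using K_pos by (simp add: e''_def)
  finally show False using pn(4)[of n] by (simp add: eq)
qed

text \<open>Coordinatewise convergence of multipliers in the unit ball is enough: outside a finite
  set the sums are uniformly small, and on the finite set the multipliers converge uniformly. Norm
  convergence would be too much to ask, as 2^(it) is not continuous in t uniformly over all
  exponents.\<close>

lemma T_continuous:
  assumes "eventually (\<lambda>t. \<forall>i. cmod (\<epsilon> t i) \<le> 1) G" "\<And>i. cmod (\<delta> i) \<le> 1" "\<And>i. ((\<lambda>t. \<epsilon> t i) \<longlongrightarrow> \<delta> i) G"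
  shows "((\<lambda>t. qnorm X (\<lambda>\<omega>. T (\<epsilon> t) \<omega> - T \<delta> \<omega>)) \<longlongrightarrow> 0) G"
proof (rule order_tendstoI)
  fix x :: real assume x: "x < 0"
  show "eventually (\<lambda>t. x < qnorm X (\<lambda>\<omega>. T (\<epsilon> t) \<omega> - T \<delta> \<omega>)) G"
    using assms(1)
  proof eventually_elim
    case (elim t)
    have "0 \<le> qnorm X (\<lambda>\<omega>. T (\<epsilon> t) \<omega> - T \<delta> \<omega>)"
      using elim assms(2) by (intro qnorm_ge_0 diff_closed T_elem bounded_rangeI[of _ 1]) auto
    then show ?case using x by linarith
  qed
next
  fix e :: real assume e: "0 < e"
  define e' where "e' = e / (4 * K)"
  have e': "0 < e'" using e K_pos by (simp add: e'_def)
  obtain F0 where F0: "finite F0" "\<And>\<epsilon>. (\<And>i. cmod (\<epsilon> i) \<le> 1) \<Longrightarrow> (\<And>i. i \<in> F0 \<Longrightarrow> \<epsilon> i = 0) \<Longrightarrow> qnorm X (T \<epsilon>) \<le> e' / 2"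
    using uniform_tail[of "e' / 2"] e' by auto
  define d where "d = e' / (C + 1)"
  have d: "0 < d" "C * d \<le> e'" using e' C_nonneg by (auto simp: d_def field_simps)
  have "eventually (\<lambda>t. \<forall>i\<in>F0. dist (\<epsilon> t i) (\<delta> i) < d) G"
    using F0(1) assms(3) d(1) by (auto simp: eventually_ball_finite_distrib tendsto_iff)
  then show "eventually (\<lambda>t. qnorm X (\<lambda>\<omega>. T (\<epsilon> t) \<omega> - T \<delta> \<omega>) < e) G"
    using assms(1)
  proof eventually_elim
    case (elim t)
    have bd: "bounded (range (\<epsilon> t))" "bounded (range \<delta>)"
      using elim(2) assms(2) by (auto intro: bounded_rangeI)
    define u where "u i = (if i \<in> F0 then \<epsilon> t i - \<delta> i else 0)" for i
    \<comment> \<open>Halving keeps the difference of two multipliers in the unit ball, where the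
      uniform tail estimate applies.\<close>
    define v where "v i = (if i \<in> F0 then 0 else (\<epsilon> t i - \<delta> i) / 2)" for i
    have u: "cmod (u i) \<le> d" for i using elim(1) d by (auto simp: u_def dist_norm intro: less_imp_le)
    have v: "cmod (v i) \<le> 1" for i
      using norm_triangle_ineq4[of "\<epsilon> t i" "\<delta> i"] elim(2) assms(2)[of i] by (simp add: v_def norm_divide) (smt (verit))
    have bdu: "bounded (range u)" and bdv: "bounded (range v)"
      by (rule bounded_rangeI[OF u], rule bounded_rangeI[OF v])
    have qv: "qnorm X (T v) \<le> e' / 2" by (rule F0(2)[OF v]) (simp add: v_def)
    have uv: "(\<lambda>i. u i + 2 * v i) = (\<lambda>i. \<epsilon> t i - \<delta> i)" by (auto simp: u_def v_def)
    have "AE \<omega> in M. T (\<epsilon> t) \<omega> - T \<delta> \<omega> = T u \<omega> + 2 * T v \<omega>"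
      using T_diff[OF bd] T_add_scale[OF bdu bdv, of 2] unfolding uv by eventually_elim simp
    then have "qnorm X (\<lambda>\<omega>. T (\<epsilon> t) \<omega> - T \<delta> \<omega>) = qnorm X (\<lambda>\<omega>. T u \<omega> + 2 * T v \<omega>)"
      using bd bdu bdv by (intro AE_eq_closed(2) add_elem scale_elem T_elem meas[OF diff_closed])
    also have "\<dots> \<le> K * (qnorm X (T u) + qnorm X (\<lambda>\<omega>. 2 * T v \<omega>))"
      using bdu bdv by (intro quasi_triangle scale_elem T_elem)
    also have "\<dots> \<le> K * (e' + 2 * (e' / 2))"
      using T_le[of u d, OF u] d(2) qv K_nonneg by (intro mult_left_mono add_mono) (auto simp: qnorm_mult[OF T_elem[OF bdv]])
    also have "\<dots> < e" using K_pos e by (simp add: e'_def)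
    finally show ?case .
  qed
qed

lemma T_sum:
  fixes n :: nat
  assumes "\<And>k. k < n \<Longrightarrow> bounded (range (\<epsilon> k))"
  shows "bounded (range (\<lambda>i. \<Sum>k<n. c k * \<epsilon> k i)) \<and>
    (AE \<omega> in M. T (\<lambda>i. \<Sum>k<n. c k * \<epsilon> k i) \<omega> = (\<Sum>k<n. c k * T (\<epsilon> k) \<omega>))"
  using assms
proof (induction n)
  case 0
  have "AE \<omega> in M. T (\<lambda>_. 0) \<omega> = (\<Sum>i\<in>{}. 0 * b i \<omega>)" by (rule T_finite) auto
  then show ?case by (simp add: bounded_rangeI[of _ 0])
next
  case (Suc n)
  have IH: "bounded (range (\<lambda>i. \<Sum>k<n. c k * \<epsilon> k i))"
    "AE \<omega> in M. T (\<lambda>i. \<Sum>k<n. c k * \<epsilon> k i) \<omega> = (\<Sum>k<n. c k * T (\<epsilon> k) \<omega>)"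
    using Suc by auto
  have bn: "bounded (range (\<epsilon> n))" using Suc.prems by simp
  obtain B1 where B1: "\<And>i. cmod (\<Sum>k<n. c k * \<epsilon> k i) \<le> B1" using IH(1) by (auto simp: bounded_iff)
  obtain B2 where B2: "\<And>i. cmod (\<epsilon> n i) \<le> B2" using bn by (auto simp: bounded_iff)
  have "cmod ((\<Sum>k<n. c k * \<epsilon> k i) + c n * \<epsilon> n i) \<le> B1 + cmod (c n) * B2" for i
    using norm_triangle_ineq[of "\<Sum>k<n. c k * \<epsilon> k i" "c n * \<epsilon> n i"] B1[of i] mult_left_mono[OF B2[of i], of "cmod (c n)"]
    by (simp add: norm_mult)
  then have "bounded (range (\<lambda>i. (\<Sum>k<n. c k * \<epsilon> k i) + c n * \<epsilon> n i))" by (rule bounded_rangeI)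
  moreover have "AE \<omega> in M. T (\<lambda>i. (\<Sum>k<n. c k * \<epsilon> k i) + c n * \<epsilon> n i) \<omega> = (\<Sum>k<n. c k * T (\<epsilon> k) \<omega>) + c n * T (\<epsilon> n) \<omega>"
    using IH(2) T_add_scale[OF IH(1) bn, of "c n"] by eventually_elim simp
  ultimately show ?case by simp
qed

end

section \<open>The analytic function of an admissible series\<close>

lemma power_over_fact_le_exp:
  fixes x :: real
  assumes "0 \<le> x"
  shows "x ^ n / fact n \<le> exp x"
proof -
  have "(\<Sum>k\<in>{n}. x ^ k / fact k) \<le> (\<Sum>k. x ^ k / fact k)"
    by (rule sum_le_suminf) (use assms summable_exp_generic[of x] in \<open>auto simp: field_simps\<close>)
  also have "\<dots> = exp x" by (simp add: exp_def field_simps)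
  finally show ?thesis by simp
qed

text \<open>The bound trades growth in u for decay in n, via |u|^n / n! <= 4^(-n) exp (4 |u|). The
  growth exp (5 |u|) is harmless later, where it meets exponentially decaying multipliers.\<close>

lemma exp_remainder_bound:
  fixes u :: complex
  assumes "0 < n"
  shows "cmod (exp u - (\<Sum>k<n. u ^ k / fact k)) \<le> n * (1/4) ^ n * exp (5 * cmod u)"
proof -
  obtain m where m: "n = Suc m" using assms by (cases n) auto
  have "cmod (exp u - (\<Sum>k\<le>m. u ^ k / fact k)) \<le> exp \<bar>Re u\<bar> * (cmod u) ^ Suc m / fact m"
    by (rule Taylor_exp)
  also have "\<dots> = exp \<bar>Re u\<bar> * (Suc m * (1/4) ^ Suc m * ((4 * cmod u) ^ Suc m / fact (Suc m)))"
  proof -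
    have "(1/4) ^ Suc m * (4 * cmod u) ^ Suc m = cmod u ^ Suc m"
      by (simp only: power_mult_distrib[symmetric]) simp
    moreover have "real (Suc m) / fact (Suc m) = 1 / fact m" by (simp del: of_nat_Suc)
    moreover have "A * q * (r / F) = A / F * (q * r)" for A q r F :: real by simp
    ultimately have "Suc m * (1/4) ^ Suc m * ((4 * cmod u) ^ Suc m / fact (Suc m)) = 1 / fact m * cmod u ^ Suc m"
      by (simp only:)
    then show ?thesis by (simp only: times_divide_eq_left mult_1_left times_divide_eq_right)
  qed
  also have "\<dots> \<le> exp (cmod u) * (Suc m * (1/4) ^ Suc m * exp (4 * cmod u))"
    by (intro mult_mono mult_left_mono power_over_fact_le_exp) (auto simp: abs_Re_le_cmod)
  also have "\<dots> = Suc m * (1/4) ^ Suc m * exp (5 * cmod u)"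
    using exp_add[of "cmod u" "4 * cmod u"] by simp
  finally show ?thesis by (simp add: m lessThan_Suc_atMost)
qed

definition dyadic :: "int \<Rightarrow> complex \<Rightarrow> complex" where
  "dyadic i z = exp (of_real (of_int i * ln 2) * z)"

lemma dyadic_add: "dyadic i (z + w) = dyadic i z * dyadic i w"
  by (simp add: dyadic_def distrib_left exp_add)

lemma dyadic_of_real: "dyadic i (of_real x) = of_real (2 powr (of_int i * x))"
  by (simp add: dyadic_def powr_def mult_ac flip: exp_of_real)

lemma cmod_dyadic: "cmod (dyadic i z) = exp (of_int i * ln 2 * Re z)"
  by (simp add: dyadic_def)

lemma dyadic_shift: "dyadic i (z + w) = dyadic i z * exp (of_real (of_int i * ln 2) * w)"
  by (simp add: dyadic_add) (simp add: dyadic_def)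

text \<open>For z inside the strip the series of 2^(i (z - \<theta>)) a_i need not converge in
  either end point space. For i <= 0 the factor 2^(i z) is bounded against the weights of X0, and
  for i > 0 the factor 2^(i (z - 1)) against those of X1. The index set I is everything for the full
  function and finite for its approximants.\<close>

definition lower_part :: "int set \<Rightarrow> complex \<Rightarrow> int \<Rightarrow> complex" where
  "lower_part I z i = (if i \<in> I \<and> i \<le> 0 then dyadic i z else 0)"

definition upper_part :: "int set \<Rightarrow> complex \<Rightarrow> int \<Rightarrow> complex" where
  "upper_part I z i = (if i \<in> I \<and> 0 < i then dyadic i (z - 1) else 0)"

definition whole_part :: "int set \<Rightarrow> real \<Rightarrow> int \<Rightarrow> complex" where
  "whole_part I t i = (if i \<in> I then dyadic i (Complex 0 t) else 0)"

lemma cmod_lower_part: "x \<le> Re z \<Longrightarrow> cmod (lower_part I z i) \<le> exp (- (\<bar>of_int i\<bar> * ln 2 * x))"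
  using mult_left_mono_neg[of x "Re z" "of_int i * ln 2"]
  by (auto simp: lower_part_def cmod_dyadic mult_nonpos_nonneg)

lemma cmod_upper_part: "Re z \<le> 1 - x \<Longrightarrow> cmod (upper_part I z i) \<le> exp (- (\<bar>of_int i\<bar> * ln 2 * x))"
  using mult_left_mono[of "Re z - 1" "- x" "of_int i * ln 2"]
  by (auto simp: upper_part_def cmod_dyadic)

lemma cmod_lower_part_le_1: "0 \<le> Re z \<Longrightarrow> cmod (lower_part I z i) \<le> 1"
  using cmod_lower_part[of 0 z] by simp

lemma cmod_upper_part_le_1: "Re z \<le> 1 \<Longrightarrow> cmod (upper_part I z i) \<le> 1"
  using cmod_upper_part[of z 0] by simp

lemma cmod_whole_part_le_1: "cmod (whole_part I t i) \<le> 1"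
  by (simp add: whole_part_def cmod_dyadic)

lemma lower_part_shift: "lower_part I (z + w) i = lower_part I z i * exp (of_real (of_int i * ln 2) * w)"
  by (simp add: lower_part_def dyadic_shift)

lemma upper_part_shift: "upper_part I (z + w) i = upper_part I z i * exp (of_real (of_int i * ln 2) * w)"
  using dyadic_shift[of i "z - 1" w] by (simp add: upper_part_def algebra_simps)

text \<open>Taylor expansion of 2^(i w) with errors independent of i. The multiplier decays like
  2^(-|i| x), where x is at most the distance to the boundary, and |w| <= x / 10 makes this decay
  beat the factor exp (5 |u|) of the remainder.\<close>

lemma multiplier_taylor_bounds:
  fixes g :: complex and i :: int and x r :: real
  assumes g: "cmod g \<le> exp (- (\<bar>of_int i\<bar> * ln 2 * x))" and x: "0 < x"
  shows "cmod (g * (of_real (of_int i * ln 2) ^ k / fact k)) \<le> (1 / x) ^ k"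
    and "0 < n \<Longrightarrow> cmod w \<le> x / 10 \<Longrightarrow>
      cmod ((\<Sum>k<n. w ^ k * (g * (of_real (of_int i * ln 2) ^ k / fact k))) - g * exp (of_real (of_int i * ln 2) * w)) \<le> n * (1/4) ^ n"
proof -
  define s where "s = \<bar>of_int i\<bar> * ln (2::real)"
  have s: "0 \<le> s" by (simp add: s_def)
  have L: "cmod (of_real (of_int i * ln 2)) = s" by (simp add: s_def norm_mult)
  have "cmod (g * (of_real (of_int i * ln 2) ^ k / fact k)) = cmod g * (s ^ k / fact k)"
    by (simp only: norm_mult norm_divide norm_power L) simp
  also have "\<dots> \<le> exp (- (s * x)) * (s ^ k / fact k)"
    using g s by (intro mult_right_mono) (auto simp: s_def)
  also have "s ^ k / fact k = (1 / x) ^ k * ((s * x) ^ k / fact k)"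
    using x by (simp add: power_mult_distrib power_one_over)
  also have "exp (- (s * x)) * ((1 / x) ^ k * ((s * x) ^ k / fact k)) \<le> exp (- (s * x)) * ((1 / x) ^ k * exp (s * x))"
    using s x by (intro mult_left_mono power_over_fact_le_exp) auto
  also have "\<dots> = (1 / x) ^ k" by (simp add: exp_minus)
  finally show "cmod (g * (of_real (of_int i * ln 2) ^ k / fact k)) \<le> (1 / x) ^ k" .
  show "cmod ((\<Sum>k<n. w ^ k * (g * (of_real (of_int i * ln 2) ^ k / fact k))) - g * exp (of_real (of_int i * ln 2) * w)) \<le> n * (1/4) ^ n"
    if n: "0 < n" and w: "cmod w \<le> x / 10"
  proof -
    define u where "u = of_real (of_int i * ln 2) * w"
    have "cmod u = s * cmod w" by (simp only: u_def norm_mult L)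
    moreover have "s * cmod w \<le> s * x / 10" using mult_left_mono[OF w s] by simp
    moreover have "0 \<le> s * x" using s x by simp
    ultimately have u: "5 * cmod u \<le> s * x" by linarith
    have "(\<Sum>k<n. w ^ k * (g * (of_real (of_int i * ln 2) ^ k / fact k))) - g * exp (of_real (of_int i * ln 2) * w) =
        - (g * (exp u - (\<Sum>k<n. u ^ k / fact k)))"
      by (simp add: u_def power_mult_distrib sum_distrib_left algebra_simps)
    then have "cmod ((\<Sum>k<n. w ^ k * (g * (of_real (of_int i * ln 2) ^ k / fact k))) - g * exp (of_real (of_int i * ln 2) * w)) =
        cmod g * cmod (exp u - (\<Sum>k<n. u ^ k / fact k))" by (simp only: norm_minus_cancel norm_mult)
    also have "\<dots> \<le> exp (- (s * x)) * (n * (1/4) ^ n * exp (s * x))"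
    proof (rule mult_mono)
      have "cmod (exp u - (\<Sum>k<n. u ^ k / fact k)) \<le> n * (1/4) ^ n * exp (5 * cmod u)" by (rule exp_remainder_bound[OF n])
      also have "\<dots> \<le> n * (1/4) ^ n * exp (s * x)" using u by (intro mult_left_mono) auto
      finally show "cmod (exp u - (\<Sum>k<n. u ^ k / fact k)) \<le> n * (1/4) ^ n * exp (s * x)" .
    qed (use g in \<open>auto simp: s_def\<close>)
    also have "\<dots> = n * (1/4) ^ n" by (simp add: exp_minus)
    finally show ?thesis .
  qed
qed

locale couple_series = lattice_couple M X0 X1 K
  for M :: "'a measure" and X0 X1 :: "'a fspace" and K :: real +
  fixes a :: "int \<Rightarrow> 'a \<Rightarrow> complex" and \<theta> C :: real
  assumes a_elem: "a i \<in> elems X0" "a i \<in> elems X1"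
    and series: "series_bounded X0 \<theta> 0 a C" "series_bounded X1 \<theta> 1 a C"
    and \<theta>: "0 < \<theta>" "\<theta> < 1"
begin

definition b0 :: "int \<Rightarrow> 'a \<Rightarrow> complex" where "b0 i = (\<lambda>\<omega>. dyadic i (- of_real \<theta>) * a i \<omega>)"
definition b1 :: "int \<Rightarrow> 'a \<Rightarrow> complex" where "b1 i = (\<lambda>\<omega>. dyadic i (1 - of_real \<theta>) * a i \<omega>)"

sublocale S0: multiplier_series M X0 K b0 C
proof unfold_locales
  show "b0 i \<in> elems X0" for i unfolding b0_def by (intro X0.scale_elem a_elem)
  fix \<epsilon> :: "int \<Rightarrow> complex" assume bd: "bounded (range \<epsilon>)"
  have eq: "weighted_sum \<theta> 0 \<epsilon> a = (\<lambda>F \<omega>. \<Sum>i\<in>F. \<epsilon> i * b0 i \<omega>)"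
    using dyadic_of_real[of _ "- \<theta>"] by (simp add: weighted_sum_def b0_def fun_eq_iff mult.assoc)
  from series(1)[unfolded series_bounded_def, rule_format, OF bd]
  show "\<exists>s\<in>elems X0. converges_in X0 (\<lambda>F \<omega>. \<Sum>i\<in>F. \<epsilon> i * b0 i \<omega>) s (finite_subsets_at_top UNIV) \<and>
        qnorm X0 s \<le> C * (SUP i. cmod (\<epsilon> i))"
    unfolding eq .
qed

sublocale S1: multiplier_series M X1 K b1 C
proof unfold_locales
  show "b1 i \<in> elems X1" for i unfolding b1_def by (intro X1.scale_elem a_elem)
  fix \<epsilon> :: "int \<Rightarrow> complex" assume bd: "bounded (range \<epsilon>)"
  have eq: "weighted_sum \<theta> 1 \<epsilon> a = (\<lambda>F \<omega>. \<Sum>i\<in>F. \<epsilon> i * b1 i \<omega>)"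
    using dyadic_of_real[of _ "1 - \<theta>"] by (simp add: weighted_sum_def b1_def fun_eq_iff mult.assoc)
  from series(2)[unfolded series_bounded_def, rule_format, OF bd]
  show "\<exists>s\<in>elems X1. converges_in X1 (\<lambda>F \<omega>. \<Sum>i\<in>F. \<epsilon> i * b1 i \<omega>) s (finite_subsets_at_top UNIV) \<and>
        qnorm X1 s \<le> C * (SUP i. cmod (\<epsilon> i))"
    unfolding eq .
qed

lemma pair_converges:
  assumes "bounded (range \<epsilon>)" "bounded (range \<delta>)"
  shows "converges_in Z (\<lambda>F \<omega>. \<Sum>i\<in>F. \<epsilon> i * b0 i \<omega> + \<delta> i * b1 i \<omega>) (\<lambda>\<omega>. S0.T \<epsilon> \<omega> + S1.T \<delta> \<omega>) (finite_subsets_at_top UNIV)"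
  unfolding sum.distrib
  using assms by (intro Z.converges_in_add converges_in_X0_sum converges_in_X1_sum X0_sub X1_sub
      S0.partial_elem S1.partial_elem S0.T_elem S1.T_elem S0.T_converges S1.T_converges)

lemma pair_partial_elem: "(\<lambda>\<omega>. \<Sum>i\<in>F. \<epsilon> i * b0 i \<omega> + \<delta> i * b1 i \<omega>) \<in> elems Z"
  unfolding sum.distrib by (intro sum_add_elem S0.partial_elem S1.partial_elem)

lemma pair_elem:
  assumes "bounded (range \<epsilon>)" "bounded (range \<delta>)"
  shows "(\<lambda>\<omega>. S0.T \<epsilon> \<omega> + S1.T \<delta> \<omega>) \<in> elems Z"
  using assms by (intro sum_add_elem S0.T_elem S1.T_elem)

text \<open>Two splittings of a series between X0 and X1 are compared through their finite partial
  sums in X0 + X1.\<close>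

lemma pair_unique:
  assumes "bounded (range \<epsilon>)" "bounded (range \<delta>)" "f \<in> elems Z"
    "converges_in Z (\<lambda>F \<omega>. \<Sum>i\<in>F. \<epsilon> i * b0 i \<omega> + \<delta> i * b1 i \<omega>) f (finite_subsets_at_top UNIV)"
  shows "AE \<omega> in M. S0.T \<epsilon> \<omega> + S1.T \<delta> \<omega> = f \<omega>"
  by (rule Z.converges_in_unique[OF pair_partial_elem pair_elem[OF assms(1,2)] assms(3) _ pair_converges[OF assms(1,2)] assms(4)]) simp

definition interpolant :: "int set \<Rightarrow> complex \<Rightarrow> 'a \<Rightarrow> complex" where
  "interpolant I z = (\<lambda>\<omega>. S0.T (lower_part I z) \<omega> + S1.T (upper_part I z) \<omega>)"

lemma bounded_parts:
  shows bounded_lower: "0 \<le> Re z \<Longrightarrow> bounded (range (lower_part I z))"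
    and bounded_upper: "Re z \<le> 1 \<Longrightarrow> bounded (range (upper_part I z))"
    and bounded_whole: "bounded (range (whole_part I t))"
  using S0.bounded_rangeI cmod_lower_part_le_1 cmod_upper_part_le_1 cmod_whole_part_le_1 by blast+

lemma interpolant_elem: "0 \<le> Re z \<Longrightarrow> Re z \<le> 1 \<Longrightarrow> interpolant I z \<in> elems Z"
  unfolding interpolant_def by (intro pair_elem bounded_parts)

lemma interpolant_norm: "0 \<le> Re z \<Longrightarrow> Re z \<le> 1 \<Longrightarrow> qnorm Z (interpolant I z) \<le> C + C"
proof -
  assume z: "0 \<le> Re z" "Re z \<le> 1"
  have "qnorm Z (interpolant I z) \<le> qnorm X0 (S0.T (lower_part I z)) + qnorm X1 (S1.T (upper_part I z))"
    unfolding interpolant_def using z by (intro sum_add_elem S0.T_elem S1.T_elem bounded_parts)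
  also have "\<dots> \<le> C * 1 + C * 1"
    using z by (intro add_mono S0.T_le S1.T_le cmod_lower_part_le_1 cmod_upper_part_le_1)
  finally show ?thesis by simp
qed

lemma lower_upper_combine:
  "lower_part I z i * b0 i \<omega> + upper_part I z i * b1 i \<omega> = (if i \<in> I then dyadic i (z - of_real \<theta>) * a i \<omega> else 0)"
  using dyadic_add[of i z "- of_real \<theta>"] dyadic_add[of i "z - 1" "1 - of_real \<theta>"]
  by (auto simp: lower_part_def upper_part_def b0_def b1_def)

text \<open>On Re z = 0 all factors 2^(i z) have modulus 1, so the undivided series converges in X0.
  It has the same finite partial sums as the divided one, hence the same sum almost
  everywhere.\<close>

lemma trace_X0: "AE \<omega> in M. interpolant I (Complex 0 t) \<omega> = S0.T (whole_part I t) \<omega>"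
proof -
  have "whole_part I t i * b0 i \<omega> = (if i \<in> I then dyadic i (Complex 0 t - of_real \<theta>) * a i \<omega> else 0)" for i \<omega>
    using dyadic_add[of i "Complex 0 t" "- of_real \<theta>"] by (simp add: whole_part_def b0_def)
  then have eq: "(\<lambda>F \<omega>. \<Sum>i\<in>F. lower_part I (Complex 0 t) i * b0 i \<omega> + upper_part I (Complex 0 t) i * b1 i \<omega>) =
      (\<lambda>F \<omega>. \<Sum>i\<in>F. whole_part I t i * b0 i \<omega>)"
    by (simp add: lower_upper_combine)
  show ?thesis
    unfolding interpolant_def
    by (rule pair_unique, simp_all only: eq)
       (auto intro!: bounded_parts X0_sub S0.T_elem converges_in_X0_sum S0.partial_elem S0.T_converges)
qed

lemma trace_X1: "AE \<omega> in M. interpolant I (Complex 1 t) \<omega> = S1.T (whole_part I t) \<omega>"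
proof -
  have c: "Complex 1 t - of_real \<theta> = Complex 0 t + (1 - of_real \<theta>)" by (simp add: complex_eq_iff)
  have "whole_part I t i * b1 i \<omega> = (if i \<in> I then dyadic i (Complex 1 t - of_real \<theta>) * a i \<omega> else 0)" for i \<omega>
    unfolding c dyadic_add by (simp add: whole_part_def b1_def)
  then have eq: "(\<lambda>F \<omega>. \<Sum>i\<in>F. lower_part I (Complex 1 t) i * b0 i \<omega> + upper_part I (Complex 1 t) i * b1 i \<omega>) =
      (\<lambda>F \<omega>. \<Sum>i\<in>F. whole_part I t i * b1 i \<omega>)"
    by (simp add: lower_upper_combine)
  show ?thesis
    unfolding interpolant_def
    by (rule pair_unique, simp_all only: eq)
       (auto intro!: bounded_parts X1_sub S1.T_elem converges_in_X1_sum S1.partial_elem S1.T_converges)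
qed

lemma closed_stripD: "z \<in> closure open_strip \<Longrightarrow> 0 \<le> Re z" "z \<in> closure open_strip \<Longrightarrow> Re z \<le> 1"
  by (auto simp: closure_open_strip)

text \<open>Each coordinate of the two multiplier sequences is continuous in z, and all stay in the
  unit ball on the closed strip. The uniform tails of multiplier series do the rest.\<close>

lemma interpolant_continuous: "continuous_into Z (closure open_strip) (interpolant I)"
  unfolding continuous_into_def
proof (intro conjI ballI)
  fix z assume z: "z \<in> closure open_strip"
  note z' = closed_stripD[OF z]
  show "interpolant I z \<in> elems Z" by (rule interpolant_elem[OF z'])
  let ?G = "at z within closure open_strip"
  have ev: "eventually (\<lambda>y. y \<in> closure open_strip) ?G" by (simp add: eventually_at_filter)
  have dy: "((\<lambda>y. dyadic i (y - c)) \<longlongrightarrow> dyadic i (z - c)) ?G" for i c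
    unfolding dyadic_def by (intro tendsto_intros)
  have "((\<lambda>y. lower_part I y i) \<longlongrightarrow> lower_part I z i) ?G" for i
    using dy[of i 0] by (cases "i \<in> I \<and> i \<le> 0") (auto simp: lower_part_def)
  moreover have "eventually (\<lambda>y. \<forall>i. cmod (lower_part I y i) \<le> 1) ?G"
    using ev by eventually_elim (use closed_stripD cmod_lower_part_le_1 in blast)
  ultimately have 0: "((\<lambda>y. qnorm X0 (\<lambda>\<omega>. S0.T (lower_part I y) \<omega> - S0.T (lower_part I z) \<omega>)) \<longlongrightarrow> 0) ?G"
    using z' by (intro S0.T_continuous cmod_lower_part_le_1)
  have "((\<lambda>y. upper_part I y i) \<longlongrightarrow> upper_part I z i) ?G" for i
    using dy[of i 1] by (cases "i \<in> I \<and> 0 < i") (auto simp: upper_part_def)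
  moreover have "eventually (\<lambda>y. \<forall>i. cmod (upper_part I y i) \<le> 1) ?G"
    using ev by eventually_elim (use closed_stripD cmod_upper_part_le_1 in blast)
  ultimately have 1: "((\<lambda>y. qnorm X1 (\<lambda>\<omega>. S1.T (upper_part I y) \<omega> - S1.T (upper_part I z) \<omega>)) \<longlongrightarrow> 0) ?G"
    using z' by (intro S1.T_continuous cmod_upper_part_le_1)
  show "converges_in Z (interpolant I) (interpolant I z) ?G"
  proof (rule converges_in_squeeze)
    show "((\<lambda>y. qnorm X0 (\<lambda>\<omega>. S0.T (lower_part I y) \<omega> - S0.T (lower_part I z) \<omega>) +
        qnorm X1 (\<lambda>\<omega>. S1.T (upper_part I y) \<omega> - S1.T (upper_part I z) \<omega>)) \<longlongrightarrow> 0) ?G"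
      using tendsto_add[OF 0 1] by simp
    have eq: "(\<lambda>\<omega>. interpolant I y \<omega> - interpolant I z \<omega>) = (\<lambda>\<omega>. (S0.T (lower_part I y) \<omega> - S0.T (lower_part I z) \<omega>) +
        (S1.T (upper_part I y) \<omega> - S1.T (upper_part I z) \<omega>))" for y
      by (auto simp: interpolant_def)
    show "eventually (\<lambda>y. (\<lambda>\<omega>. interpolant I y \<omega> - interpolant I z \<omega>) \<in> elems Z) ?G"
      using ev
    proof eventually_elim
      case (elim y)
      show ?case by (rule Z.diff_closed[OF interpolant_elem[OF closed_stripD[OF elim]] interpolant_elem[OF z']])
    qed
    show "eventually (\<lambda>y. qnorm Z (\<lambda>\<omega>. interpolant I y \<omega> - interpolant I z \<omega>) \<le>
        qnorm X0 (\<lambda>\<omega>. S0.T (lower_part I y) \<omega> - S0.T (lower_part I z) \<omega>) +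
        qnorm X1 (\<lambda>\<omega>. S1.T (upper_part I y) \<omega> - S1.T (upper_part I z) \<omega>)) ?G"
      using ev
    proof eventually_elim
      case (elim y)
      show ?case unfolding eq
        by (intro sum_add_elem X0.diff_closed X1.diff_closed S0.T_elem S1.T_elem bounded_parts closed_stripD elim z')
    qed
  qed
qed

lemma interpolant_meas: "0 \<le> Re z \<Longrightarrow> Re z \<le> 1 \<Longrightarrow> interpolant I z \<in> borel_measurable M"
  by (rule Z.meas[OF interpolant_elem])

lemma trace_X0_elem: "interpolant I (Complex 0 t) \<in> elems X0" "qnorm X0 (interpolant I (Complex 0 t)) \<le> C"
proof -
  have m: "interpolant I (Complex 0 t) \<in> borel_measurable M" by (rule interpolant_meas) auto
  note T = S0.T_elem[OF bounded_whole[of I t]]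
  show "interpolant I (Complex 0 t) \<in> elems X0" by (rule X0.AE_eq_closed(1)[OF T m trace_X0])
  have "qnorm X0 (interpolant I (Complex 0 t)) = qnorm X0 (S0.T (whole_part I t))"
    by (rule X0.AE_eq_closed(2)[OF T m trace_X0])
  also have "\<dots> \<le> C * 1" by (intro S0.T_le cmod_whole_part_le_1)
  finally show "qnorm X0 (interpolant I (Complex 0 t)) \<le> C" by simp
qed

lemma trace_X1_elem: "interpolant I (Complex 1 t) \<in> elems X1" "qnorm X1 (interpolant I (Complex 1 t)) \<le> C"
proof -
  have m: "interpolant I (Complex 1 t) \<in> borel_measurable M" by (rule interpolant_meas) auto
  note T = S1.T_elem[OF bounded_whole[of I t]]
  show "interpolant I (Complex 1 t) \<in> elems X1" by (rule X1.AE_eq_closed(1)[OF T m trace_X1])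
  have "qnorm X1 (interpolant I (Complex 1 t)) = qnorm X1 (S1.T (whole_part I t))"
    by (rule X1.AE_eq_closed(2)[OF T m trace_X1])
  also have "\<dots> \<le> C * 1" by (intro S1.T_le cmod_whole_part_le_1)
  finally show "qnorm X1 (interpolant I (Complex 1 t)) \<le> C" by simp
qed

lemma trace_X0_diff: "qnorm X0 (\<lambda>\<omega>. interpolant I (Complex 0 s) \<omega> - interpolant J (Complex 0 t) \<omega>) =
    qnorm X0 (\<lambda>\<omega>. S0.T (whole_part I s) \<omega> - S0.T (whole_part J t) \<omega>)"
proof (rule X0.AE_eq_closed(2))
  show "(\<lambda>\<omega>. S0.T (whole_part I s) \<omega> - S0.T (whole_part J t) \<omega>) \<in> elems X0"
    by (intro X0.diff_closed S0.T_elem bounded_whole)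
  show "(\<lambda>\<omega>. interpolant I (Complex 0 s) \<omega> - interpolant J (Complex 0 t) \<omega>) \<in> borel_measurable M"
    by (intro borel_measurable_diff interpolant_meas) auto
  show "AE \<omega> in M. interpolant I (Complex 0 s) \<omega> - interpolant J (Complex 0 t) \<omega> = S0.T (whole_part I s) \<omega> - S0.T (whole_part J t) \<omega>"
    using trace_X0[of I s] trace_X0[of J t] by eventually_elim simp
qed

lemma trace_X1_diff: "qnorm X1 (\<lambda>\<omega>. interpolant I (Complex 1 s) \<omega> - interpolant J (Complex 1 t) \<omega>) =
    qnorm X1 (\<lambda>\<omega>. S1.T (whole_part I s) \<omega> - S1.T (whole_part J t) \<omega>)"
proof (rule X1.AE_eq_closed(2))
  show "(\<lambda>\<omega>. S1.T (whole_part I s) \<omega> - S1.T (whole_part J t) \<omega>) \<in> elems X1"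
    by (intro X1.diff_closed S1.T_elem bounded_whole)
  show "(\<lambda>\<omega>. interpolant I (Complex 1 s) \<omega> - interpolant J (Complex 1 t) \<omega>) \<in> borel_measurable M"
    by (intro borel_measurable_diff interpolant_meas) auto
  show "AE \<omega> in M. interpolant I (Complex 1 s) \<omega> - interpolant J (Complex 1 t) \<omega> = S1.T (whole_part I s) \<omega> - S1.T (whole_part J t) \<omega>"
    using trace_X1[of I s] trace_X1[of J t] by eventually_elim simp
qed

lemma whole_part_tendsto: "((\<lambda>s. whole_part I s i) \<longlongrightarrow> whole_part I t i) (at t)"
proof -
  have "Complex 0 s = \<i> * of_real s" for s by (simp add: complex_eq_iff)
  then show ?thesis by (auto simp: whole_part_def dyadic_def intro!: tendsto_intros)
qed

lemma trace_X0_continuous: "continuous_into X0 UNIV (\<lambda>t. interpolant I (Complex 0 t))"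
  unfolding continuous_into_def converges_in_def trace_X0_diff
  by (intro conjI ballI trace_X0_elem S0.T_continuous whole_part_tendsto always_eventually allI cmod_whole_part_le_1)

lemma trace_X1_continuous: "continuous_into X1 UNIV (\<lambda>t. interpolant I (Complex 1 t))"
  unfolding continuous_into_def converges_in_def trace_X1_diff
  by (intro conjI ballI trace_X1_elem S1.T_continuous whole_part_tendsto always_eventually allI cmod_whole_part_le_1)

text \<open>The Taylor coefficients are again multiplier series, with multipliers \<alpha> and
  \<beta> obtained by differentiating each exponential. Uniform convergence of the multipliers in
  the supremum norm gives uniform convergence in X0 + X1 on the disc of radius x / 10.\<close>

lemma interpolant_analytic: "analytic_into Z open_strip (interpolant I)"
  unfolding analytic_into_def
proof (intro conjI ballI)
  fix z assume "z \<in> open_strip"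
  then show "interpolant I z \<in> elems Z" by (intro interpolant_elem) (auto simp: open_strip_def)
next
  fix z0 assume z0: "z0 \<in> open_strip"
  define x where "x = min (Re z0) (1 - Re z0)"
  have x: "0 < x" "x \<le> Re z0" "Re z0 \<le> 1 - x" using z0 by (auto simp: x_def open_strip_def min_def)
  define tl where "tl k i = of_real (of_int i * ln 2) ^ k / (fact k :: complex)" for k and i :: int
  define \<alpha> where "\<alpha> k i = lower_part I z0 i * tl k i" for k i
  define \<beta> where "\<beta> k i = upper_part I z0 i * tl k i" for k i
  have b\<alpha>: "cmod (\<alpha> k i) \<le> (1 / x) ^ k" and b\<beta>: "cmod (\<beta> k i) \<le> (1 / x) ^ k" for k i
    unfolding \<alpha>_def \<beta>_def tl_def
    by (rule multiplier_taylor_bounds(1)[OF cmod_lower_part[OF x(2)] x(1)],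
        rule multiplier_taylor_bounds(1)[OF cmod_upper_part[OF x(3)] x(1)])
  have bd\<alpha>: "bounded (range (\<alpha> k))" and bd\<beta>: "bounded (range (\<beta> k))" for k
    by (rule S0.bounded_rangeI[OF b\<alpha>], rule S0.bounded_rangeI[OF b\<beta>])
  define c where "c k = (\<lambda>\<omega>. S0.T (\<alpha> k) \<omega> + S1.T (\<beta> k) \<omega>)" for k
  show "\<exists>r>0. \<exists>c. ball z0 r \<subseteq> open_strip \<and> (\<forall>k. c k \<in> elems Z) \<and>
      uniform_limit (ball z0 r)
        (\<lambda>n z. qnorm Z (\<lambda>\<omega>. (\<Sum>k<n. (z - z0) ^ k * c k \<omega>) - interpolant I z \<omega>)) (\<lambda>_. 0) sequentially"
  proof (intro exI[of _ "x / 10"] exI[of _ c] conjI allI)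
    show "0 < x / 10" using x by simp
    have strip: "0 \<le> Re z \<and> Re z \<le> 1 \<and> z \<in> open_strip" if "z \<in> ball z0 (x / 10)" for z
    proof -
      have "\<bar>Re (z - z0)\<bar> < x / 10" using that abs_Re_le_cmod[of "z - z0"] by (simp add: dist_norm norm_minus_commute)
      then have "0 < Re z" "Re z < 1" using x by (auto simp: abs_if split: if_splits)
      then show ?thesis by (simp add: open_strip_def)
    qed
    show "ball z0 (x / 10) \<subseteq> open_strip" using strip by blast
    show "c k \<in> elems Z" for k unfolding c_def by (rule pair_elem[OF bd\<alpha> bd\<beta>])
    have est: "0 \<le> qnorm Z (\<lambda>\<omega>. (\<Sum>k<n. (z - z0) ^ k * c k \<omega>) - interpolant I z \<omega>) \<and>
        qnorm Z (\<lambda>\<omega>. (\<Sum>k<n. (z - z0) ^ k * c k \<omega>) - interpolant I z \<omega>) \<le> 2 * C * (n * (1/4) ^ n)"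
      if z: "z \<in> ball z0 (x / 10)" and n: "0 < n" for z n
    proof -
      define w where "w = z - z0"
      have w: "cmod w \<le> x / 10" using z by (simp add: w_def dist_norm norm_minus_commute)
      have zw: "z = z0 + w" by (simp add: w_def)
      have S: "bounded (range (\<lambda>i. \<Sum>k<n. w ^ k * \<alpha> k i))" "AE \<omega> in M. S0.T (\<lambda>i. \<Sum>k<n. w ^ k * \<alpha> k i) \<omega> = (\<Sum>k<n. w ^ k * S0.T (\<alpha> k) \<omega>)"
        "bounded (range (\<lambda>i. \<Sum>k<n. w ^ k * \<beta> k i))" "AE \<omega> in M. S1.T (\<lambda>i. \<Sum>k<n. w ^ k * \<beta> k i) \<omega> = (\<Sum>k<n. w ^ k * S1.T (\<beta> k) \<omega>)"
        using S0.T_sum[of n \<alpha> "\<lambda>k. w ^ k"] S1.T_sum[of n \<beta> "\<lambda>k. w ^ k"] bd\<alpha> bd\<beta> by blast+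
      have bl: "bounded (range (lower_part I z))" and bu: "bounded (range (upper_part I z))"
        using strip[OF z] bounded_parts by blast+
      define u where "u = (\<lambda>\<omega>. S0.T (\<lambda>i. \<Sum>k<n. w ^ k * \<alpha> k i) \<omega> - S0.T (lower_part I z) \<omega>)"
      define v where "v = (\<lambda>\<omega>. S1.T (\<lambda>i. \<Sum>k<n. w ^ k * \<beta> k i) \<omega> - S1.T (upper_part I z) \<omega>)"
      have uX: "u \<in> elems X0" unfolding u_def by (intro X0.diff_closed S0.T_elem S bl)
      have vX: "v \<in> elems X1" unfolding v_def by (intro X1.diff_closed S1.T_elem S bu)
      have "qnorm X0 u \<le> C * (n * (1/4) ^ n)"
        unfolding u_def
      proof (rule S0.T_diff_norm[OF S(1) bl])
        show "cmod ((\<Sum>k<n. w ^ k * \<alpha> k i) - lower_part I z i) \<le> n * (1/4) ^ n" for i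
          unfolding zw lower_part_shift \<alpha>_def tl_def
          by (rule multiplier_taylor_bounds(2)[OF cmod_lower_part[OF x(2)] x(1) n w])
      qed
      moreover have "qnorm X1 v \<le> C * (n * (1/4) ^ n)"
        unfolding v_def
      proof (rule S1.T_diff_norm[OF S(3) bu])
        show "cmod ((\<Sum>k<n. w ^ k * \<beta> k i) - upper_part I z i) \<le> n * (1/4) ^ n" for i
          unfolding zw upper_part_shift \<beta>_def tl_def
          by (rule multiplier_taylor_bounds(2)[OF cmod_upper_part[OF x(3)] x(1) n w])
      qed
      moreover have uv: "AE \<omega> in M. (\<Sum>k<n. (z - z0) ^ k * c k \<omega>) - interpolant I z \<omega> = u \<omega> + v \<omega>"
        using S(2,4)
        by eventually_elim (simp add: u_def v_def interpolant_def c_def w_def[symmetric] sum.distrib distrib_left)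
      moreover have el: "(\<lambda>\<omega>. (\<Sum>k<n. (z - z0) ^ k * c k \<omega>) - interpolant I z \<omega>) \<in> elems Z"
        using strip[OF z] unfolding c_def
        by (intro Z.diff_closed Z.sum_closed Z.scale_elem pair_elem bd\<alpha> bd\<beta> interpolant_elem) auto
      ultimately show ?thesis
        using sum_elemI(2)[OF uX vX Z.meas[OF el] uv] Z.qnorm_ge_0[OF el] by linarith
    qed
    show "uniform_limit (ball z0 (x / 10))
        (\<lambda>n z. qnorm Z (\<lambda>\<omega>. (\<Sum>k<n. (z - z0) ^ k * c k \<omega>) - interpolant I z \<omega>)) (\<lambda>_. 0) sequentially"
    proof (rule uniform_limitI)
      fix e :: real assume e: "0 < e"
      have "(\<lambda>n. 2 * C * (real n * (1/4) ^ n)) \<longlonglongrightarrow> 2 * C * 0"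
        by (intro tendsto_intros) real_asymp
      then have "eventually (\<lambda>n. 2 * C * (real n * (1/4) ^ n) < e) sequentially"
        using e by (intro order_tendstoD) auto
      then show "\<forall>\<^sub>F n in sequentially. \<forall>z\<in>ball z0 (x / 10).
          dist (qnorm Z (\<lambda>\<omega>. (\<Sum>k<n. (z - z0) ^ k * c k \<omega>) - interpolant I z \<omega>)) 0 < e"
        using eventually_gt_at_top[of 0]
      proof eventually_elim
        case (elim n)
        show ?case
        proof
          fix z assume "z \<in> ball z0 (x / 10)"
          from est[OF this elim(2)] elim(1)
          show "dist (qnorm Z (\<lambda>\<omega>. (\<Sum>k<n. (z - z0) ^ k * c k \<omega>) - interpolant I z \<omega>)) 0 < e"
            by (simp add: dist_real_def)
        qed
      qed
    qed
  qed
qed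

lemma interpolant_calA: "interpolant I \<in> calA M X0 X1"
proof -
  have "bounded_into Z open_strip (interpolant I)"
    unfolding bounded_into_def
    by (intro conjI exI[of _ "C + C"] ballI interpolant_elem interpolant_norm) (auto simp: open_strip_def)
  moreover have "bounded_into X0 UNIV (\<lambda>t. interpolant I (Complex 0 t))" "bounded_into X1 UNIV (\<lambda>t. interpolant I (Complex 1 t))"
    unfolding bounded_into_def using trace_X0_elem trace_X1_elem by blast+
  ultimately show ?thesis
    by (simp add: calA_def interpolant_analytic interpolant_continuous trace_X0_continuous trace_X1_continuous)
qed

lemma interpolant_finite:
  assumes I: "finite I" and z: "0 \<le> Re z" "Re z \<le> 1"
  shows "interpolant I z \<in> elems X0" "interpolant I z \<in> elems X1"
proof -
  have "AE \<omega> in M. S0.T (lower_part I z) \<omega> = (\<Sum>i\<in>I. lower_part I z i * b0 i \<omega>)"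
    by (rule S0.T_finite[OF I]) (simp add: lower_part_def)
  moreover have "AE \<omega> in M. S1.T (upper_part I z) \<omega> = (\<Sum>i\<in>I. upper_part I z i * b1 i \<omega>)"
    by (rule S1.T_finite[OF I]) (simp add: upper_part_def)
  ultimately have eq: "AE \<omega> in M. interpolant I z \<omega> = (\<Sum>i\<in>I. lower_part I z i * b0 i \<omega>) + (\<Sum>i\<in>I. upper_part I z i * b1 i \<omega>)"
    by eventually_elim (simp add: interpolant_def)
  have "(\<lambda>\<omega>. (\<Sum>i\<in>I. lower_part I z i * b0 i \<omega>) + (\<Sum>i\<in>I. upper_part I z i * b1 i \<omega>)) \<in> elems X0"
    unfolding b0_def b1_def by (intro X0.add_elem X0.sum_closed X0.scale_elem a_elem)
  from X0.AE_eq_closed(1)[OF this interpolant_meas[OF z] eq] show "interpolant I z \<in> elems X0" .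
  have "(\<lambda>\<omega>. (\<Sum>i\<in>I. lower_part I z i * b0 i \<omega>) + (\<Sum>i\<in>I. upper_part I z i * b1 i \<omega>)) \<in> elems X1"
    unfolding b0_def b1_def by (intro X1.add_elem X1.sum_closed X1.scale_elem a_elem)
  from X1.AE_eq_closed(1)[OF this interpolant_meas[OF z] eq] show "interpolant I z \<in> elems X1" .
qed

text \<open>Truncation to a finite index set I changes the boundary values by multipliers of modulus
  at most 1 that vanish on I. The uniform tail estimates make this change small in both end point
  spaces, uniformly in t.\<close>

lemma interpolant_calA0: "interpolant UNIV \<in> calA0 M X0 X1"
  unfolding calA0_def
proof (intro CollectI conjI allI impI interpolant_calA)
  fix e :: real assume e: "0 < e"
  obtain F0 where F0: "finite F0" "\<And>\<epsilon>. (\<And>i. cmod (\<epsilon> i) \<le> 1) \<Longrightarrow> (\<And>i. i \<in> F0 \<Longrightarrow> \<epsilon> i = 0) \<Longrightarrow> qnorm X0 (S0.T \<epsilon>) \<le> e / 2"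
    using S0.uniform_tail[of "e / 2"] e by auto
  obtain F1 where F1: "finite F1" "\<And>\<epsilon>. (\<And>i. cmod (\<epsilon> i) \<le> 1) \<Longrightarrow> (\<And>i. i \<in> F1 \<Longrightarrow> \<epsilon> i = 0) \<Longrightarrow> qnorm X1 (S1.T \<epsilon>) \<le> e / 2"
    using S1.uniform_tail[of "e / 2"] e by auto
  define I where "I = F0 \<union> F1"
  have I: "finite I" using F0 F1 by (simp add: I_def)
  have d: "whole_part UNIV t i - whole_part I t i = (if i \<in> I then 0 else dyadic i (Complex 0 t))" for t i
    by (simp add: whole_part_def)
  have d1: "cmod (whole_part UNIV t i - whole_part I t i) \<le> 1" for t i
    by (simp add: d cmod_dyadic)
  show "\<exists>g\<in>calA M X0 X1. (\<forall>z\<in>open_strip. g z \<in> elems X0 \<inter> elems X1) \<and>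
      calA_norm X0 X1 (\<lambda>z \<omega>. interpolant UNIV z \<omega> - g z \<omega>) < e"
  proof (intro bexI[of _ "interpolant I"] conjI ballI interpolant_calA)
    fix z assume "z \<in> open_strip"
    then show "interpolant I z \<in> elems X0 \<inter> elems X1"
      using interpolant_finite[OF I, of z] by (auto simp: open_strip_def)
  next
    have n0: "qnorm X0 (\<lambda>\<omega>. interpolant UNIV (Complex 0 t) \<omega> - interpolant I (Complex 0 t) \<omega>) \<le> e / 2" for t
    proof -
      have "qnorm X0 (\<lambda>\<omega>. S0.T (whole_part UNIV t) \<omega> - S0.T (whole_part I t) \<omega>) = qnorm X0 (S0.T (\<lambda>i. whole_part UNIV t i - whole_part I t i))"
        using S0.T_diff[OF bounded_whole bounded_whole, of UNIV t I t]
        by (intro X0.AE_eq_closed(2)[symmetric, OF X0.diff_closed[OF S0.T_elem[OF bounded_whole] S0.T_elem[OF bounded_whole]]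
            X0.meas[OF S0.T_elem[OF S0.bounded_rangeI[OF d1]]]])
      also have "\<dots> \<le> e / 2" by (rule F0(2)[OF d1]) (simp add: whole_part_def I_def)
      finally show ?thesis by (simp add: trace_X0_diff)
    qed
    have n1: "qnorm X1 (\<lambda>\<omega>. interpolant UNIV (Complex 1 t) \<omega> - interpolant I (Complex 1 t) \<omega>) \<le> e / 2" for t
    proof -
      have "qnorm X1 (\<lambda>\<omega>. S1.T (whole_part UNIV t) \<omega> - S1.T (whole_part I t) \<omega>) = qnorm X1 (S1.T (\<lambda>i. whole_part UNIV t i - whole_part I t i))"
        using S1.T_diff[OF bounded_whole bounded_whole, of UNIV t I t]
        by (intro X1.AE_eq_closed(2)[symmetric, OF X1.diff_closed[OF S1.T_elem[OF bounded_whole] S1.T_elem[OF bounded_whole]]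
            X1.meas[OF S1.T_elem[OF S1.bounded_rangeI[OF d1]]]])
      also have "\<dots> \<le> e / 2" by (rule F1(2)[OF d1]) (simp add: whole_part_def I_def)
      finally show ?thesis by (simp add: trace_X1_diff)
    qed
    have "calA_norm X0 X1 (\<lambda>z \<omega>. interpolant UNIV z \<omega> - interpolant I z \<omega>) \<le> e / 2"
      unfolding calA_norm_def by (intro max.boundedI cSUP_least n0 n1) auto
    then show "calA_norm X0 X1 (\<lambda>z \<omega>. interpolant UNIV z \<omega> - interpolant I z \<omega>) < e" using e by simp
  qed
qed

lemma interpolant_norm_le: "calA_norm X0 X1 (interpolant UNIV) \<le> C"
  unfolding calA_norm_def by (intro max.boundedI cSUP_least trace_X0_elem trace_X1_elem) auto

lemma interpolant_value:
  assumes "decomposes M X0 X1 a f" "f \<in> elems Z"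
  shows "AE \<omega> in M. interpolant UNIV (of_real \<theta>) \<omega> = f \<omega>"
  unfolding interpolant_def
proof (rule pair_unique[OF _ _ assms(2)])
  show "bounded (range (lower_part UNIV (of_real \<theta>)))" "bounded (range (upper_part UNIV (of_real \<theta>)))"
    using \<theta> by (auto intro: bounded_parts)
  have "dyadic i (of_real \<theta> - of_real \<theta>) = 1" for i by (simp add: dyadic_def)
  then show "converges_in Z (\<lambda>F \<omega>. \<Sum>i\<in>F. lower_part UNIV (of_real \<theta>) i * b0 i \<omega> + upper_part UNIV (of_real \<theta>) i * b1 i \<omega>) f (finite_subsets_at_top UNIV)"
    using assms(1) unfolding lower_upper_combine by (simp add: decomposes_def)
qed

end

text \<open>All multipliers on the boundary have modulus 1, so this embedding has constant
  1.\<close>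

lemma (in lattice_couple) conv_bracket_into_inner:
  assumes \<theta>: "0 < \<theta>" "\<theta> < 1" and f: "f \<in> elems Z" and C: "C \<in> conv_bracket_bounds M X0 X1 \<theta> f"
  obtains F where "F \<in> calA0 M X0 X1" "calA_norm X0 X1 F \<le> C" "AE \<omega> in M. F (of_real \<theta>) \<omega> = f \<omega>"
proof -
  obtain a where a: "decomposes M X0 X1 a f" "series_bounded X0 \<theta> 0 a C" "series_bounded X1 \<theta> 1 a C"
    using C by (auto simp: conv_bracket_bounds_def)
  interpret couple_series M X0 X1 K a \<theta> C
    using a \<theta> by unfold_locales (auto simp: decomposes_def)
  show thesis
    by (rule that[OF interpolant_calA0 interpolant_norm_le interpolant_value[OF a(1) f]])
qed

section \<open>Differences in the space of analytic functions\<close>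

context quasi_normed_fspace
begin

lemma bounded_into_diff:
  assumes "bounded_into X D f" "bounded_into X D g"
  shows "bounded_into X D (\<lambda>z \<omega>. f z \<omega> - g z \<omega>)"
proof -
  obtain A B where A: "\<And>z. z \<in> D \<Longrightarrow> qnorm X (f z) \<le> A" and B: "\<And>z. z \<in> D \<Longrightarrow> qnorm X (g z) \<le> B"
    using assms unfolding bounded_into_def by blast
  have el: "f z \<in> elems X" "g z \<in> elems X" if "z \<in> D" for z
    using assms that by (auto simp: bounded_into_def)
  have "qnorm X (\<lambda>\<omega>. f z \<omega> - g z \<omega>) \<le> K * (A + B)" if z: "z \<in> D" for z
    using quasi_triangle_diff[OF el[OF z]] mult_left_mono[OF add_mono[OF A[OF z] B[OF z]] K_nonneg] by linarith
  then show ?thesis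
    unfolding bounded_into_def using el by (intro conjI ballI exI[of _ "K * (A + B)"] diff_closed)
qed

lemma converges_in_diff:
  assumes u: "eventually (\<lambda>i. u i \<in> elems X) F" and v: "eventually (\<lambda>i. v i \<in> elems X) F"
    and f: "f \<in> elems X" "g \<in> elems X" "converges_in X u f F" "converges_in X v g F"
  shows "converges_in X (\<lambda>i \<omega>. u i \<omega> - v i \<omega>) (\<lambda>\<omega>. f \<omega> - g \<omega>) F"
proof -
  have 1: "((\<lambda>i. K * (qnorm X (\<lambda>\<omega>. u i \<omega> - f \<omega>) + qnorm X (\<lambda>\<omega>. v i \<omega> - g \<omega>))) \<longlongrightarrow> K * (0 + 0)) F"
    using f(3,4) unfolding converges_in_def by (intro tendsto_intros)
  have "eventually (\<lambda>i. 0 \<le> qnorm X (\<lambda>\<omega>. u i \<omega> - v i \<omega> - (f \<omega> - g \<omega>)) \<and> qnorm X (\<lambda>\<omega>. u i \<omega> - v i \<omega> - (f \<omega> - g \<omega>)) \<le>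
      K * (qnorm X (\<lambda>\<omega>. u i \<omega> - f \<omega>) + qnorm X (\<lambda>\<omega>. v i \<omega> - g \<omega>))) F"
    using u v
  proof eventually_elim
    case (elim i)
    have eq: "(\<lambda>\<omega>. u i \<omega> - v i \<omega> - (f \<omega> - g \<omega>)) = (\<lambda>\<omega>. (u i \<omega> - f \<omega>) - (v i \<omega> - g \<omega>))" by (auto simp: algebra_simps)
    show ?case unfolding eq
      using quasi_triangle_diff[OF diff_closed[OF elim(1) f(1)] diff_closed[OF elim(2) f(2)]]
        qnorm_ge_0[OF diff_closed[OF diff_closed[OF elim(1) f(1)] diff_closed[OF elim(2) f(2)]]] by blast
  qed
  then show ?thesis
    unfolding converges_in_def
    by (intro tendsto_sandwich[OF _ _ tendsto_const[of 0] 1[simplified]]) (auto elim: eventually_mono)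
qed

lemma continuous_into_diff:
  assumes "continuous_into X D f" "continuous_into X D g"
  shows "continuous_into X D (\<lambda>z \<omega>. f z \<omega> - g z \<omega>)"
  unfolding continuous_into_def
proof (intro conjI ballI)
  have el: "f z \<in> elems X" "g z \<in> elems X" if "z \<in> D" for z
    using assms that by (auto simp: continuous_into_def)
  fix z assume z: "z \<in> D"
  show "(\<lambda>\<omega>. f z \<omega> - g z \<omega>) \<in> elems X" by (intro diff_closed el z)
  have ev: "eventually (\<lambda>y. y \<in> D) (at z within D)" by (simp add: eventually_at_filter)
  show "converges_in X (\<lambda>z \<omega>. f z \<omega> - g z \<omega>) (\<lambda>\<omega>. f z \<omega> - g z \<omega>) (at z within D)"
  proof (rule converges_in_diff)
    show "eventually (\<lambda>y. f y \<in> elems X) (at z within D)" "eventually (\<lambda>y. g y \<in> elems X) (at z within D)"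
      using ev el by (auto elim: eventually_mono)
    show "converges_in X f (f z) (at z within D)" "converges_in X g (g z) (at z within D)"
      using assms z by (auto simp: continuous_into_def)
  qed (use el z in auto)
qed

lemma analytic_into_diff:
  assumes "analytic_into X D f" "analytic_into X D g"
  shows "analytic_into X D (\<lambda>z \<omega>. f z \<omega> - g z \<omega>)"
  unfolding analytic_into_def
proof (intro conjI ballI)
  have el: "f z \<in> elems X" "g z \<in> elems X" if "z \<in> D" for z
    using assms that by (auto simp: analytic_into_def)
  then show "(\<lambda>\<omega>. f z \<omega> - g z \<omega>) \<in> elems X" if "z \<in> D" for z
    using that by (intro diff_closed)
  fix z0 assume z0: "z0 \<in> D"
  obtain r c where r: "r > 0" "ball z0 r \<subseteq> D" and c: "\<And>k. c k \<in> elems X"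
    and u: "uniform_limit (ball z0 r)
        (\<lambda>n z. qnorm X (\<lambda>\<omega>. (\<Sum>k<n. (z - z0) ^ k * c k \<omega>) - f z \<omega>)) (\<lambda>_. 0) sequentially"
    using assms(1) z0 unfolding analytic_into_def by blast
  obtain r' c' where r': "r' > 0" "ball z0 r' \<subseteq> D" and c': "\<And>k. c' k \<in> elems X"
    and u': "uniform_limit (ball z0 r')
        (\<lambda>n z. qnorm X (\<lambda>\<omega>. (\<Sum>k<n. (z - z0) ^ k * c' k \<omega>) - g z \<omega>)) (\<lambda>_. 0) sequentially"
    using assms(2) z0 unfolding analytic_into_def by blast
  define R where "R = min r r'"
  have sub: "ball z0 R \<subseteq> ball z0 r" "ball z0 R \<subseteq> ball z0 r'" by (auto simp: R_def)
  show "\<exists>r>0. \<exists>c. ball z0 r \<subseteq> D \<and> (\<forall>k. c k \<in> elems X) \<and>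
      uniform_limit (ball z0 r)
        (\<lambda>n z. qnorm X (\<lambda>\<omega>. (\<Sum>k<n. (z - z0) ^ k * c k \<omega>) - (f z \<omega> - g z \<omega>))) (\<lambda>_. 0) sequentially"
  proof (intro exI[of _ R] exI[of _ "\<lambda>k \<omega>. c k \<omega> - c' k \<omega>"] conjI allI diff_closed c c')
    show "0 < R" using r r' by (simp add: R_def)
    show "ball z0 R \<subseteq> D" using sub r by blast
    show "uniform_limit (ball z0 R)
        (\<lambda>n z. qnorm X (\<lambda>\<omega>. (\<Sum>k<n. (z - z0) ^ k * (c k \<omega> - c' k \<omega>)) - (f z \<omega> - g z \<omega>))) (\<lambda>_. 0) sequentially"
    proof (rule uniform_limitI)
      fix e :: real assume e: "0 < e"
      define d where "d = e / (2 * K)"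
      have d: "0 < d" using e K_pos by (simp add: d_def)
      show "\<forall>\<^sub>F n in sequentially. \<forall>z\<in>ball z0 R.
          dist (qnorm X (\<lambda>\<omega>. (\<Sum>k<n. (z - z0) ^ k * (c k \<omega> - c' k \<omega>)) - (f z \<omega> - g z \<omega>))) 0 < e"
        using uniform_limitD[OF u d] uniform_limitD[OF u' d]
      proof eventually_elim
        case (elim n)
        show ?case
        proof
          fix z assume z: "z \<in> ball z0 R"
          have zD: "z \<in> D" using z sub r by blast
          let ?S = "\<lambda>c \<omega>. \<Sum>k<n. (z - z0) ^ k * c k \<omega>"
          have S: "?S c \<in> elems X" "?S c' \<in> elems X" by (intro sum_closed scale_elem c c')+
          have "(\<lambda>\<omega>. (\<Sum>k<n. (z - z0) ^ k * (c k \<omega> - c' k \<omega>)) - (f z \<omega> - g z \<omega>)) =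
              (\<lambda>\<omega>. (?S c \<omega> - f z \<omega>) - (?S c' \<omega> - g z \<omega>))"
            by (auto simp: right_diff_distrib sum_subtractf)
          moreover have "qnorm X (\<lambda>\<omega>. (?S c \<omega> - f z \<omega>) - (?S c' \<omega> - g z \<omega>)) \<le>
              K * (qnorm X (\<lambda>\<omega>. ?S c \<omega> - f z \<omega>) + qnorm X (\<lambda>\<omega>. ?S c' \<omega> - g z \<omega>))"
            by (intro quasi_triangle_diff diff_closed S el zD)
          moreover have "qnorm X (\<lambda>\<omega>. ?S c \<omega> - f z \<omega>) < d" "qnorm X (\<lambda>\<omega>. ?S c' \<omega> - g z \<omega>) < d"
            using elim z sub by (force simp: dist_real_def)+
          moreover have "0 \<le> qnorm X (\<lambda>\<omega>. (?S c \<omega> - f z \<omega>) - (?S c' \<omega> - g z \<omega>))"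
            by (intro qnorm_ge_0 diff_closed S el zD)
          moreover have "K * (x + y) < e" if "x < d" "y < d" for x y
          proof -
            have "K * (x + y) < K * (d + d)" using that K_pos by (intro mult_strict_left_mono) auto
            also have "\<dots> = e" using K_pos by (simp add: d_def)
            finally show ?thesis .
          qed
          ultimately show "dist (qnorm X (\<lambda>\<omega>. (\<Sum>k<n. (z - z0) ^ k * (c k \<omega> - c' k \<omega>)) - (f z \<omega> - g z \<omega>))) 0 < e"
            by (simp add: dist_real_def) (meson order_le_less_trans)
        qed
      qed
    qed
  qed
qed

end

context lattice_couple
begin

lemma calA_diff:
  assumes "f \<in> calA M X0 X1" "g \<in> calA M X0 X1"
  shows "(\<lambda>z \<omega>. f z \<omega> - g z \<omega>) \<in> calA M X0 X1"
  using assms unfolding calA_def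
  by (auto intro!: Z.bounded_into_diff Z.analytic_into_diff Z.continuous_into_diff X0.bounded_into_diff
      X0.continuous_into_diff X1.bounded_into_diff X1.continuous_into_diff)

lemma calA_boundary:
  assumes "f \<in> calA M X0 X1"
  shows "f (Complex 0 t) \<in> elems X0" "f (Complex 1 t) \<in> elems X1"
    "qnorm X0 (f (Complex 0 t)) \<le> calA_norm X0 X1 f" "qnorm X1 (f (Complex 1 t)) \<le> calA_norm X0 X1 f"
proof -
  have b: "bounded_into X0 UNIV (\<lambda>t. f (Complex 0 t))" "bounded_into X1 UNIV (\<lambda>t. f (Complex 1 t))"
    using assms by (auto simp: calA_def)
  then show "f (Complex 0 t) \<in> elems X0" "f (Complex 1 t) \<in> elems X1" by (auto simp: bounded_into_def)
  have "bdd_above (range (\<lambda>t. qnorm X0 (f (Complex 0 t))))" "bdd_above (range (\<lambda>t. qnorm X1 (f (Complex 1 t))))"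
    using b by (auto simp: bounded_into_def bdd_above_def)
  then have "qnorm X0 (f (Complex 0 t)) \<le> (SUP t. qnorm X0 (f (Complex 0 t)))"
    "qnorm X1 (f (Complex 1 t)) \<le> (SUP t. qnorm X1 (f (Complex 1 t)))" by (auto intro: cSUP_upper)
  then show "qnorm X0 (f (Complex 0 t)) \<le> calA_norm X0 X1 f" "qnorm X1 (f (Complex 1 t)) \<le> calA_norm X0 X1 f"
    by (auto simp: calA_norm_def max.coboundedI1 max.coboundedI2)
qed

lemma calA_norm_nonneg: "f \<in> calA M X0 X1 \<Longrightarrow> 0 \<le> calA_norm X0 X1 f"
  using calA_boundary(1,3)[of f 0] X0.qnorm_ge_0 by force

lemma calA_value: "f \<in> calA M X0 X1 \<Longrightarrow> z \<in> open_strip \<Longrightarrow> f z \<in> elems Z"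
  by (auto simp: calA_def analytic_into_def)

section \<open>From the three lines estimate to a factorisation\<close>

text \<open>A small factor l in one component is compensated by a negative power of l in the other.
  These are factorisations of |y| by multiples of itself, to be used where a remainder in the wrong
  space is too large to absorb.\<close>

lemma powr_split_one:
  fixes x l :: real
  assumes "0 \<le> x" "0 < l" "0 < \<theta>" "\<theta> < 1"
  shows "(l powr (- \<theta> / (1 - \<theta>)) * x) powr (1 - \<theta>) * (l * x) powr \<theta> = x"
    and "(l * x) powr (1 - \<theta>) * (l powr (- (1 - \<theta>) / \<theta>) * x) powr \<theta> = x"
proof -
  have x: "x powr (1 - \<theta>) * x powr \<theta> = x"
    using assms(1) by (cases "x = 0") (auto simp flip: powr_add)
  have "(l powr (- \<theta> / (1 - \<theta>)) * x) powr (1 - \<theta>) * (l * x) powr \<theta> =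
      (l powr (- \<theta> / (1 - \<theta>) * (1 - \<theta>)) * l powr \<theta>) * (x powr (1 - \<theta>) * x powr \<theta>)"
    using assms by (simp add: powr_mult powr_powr mult_ac)
  also have "- \<theta> / (1 - \<theta>) * (1 - \<theta>) = - \<theta>" using assms by simp
  also have "l powr (- \<theta>) * l powr \<theta> = 1" using assms by (simp flip: powr_add)
  finally show "(l powr (- \<theta> / (1 - \<theta>)) * x) powr (1 - \<theta>) * (l * x) powr \<theta> = x" using x by simp
  have "(l * x) powr (1 - \<theta>) * (l powr (- (1 - \<theta>) / \<theta>) * x) powr \<theta> =
      (l powr (1 - \<theta>) * l powr (- (1 - \<theta>) / \<theta> * \<theta>)) * (x powr (1 - \<theta>) * x powr \<theta>)"
    using assms by (simp add: powr_mult powr_powr mult_ac)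
  also have "- (1 - \<theta>) / \<theta> * \<theta> = - (1 - \<theta>)" using assms by simp
  also have "l powr (1 - \<theta>) * l powr (- (1 - \<theta>)) = 1" using assms by (simp flip: powr_add)
  finally show "(l * x) powr (1 - \<theta>) * (l powr (- (1 - \<theta>) / \<theta>) * x) powr \<theta> = x" using x by simp
qed

text \<open>For \<open>y\<close> in both spaces the error terms of the three lines estimate, small in the wrong space, can be
  absorbed: where they exceed a small multiple of \<open>\<bar>y\<bar>\<close>, the function \<open>y\<close> itself is small in that space.\<close>

lemma calderon_absorb:
  assumes \<theta>: "0 < \<theta>" "\<theta> < 1" and y: "y \<in> elems X0" "y \<in> elems X1" and A: "0 < A"
    and approx: "\<And>\<eta>. 0 < \<eta> \<Longrightarrow> \<exists>P0 P1 R0 R1. X0.dominated P0 (C * A) \<and> X1.dominated P1 (C * A) \<and>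
      X0.dominated R0 \<eta> \<and> X1.dominated R1 \<eta> \<and>
      (\<forall>\<omega>. 0 \<le> P0 \<omega> \<and> 0 \<le> P1 \<omega> \<and> 0 \<le> R0 \<omega> \<and> 0 \<le> R1 \<omega>) \<and>
      (AE \<omega> in M. cmod (y \<omega>) \<le> (P0 \<omega> + R1 \<omega>) powr (1 - \<theta>) * (P1 \<omega> + R0 \<omega>) powr \<theta>)"
  obtains f0 f1 where "f0 \<in> elems X0" "f1 \<in> elems X1" "qnorm X0 f0 \<le> K * (C + 2 * K) * A" "qnorm X1 f1 \<le> K * (C + 2 * K) * A"
    "AE \<omega> in M. cmod (y \<omega>) \<le> cmod (f0 \<omega>) powr (1 - \<theta>) * cmod (f1 \<omega>) powr \<theta>"
proof -
  define Y where "Y = 1 + max (qnorm X0 y) (qnorm X1 y)"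
  have Y: "0 < Y" "qnorm X0 y \<le> Y" "qnorm X1 y \<le> Y"
    using X0.qnorm_ge_0[OF y(1)] by (auto simp: Y_def)
  \<comment> \<open>Chosen so that l |y| has norm at most A in both spaces; this uses that y lies in
    the intersection. The summand 1 in Y prevents division by 0.\<close>
  define l where "l = A / Y"
  have l: "0 < l" "l * qnorm X0 y \<le> A" "l * qnorm X1 y \<le> A" using A Y by (auto simp: l_def field_simps)
  define t0 where "t0 = l powr (- \<theta> / (1 - \<theta>))"
  define t1 where "t1 = l powr (- (1 - \<theta>) / \<theta>)"
  have t: "0 < t0" "0 < t1" using l by (auto simp: t0_def t1_def)
  \<comment> \<open>The remainders are requested only now, small enough to survive multiplication by
    t0 / l and t1 / l, which depend on the norms of y.\<close>
  define \<eta> where "\<eta> = l * A / (t0 + t1)"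
  have \<eta>: "0 < \<eta>" using l A t by (simp add: \<eta>_def)
  have \<eta>t: "t0 / l * \<eta> \<le> A" "t1 / l * \<eta> \<le> A" using l A t by (auto simp: \<eta>_def field_simps)
  obtain P0 P1 R0 R1 where P: "X0.dominated P0 (C * A)" "X1.dominated P1 (C * A)"
      and R: "X0.dominated R0 \<eta>" "X1.dominated R1 \<eta>"
      and nn: "\<forall>\<omega>. 0 \<le> P0 \<omega> \<and> 0 \<le> P1 \<omega> \<and> 0 \<le> R0 \<omega> \<and> 0 \<le> R1 \<omega>"
      and est: "AE \<omega> in M. cmod (y \<omega>) \<le> (P0 \<omega> + R1 \<omega>) powr (1 - \<theta>) * (P1 \<omega> + R0 \<omega>) powr \<theta>"
    using approx[OF \<eta>] by (elim exE conjE) (rule that)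
  \<comment> \<open>The minimum is bounded by R0 / l, so its multiple by t0 is small in X0; where l
    |y| < R0 it equals |y|, so the factorisation by multiples of y is available.\<close>
  define u0 where "u0 \<omega> = P0 \<omega> + (l * cmod (y \<omega>) + t0 * min (cmod (y \<omega>)) (R0 \<omega> / l))" for \<omega>
  define u1 where "u1 \<omega> = P1 \<omega> + (l * cmod (y \<omega>) + t1 * min (cmod (y \<omega>)) (R1 \<omega> / l))" for \<omega>
  have bound: "K * (C * A + K * (A + A)) \<le> K * (C + 2 * K) * A" by (simp add: algebra_simps)
  have "X0.dominated (\<lambda>\<omega>. t0 * min (cmod (y \<omega>)) (R0 \<omega> / l)) A"
    by (rule X0.dominated_mono[OF X0.dominated_scale[OF R(1), of "t0 / l"] _ \<eta>t(1)])
       (use t l in \<open>auto intro!: AE_I2 mult_left_mono simp: min_def field_simps\<close>)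
  moreover have "X0.dominated (\<lambda>\<omega>. l * cmod (y \<omega>)) A"
    by (rule X0.dominated_mono[OF X0.dominated_scale[OF X0.dominated_cmod[OF y(1) order_refl], of l] _ l(2)]) (use l in auto)
  ultimately have "X0.dominated u0 (K * (C * A + K * (A + A)))"
    unfolding u0_def by (intro X0.dominated_add P)
  then obtain f0 where f0: "f0 \<in> elems X0" "qnorm X0 f0 \<le> K * (C * A + K * (A + A))" "AE \<omega> in M. u0 \<omega> \<le> cmod (f0 \<omega>)"
    by (auto simp: X0.dominated_def)
  have "X1.dominated (\<lambda>\<omega>. t1 * min (cmod (y \<omega>)) (R1 \<omega> / l)) A"
    by (rule X1.dominated_mono[OF X1.dominated_scale[OF R(2), of "t1 / l"] _ \<eta>t(2)])
       (use t l in \<open>auto intro!: AE_I2 mult_left_mono simp: min_def field_simps\<close>)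
  moreover have "X1.dominated (\<lambda>\<omega>. l * cmod (y \<omega>)) A"
    by (rule X1.dominated_mono[OF X1.dominated_scale[OF X1.dominated_cmod[OF y(2) order_refl], of l] _ l(3)]) (use l in auto)
  ultimately have "X1.dominated u1 (K * (C * A + K * (A + A)))"
    unfolding u1_def by (intro X1.dominated_add P)
  then obtain f1 where f1: "f1 \<in> elems X1" "qnorm X1 f1 \<le> K * (C * A + K * (A + A))" "AE \<omega> in M. u1 \<omega> \<le> cmod (f1 \<omega>)"
    by (auto simp: X1.dominated_def)
  have "AE \<omega> in M. cmod (y \<omega>) \<le> cmod (f0 \<omega>) powr (1 - \<theta>) * cmod (f1 \<omega>) powr \<theta>"
    using est f0(3) f1(3)
  proof eventually_elim
    case (elim \<omega>)
    have p: "0 \<le> P0 \<omega>" "0 \<le> P1 \<omega>" "0 \<le> R0 \<omega>" "0 \<le> R1 \<omega>" using nn by auto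
    define c where "c = cmod (y \<omega>)"
    have c: "0 \<le> c" by (simp add: c_def)
    have m: "0 \<le> t0 * min c (R0 \<omega> / l)" "0 \<le> t1 * min c (R1 \<omega> / l)" "0 \<le> l * c"
      using p c t l by auto
    have "c \<le> u0 \<omega> powr (1 - \<theta>) * u1 \<omega> powr \<theta>"
    proof (cases "l * c < R0 \<omega>")
      case True
      then have "min c (R0 \<omega> / l) = c" using l by (simp add: min_def field_simps)
      then have "t0 * c \<le> u0 \<omega>" "l * c \<le> u1 \<omega>" using m p by (auto simp: u0_def u1_def c_def[symmetric])
      then have "(t0 * c) powr (1 - \<theta>) * (l * c) powr \<theta> \<le> u0 \<omega> powr (1 - \<theta>) * u1 \<omega> powr \<theta>"
        using \<theta> c t l by (intro mult_mono powr_mono2) auto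
      then show ?thesis using powr_split_one(1)[OF c l(1) \<theta>] by (simp add: t0_def)
    next
      case False
      show ?thesis
      proof (cases "l * c < R1 \<omega>")
        case True
        then have "min c (R1 \<omega> / l) = c" using l by (simp add: min_def field_simps)
        then have "l * c \<le> u0 \<omega>" "t1 * c \<le> u1 \<omega>" using m p by (auto simp: u0_def u1_def c_def[symmetric])
        then have "(l * c) powr (1 - \<theta>) * (t1 * c) powr \<theta> \<le> u0 \<omega> powr (1 - \<theta>) * u1 \<omega> powr \<theta>"
          using \<theta> c t l by (intro mult_mono powr_mono2) auto
        then show ?thesis using powr_split_one(2)[OF c l(1) \<theta>] by (simp add: t1_def)
      next
        case F: False
        \<comment> \<open>Here both remainders are at most l |y| and disappear in that term.\<close>
        have "P0 \<omega> + R1 \<omega> \<le> u0 \<omega>" "P1 \<omega> + R0 \<omega> \<le> u1 \<omega>"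
          using m F False by (auto simp: u0_def u1_def c_def[symmetric])
        then have "(P0 \<omega> + R1 \<omega>) powr (1 - \<theta>) * (P1 \<omega> + R0 \<omega>) powr \<theta> \<le> u0 \<omega> powr (1 - \<theta>) * u1 \<omega> powr \<theta>"
          using \<theta> p by (intro mult_mono powr_mono2) auto
        then show ?thesis using elim(1) by (simp add: c_def)
      qed
    qed
    also have "\<dots> \<le> cmod (f0 \<omega>) powr (1 - \<theta>) * cmod (f1 \<omega>) powr \<theta>"
      using \<theta> elim(2,3) m p by (intro mult_mono powr_mono2) (auto simp: u0_def u1_def c_def[symmetric])
    finally show ?case by (simp add: c_def)
  qed
  then show thesis using that[OF f0(1) f1(1)] f0(2) f1(2) bound by linarith
qed

text \<open>Meant for f - g at \<theta>, which need not lie in the intersection. Bounding both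
  factors by the sum of all four majorants, with remainders of size A, still controls the quasi-norm
  of X0 + X1 and yields convergence there.\<close>

lemma three_lines_sum_norm:
  assumes C: "0 < C" and \<theta>: "0 < \<theta>" "\<theta> < 1" and g: "g \<in> elems Z" and A: "0 < A"
    and approx: "\<And>\<eta>. 0 < \<eta> \<Longrightarrow> \<exists>P0 P1 R0 R1. X0.dominated P0 (C * A) \<and> X1.dominated P1 (C * A) \<and>
      X0.dominated R0 \<eta> \<and> X1.dominated R1 \<eta> \<and>
      (\<forall>\<omega>. 0 \<le> P0 \<omega> \<and> 0 \<le> P1 \<omega> \<and> 0 \<le> R0 \<omega> \<and> 0 \<le> R1 \<omega>) \<and>
      (AE \<omega> in M. cmod (g \<omega>) \<le> (P0 \<omega> + R1 \<omega>) powr (1 - \<theta>) * (P1 \<omega> + R0 \<omega>) powr \<theta>)"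
  shows "qnorm Z g \<le> 2 * K * (C + 1) * A"
proof -
  obtain P0 P1 R0 R1 where P: "X0.dominated P0 (C * A)" "X1.dominated P1 (C * A)"
      and R: "X0.dominated R0 A" "X1.dominated R1 A"
      and nn: "\<forall>\<omega>. 0 \<le> P0 \<omega> \<and> 0 \<le> P1 \<omega> \<and> 0 \<le> R0 \<omega> \<and> 0 \<le> R1 \<omega>"
      and est: "AE \<omega> in M. cmod (g \<omega>) \<le> (P0 \<omega> + R1 \<omega>) powr (1 - \<theta>) * (P1 \<omega> + R0 \<omega>) powr \<theta>"
    using approx[OF A] by (elim exE conjE) (rule that)
  have "AE \<omega> in M. cmod (g \<omega>) \<le> (P0 \<omega> + R0 \<omega>) + (P1 \<omega> + R1 \<omega>)"
    using est
  proof eventually_elim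
    case (elim \<omega>)
    have p: "0 \<le> P0 \<omega>" "0 \<le> P1 \<omega>" "0 \<le> R0 \<omega>" "0 \<le> R1 \<omega>" using nn by auto
    define m where "m = (P0 \<omega> + R0 \<omega>) + (P1 \<omega> + R1 \<omega>)"
    have m: "0 \<le> m" "P0 \<omega> + R1 \<omega> \<le> m" "P1 \<omega> + R0 \<omega> \<le> m" using p by (auto simp: m_def)
    have "(P0 \<omega> + R1 \<omega>) powr (1 - \<theta>) * (P1 \<omega> + R0 \<omega>) powr \<theta> \<le> m powr (1 - \<theta>) * m powr \<theta>"
      using \<theta> p m by (intro mult_mono powr_mono2) auto
    also have "\<dots> = m" using m(1) by (cases "m = 0") (auto simp flip: powr_add)
    finally show ?case using elim by (simp add: m_def)
  qed
  from dominated_sum_elem(2)[OF X0.dominated_add[OF P(1) R(1)] X1.dominated_add[OF P(2) R(2)] Z.meas[OF g] this]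
  show ?thesis by (simp add: algebra_simps)
qed

end

section \<open>Finite decompositions and their sums\<close>

context quasi_normed_fspace
begin

lemma weighted_sum_elem: "(\<And>i. a i \<in> elems X) \<Longrightarrow> weighted_sum \<theta> j \<epsilon> a F \<in> elems X"
  unfolding weighted_sum_def by (intro sum_closed scale_elem)

lemma finite_sums_bounded_nonneg:
  assumes "finite_sums_bounded X \<theta> j a C"
  shows "0 \<le> C"
proof -
  have "bounded (range (\<lambda>_::int. 1::complex))" by (auto simp: bounded_iff)
  then have "qnorm X (weighted_sum \<theta> j (\<lambda>_. 1) a {}) \<le> C * (SUP i::int. cmod 1)"
    using assms unfolding finite_sums_bounded_def by blast
  then show ?thesis by (simp add: weighted_sum_def)
qed

lemma finite_sums_boundedD:
  assumes "finite_sums_bounded X \<theta> j a C" "finite F" "\<And>i. i \<in> F \<Longrightarrow> cmod (\<epsilon> i) \<le> B" "0 \<le> B"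
  shows "qnorm X (weighted_sum \<theta> j \<epsilon> a F) \<le> C * B"
proof -
  define \<delta> where "\<delta> i = (if i \<in> F then \<epsilon> i else 0)" for i
  have \<delta>: "cmod (\<delta> i) \<le> B" for i using assms(3,4) by (auto simp: \<delta>_def)
  have "bounded (range \<delta>)" using \<delta> by (auto simp: bounded_iff)
  then have "qnorm X (weighted_sum \<theta> j \<delta> a F) \<le> C * (SUP i. cmod (\<delta> i))"
    using assms(1,2) unfolding finite_sums_bounded_def by blast
  moreover have "(SUP i. cmod (\<delta> i)) \<le> B" by (rule cSUP_least) (use \<delta> in auto)
  moreover have "weighted_sum \<theta> j \<delta> a F = weighted_sum \<theta> j \<epsilon> a F"
    by (auto simp: weighted_sum_def \<delta>_def)
  ultimately show ?thesis
    using mult_left_mono[OF _ finite_sums_bounded_nonneg[OF assms(1)]] by (metis order_trans)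
qed

lemma finite_sums_boundedI:
  assumes "0 \<le> C" "\<And>F \<epsilon> B. \<lbrakk>finite F; \<And>i. cmod (\<epsilon> i) \<le> B; 0 \<le> B\<rbrakk> \<Longrightarrow> qnorm X (weighted_sum \<theta> j \<epsilon> a F) \<le> C * B"
  shows "finite_sums_bounded X \<theta> j a C"
  unfolding finite_sums_bounded_def
proof (intro allI impI)
  fix F :: "int set" and \<epsilon> :: "int \<Rightarrow> complex"
  assume F: "finite F" and b: "bounded (range \<epsilon>)"
  have "bdd_above (range (\<lambda>i. cmod (\<epsilon> i)))" using b by (auto simp: bounded_iff bdd_above_def)
  then have le: "cmod (\<epsilon> i) \<le> (SUP i. cmod (\<epsilon> i))" for i by (intro cSUP_upper) auto
  show "qnorm X (weighted_sum \<theta> j \<epsilon> a F) \<le> C * (SUP i. cmod (\<epsilon> i))"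
    using order_trans[OF norm_ge_zero le] by (intro assms(2) F le)
qed

text \<open>The multipliers 2^(-i (j - \<theta>)) cancel the weights.\<close>

lemma unweighted_sum_le:
  assumes "finite_sums_bounded X \<theta> j a C" "finite F"
    "\<And>i. i \<in> F \<Longrightarrow> 2 powr (- (real_of_int i * (j - \<theta>))) \<le> B" "0 \<le> B"
  shows "qnorm X (\<lambda>\<omega>. \<Sum>i\<in>F. a i \<omega>) \<le> C * B"
proof -
  have "(\<lambda>\<omega>. \<Sum>i\<in>F. a i \<omega>) = weighted_sum \<theta> j (\<lambda>i. of_real (2 powr (- (real_of_int i * (j - \<theta>))))) a F"
    by (simp add: weighted_sum_def powr_minus flip: of_real_mult)
  then show ?thesis using finite_sums_boundedD[OF assms(1,2)] assms(3,4) by simp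
qed

text \<open>The middle part is kept and two terms are placed at N and -N. Their norm bounds
  compensate the weights at these indices, and the constant comes from K (c + K (3 K^2 c + 3 K^2 c))
  <= 7 K^4 c.\<close>

lemma finite_sums_bounded_extend:
  fixes N :: int
  assumes a: "\<And>i. a i \<in> elems X" and bd: "finite_sums_bounded X \<theta> j a c" and N: "0 < N"
    and r: "r \<in> elems X" "qnorm X r \<le> 3 * K\<^sup>2 * c * 2 powr (- (real_of_int N * (j - \<theta>)))"
    and s: "s \<in> elems X" "qnorm X s \<le> 3 * K\<^sup>2 * c * 2 powr (real_of_int N * (j - \<theta>))"
  shows "finite_sums_bounded X \<theta> j
    (\<lambda>i \<omega>. (if \<bar>i\<bar> < N then a i \<omega> else 0) + ((if i = N then r \<omega> else 0) + (if i = - N then s \<omega> else 0))) (7 * K ^ 4 * c)"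
    (is "finite_sums_bounded X \<theta> j ?b _")
proof (rule finite_sums_boundedI)
  have c: "0 \<le> c" by (rule finite_sums_bounded_nonneg[OF bd])
  then show "0 \<le> 7 * K ^ 4 * c" using K_nonneg by simp
  fix F :: "int set" and \<epsilon> :: "int \<Rightarrow> complex" and B :: real
  assume F: "finite F" and \<epsilon>: "\<And>i. cmod (\<epsilon> i) \<le> B" and B: "0 \<le> B"
  define w where "w i = \<epsilon> i * complex_of_real (2 powr (real_of_int i * (j - \<theta>)))" for i
  define F' where "F' = {i\<in>F. \<bar>i\<bar> < N}"
  define A where "A = weighted_sum \<theta> j \<epsilon> a F'"
  define r' where "r' = (\<lambda>\<omega>. (if N \<in> F then w N else 0) * r \<omega>)"
  define s' where "s' = (\<lambda>\<omega>. (if - N \<in> F then w (- N) else 0) * s \<omega>)"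
  have eq: "weighted_sum \<theta> j \<epsilon> ?b F = (\<lambda>\<omega>. A \<omega> + (r' \<omega> + s' \<omega>))"
  proof
    fix \<omega>
    have "weighted_sum \<theta> j \<epsilon> ?b F \<omega> = (\<Sum>i\<in>F. (if \<bar>i\<bar> < N then w i * a i \<omega> else 0) +
        ((if i = N then w i * r \<omega> else 0) + (if i = - N then w i * s \<omega> else 0)))"
      unfolding weighted_sum_def w_def by (intro sum.cong refl) (simp add: distrib_left)
    also have "\<dots> = (\<Sum>i\<in>F. if \<bar>i\<bar> < N then w i * a i \<omega> else 0) + (r' \<omega> + s' \<omega>)"
      using F by (simp add: sum.distrib r'_def s'_def)
    also have "(\<Sum>i\<in>F. if \<bar>i\<bar> < N then w i * a i \<omega> else 0) = A \<omega>"
      unfolding A_def weighted_sum_def F'_def w_def[symmetric] using F by (simp add: sum.inter_filter)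
    finally show "weighted_sum \<theta> j \<epsilon> ?b F \<omega> = A \<omega> + (r' \<omega> + s' \<omega>)" .
  qed
  have Ax: "A \<in> elems X" "qnorm X A \<le> c * B"
    unfolding A_def using F \<epsilon> B by (auto intro: weighted_sum_elem a finite_sums_boundedD[OF bd] simp: F'_def)
  have wb: "cmod (if P then w i else 0) \<le> B * 2 powr (real_of_int i * (j - \<theta>))" for i P
    using mult_right_mono[OF \<epsilon>[of i], of "2 powr (real_of_int i * (j - \<theta>))"] B by (simp add: w_def norm_mult)
  have rx: "r' \<in> elems X" "qnorm X r' \<le> 3 * K\<^sup>2 * c * B"
  proof -
    show "r' \<in> elems X" unfolding r'_def by (intro scale_elem r)
    have "qnorm X r' \<le> B * 2 powr (real_of_int N * (j - \<theta>)) * (3 * K\<^sup>2 * c * 2 powr (- (real_of_int N * (j - \<theta>))))"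
      unfolding r'_def qnorm_mult[OF r(1)] using wb B r(2) qnorm_ge_0[OF r(1)] by (intro mult_mono) auto
    also have "\<dots> = 3 * K\<^sup>2 * c * B" by (simp add: powr_minus)
    finally show "qnorm X r' \<le> 3 * K\<^sup>2 * c * B" .
  qed
  have sx: "s' \<in> elems X" "qnorm X s' \<le> 3 * K\<^sup>2 * c * B"
  proof -
    show "s' \<in> elems X" unfolding s'_def by (intro scale_elem s)
    have "qnorm X s' \<le> B * 2 powr (real_of_int (- N) * (j - \<theta>)) * (3 * K\<^sup>2 * c * 2 powr (real_of_int N * (j - \<theta>)))"
      unfolding s'_def qnorm_mult[OF s(1)] using wb[of "- N \<in> F" "- N"] B s(2) qnorm_ge_0[OF s(1)] by (intro mult_mono) auto
    also have "\<dots> = 3 * K\<^sup>2 * c * B" by (simp add: powr_minus)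
    finally show "qnorm X s' \<le> 3 * K\<^sup>2 * c * B" .
  qed
  have "qnorm X (weighted_sum \<theta> j \<epsilon> ?b F) \<le> K * (c * B + K * (3 * K\<^sup>2 * c * B + 3 * K\<^sup>2 * c * B))"
    unfolding eq
    by (rule order_trans[OF quasi_triangle[OF Ax(1) add_elem[OF rx(1) sx(1)]]],
        intro mult_left_mono add_mono K_nonneg Ax(2),
        rule order_trans[OF quasi_triangle[OF rx(1) sx(1)]],
        intro mult_left_mono add_mono K_nonneg rx sx)
  also have "\<dots> = K * (c * B) + 6 * K ^ 4 * (c * B)" by (simp add: algebra_simps power2_eq_square power4_eq_xxxx)
  also have "K * (c * B) \<le> K ^ 4 * (c * B)"
    using c B self_le_power[OF K_ge_1, of 4] by (intro mult_right_mono) auto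
  finally show "qnorm X (weighted_sum \<theta> j \<epsilon> ?b F) \<le> 7 * K ^ 4 * c * B" by (simp add: algebra_simps)
qed

end

context normed_lattice
begin

text \<open>On the side where the weights grow, \<sigma> = 1 for X1 and \<sigma> = -1 for X0, the
  unweighted series converges geometrically. A block is estimated as a whole by the multiplier
  bound, so no powers of K accumulate.\<close>

lemma one_sided_tail:
  fixes N :: nat and \<sigma> :: int
  assumes a: "\<And>i. a i \<in> elems X" and bd: "finite_sums_bounded X \<theta> j a c"
    and \<sigma>: "\<sigma> = 1 \<or> \<sigma> = -1" and pos: "0 < real_of_int \<sigma> * (j - \<theta>)"
  obtains r where "r \<in> elems X" "converges_in X (\<lambda>n \<omega>. \<Sum>k<n. a (\<sigma> * (int N + int k)) \<omega>) r sequentially"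
    "qnorm X r \<le> c * 2 powr (- (real N * (real_of_int \<sigma> * (j - \<theta>))))"
proof -
  define \<delta> where "\<delta> = real_of_int \<sigma> * (j - \<theta>)"
  define u where "u n = (\<lambda>\<omega>. \<Sum>k<n. a (\<sigma> * (int N + int k)) \<omega>)" for n :: nat
  have uX: "u n \<in> elems X" for n unfolding u_def by (intro sum_closed a)
  have c: "0 \<le> c" by (rule finite_sums_bounded_nonneg[OF bd])
  have block: "qnorm X (\<lambda>\<omega>. u n \<omega> - u m \<omega>) \<le> c * 2 powr (- (real (N + m) * \<delta>))" if "m \<le> n" for m n
  proof -
    define f where "f k = \<sigma> * (int N + int k)" for k :: nat
    have inj: "inj_on f {m..<n}" using \<sigma> by (auto simp: f_def inj_on_def)
    have "{..<n} - {..<m} = {m..<n}" by auto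
    then have "u n \<omega> - u m \<omega> = (\<Sum>k\<in>{m..<n}. a (f k) \<omega>)" for \<omega>
      using that by (simp add: u_def f_def sum_diff[symmetric])
    then have "(\<lambda>\<omega>. u n \<omega> - u m \<omega>) = (\<lambda>\<omega>. \<Sum>i\<in>f ` {m..<n}. a i \<omega>)"
      by (simp add: sum.reindex[OF inj])
    moreover have "qnorm X (\<lambda>\<omega>. \<Sum>i\<in>f ` {m..<n}. a i \<omega>) \<le> c * 2 powr (- (real (N + m) * \<delta>))"
    proof (rule unweighted_sum_le[OF bd])
      fix i assume "i \<in> f ` {m..<n}"
      then obtain k where k: "m \<le> k" "i = f k" by auto
      have "real_of_int i * (j - \<theta>) = real (N + k) * \<delta>" by (simp add: k f_def \<delta>_def algebra_simps)
      moreover have "real (N + m) * \<delta> \<le> real (N + k) * \<delta>"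
        using k pos by (intro mult_right_mono) (auto simp: \<delta>_def)
      ultimately show "2 powr (- (real_of_int i * (j - \<theta>))) \<le> 2 powr (- (real (N + m) * \<delta>))"
        by (intro powr_mono) auto
    qed auto
    ultimately show ?thesis by simp
  qed
  have "(\<lambda>m. c * 2 powr (- (real (N + m) * \<delta>))) \<longlonglongrightarrow> c * 0"
  proof (intro tendsto_mult tendsto_const)
    have "0 < \<delta>" using pos by (simp add: \<delta>_def)
    then show "(\<lambda>m. 2 powr (- (real (N + m) * \<delta>))) \<longlonglongrightarrow> 0" by real_asymp
  qed
  then have small: "(\<lambda>m. c * 2 powr (- (real (N + m) * \<delta>))) \<longlonglongrightarrow> 0" by simp
  have "\<exists>f\<in>elems X. converges_in X u f sequentially"
  proof (rule complete[OF uX], intro allI impI)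
    fix e :: real assume "0 < e"
    from order_tendstoD(2)[OF small this] obtain n0 where
      n0: "\<And>m. n0 \<le> m \<Longrightarrow> c * 2 powr (- (real (N + m) * \<delta>)) < e" by (auto simp: eventually_sequentially)
    have "qnorm X (\<lambda>\<omega>. u m \<omega> - u n \<omega>) < e" if "n0 \<le> m" "n0 \<le> n" for m n
    proof (cases "m \<le> n")
      case True
      then show ?thesis using block[of m n] n0[OF that(1)] qnorm_diff_commute[OF uX[of m] uX[of n]] by simp
    next
      case False
      then show ?thesis using block[of n m] n0[OF that(2)] by simp
    qed
    then show "\<exists>n0. \<forall>m\<ge>n0. \<forall>n\<ge>n0. qnorm X (\<lambda>\<omega>. u m \<omega> - u n \<omega>) < e" by blast
  qed
  then obtain r where r: "r \<in> elems X" "converges_in X u r sequentially" by blast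
  have "u 0 = (\<lambda>_. 0)" by (simp add: u_def)
  then have "qnorm X (u n) \<le> c * 2 powr (- (real N * \<delta>))" for n
    using block[of 0 n] by simp
  then have "qnorm X r \<le> c * 2 powr (- (real N * \<delta>))" by (intro qnorm_limit_le[OF uX r])
  then show thesis using that r unfolding u_def \<delta>_def by blast
qed

text \<open>The sums over n and i are interchanged. If F contains the supports of the first m
  families, the weighted sum of \<beta> over F and s share their first m terms, and the remaining
  terms are geometrically small uniformly in F. Finiteness of the supports is what turns boundedness
  of the multiplier sums into convergence.\<close>

lemma double_series:
  assumes b: "\<And>n i. b n i \<in> elems X" and S: "\<And>n. finite (S n)" "\<And>n. \<forall>i \<omega>. i \<notin> S n \<longrightarrow> b n i \<omega> = 0"
    and bd: "\<And>n. finite_sums_bounded X \<theta> j (b n) (D / (2 * K) ^ n)"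
    and \<beta>: "\<And>i. \<beta> i \<in> elems X" "\<And>i. converges_in X (\<lambda>m \<omega>. \<Sum>n<m. b n i \<omega>) (\<beta> i) sequentially"
    and \<epsilon>: "bounded (range \<epsilon>)"
  obtains s where "s \<in> elems X" "converges_in X (weighted_sum \<theta> j \<epsilon> \<beta>) s (finite_subsets_at_top UNIV)"
    "converges_in X (\<lambda>m \<omega>. \<Sum>n<m. weighted_sum \<theta> j \<epsilon> (b n) (S n) \<omega>) s sequentially"
    "qnorm X s \<le> 2 * K * D * (SUP i. cmod (\<epsilon> i))"
proof -
  define B where "B = (SUP i. cmod (\<epsilon> i))"
  have "bdd_above (range (\<lambda>i. cmod (\<epsilon> i)))" using \<epsilon> by (auto simp: bounded_iff bdd_above_def)
  then have B: "cmod (\<epsilon> i) \<le> B" for i unfolding B_def by (intro cSUP_upper) auto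
  have B0: "0 \<le> B" by (rule order_trans[OF norm_ge_zero B])
  have le: "qnorm X (weighted_sum \<theta> j \<epsilon> (b n) F) \<le> D * B / (2 * K) ^ n" if "finite F" for n F
    using finite_sums_boundedD[OF bd[of n] that B B0] by simp
  have wX: "weighted_sum \<theta> j \<epsilon> (b n) F \<in> elems X" for n F by (rule weighted_sum_elem[OF b])
  obtain s where s: "s \<in> elems X"
    "converges_in X (\<lambda>m \<omega>. \<Sum>n<m. weighted_sum \<theta> j \<epsilon> (b n) (S n) \<omega>) s sequentially"
    "\<And>m. qnorm X (\<lambda>\<omega>. s \<omega> - (\<Sum>n<m. weighted_sum \<theta> j \<epsilon> (b n) (S n) \<omega>)) \<le> 2 * K * (D * B) / (2 * K) ^ m"
    by (rule geometric_series[where f = "\<lambda>n. weighted_sum \<theta> j \<epsilon> (b n) (S n)", OF wX le[OF S(1)]], rule that)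
  have close: "qnorm X (\<lambda>\<omega>. weighted_sum \<theta> j \<epsilon> \<beta> F \<omega> - s \<omega>) \<le> K * (4 * K * (D * B) / (2 * K) ^ m)"
    if F: "finite F" "(\<Union>n<m. S n) \<subseteq> F" for F m
  proof -
    obtain t where t: "t \<in> elems X"
      "converges_in X (\<lambda>m \<omega>. \<Sum>n<m. weighted_sum \<theta> j \<epsilon> (b n) F \<omega>) t sequentially"
      "\<And>m. qnorm X (\<lambda>\<omega>. t \<omega> - (\<Sum>n<m. weighted_sum \<theta> j \<epsilon> (b n) F \<omega>)) \<le> 2 * K * (D * B) / (2 * K) ^ m"
      by (rule geometric_series[where f = "\<lambda>n. weighted_sum \<theta> j \<epsilon> (b n) F", OF wX le[OF F(1)]], rule that)
    \<comment> \<open>For fixed finite F the limit in n may be taken term by term, which identifies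
      the geometric sum t with the weighted sum of \<beta>.\<close>
    have "converges_in X (\<lambda>m \<omega>. \<Sum>i\<in>F. (\<epsilon> i * complex_of_real (2 powr (real_of_int i * (j - \<theta>)))) * (\<Sum>n<m. b n i \<omega>))
        (\<lambda>\<omega>. \<Sum>i\<in>F. (\<epsilon> i * complex_of_real (2 powr (real_of_int i * (j - \<theta>)))) * \<beta> i \<omega>) sequentially"
      by (intro converges_in_sum scale_elem converges_in_scale sum_closed b \<beta>)
    moreover have "(\<Sum>i\<in>F. (\<epsilon> i * complex_of_real (2 powr (real_of_int i * (j - \<theta>)))) * (\<Sum>n<m. b n i \<omega>)) =
        (\<Sum>n<m. weighted_sum \<theta> j \<epsilon> (b n) F \<omega>)" for m \<omega>
      unfolding weighted_sum_def sum_distrib_left by (rule sum.swap)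
    ultimately have "converges_in X (\<lambda>m \<omega>. \<Sum>n<m. weighted_sum \<theta> j \<epsilon> (b n) F \<omega>) (weighted_sum \<theta> j \<epsilon> \<beta> F) sequentially"
      unfolding weighted_sum_def by simp
    then have "AE \<omega> in M. weighted_sum \<theta> j \<epsilon> \<beta> F \<omega> = t \<omega>"
      by (rule converges_in_unique[OF sum_closed[OF wX] weighted_sum_elem[OF \<beta>(1)] t(1) trivial_limit_sequentially _ t(2)])
    then have "AE \<omega> in M. weighted_sum \<theta> j \<epsilon> \<beta> F \<omega> - s \<omega> = t \<omega> - s \<omega>" by eventually_elim simp
    then have "qnorm X (\<lambda>\<omega>. weighted_sum \<theta> j \<epsilon> \<beta> F \<omega> - s \<omega>) = qnorm X (\<lambda>\<omega>. t \<omega> - s \<omega>)"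
      by (intro AE_eq_closed(2)[OF diff_closed[OF t(1) s(1)]] meas diff_closed weighted_sum_elem \<beta> s)
    moreover
    define p where "p = (\<lambda>\<omega>. \<Sum>n<m. weighted_sum \<theta> j \<epsilon> (b n) (S n) \<omega>)"
    have pX: "p \<in> elems X" unfolding p_def by (intro sum_closed wX)
    have "weighted_sum \<theta> j \<epsilon> (b n) F = weighted_sum \<theta> j \<epsilon> (b n) (S n)" if "n < m" for n
      unfolding weighted_sum_def using that F S(2)
      by (intro ext sum.mono_neutral_right) auto
    then have "p = (\<lambda>\<omega>. \<Sum>n<m. weighted_sum \<theta> j \<epsilon> (b n) F \<omega>)" by (simp add: p_def)
    then have "qnorm X (\<lambda>\<omega>. t \<omega> - p \<omega>) \<le> 2 * K * (D * B) / (2 * K) ^ m" using t(3) by simp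
    moreover have "qnorm X (\<lambda>\<omega>. p \<omega> - s \<omega>) \<le> 2 * K * (D * B) / (2 * K) ^ m"
      using s(3)[of m] qnorm_diff_commute[OF pX s(1)] by (simp add: p_def)
    moreover have "qnorm X (\<lambda>\<omega>. t \<omega> - s \<omega>) \<le> K * (qnorm X (\<lambda>\<omega>. t \<omega> - p \<omega>) + qnorm X (\<lambda>\<omega>. p \<omega> - s \<omega>))"
      by (rule quasi_triangle3[OF t(1) pX s(1)])
    ultimately have "qnorm X (\<lambda>\<omega>. weighted_sum \<theta> j \<epsilon> \<beta> F \<omega> - s \<omega>) \<le>
        K * (2 * K * (D * B) / (2 * K) ^ m + 2 * K * (D * B) / (2 * K) ^ m)"
      using K_nonneg by (smt (verit) mult_left_mono)
    then show ?thesis by (simp add: add_divide_distrib[symmetric] mult_ac)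
  qed
  show thesis
  proof (rule that[OF s(1) _ s(2)])
    show "qnorm X s \<le> 2 * K * D * (SUP i. cmod (\<epsilon> i))"
      using s(3)[of 0] by (simp add: B_def mult.assoc)
    have lim: "(\<lambda>m. K * (4 * K * (D * B) / (2 * K) ^ m)) \<longlonglongrightarrow> K * 0"
      using K_ge_1 by (intro tendsto_mult tendsto_const LIMSEQ_divide_realpow_zero) auto
    show "converges_in X (weighted_sum \<theta> j \<epsilon> \<beta>) s (finite_subsets_at_top UNIV)"
      unfolding converges_in_def
    proof (rule tendstoI)
      fix e :: real assume "0 < e"
      then have "eventually (\<lambda>m. K * (4 * K * (D * B) / (2 * K) ^ m) < e) sequentially"
        using order_tendstoD(2)[OF lim] by simp
      then obtain m where m: "K * (4 * K * (D * B) / (2 * K) ^ m) < e" by (auto simp: eventually_sequentially)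
      have "qnorm X (\<lambda>\<omega>. weighted_sum \<theta> j \<epsilon> \<beta> F \<omega> - s \<omega>) < e \<and> 0 \<le> qnorm X (\<lambda>\<omega>. weighted_sum \<theta> j \<epsilon> \<beta> F \<omega> - s \<omega>)"
        if "finite F" "(\<Union>n<m. S n) \<subseteq> F" for F
        using close[OF that] m by (auto intro!: qnorm_ge_0 diff_closed weighted_sum_elem \<beta> s)
      then show "eventually (\<lambda>F. dist (qnorm X (\<lambda>\<omega>. weighted_sum \<theta> j \<epsilon> \<beta> F \<omega> - s \<omega>)) 0 < e) (finite_subsets_at_top UNIV)"
        using S(1) unfolding eventually_finite_subsets_at_top
        by (intro exI[of _ "\<Union>n<m. S n"]) (auto simp: dist_real_def)
    qed
  qed
qed

end

context lattice_couple
begin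

text \<open>The unordered sum is evaluated along the symmetric sets G n, which exhaust the integers.
  This identifies y with the middle part plus the two one-sided limits, each of which is known to
  converge in only one of the spaces.\<close>

lemma one_sided_limits_sum:
  assumes a: "decomposes M X0 X1 a y" and y: "y \<in> elems Z"
    and r: "r \<in> elems X1" "converges_in X1 (\<lambda>n \<omega>. \<Sum>k<n. a (int N + int k) \<omega>) r sequentially"
    and s: "s \<in> elems X0" "converges_in X0 (\<lambda>n \<omega>. \<Sum>k<n. a (- (int N + int k)) \<omega>) s sequentially"
    and N: "0 < N"
  shows "AE \<omega> in M. y \<omega> = (\<Sum>i | \<bar>i\<bar> < int N. a i \<omega>) + (r \<omega> + s \<omega>)"
proof -
  have ael: "a i \<in> elems X0" "a i \<in> elems X1" for i using a by (auto simp: decomposes_def)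
  note aZ = X0_sub(1)[OF ael(1)]
  define G where "G n = {i. \<bar>i\<bar> < int N} \<union> ((\<lambda>k. int N + int k) ` {..<n} \<union> (\<lambda>k. - (int N + int k)) ` {..<n})" for n
  have fin: "finite {i. \<bar>i\<bar> < int N}" by (rule finite_subset[of _ "{- int N..int N}"]) auto
  have Gfin: "finite (G n)" for n unfolding G_def using fin by auto
  have Gsum: "(\<Sum>i\<in>G n. a i \<omega>) = (\<Sum>i | \<bar>i\<bar> < int N. a i \<omega>) + ((\<Sum>k<n. a (int N + int k) \<omega>) + (\<Sum>k<n. a (- (int N + int k)) \<omega>))" for n \<omega>
  proof -
    have "(\<Sum>i\<in>G n. a i \<omega>) = (\<Sum>i | \<bar>i\<bar> < int N. a i \<omega>) + ((\<Sum>i\<in>(\<lambda>k. int N + int k) ` {..<n}. a i \<omega>) + (\<Sum>i\<in>(\<lambda>k. - (int N + int k)) ` {..<n}. a i \<omega>))"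
      unfolding G_def using fin N by (subst sum.union_disjoint; (subst sum.union_disjoint)?) auto
    then show ?thesis by (simp add: sum.reindex inj_on_def)
  qed
  have "filterlim G (finite_subsets_at_top UNIV) sequentially"
    unfolding filterlim_finite_subsets_at_top
  proof (intro allI impI)
    fix F :: "int set" assume "finite F \<and> F \<subseteq> UNIV"
    then have F: "finite F" by simp
    define m where "m = Max (insert 0 ((\<lambda>i. nat \<bar>i\<bar>) ` F))"
    have m: "nat \<bar>i\<bar> \<le> m" if "i \<in> F" for i using F that by (simp add: m_def)
    have "F \<subseteq> G n" if "m < n" for n
    proof
      fix i assume i: "i \<in> F"
      show "i \<in> G n"
      proof (cases "\<bar>i\<bar> < int N")
        case False
        have "i = int N + int (nat (\<bar>i\<bar> - int N)) \<or> i = - (int N + int (nat (\<bar>i\<bar> - int N)))" using False by auto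
        moreover have "nat (\<bar>i\<bar> - int N) < n" using m[OF i] that by auto
        ultimately show ?thesis unfolding G_def by blast
      qed (simp add: G_def)
    qed
    then show "eventually (\<lambda>n. finite (G n) \<and> F \<subseteq> G n \<and> G n \<subseteq> UNIV) sequentially"
      using Gfin by (intro eventually_sequentiallyI[of "Suc m"]) simp
  qed
  with a have 1: "converges_in Z (\<lambda>n \<omega>. \<Sum>i\<in>G n. a i \<omega>) y sequentially"
    unfolding decomposes_def converges_in_def by (auto dest: filterlim_compose)
  have 2: "converges_in Z (\<lambda>n \<omega>. \<Sum>i\<in>G n. a i \<omega>) (\<lambda>\<omega>. (\<Sum>i | \<bar>i\<bar> < int N. a i \<omega>) + (r \<omega> + s \<omega>)) sequentially"
    unfolding Gsum
    by (intro Z.converges_in_add Z.converges_in_const Z.sum_closed Z.add_elem converges_in_X0_sum[OF _ s]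
        converges_in_X1_sum[OF _ r] X0_sub(1)[OF s(1)] X1_sub(1)[OF r(1)] aZ X0.sum_closed X1.sum_closed ael)
  have "(\<lambda>\<omega>. (\<Sum>i | \<bar>i\<bar> < int N. a i \<omega>) + (r \<omega> + s \<omega>)) \<in> elems Z"
    by (intro Z.add_elem Z.sum_closed aZ X0_sub(1)[OF s(1)] X1_sub(1)[OF r(1)])
  from Z.converges_in_unique[OF Z.sum_closed[OF aZ] y this trivial_limit_sequentially 1 2]
  show ?thesis .
qed

text \<open>The tails beyond N on either side are condensed into single terms r at N and s at -N.
  Each tail is small in the space whose weights grow on its side. In the other space it is recovered
  from y, which lies in both spaces, minus the rest, and for large N the small weight there
  compensates its size.\<close>

lemma finite_decomposition:
  assumes \<theta>: "0 < \<theta>" "\<theta> < 1" and y: "y \<in> elems X0" "y \<in> elems X1"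
    and c: "c \<in> bracket_bounds M X0 X1 \<theta> y" "0 < c"
  obtains b S where "finite S" "\<And>i. b i \<in> elems X0" "\<And>i. b i \<in> elems X1" "\<forall>i \<omega>. i \<notin> S \<longrightarrow> b i \<omega> = 0"
    "AE \<omega> in M. y \<omega> = (\<Sum>i\<in>S. b i \<omega>)"
    "finite_sums_bounded X0 \<theta> 0 b (7 * K ^ 4 * c)" "finite_sums_bounded X1 \<theta> 1 b (7 * K ^ 4 * c)"
proof -
  obtain a where a: "decomposes M X0 X1 a y" and bd: "finite_sums_bounded X0 \<theta> 0 a c" "finite_sums_bounded X1 \<theta> 1 a c"
    using c(1) by (auto simp: bracket_bounds_def)
  have ael: "a i \<in> elems X0" "a i \<in> elems X1" for i using a by (auto simp: decomposes_def)
  \<comment> \<open>From some N on, the norms of y are dominated by the inverse weights at N in X0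
    and at -N in X1; N depends on y, but the final constant does not.\<close>
  have "eventually (\<lambda>N. qnorm X0 y \<le> c * 2 powr (real N * \<theta>) \<and> qnorm X1 y \<le> c * 2 powr (real N * (1 - \<theta>)) \<and> 0 < N) sequentially"
  proof (intro eventually_conj eventually_gt_at_top)
    have "filterlim (\<lambda>N. c * 2 powr (real N * \<theta>)) at_top sequentially" using c(2) \<theta> by real_asymp
    then show "eventually (\<lambda>N. qnorm X0 y \<le> c * 2 powr (real N * \<theta>)) sequentially" by (simp add: filterlim_at_top)
    have "0 < 1 - \<theta>" using \<theta> by simp
    then have "filterlim (\<lambda>N. c * 2 powr (real N * (1 - \<theta>))) at_top sequentially" using c(2) by real_asymp
    then show "eventually (\<lambda>N. qnorm X1 y \<le> c * 2 powr (real N * (1 - \<theta>))) sequentially" by (simp add: filterlim_at_top)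
  qed
  then obtain N :: nat where N: "qnorm X0 y \<le> c * 2 powr (real N * \<theta>)" "qnorm X1 y \<le> c * 2 powr (real N * (1 - \<theta>))" "0 < N"
    by (auto simp: eventually_sequentially)
  obtain r where r: "r \<in> elems X1" "converges_in X1 (\<lambda>n \<omega>. \<Sum>k<n. a (int N + int k) \<omega>) r sequentially"
      "qnorm X1 r \<le> c * 2 powr (- (real N * (1 - \<theta>)))"
    using X1.one_sided_tail[OF ael(2) bd(2), of 1 N] \<theta> by auto
  obtain s where s: "s \<in> elems X0" "converges_in X0 (\<lambda>n \<omega>. \<Sum>k<n. a (- (int N + int k)) \<omega>) s sequentially"
      "qnorm X0 s \<le> c * 2 powr (- (real N * \<theta>))"
    using X0.one_sided_tail[OF ael(1) bd(1), of "-1" N] \<theta> by auto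
  define m where "m = (\<lambda>\<omega>. \<Sum>i | \<bar>i\<bar> < int N. a i \<omega>)"
  have fin: "finite {i. \<bar>i\<bar> < int N}" by (rule finite_subset[of _ "{- int N..int N}"]) auto
  have mX: "m \<in> elems X0" "m \<in> elems X1" unfolding m_def by (intro X0.sum_closed X1.sum_closed ael)+
  have m0: "qnorm X0 m \<le> c * 2 powr (real N * \<theta>)"
    unfolding m_def
  proof (rule X0.unweighted_sum_le[OF bd(1) fin])
    fix i :: int assume "i \<in> {i. \<bar>i\<bar> < int N}"
    then have "real_of_int i \<le> real N" by auto
    then show "2 powr (- (real_of_int i * (0 - \<theta>))) \<le> 2 powr (real N * \<theta>)" using \<theta> by (intro powr_mono) auto
  qed simp
  have m1: "qnorm X1 m \<le> c * 2 powr (real N * (1 - \<theta>))"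
    unfolding m_def
  proof (rule X1.unweighted_sum_le[OF bd(2) fin])
    fix i :: int assume "i \<in> {i. \<bar>i\<bar> < int N}"
    then have "- real_of_int i \<le> real N" by auto
    then have "- real_of_int i * (1 - \<theta>) \<le> real N * (1 - \<theta>)" using \<theta> by (intro mult_right_mono) auto
    then show "2 powr (- (real_of_int i * (1 - \<theta>))) \<le> 2 powr (real N * (1 - \<theta>))" by (intro powr_mono) auto
  qed simp
  have eq: "AE \<omega> in M. y \<omega> = m \<omega> + (r \<omega> + s \<omega>)"
    using one_sided_limits_sum[OF a X0_sub(1)[OF y(1)] r(1,2) s(1,2) N(3)] unfolding m_def .
  have three: "K * (K * (B + B) + B) \<le> 3 * K\<^sup>2 * B" if "0 \<le> B" for B
    using that mult_right_mono[OF self_le_power[OF K_ge_1, of 2], of B] by (simp add: algebra_simps power2_eq_square)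
  \<comment> \<open>The right tail r, obtained in X1, lies in X0 because it equals y - m - s almost
    everywhere.\<close>
  have rX0: "r \<in> elems X0" "qnorm X0 r \<le> 3 * K\<^sup>2 * (c * 2 powr (real N * \<theta>))"
  proof -
    have d: "(\<lambda>\<omega>. (y \<omega> - m \<omega>) - s \<omega>) \<in> elems X0" by (intro X0.diff_closed y mX s)
    have "AE \<omega> in M. r \<omega> = (y \<omega> - m \<omega>) - s \<omega>" using eq by eventually_elim simp
    note * = X0.AE_eq_closed[OF d X1.meas[OF r(1)] this]
    show "r \<in> elems X0" by (rule *)
    have "2 powr (- (real N * \<theta>)) \<le> 2 powr (real N * \<theta>)" using \<theta> by (intro powr_mono) auto
    then have s': "qnorm X0 s \<le> c * 2 powr (real N * \<theta>)" using s(3) c(2) by (meson order_trans mult_left_mono less_imp_le)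
    have "qnorm X0 r \<le> K * (K * (qnorm X0 y + qnorm X0 m) + qnorm X0 s)"
      unfolding *(2)
      by (rule order_trans[OF X0.quasi_triangle_diff[OF X0.diff_closed[OF y(1) mX(1)] s(1)]])
         (intro mult_left_mono add_mono X0.quasi_triangle_diff y mX K_nonneg order_refl)
    also have "\<dots> \<le> K * (K * (c * 2 powr (real N * \<theta>) + c * 2 powr (real N * \<theta>)) + c * 2 powr (real N * \<theta>))"
      by (intro mult_left_mono add_mono K_nonneg N m0 s')
    also have "\<dots> \<le> 3 * K\<^sup>2 * (c * 2 powr (real N * \<theta>))" using c(2) by (intro three) auto
    finally show "qnorm X0 r \<le> 3 * K\<^sup>2 * (c * 2 powr (real N * \<theta>))" .
  qed
  have sX1: "s \<in> elems X1" "qnorm X1 s \<le> 3 * K\<^sup>2 * (c * 2 powr (real N * (1 - \<theta>)))"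
  proof -
    have d: "(\<lambda>\<omega>. (y \<omega> - m \<omega>) - r \<omega>) \<in> elems X1" by (intro X1.diff_closed y mX r)
    have "AE \<omega> in M. s \<omega> = (y \<omega> - m \<omega>) - r \<omega>" using eq by eventually_elim simp
    note * = X1.AE_eq_closed[OF d X0.meas[OF s(1)] this]
    show "s \<in> elems X1" by (rule *)
    have "2 powr (- (real N * (1 - \<theta>))) \<le> 2 powr (real N * (1 - \<theta>))" using \<theta> by (intro powr_mono) auto
    then have r': "qnorm X1 r \<le> c * 2 powr (real N * (1 - \<theta>))" using r(3) c(2) by (meson order_trans mult_left_mono less_imp_le)
    have "qnorm X1 s \<le> K * (K * (qnorm X1 y + qnorm X1 m) + qnorm X1 r)"
      unfolding *(2)
      by (rule order_trans[OF X1.quasi_triangle_diff[OF X1.diff_closed[OF y(2) mX(2)] r(1)]])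
         (intro mult_left_mono add_mono X1.quasi_triangle_diff y mX K_nonneg order_refl)
    also have "\<dots> \<le> K * (K * (c * 2 powr (real N * (1 - \<theta>)) + c * 2 powr (real N * (1 - \<theta>))) + c * 2 powr (real N * (1 - \<theta>)))"
      by (intro mult_left_mono add_mono K_nonneg N m1 r')
    also have "\<dots> \<le> 3 * K\<^sup>2 * (c * 2 powr (real N * (1 - \<theta>)))" using c(2) by (intro three) auto
    finally show "qnorm X1 s \<le> 3 * K\<^sup>2 * (c * 2 powr (real N * (1 - \<theta>)))" .
  qed
  have one: "c * t \<le> 3 * K\<^sup>2 * c * t" if "0 \<le> t" for t
  proof -
    have "1 \<le> K\<^sup>2" using K_ge_1 by simp
    then have "1 * (c * t) \<le> (3 * K\<^sup>2) * (c * t)" using that c(2) by (intro mult_right_mono) auto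
    then show ?thesis by (simp add: mult.assoc)
  qed
  define b where "b = (\<lambda>i \<omega>. (if \<bar>i\<bar> < int N then a i \<omega> else 0) + ((if i = int N then r \<omega> else 0) + (if i = - int N then s \<omega> else 0)))"
  define S where "S = {- int N..int N}"
  have ifel: "(\<lambda>\<omega>. if P then f \<omega> else 0) \<in> elems X0" if "f \<in> elems X0" for P f using that X0.zero_elem by (cases P) simp_all
  have ifel1: "(\<lambda>\<omega>. if P then f \<omega> else 0) \<in> elems X1" if "f \<in> elems X1" for P f using that X1.zero_elem by (cases P) simp_all
  show thesis
  proof (rule that)
    show "finite S" by (simp add: S_def)
    show "b i \<in> elems X0" for i unfolding b_def by (intro X0.add_elem ifel ael rX0 s)
    show "b i \<in> elems X1" for i unfolding b_def by (intro X1.add_elem ifel1 ael sX1 r)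
    show "\<forall>i \<omega>. i \<notin> S \<longrightarrow> b i \<omega> = 0" by (auto simp: b_def S_def)
    show "AE \<omega> in M. y \<omega> = (\<Sum>i\<in>S. b i \<omega>)"
      using eq
    proof eventually_elim
      case (elim \<omega>)
      have "{i\<in>S. \<bar>i\<bar> < int N} = {i. \<bar>i\<bar> < int N}" by (auto simp: S_def)
      then have "(\<Sum>i\<in>S. if \<bar>i\<bar> < int N then a i \<omega> else 0) = m \<omega>"
        unfolding m_def by (subst sum.inter_filter[symmetric]) (auto simp: S_def)
      then show ?case using elim by (simp add: b_def sum.distrib) (simp add: S_def)
    qed
    show "finite_sums_bounded X0 \<theta> 0 b (7 * K ^ 4 * c)"
      unfolding b_def
      by (rule X0.finite_sums_bounded_extend[OF ael(1) bd(1)])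
         (use N(3) rX0 s(1) order_trans[OF s(3) one] in \<open>auto simp: mult.assoc\<close>)
    show "finite_sums_bounded X1 \<theta> 1 b (7 * K ^ 4 * c)"
      unfolding b_def
      by (rule X1.finite_sums_bounded_extend[OF ael(2) bd(2)])
         (use N(3) sX1 r(1) order_trans[OF r(3) one] in \<open>auto simp: mult.assoc\<close>)
  qed
qed

text \<open>The terms for a fixed index i converge in both spaces, and the two limits agree because
  they agree in X0 + X1. Multiplier convergence comes from \<open>double_series\<close>. It remains
  to see that the terms \<beta> i add up to x, for which the same interchange is used with special
  multipliers.\<close>

lemma decompositions_sum:
  assumes \<theta>: "0 < \<theta>" "\<theta> < 1" and x: "x \<in> elems Z"
    and b: "\<And>n i. b n i \<in> elems X0" "\<And>n i. b n i \<in> elems X1"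
    and S: "\<And>n. finite (S n)" "\<And>n. \<forall>i \<omega>. i \<notin> S n \<longrightarrow> b n i \<omega> = 0"
    and y: "\<And>n. y n \<in> elems Z" "\<And>n. AE \<omega> in M. y n \<omega> = (\<Sum>i\<in>S n. b n i \<omega>)"
    and bd0: "\<And>n. finite_sums_bounded X0 \<theta> 0 (b n) (D / (2 * K) ^ n)"
    and bd1: "\<And>n. finite_sums_bounded X1 \<theta> 1 (b n) (D / (2 * K) ^ n)"
    and lim: "converges_in Z (\<lambda>m \<omega>. \<Sum>n<m. y n \<omega>) x sequentially"
  shows "2 * K * D \<in> conv_bracket_bounds M X0 X1 \<theta> x"
proof -
  have D: "0 \<le> D" using X0.finite_sums_bounded_nonneg[OF bd0[of 0]] by simp
  have "\<exists>\<beta>. \<beta> \<in> elems X0 \<and> \<beta> \<in> elems X1 \<and> converges_in X0 (\<lambda>m \<omega>. \<Sum>n<m. b n i \<omega>) \<beta> sequentially \<and>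
      converges_in X1 (\<lambda>m \<omega>. \<Sum>n<m. b n i \<omega>) \<beta> sequentially" for i
  proof -
    define B where "B = max (2 powr (- (real_of_int i * (0 - \<theta>)))) (2 powr (- (real_of_int i * (1 - \<theta>))))"
    have B: "0 \<le> B" by (simp add: B_def le_max_iff_disj)
    have n0: "qnorm X0 (b n i) \<le> D * B / (2 * K) ^ n" for n
      using X0.unweighted_sum_le[OF bd0[of n], of "{i}" B] B by (simp add: B_def)
    obtain p where p: "p \<in> elems X0" "converges_in X0 (\<lambda>m \<omega>. \<Sum>n<m. b n i \<omega>) p sequentially"
      by (rule X0.geometric_series[where f = "\<lambda>n. b n i", OF b(1) n0], rule that)
    have n1: "qnorm X1 (b n i) \<le> D * B / (2 * K) ^ n" for n
      using X1.unweighted_sum_le[OF bd1[of n], of "{i}" B] B by (simp add: B_def)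
    obtain q where q: "q \<in> elems X1" "converges_in X1 (\<lambda>m \<omega>. \<Sum>n<m. b n i \<omega>) q sequentially"
      by (rule X1.geometric_series[where f = "\<lambda>n. b n i", OF b(2) n1], rule that)
    have pq: "AE \<omega> in M. p \<omega> = q \<omega>"
      by (rule Z.converges_in_unique[OF X0_sub(1)[OF X0.sum_closed[OF b(1)]] X0_sub(1)[OF p(1)] X1_sub(1)[OF q(1)]
            trivial_limit_sequentially converges_in_X0_sum[OF X0.sum_closed[OF b(1)] p]
            converges_in_X1_sum[OF X1.sum_closed[OF b(2)] q]])
    have pX1: "p \<in> elems X1" by (rule X1.AE_eq_closed(1)[OF q(1) X0.meas[OF p(1)] pq])
    have "qnorm X1 (\<lambda>\<omega>. (\<Sum>n<m. b n i \<omega>) - p \<omega>) = qnorm X1 (\<lambda>\<omega>. (\<Sum>n<m. b n i \<omega>) - q \<omega>)" for m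
    proof (rule X1.AE_eq_closed(2)[OF X1.diff_closed[OF X1.sum_closed[OF b(2)] q(1)]
          X1.meas[OF X1.diff_closed[OF X1.sum_closed[OF b(2)] pX1]]])
      show "AE \<omega> in M. (\<Sum>n<m. b n i \<omega>) - p \<omega> = (\<Sum>n<m. b n i \<omega>) - q \<omega>" using pq by eventually_elim simp
    qed
    then have "converges_in X1 (\<lambda>m \<omega>. \<Sum>n<m. b n i \<omega>) p sequentially" using q(2) by (simp add: converges_in_def)
    then show ?thesis using p pX1 by (intro exI[of _ p] conjI)
  qed
  then have "\<forall>i. \<exists>\<beta>. \<beta> \<in> elems X0 \<and> \<beta> \<in> elems X1 \<and> converges_in X0 (\<lambda>m \<omega>. \<Sum>n<m. b n i \<omega>) \<beta> sequentially \<and>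
      converges_in X1 (\<lambda>m \<omega>. \<Sum>n<m. b n i \<omega>) \<beta> sequentially" ..
  from choice[OF this] obtain \<beta> where \<beta>: "\<And>i. \<beta> i \<in> elems X0" "\<And>i. \<beta> i \<in> elems X1"
      "\<And>i. converges_in X0 (\<lambda>m \<omega>. \<Sum>n<m. b n i \<omega>) (\<beta> i) sequentially"
      "\<And>i. converges_in X1 (\<lambda>m \<omega>. \<Sum>n<m. b n i \<omega>) (\<beta> i) sequentially" by blast
  note series0 = X0.double_series[where b = b and S = S and \<beta> = \<beta>, OF b(1) S bd0 \<beta>(1,3)]
  note series1 = X1.double_series[where b = b and S = S and \<beta> = \<beta>, OF b(2) S bd1 \<beta>(2,4)]
  have sb0: "series_bounded X0 \<theta> 0 \<beta> (2 * K * D)"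
    unfolding series_bounded_def
  proof (intro allI impI)
    fix \<epsilon> :: "int \<Rightarrow> complex" assume bd: "bounded (range \<epsilon>)"
    show "\<exists>s\<in>elems X0. converges_in X0 (weighted_sum \<theta> 0 \<epsilon> \<beta>) s (finite_subsets_at_top UNIV) \<and>
      qnorm X0 s \<le> 2 * K * D * (SUP i. cmod (\<epsilon> i))" by (rule series0[OF bd]) (intro bexI conjI)
  qed
  have sb1: "series_bounded X1 \<theta> 1 \<beta> (2 * K * D)"
    unfolding series_bounded_def
  proof (intro allI impI)
    fix \<epsilon> :: "int \<Rightarrow> complex" assume bd: "bounded (range \<epsilon>)"
    show "\<exists>s\<in>elems X1. converges_in X1 (weighted_sum \<theta> 1 \<epsilon> \<beta>) s (finite_subsets_at_top UNIV) \<and>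
      qnorm X1 s \<le> 2 * K * D * (SUP i. cmod (\<epsilon> i))" by (rule series1[OF bd]) (intro bexI conjI)
  qed
  \<comment> \<open>These multipliers undo the weights, for i <= 0 in X0 and for i > 0 in X1, where
    the inverse weights are at most 1. The unweighted sum becomes a sum of two admissible multiplier
    series.\<close>
  define \<epsilon>0 where "\<epsilon>0 i = (if i \<le> 0 then complex_of_real (2 powr (- (real_of_int i * (0 - \<theta>)))) else 0)" for i
  define \<epsilon>1 where "\<epsilon>1 i = (if i \<le> 0 then 0 else complex_of_real (2 powr (- (real_of_int i * (1 - \<theta>)))))" for i
  have split: "weighted_sum \<theta> 0 \<epsilon>0 u F \<omega> + weighted_sum \<theta> 1 \<epsilon>1 u F \<omega> = (\<Sum>i\<in>F. u i \<omega>)" for u F \<omega>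
    unfolding weighted_sum_def sum.distrib[symmetric]
    by (intro sum.cong refl) (auto simp: \<epsilon>0_def \<epsilon>1_def powr_minus simp flip: of_real_mult)
  have "2 powr (- (real_of_int i * (0 - \<theta>))) \<le> 2 powr 0" if "i \<le> 0" for i :: int
    using that \<theta> by (intro powr_mono) (auto simp: mult_nonpos_nonneg)
  then have "cmod (\<epsilon>0 i) \<le> 1" for i by (simp add: \<epsilon>0_def)
  then have e0: "bounded (range \<epsilon>0)" by (auto simp: bounded_iff)
  have "2 powr (- (real_of_int i * (1 - \<theta>))) \<le> 2 powr 0" if "\<not> i \<le> 0" for i :: int
    using that \<theta> by (intro powr_mono) auto
  then have "cmod (\<epsilon>1 i) \<le> 1" for i by (simp add: \<epsilon>1_def)
  then have e1: "bounded (range \<epsilon>1)" by (auto simp: bounded_iff)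
  obtain s where s: "s \<in> elems X0" "converges_in X0 (weighted_sum \<theta> 0 \<epsilon>0 \<beta>) s (finite_subsets_at_top UNIV)"
    "converges_in X0 (\<lambda>m \<omega>. \<Sum>n<m. weighted_sum \<theta> 0 \<epsilon>0 (b n) (S n) \<omega>) s sequentially"
    by (rule series0[OF e0], rule that)
  obtain t where t: "t \<in> elems X1" "converges_in X1 (weighted_sum \<theta> 1 \<epsilon>1 \<beta>) t (finite_subsets_at_top UNIV)"
    "converges_in X1 (\<lambda>m \<omega>. \<Sum>n<m. weighted_sum \<theta> 1 \<epsilon>1 (b n) (S n) \<omega>) t sequentially"
    by (rule series1[OF e1], rule that)
  have w0: "weighted_sum \<theta> 0 \<epsilon>0 u F \<in> elems X0" if "\<And>i. u i \<in> elems X0" for u F by (rule X0.weighted_sum_elem[OF that])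
  have w1: "weighted_sum \<theta> 1 \<epsilon>1 u F \<in> elems X1" if "\<And>i. u i \<in> elems X1" for u F by (rule X1.weighted_sum_elem[OF that])
  have st: "(\<lambda>\<omega>. s \<omega> + t \<omega>) \<in> elems Z" by (rule sum_add_elem(1)[OF s(1) t(1)])
  have 1: "converges_in Z (\<lambda>F \<omega>. \<Sum>i\<in>F. \<beta> i \<omega>) (\<lambda>\<omega>. s \<omega> + t \<omega>) (finite_subsets_at_top UNIV)"
    unfolding split[symmetric]
    by (intro Z.converges_in_add X0_sub(1) X1_sub(1) w0 w1 \<beta> s(1) t(1) converges_in_X0_sum[OF w0 s(1,2)] converges_in_X1_sum[OF w1 t(1,2)])
  have 2: "converges_in Z (\<lambda>m \<omega>. \<Sum>n<m. \<Sum>i\<in>S n. b n i \<omega>) (\<lambda>\<omega>. s \<omega> + t \<omega>) sequentially"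
    unfolding split[symmetric] sum.distrib
    by (intro Z.converges_in_add X0_sub(1) X1_sub(1) w0 w1 X0.sum_closed X1.sum_closed b s(1) t(1)
        converges_in_X0_sum[OF X0.sum_closed[OF w0] s(1,3)] converges_in_X1_sum[OF X1.sum_closed[OF w1] t(1,3)])
  have yb: "(\<lambda>\<omega>. \<Sum>n<m. \<Sum>i\<in>S n. b n i \<omega>) \<in> elems Z" for m by (intro X0_sub(1) X0.sum_closed b)
  have "qnorm Z (\<lambda>\<omega>. (\<Sum>n<m. y n \<omega>) - (s \<omega> + t \<omega>)) = qnorm Z (\<lambda>\<omega>. (\<Sum>n<m. \<Sum>i\<in>S n. b n i \<omega>) - (s \<omega> + t \<omega>))" for m
  proof (rule Z.AE_eq_closed(2)[OF Z.diff_closed[OF yb st] Z.meas[OF Z.diff_closed[OF Z.sum_closed[OF y(1)] st]]])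
    have "AE \<omega> in M. \<forall>n. y n \<omega> = (\<Sum>i\<in>S n. b n i \<omega>)" using y(2) by (simp add: AE_all_countable)
    then show "AE \<omega> in M. (\<Sum>n<m. y n \<omega>) - (s \<omega> + t \<omega>) = (\<Sum>n<m. \<Sum>i\<in>S n. b n i \<omega>) - (s \<omega> + t \<omega>)"
      by eventually_elim simp
  qed
  then have "converges_in Z (\<lambda>m \<omega>. \<Sum>n<m. y n \<omega>) (\<lambda>\<omega>. s \<omega> + t \<omega>) sequentially"
    using 2 by (simp add: converges_in_def)
  from Z.converges_in_unique[OF Z.sum_closed[OF y(1)] x st trivial_limit_sequentially lim this]
  have eq: "AE \<omega> in M. x \<omega> = s \<omega> + t \<omega>" .
  have \<beta>Z: "(\<lambda>\<omega>. \<Sum>i\<in>F. \<beta> i \<omega>) \<in> elems Z" for F by (intro X0_sub(1) X0.sum_closed \<beta>)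
  have "qnorm Z (\<lambda>\<omega>. (\<Sum>i\<in>F. \<beta> i \<omega>) - x \<omega>) = qnorm Z (\<lambda>\<omega>. (\<Sum>i\<in>F. \<beta> i \<omega>) - (s \<omega> + t \<omega>))" for F
  proof (rule Z.AE_eq_closed(2)[OF Z.diff_closed[OF \<beta>Z st] Z.meas[OF Z.diff_closed[OF \<beta>Z x]]])
    show "AE \<omega> in M. (\<Sum>i\<in>F. \<beta> i \<omega>) - x \<omega> = (\<Sum>i\<in>F. \<beta> i \<omega>) - (s \<omega> + t \<omega>)" using eq by eventually_elim simp
  qed
  then have "converges_in Z (\<lambda>F \<omega>. \<Sum>i\<in>F. \<beta> i \<omega>) x (finite_subsets_at_top UNIV)"
    using 1 by (simp add: converges_in_def)
  then show ?thesis
    using \<beta>(1,2) sb0 sb1 unfolding conv_bracket_bounds_def decomposes_def by blast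
qed

end

section \<open>The inner complex method and the bracket spaces\<close>

context quasi_normed_fspace
begin

lemma finite_sums_bounded_mono:
  assumes "finite_sums_bounded X \<theta> j a c" "c \<le> d"
  shows "finite_sums_bounded X \<theta> j a d"
proof (rule finite_sums_boundedI)
  show "0 \<le> d" using finite_sums_bounded_nonneg[OF assms(1)] assms(2) by simp
  show "qnorm X (weighted_sum \<theta> j \<epsilon> a F) \<le> d * B"
    if "finite F" "\<And>i. cmod (\<epsilon> i) \<le> B" "0 \<le> B" for F \<epsilon> B
    using finite_sums_boundedD[where \<epsilon> = \<epsilon>, OF assms(1) that] mult_right_mono[OF assms(2) that(3)] by simp
qed

end

context lattice_couple
begin

lemma bracket_bounds_mono:
  assumes "c \<in> bracket_bounds M X0 X1 \<theta> y" "c \<le> d"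
  shows "d \<in> bracket_bounds M X0 X1 \<theta> y"
proof -
  obtain a where a: "decomposes M X0 X1 a y" "finite_sums_bounded X0 \<theta> 0 a c" "finite_sums_bounded X1 \<theta> 1 a c"
    using assms(1) by (auto simp: bracket_bounds_def)
  show ?thesis
    unfolding bracket_bounds_def
    by (intro CollectI exI[of _ a] conjI a X0.finite_sums_bounded_mono[OF a(2) assms(2)]
        X1.finite_sums_bounded_mono[OF a(3) assms(2)])
qed

lemma calderon_bounds_nonneg: "c \<in> calderon_bounds M X0 X1 \<theta> y \<Longrightarrow> 0 \<le> c"
  by (auto simp: calderon_bounds_def)

text \<open>The strict inequality for D leaves room for the infimum in the bracket quasi-norm, which
  need not be attained; admissible constants are upward closed.\<close>

lemma calderon_into_bracket:
  assumes \<theta>: "0 < \<theta>" "\<theta> < 1"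
    and sub: "elems (calderon_product M X0 X1 \<theta>) \<subseteq> elems (bracket_space M X0 X1 \<theta>)"
    and E: "0 < E" "\<And>f. f \<in> elems (calderon_product M X0 X1 \<theta>) \<Longrightarrow>
      qnorm (bracket_space M X0 X1 \<theta>) f \<le> E * qnorm (calderon_product M X0 X1 \<theta>) f"
    and y: "y \<in> borel_measurable M" and f: "f0 \<in> elems X0" "f1 \<in> elems X1"
    and le: "qnorm X0 f0 \<le> B" "qnorm X1 f1 \<le> B"
    and dom: "AE \<omega> in M. cmod (y \<omega>) \<le> cmod (f0 \<omega>) powr (1 - \<theta>) * cmod (f1 \<omega>) powr \<theta>"
    and D: "E * B < D"
  shows "D \<in> bracket_bounds M X0 X1 \<theta> y"
proof -
  let ?c = "qnorm X0 f0 powr (1 - \<theta>) * qnorm X1 f1 powr \<theta>"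
  have c: "?c \<in> calderon_bounds M X0 X1 \<theta> y"
    unfolding calderon_bounds_def by (intro CollectI exI[of _ f0] exI[of _ f1] conjI refl f dom)
  then have yc: "y \<in> elems (calderon_product M X0 X1 \<theta>)"
    using y by (auto simp: calderon_product_def)
  have B: "0 \<le> B" using le(1) X0.qnorm_ge_0[OF f(1)] by simp
  have "?c \<le> B powr (1 - \<theta>) * B powr \<theta>"
    using \<theta> le X0.qnorm_ge_0[OF f(1)] X1.qnorm_ge_0[OF f(2)] by (intro mult_mono powr_mono2) auto
  also have "\<dots> = B" using B by (cases "B = 0") (auto simp flip: powr_add)
  finally have "?c \<le> B" .
  moreover have "Inf (calderon_bounds M X0 X1 \<theta> y) \<le> ?c"
    by (rule cInf_lower[OF c]) (rule bdd_belowI, rule calderon_bounds_nonneg)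
  ultimately have "qnorm (calderon_product M X0 X1 \<theta>) y \<le> B" by (simp add: calderon_product_def)
  then have "E * qnorm (calderon_product M X0 X1 \<theta>) y \<le> E * B" using E(1) by simp
  then have "qnorm (bracket_space M X0 X1 \<theta>) y < D" using E(2)[OF yc] D by linarith
  then have "Inf (bracket_bounds M X0 X1 \<theta> y) < D" by (simp add: bracket_space_def)
  moreover have "bracket_bounds M X0 X1 \<theta> y \<noteq> {}" using subsetD[OF sub yc] by (simp add: bracket_space_def)
  ultimately obtain d where "d \<in> bracket_bounds M X0 X1 \<theta> y" "d < D" using cInf_lessD by blast
  then show ?thesis using bracket_bounds_mono by (simp add: less_imp_le)
qed

text \<open>The summand e keeps the working constant A positive even when f has norm 0. Telescoping
  differences of approximants have geometrically small boundary norms, and their values at \<theta>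
  lie in X0 \<inter> X1, so the factorisation, the hypothesis and the finite decompositions apply to
  each of them.\<close>

lemma inner_into_conv_bracket:
  assumes "analytically_convex X0" "analytically_convex X1" and \<theta>: "0 < \<theta>" "\<theta> < 1"
    and equiv: "equivalent_spaces (calderon_product M X0 X1 \<theta>) (bracket_space M X0 X1 \<theta>)"
  obtains L where "0 < L" "\<And>f x e. \<lbrakk>f \<in> calA0 M X0 X1; x \<in> borel_measurable M; AE \<omega> in M. f (of_real \<theta>) \<omega> = x \<omega>; 0 < e\<rbrakk> \<Longrightarrow>
    x \<in> elems Z \<and> L * (calA_norm X0 X1 f + e) \<in> conv_bracket_bounds M X0 X1 \<theta> x"
proof (rule three_lines_estimate[OF assms(1,2) \<theta>])
  fix C assume C: "0 < C" and est: "\<And>h A \<eta>. \<lbrakk>h \<in> calA M X0 X1; 0 < A; \<And>t. qnorm X0 (h (Complex 0 t)) \<le> A;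
      \<And>t. qnorm X1 (h (Complex 1 t)) \<le> A; 0 < \<eta>\<rbrakk> \<Longrightarrow> \<exists>P0 P1 R0 R1. X0.dominated P0 (C * A) \<and> X1.dominated P1 (C * A) \<and>
      X0.dominated R0 \<eta> \<and> X1.dominated R1 \<eta> \<and> (\<forall>\<omega>. 0 \<le> P0 \<omega> \<and> 0 \<le> P1 \<omega> \<and> 0 \<le> R0 \<omega> \<and> 0 \<le> R1 \<omega>) \<and>
      (AE \<omega> in M. cmod (h (of_real \<theta>) \<omega>) \<le> (P0 \<omega> + R1 \<omega>) powr (1 - \<theta>) * (P1 \<omega> + R0 \<omega>) powr \<theta>)"
  obtain E where E: "0 < E" "\<And>f. f \<in> elems (calderon_product M X0 X1 \<theta>) \<Longrightarrow>
      qnorm (bracket_space M X0 X1 \<theta>) f \<le> E * qnorm (calderon_product M X0 X1 \<theta>) f"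
    using equiv unfolding equivalent_spaces_def by blast
  have sub: "elems (calderon_product M X0 X1 \<theta>) \<subseteq> elems (bracket_space M X0 X1 \<theta>)"
    using equiv unfolding equivalent_spaces_def by blast
  \<comment> \<open>The norm of the inclusion times the constant of \<open>calderon_absorb\<close>;
    adding 1 makes the required inequality strict.\<close>
  define H where "H = E * (K * (C + 2 * K)) + 1"
  have H: "0 < H" using E(1) C K_pos by (simp add: H_def add_pos_pos)
  let ?z = "complex_of_real \<theta>"
  have z: "?z \<in> open_strip" using \<theta> by (simp add: open_strip_def)
  show thesis
  proof (rule that)
    show "0 < 2 * K * (14 * K ^ 5 * H)" using H K_pos by simp
    fix f x and e :: real
    assume f: "f \<in> calA0 M X0 X1" and x: "x \<in> borel_measurable M" "AE \<omega> in M. f ?z \<omega> = x \<omega>" and e: "0 < e"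
    define A where "A = calA_norm X0 X1 f + e"
    have fA: "f \<in> calA M X0 X1" using f by (simp add: calA0_def)
    have A: "0 < A" using calA_norm_nonneg[OF fA] e by (simp add: A_def)
    have fZ: "f ?z \<in> elems Z" by (rule calA_value[OF fA z])
    have x': "AE \<omega> in M. x \<omega> = f ?z \<omega>" using x(2) by eventually_elim simp
    have xZ: "x \<in> elems Z" by (rule Z.AE_eq_closed(1)[OF fZ x(1) x'])
    \<comment> \<open>The rate 2 K is the one demanded by \<open>decompositions_sum\<close>; the
      additional power covers the quasi-triangle inequality in passing to differences.\<close>
    define \<rho> where "\<rho> n = A / (2 * K) ^ Suc n" for n
    have \<rho>: "0 < \<rho> n" for n using A K_pos by (simp add: \<rho>_def)
    have \<rho>mono: "\<rho> (Suc n) \<le> \<rho> n" for n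
      using A K_ge_1 unfolding \<rho>_def by (intro divide_left_mono power_increasing mult_pos_pos zero_less_power) auto
    have "\<forall>n. \<exists>g. g \<in> calA M X0 X1 \<and> (\<forall>z\<in>open_strip. g z \<in> elems X0 \<inter> elems X1) \<and>
        calA_norm X0 X1 (\<lambda>z \<omega>. f z \<omega> - g z \<omega>) < \<rho> n"
      using f \<rho> unfolding calA0_def Bex_def by simp
    from choice[OF this] obtain g where g: "\<And>n. g n \<in> calA M X0 X1" "\<And>n z. z \<in> open_strip \<Longrightarrow> g n z \<in> elems X0"
      "\<And>n z. z \<in> open_strip \<Longrightarrow> g n z \<in> elems X1" "\<And>n. calA_norm X0 X1 (\<lambda>z \<omega>. f z \<omega> - g n z \<omega>) < \<rho> n" by auto
    define h where "h n = (\<lambda>z \<omega>. f z \<omega> - g n z \<omega>)" for n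
    have hA: "h n \<in> calA M X0 X1" for n unfolding h_def by (rule calA_diff[OF fA g(1)])
    have h0: "qnorm X0 (h n (Complex 0 t)) \<le> \<rho> n" and h1: "qnorm X1 (h n (Complex 1 t)) \<le> \<rho> n" for n t
      using calA_boundary(3,4)[OF hA[of n], of t] g(4)[of n] by (auto simp: h_def)
    have f0: "qnorm X0 (f (Complex 0 t)) \<le> A" and f1: "qnorm X1 (f (Complex 1 t)) \<le> A" for t
      using calA_boundary(3,4)[OF fA, of t] e by (auto simp: A_def)
    \<comment> \<open>Telescoping: d 0 is g 0, of size comparable to f, and the later d n are also
      differences of the errors f - g m, hence small on the boundary.\<close>
    define d where "d n = (case n of 0 \<Rightarrow> g 0 | Suc m \<Rightarrow> (\<lambda>z \<omega>. g (Suc m) z \<omega> - g m z \<omega>))" for n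
    have dA: "d n \<in> calA M X0 X1" for n
      by (cases n) (auto simp: d_def intro: g(1) calA_diff)
    define An where "An n = 2 * K * A / (2 * K) ^ n" for n :: nat
    have An: "0 < An n" for n using A K_pos by (simp add: An_def)
    have A\<rho>: "K * (\<rho> n + \<rho> (Suc n)) \<le> An (Suc n)" for n
    proof -
      have "K * (\<rho> n + \<rho> (Suc n)) \<le> K * (\<rho> n + \<rho> n)" by (intro mult_left_mono add_left_mono \<rho>mono K_nonneg)
      also have "\<dots> = An (Suc n)"
      proof -
        have "K * (A / p + A / p) = 2 * K * A / p" for p by (simp add: add_divide_distrib[symmetric])
        then show ?thesis unfolding An_def \<rho>_def .
      qed
      finally show ?thesis .
    qed
    have A0: "K * (A + \<rho> 0) \<le> An 0"
    proof -
      have "\<rho> 0 \<le> A" using A K_ge_1 by (simp add: \<rho>_def field_simps)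
      then have "K * (A + \<rho> 0) \<le> K * (A + A)" by (intro mult_left_mono K_nonneg) simp
      then show ?thesis by (simp add: An_def)
    qed
    have dn: "qnorm X0 (d n (Complex 0 t)) \<le> An n \<and> qnorm X1 (d n (Complex 1 t)) \<le> An n" for n t
    proof (cases n)
      case 0
      have eq: "d 0 w = (\<lambda>\<omega>. f w \<omega> - h 0 w \<omega>)" for w by (auto simp: d_def h_def)
      have "qnorm X0 (d 0 (Complex 0 t)) \<le> K * (A + \<rho> 0)"
        unfolding eq by (rule order_trans[OF X0.quasi_triangle_diff]) (intro mult_left_mono add_mono K_nonneg f0 h0 calA_boundary(1) fA hA)+
      moreover have "qnorm X1 (d 0 (Complex 1 t)) \<le> K * (A + \<rho> 0)"
        unfolding eq by (rule order_trans[OF X1.quasi_triangle_diff]) (intro mult_left_mono add_mono K_nonneg f1 h1 calA_boundary(2) fA hA)+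
      ultimately show ?thesis using A0 0 by simp
    next
      case (Suc m)
      have eq: "d (Suc m) w = (\<lambda>\<omega>. h m w \<omega> - h (Suc m) w \<omega>)" for w by (auto simp: d_def h_def)
      have "qnorm X0 (d (Suc m) (Complex 0 t)) \<le> K * (\<rho> m + \<rho> (Suc m))"
        unfolding eq by (rule order_trans[OF X0.quasi_triangle_diff]) (intro mult_left_mono add_mono K_nonneg h0 calA_boundary(1) hA)+
      moreover have "qnorm X1 (d (Suc m) (Complex 1 t)) \<le> K * (\<rho> m + \<rho> (Suc m))"
        unfolding eq by (rule order_trans[OF X1.quasi_triangle_diff]) (intro mult_left_mono add_mono K_nonneg h1 calA_boundary(2) hA)+
      ultimately show ?thesis using A\<rho>[of m] Suc by simp
    qed
    have dn0: "qnorm X0 (d n (Complex 0 t)) \<le> An n" and dn1: "qnorm X1 (d n (Complex 1 t)) \<le> An n" for n t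
      using dn by blast+
    define y where "y n = d n ?z" for n
    have y0: "y n \<in> elems X0" for n
      unfolding y_def d_def by (cases n) (auto intro!: X0.diff_closed g(2) z)
    have y1: "y n \<in> elems X1" for n
      unfolding y_def d_def by (cases n) (auto intro!: X1.diff_closed g(3) z)
    have yb: "H * An n \<in> bracket_bounds M X0 X1 \<theta> (y n)" for n
    proof -
      obtain f0 f1 where ff: "f0 \<in> elems X0" "f1 \<in> elems X1" "qnorm X0 f0 \<le> K * (C + 2 * K) * An n"
          "qnorm X1 f1 \<le> K * (C + 2 * K) * An n"
          "AE \<omega> in M. cmod (y n \<omega>) \<le> cmod (f0 \<omega>) powr (1 - \<theta>) * cmod (f1 \<omega>) powr \<theta>"
        by (rule calderon_absorb[OF \<theta> y0 y1 An est[OF dA An dn0 dn1, folded y_def]], assumption, rule that)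
      have lt: "E * (K * (C + 2 * K) * An n) < H * An n" using An[of n] by (simp add: H_def distrib_right)
      show ?thesis by (rule calderon_into_bracket[OF \<theta> sub E X0.meas[OF y0] ff lt])
    qed
    have "\<exists>b S. finite S \<and> (\<forall>i. b i \<in> elems X0) \<and> (\<forall>i. b i \<in> elems X1) \<and> (\<forall>i \<omega>. i \<notin> S \<longrightarrow> b i \<omega> = 0) \<and>
        (AE \<omega> in M. y n \<omega> = (\<Sum>i\<in>S. b i \<omega>)) \<and>
        finite_sums_bounded X0 \<theta> 0 b (7 * K ^ 4 * (H * An n)) \<and> finite_sums_bounded X1 \<theta> 1 b (7 * K ^ 4 * (H * An n))" for n
      by (rule finite_decomposition[OF \<theta> y0[of n] y1[of n] yb mult_pos_pos[OF H An]]) (intro exI conjI; (assumption | rule allI)?)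
    then have "\<forall>n. \<exists>b S. finite S \<and> (\<forall>i. b i \<in> elems X0) \<and> (\<forall>i. b i \<in> elems X1) \<and> (\<forall>i \<omega>. i \<notin> S \<longrightarrow> b i \<omega> = 0) \<and>
        (AE \<omega> in M. y n \<omega> = (\<Sum>i\<in>S. b i \<omega>)) \<and>
        finite_sums_bounded X0 \<theta> 0 b (7 * K ^ 4 * (H * An n)) \<and> finite_sums_bounded X1 \<theta> 1 b (7 * K ^ 4 * (H * An n))" ..
    from choice[OF this] obtain b where "\<forall>n. \<exists>S. finite S \<and> (\<forall>i. b n i \<in> elems X0) \<and> (\<forall>i. b n i \<in> elems X1) \<and> (\<forall>i \<omega>. i \<notin> S \<longrightarrow> b n i \<omega> = 0) \<and>
        (AE \<omega> in M. y n \<omega> = (\<Sum>i\<in>S. b n i \<omega>)) \<and>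
        finite_sums_bounded X0 \<theta> 0 (b n) (7 * K ^ 4 * (H * An n)) \<and> finite_sums_bounded X1 \<theta> 1 (b n) (7 * K ^ 4 * (H * An n))" ..
    from choice[OF this] obtain S where bS: "\<forall>n. finite (S n) \<and> (\<forall>i. b n i \<in> elems X0) \<and> (\<forall>i. b n i \<in> elems X1) \<and> (\<forall>i \<omega>. i \<notin> S n \<longrightarrow> b n i \<omega> = 0) \<and>
        (AE \<omega> in M. y n \<omega> = (\<Sum>i\<in>S n. b n i \<omega>)) \<and>
        finite_sums_bounded X0 \<theta> 0 (b n) (7 * K ^ 4 * (H * An n)) \<and> finite_sums_bounded X1 \<theta> 1 (b n) (7 * K ^ 4 * (H * An n))" ..
    \<comment> \<open>The constant of the finite decompositions, 7 K^4, times the factor 2 K in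
      \<open>An\<close>.\<close>
    have D: "7 * K ^ 4 * (H * An n) = (14 * K ^ 5 * H * A) / (2 * K) ^ n" for n
      by (simp add: An_def eval_nat_numeral)
    have partial: "(\<Sum>n<Suc m. y n \<omega>) = g m ?z \<omega>" for m \<omega>
      by (induction m) (auto simp: y_def d_def)
    have lim: "converges_in Z (\<lambda>m \<omega>. \<Sum>n<m. y n \<omega>) x sequentially"
    proof -
      \<comment> \<open>The error f - g m is known to be small only on the boundary lines; the three
        lines estimate transfers this to the point \<theta> in X0 + X1.\<close>
      have hle: "qnorm Z (h m ?z) \<le> 2 * K * (C + 1) * \<rho> m" for m
        by (rule three_lines_sum_norm[OF C \<theta> calA_value[OF hA z] \<rho> est[OF hA \<rho> h0 h1]])
      have eq: "qnorm Z (\<lambda>\<omega>. (\<Sum>n<Suc m. y n \<omega>) - x \<omega>) = qnorm Z (h m ?z)" for m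
      proof -
        have gZ: "g m ?z \<in> elems Z" by (rule X0_sub(1)[OF g(2)[OF z]])
        have "AE \<omega> in M. g m ?z \<omega> - x \<omega> = g m ?z \<omega> - f ?z \<omega>" using x' by eventually_elim simp
        then have "qnorm Z (\<lambda>\<omega>. g m ?z \<omega> - x \<omega>) = qnorm Z (\<lambda>\<omega>. g m ?z \<omega> - f ?z \<omega>)"
          by (rule Z.AE_eq_closed(2)[OF Z.diff_closed[OF gZ fZ] Z.meas[OF Z.diff_closed[OF gZ xZ]]])
        also have "\<dots> = qnorm Z (h m ?z)" unfolding h_def by (rule Z.qnorm_diff_commute[OF gZ fZ])
        finally show ?thesis unfolding partial .
      qed
      have "\<rho> \<longlonglongrightarrow> 0"
        unfolding \<rho>_def using K_ge_1 by (intro LIMSEQ_Suc[OF LIMSEQ_divide_realpow_zero]) auto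
      then have r: "(\<lambda>m. 2 * K * (C + 1) * \<rho> m) \<longlonglongrightarrow> 0" by (rule tendsto_mult_right_zero)
      have "(\<lambda>m. qnorm Z (h m ?z)) \<longlonglongrightarrow> 0"
        by (rule tendsto_sandwich[OF _ _ tendsto_const r]) (auto intro!: always_eventually Z.qnorm_ge_0 calA_value hA z hle)
      then have "(\<lambda>m. qnorm Z (\<lambda>\<omega>. (\<Sum>n<Suc m. y n \<omega>) - x \<omega>)) \<longlonglongrightarrow> 0" unfolding eq .
      then show ?thesis unfolding converges_in_def by (rule LIMSEQ_imp_Suc)
    qed
    have "2 * K * (14 * K ^ 5 * H * A) \<in> conv_bracket_bounds M X0 X1 \<theta> x"
      by (rule decompositions_sum[where b = b and S = S and y = y, OF \<theta> xZ _ _ _ _ X0_sub(1)[OF y0] _ _ _ lim])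
         (use bS in \<open>unfold D, simp_all\<close>)
    then show "x \<in> elems Z \<and> 2 * K * (14 * K ^ 5 * H) * (calA_norm X0 X1 f + e) \<in> conv_bracket_bounds M X0 X1 \<theta> x"
      using xZ by (simp add: A_def mult.assoc)
  qed
qed

lemma conv_bracket_bounds_nonneg:
  assumes "c \<in> conv_bracket_bounds M X0 X1 \<theta> x"
  shows "0 \<le> c"
proof -
  obtain a where "series_bounded X0 \<theta> 0 a c" using assms by (auto simp: conv_bracket_bounds_def)
  moreover have "bounded (range (\<lambda>_::int. 1::complex))" by (auto simp: bounded_iff)
  ultimately obtain s where "s \<in> elems X0" "qnorm X0 s \<le> c * (SUP i::int. cmod 1)"
    unfolding series_bounded_def by blast
  then show ?thesis using X0.qnorm_ge_0[of s] by simp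
qed

text \<open>One inclusion has constant 1; the other holds with L for every positive e, and e
  disappears on passing to the infimum.\<close>

lemma inner_equivalent_conv_bracket:
  assumes "analytically_convex X0" "analytically_convex X1" and \<theta>: "0 < \<theta>" "\<theta> < 1"
    and "equivalent_spaces (calderon_product M X0 X1 \<theta>) (bracket_space M X0 X1 \<theta>)"
  shows "equivalent_spaces (inner_complex_space M X0 X1 \<theta>) (conv_bracket_space M X0 X1 \<theta>)"
proof (rule inner_into_conv_bracket[OF assms])
  fix L assume L: "0 < L" "\<And>f x e. \<lbrakk>f \<in> calA0 M X0 X1; x \<in> borel_measurable M; AE \<omega> in M. f (of_real \<theta>) \<omega> = x \<omega>; 0 < e\<rbrakk> \<Longrightarrow>
    x \<in> elems Z \<and> L * (calA_norm X0 X1 f + e) \<in> conv_bracket_bounds M X0 X1 \<theta> x"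
  let ?I = "inner_complex_space M X0 X1 \<theta>" and ?C = "conv_bracket_space M X0 X1 \<theta>"
  define N where "N x = {calA_norm X0 X1 f |f. f \<in> calA0 M X0 X1 \<and> (AE \<omega> in M. f (of_real \<theta>) \<omega> = x \<omega>)}" for x
  have qI: "qnorm ?I x = Inf (N x)" for x by (simp add: inner_complex_space_def N_def)
  have qC: "qnorm ?C x = Inf (conv_bracket_bounds M X0 X1 \<theta> x)" for x by (simp add: conv_bracket_space_def)
  have N0: "0 \<le> c" if "c \<in> N x" for c x using that calA_norm_nonneg by (auto simp: N_def calA0_def)
  have Ielem: "x \<in> elems ?I \<longleftrightarrow> x \<in> borel_measurable M \<and> N x \<noteq> {}" for x
    by (auto simp: inner_complex_space_def N_def)
  have Celem: "x \<in> elems ?C \<longleftrightarrow> x \<in> elems Z \<and> conv_bracket_bounds M X0 X1 \<theta> x \<noteq> {}" for x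
    by (simp add: conv_bracket_space_def)
  have IC: "x \<in> elems Z \<and> L * (c + e) \<in> conv_bracket_bounds M X0 X1 \<theta> x" if x: "x \<in> borel_measurable M" "c \<in> N x" and e: "0 < e" for x c e
  proof -
    obtain f where f: "f \<in> calA0 M X0 X1" "AE \<omega> in M. f (of_real \<theta>) \<omega> = x \<omega>" and c: "c = calA_norm X0 X1 f"
      using x(2) unfolding N_def by (elim CollectE exE conjE) (rule that)
    show ?thesis unfolding c by (rule L(2)[OF f(1) x(1) f(2) e])
  qed
  have CI: "\<exists>d\<in>N x. d \<le> c" if x: "x \<in> elems Z" "c \<in> conv_bracket_bounds M X0 X1 \<theta> x" for x c
  proof -
    obtain F where F: "F \<in> calA0 M X0 X1" "calA_norm X0 X1 F \<le> c" "AE \<omega> in M. F (of_real \<theta>) \<omega> = x \<omega>"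
      by (rule conv_bracket_into_inner[OF \<theta> x], rule that)
    have "calA_norm X0 X1 F \<in> N x" unfolding N_def by (intro CollectI exI[of _ F] conjI refl F(1,3))
    with F(2) show ?thesis by (rule bexI)
  qed
  have elems: "x \<in> elems ?I \<longleftrightarrow> x \<in> elems ?C" for x
  proof
    assume "x \<in> elems ?I"
    then obtain c where "x \<in> borel_measurable M" "c \<in> N x" unfolding Ielem by blast
    from IC[OF this, of 1] show "x \<in> elems ?C" unfolding Celem by auto
  next
    assume "x \<in> elems ?C"
    then obtain c where c: "x \<in> elems Z" "c \<in> conv_bracket_bounds M X0 X1 \<theta> x" unfolding Celem by blast
    from CI[OF this] Z.meas[OF c(1)] show "x \<in> elems ?I" unfolding Ielem by blast
  qed
  have le1: "qnorm ?I x \<le> qnorm ?C x" if "x \<in> elems ?C" for x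
    unfolding qI qC
  proof (rule cInf_greatest)
    show "conv_bracket_bounds M X0 X1 \<theta> x \<noteq> {}" using that Celem by blast
    fix c assume c: "c \<in> conv_bracket_bounds M X0 X1 \<theta> x"
    have "x \<in> elems Z" using that unfolding Celem by (rule conjunct1)
    from CI[OF this c] obtain d where d: "d \<in> N x" "d \<le> c" by blast
    have "Inf (N x) \<le> d" by (rule cInf_lower[OF d(1)]) (rule bdd_belowI, rule N0)
    then show "Inf (N x) \<le> c" using d(2) by simp
  qed
  have le2: "qnorm ?C x \<le> L * qnorm ?I x" if "x \<in> elems ?I" for x
  proof -
    have x: "x \<in> borel_measurable M" "N x \<noteq> {}" using that Ielem by auto
    have "qnorm ?C x / L \<le> qnorm ?I x"
      unfolding qI
    proof (rule cInf_greatest[OF x(2)])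
      fix c assume c: "c \<in> N x"
      show "qnorm ?C x / L \<le> c"
      proof (rule field_le_epsilon)
        fix e :: real assume "0 < e"
        from IC[OF x(1) c this] have "L * (c + e) \<in> conv_bracket_bounds M X0 X1 \<theta> x" by simp
        then have "qnorm ?C x \<le> L * (c + e)"
          unfolding qC by (rule cInf_lower) (rule bdd_belowI, rule conv_bracket_bounds_nonneg)
        then show "qnorm ?C x / L \<le> c + e" using L(1) by (simp add: field_simps)
      qed
    qed
    then show ?thesis using L(1) by (simp add: field_simps)
  qed
  have nn: "0 \<le> qnorm ?I x" if "x \<in> elems ?I" for x
    unfolding qI using that N0 unfolding Ielem by (intro cInf_greatest) auto
  show "equivalent_spaces ?I ?C"
    unfolding equivalent_spaces_def
  proof (intro conjI exI[of _ "max 1 L"] ballI)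
    show "elems ?I = elems ?C" using elems by blast
    show "0 < max 1 L" by simp
    fix x assume x: "x \<in> elems ?I"
    have "1 * qnorm ?C x \<le> max 1 L * qnorm ?C x"
      using order_trans[OF nn[OF x] le1] x elems by (intro mult_right_mono) auto
    then show "qnorm ?I x \<le> max 1 L * qnorm ?C x" using le1 x elems by (auto intro: order_trans)
    have "L * qnorm ?I x \<le> max 1 L * qnorm ?I x" by (intro mult_right_mono nn[OF x]) simp
    then show "qnorm ?C x \<le> max 1 L * qnorm ?I x" using le2[OF x] by simp
  qed
qed

end

theorem corollary2p65:
  fixes M :: "'a measure" and X0 X1 :: "'a fspace" and \<theta> :: real
  assumes "sigma_finite_measure M"
    and "quasi_banach_lattice M X0" and "analytically_convex X0"
    and "quasi_banach_lattice M X1" and "analytically_convex X1"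
    and "0 < \<theta>" and "\<theta> < 1"
    and "equivalent_spaces (calderon_product M X0 X1 \<theta>) (bracket_space M X0 X1 \<theta>)"
  shows "equivalent_spaces (inner_complex_space M X0 X1 \<theta>) (conv_bracket_space M X0 X1 \<theta>)"
proof -
  obtain K0 K1 where "\<forall>K\<ge>K0. normed_lattice M X0 K" "\<forall>K\<ge>K1. normed_lattice M X1 K"
    using quasi_banach_lattice.normed_lattice_exists[OF assms(2)]
      quasi_banach_lattice.normed_lattice_exists[OF assms(4)] by blast
  then have "lattice_couple M X0 X1 (max K0 K1)"
    by (intro lattice_couple.intro) auto
  then show ?thesis by (rule lattice_couple.inner_equivalent_conv_bracket[OF _ assms(3,5-8)])
qed

end
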